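(* Let $\ell$ be a rational prime with $\ell\equiv 7 \bmod 9$ or $\ell\equiv 4\bmod 9$, and let $\lambda\in\mathbb{Z}[\rho]$ satisfy $\lambda\bar\lambda=\ell$ and $\lambda\equiv 1\bmod 3$. Then the denominator of $C_{\frac{2}{3}(\ell-1)}$ (if $\ell\equiv 7\bmod 9$), resp. of $D_{\frac{2}{3}(\ell-1)}$ (if $\ell\equiv 4 \bmod 9$), is not divisible by $\ell$, and in the localization $\mathbb{Z}[\rho]_{(\lambda)}$ one has $$\alpha_\lambda\equiv\begin{cases}-\frac{1}{3}C_{\frac{2}{3}(\ell-1)} \bmod \lambda & \text{if } \ell\equiv 7\bmod 9,\\ -\frac{1}{3}D_{\frac{2}{3}(\ell-1)}\bmod\lambda & \text{if }\ell\equiv 4\bmod 9.\end{cases}$$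
   Context: Let $\rho=e^{2\pi i/3}$, $\varpi=\int_0^1 (1-t^3)^{-2/3}\,dt$, and $\wp$ the Weierstrass $\wp$-function with period lattice $\varpi\mathbb{Z}[\rho]$. Put $\varphi(u)=\frac{6\wp(\varpi u)}{9+\wp'(\varpi u)}$ (an elliptic function with period lattice $\mathbb{Z}[\rho]$) and $\mathrm{sl}(u)=\varphi(u/(-3\varpi))$. The rational numbers $C_n,D_n$ are defined by the expansions at $u=0$: $\mathrm{sl}(u)=\sum_{m\ge0}C_{3m+1}u^{3m+1}$ and $\mathrm{sl}(u)^{-1}=\frac1u+\sum_{n\ge0}D_{3n+2}u^{3n+2}$. For $\ell,\lambda$ as in the claim, $\chi_\lambda$ denotes the cubic residue character modulo $\lambda$: for $\nu\in\mathbb{Z}[\rho]$ prime to $\lambda$, $\chi_\lambda(\nu)$ is the cube root of unity with $\chi_\lambda(\nu)\equiv\nu^{(\ell-1)/3}\bmod\lambda$. Put $\tilde\lambda=\prod_{r\in(\mathbb{Z}[\rho]/(\lambda))^\times,\ \chi_\lambda(r)=1}\varphi(r/\lambda)$ and, for $f=\varphi$ or $f=\varphi^{-1}$, the elliptic Gauss sum $G_\lambda(\chi_\lambda,f)=\frac13\sum_{r\in(\mathbb{Z}[\rho]/(\lambda))^\times}\chi_\lambda(r)f(r/\lambda)$. Define $\alpha_\lambda=G_\lambda(\chi_\lambda,\varphi)/\tilde\lambda^2$ if $\ell\equiv7\bmod 9$ and $\alpha_\lambda=G_\lambda(\chi_\lambda,\varphi^{-1})/\tilde\lambda^2$ if $\ell\equiv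 4\bmod 9$. (It is known, by Asai, that $\alpha_\lambda\in\chi_\lambda(3)(1+3\mathbb{Z})$ if $\ell\equiv 7\bmod 9$ and $\alpha_\lambda\in\overline{\chi_\lambda(3)}(-1+3\mathbb{Z})$ if $\ell\equiv 4\bmod 9$; in particular $\alpha_\lambda\in\mathbb{Z}[\rho]$.) *)

theory Defs
  imports "HOL-Complex_Analysis.Complex_Analysis"
begin

definition rho :: complex where
  "rho = exp (2 * of_real pi * \<i> / 3)"

definition eis :: "complex set" where
  "eis = {of_int a + of_int b * rho |a b. True}"

definition eis_dvd :: "complex \<Rightarrow> complex \<Rightarrow> bool" where
  "eis_dvd x y \<longleftrightarrow> (\<exists>z\<in>eis. y = x * z)"

definition eis_cong :: "complex \<Rightarrow> complex \<Rightarrow> complex \<Rightarrow> bool" where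
  "eis_cong m x y \<longleftrightarrow> eis_dvd m (x - y)"

(* The localization at the ideal generated by lam (lam prime in eis). *)
definition eis_loc :: "complex \<Rightarrow> complex set" where
  "eis_loc lam = {x / s |x s. x \<in> eis \<and> s \<in> eis \<and> \<not> eis_dvd lam s}"

definition loc_cong :: "complex \<Rightarrow> complex \<Rightarrow> complex \<Rightarrow> bool" where
  "loc_cong lam x y \<longleftrightarrow>
     x \<in> eis_loc lam \<and> y \<in> eis_loc lam \<and> (\<exists>z\<in>eis_loc lam. x - y = lam * z)"

(* The integrand is unbounded at 1; its Henstock-Kurzweil integral is the improper integral. *)
definition varpi :: real where
  "varpi = integral {0..1} (\<lambda>t. (1 - t ^ 3) powr (- 2 / 3))"

(* The junk value at points of the lattice L is never relevant below: only the germ of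
   phi on a punctured neighbourhood of 0 and its values at points outside eis are used. *)
definition weierstrass_p :: "complex set \<Rightarrow> complex \<Rightarrow> complex" where
  "weierstrass_p L z = 1 / z ^ 2 + (\<Sum>\<^sub>\<infinity>w\<in>L - {0}. 1 / (z - w) ^ 2 - 1 / w ^ 2)"

definition wp :: "complex \<Rightarrow> complex" where
  "wp = weierstrass_p ((\<lambda>w. of_real varpi * w) ` eis)"

definition phi :: "complex \<Rightarrow> complex" where
  "phi u = 6 * wp (of_real varpi * u) / (9 + deriv wp (of_real varpi * u))"

definition sl :: "complex \<Rightarrow> complex" where
  "sl u = phi (u / (- 3 * of_real varpi))"

definition C_coeff :: "nat \<Rightarrow> complex" where
  "C_coeff n = fls_nth (laurent_expansion sl 0) (int n)"

definition D_coeff :: "nat \<Rightarrow> complex" where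
  "D_coeff n = fls_nth (laurent_expansion (\<lambda>u. inverse (sl u)) 0) (int n)"

(* Elements of eis that are invertible modulo lam, and the set of their residue classes. *)
definition eis_coprime :: "complex \<Rightarrow> complex set" where
  "eis_coprime lam = {r \<in> eis. \<exists>s\<in>eis. eis_cong lam (r * s) 1}"

definition residue_units :: "complex \<Rightarrow> complex set set" where
  "residue_units lam = eis_coprime lam //
     {(r, s). r \<in> eis_coprime lam \<and> s \<in> eis_coprime lam \<and> eis_cong lam r s}"

(* Functions of a residue class are evaluated at an arbitrary representative; those used below
   do not depend on the choice, since phi is periodic with respect to eis. *)
definition representative :: "complex set \<Rightarrow> complex" where
  "representative c = (SOME r. r \<in> c)"

(* In the following definitions ell is the norm of lam. *)
definition cubic_char :: "nat \<Rightarrow> complex \<Rightarrow> complex \<Rightarrow> complex" where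
  "cubic_char ell lam v = (THE z. z ^ 3 = 1 \<and> eis_cong lam z (v ^ ((ell - 1) div 3)))"

definition lambda_tilde :: "nat \<Rightarrow> complex \<Rightarrow> complex" where
  "lambda_tilde ell lam =
     (\<Prod>c | c \<in> residue_units lam \<and> cubic_char ell lam (representative c) = 1.
        phi (representative c / lam))"

definition gauss_sum :: "nat \<Rightarrow> complex \<Rightarrow> (complex \<Rightarrow> complex) \<Rightarrow> complex" where
  "gauss_sum ell lam f =
     1 / 3 * (\<Sum>c\<in>residue_units lam.
        cubic_char ell lam (representative c) * f (representative c / lam))"

(* Only meaningful for ell congruent to 7 (first branch) or 4 (second branch) modulo 9. *)
definition alpha :: "nat \<Rightarrow> complex \<Rightarrow> complex" where
  "alpha ell lam =
     (if ell mod 9 = 7 then gauss_sum ell lam phi / lambda_tilde ell lam ^ 2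
      else gauss_sum ell lam (\<lambda>u. inverse (phi u)) / lambda_tilde ell lam ^ 2)"

end

theory Submission
  imports Defs "HOL-Number_Theory.Number_Theory"
begin

text \<open>
  Up to the scaling by the period, \<open>phi\<close> is Dixon's elliptic function \<open>sm\<close>, which together with
  its companion \<open>cm\<close> parametrises the Fermat cubic \<open>x ^ 3 + y ^ 3 = 1\<close>. Extend the \<open>lam\<close>-adic
  valuation to a valuation ring \<open>V\<close> of the complex numbers with maximal ideal \<open>mm\<close>. The Hasse
  invariant of the cubic at \<open>lam\<close> is a binomial coefficient prime to \<open>ell\<close>, hence some, and then
  every, \<open>lam\<close>-division point is congruent to the origin: \<open>sm (r * v1)\<close> lies in \<open>mm\<close>. Solving
  \<open>sm v1 = smF t\<close> modulo \<open>t ^ ell\<close> for the Taylor series \<open>smF\<close> of \<open>sm\<close>, the addition theorem gives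
  \<open>sm (r * v1) = smF (r * t)\<close> modulo \<open>t ^ ell\<close>, and \<open>r = lam\<close> shows that \<open>t ^ (ell - 1)\<close> divides \<open>lam\<close>.
  Since the cubic character is \<open>n ^ ((ell - 1) / 3)\<close> modulo \<open>lam\<close>, the power sums modulo \<open>ell\<close> kill
  all coefficients before \<open>t ^ (2 * (ell - 1) / 3)\<close> in the Gauss sum, while the square of
  \<open>lambda_tilde\<close> is \<open>t ^ (2 * (ell - 1) / 3)\<close> times a unit congruent to 1. This is the congruence
  modulo \<open>mm\<close>. Finally \<open>alpha\<close> does not change when the division points are multiplied by an
  integer, so it is a trace and lies in the field of fractions of \<open>eis\<close>; there a congruence
  modulo \<open>mm\<close> is one modulo \<open>lam\<close>.
\<close>

section \<open>Eisenstein integers\<close>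

text \<open>The Taylor coefficients of \<open>smF\<close> are integral at \<open>lam\<close> only in
  degrees below \<open>ell\<close>; in degree \<open>ell\<close> integrality fails, and this failure
  is the Hasse invariant statement. Hence no series is ever summed: each one is truncated, with an
  error in \<open>t ^ ell * V\<close>, or one order less for the inverse of \<open>sm\<close>. The
  precision is enough because the wanted term has degree \<open>2 * kk\<close> with
  \<open>kk = (ell - 1) / 3\<close>, and a multiple of \<open>lam\<close> is itself an error of
  order \<open>t ^ (ell - 1)\<close>. The invariant is applied by contradiction: if all values of
  \<open>pp\<close> at the \<open>lam\<close>-division points were integral, the traces of the
  derivatives of \<open>pp\<close>, which are explicit multiples of Taylor coefficients, would make
  \<open>smF\<close> integral in degree \<open>ell\<close>. The same traces replace Galois theory:
  with Newton's identities they show that a rational expression in division values that is the same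
  for all points lies in the base field. The condition on \<open>ell\<close> modulo 9 says that
  \<open>kk\<close> is prime to 3, so that the cubic character is not trivial on \<open>rho\<close>;
  the square in \<open>alpha\<close> makes the character values of the Gauss sum and of
  \<open>lambda_tilde\<close> cancel.\<close>

lemma rho_eq: "rho = Complex (- 1 / 2) (sqrt 3 / 2)"
  unfolding rho_def by (simp add: complex_eq_iff Re_exp Im_exp cos_120 sin_120)

lemma rho_sum: "1 + rho + rho ^ 2 = 0"
  by (simp add: rho_eq complex_eq_iff power2_eq_square)

lemma rho_square: "rho ^ 2 = - 1 - rho"
  using rho_sum by (simp add: algebra_simps add_eq_0_iff2)

lemma rho_square': "rho * rho = - 1 - rho"
  using rho_square by (simp add: power2_eq_square)

lemma rho_cube: "rho ^ 3 = 1"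
proof -
  have "rho ^ 3 = rho * (rho * rho)" by (simp add: power3_eq_cube)
  also have "\<dots> = 1" by (simp add: rho_square' algebra_simps)
  finally show ?thesis .
qed

lemma cnj_rho: "cnj rho = - 1 - rho"
  by (simp add: rho_eq complex_eq_iff)

lemma rho_nonzero [simp]: "rho \<noteq> 0"
  by (simp add: rho_eq complex_eq_iff)

lemma norm_rho [simp]: "norm rho = 1"
  by (simp add: rho_eq cmod_def power2_eq_square)

lemma eisI: "z = of_int a + of_int b * rho \<Longrightarrow> z \<in> eis"
  unfolding eis_def by blast

lemma eisE: "z \<in> eis \<Longrightarrow> (\<And>a b. z = of_int a + of_int b * rho \<Longrightarrow> P) \<Longrightarrow> P"
  unfolding eis_def by blast

lemma eis_of_int [simp, intro]: "of_int n \<in> eis"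
  by (rule eisI[of _ n 0]) simp

lemma eis_of_nat [simp, intro]: "of_nat n \<in> eis"
  by (rule eisI[of _ "int n" 0]) simp

lemma eis_numeral [simp, intro]: "numeral n \<in> eis"
  using eis_of_nat[of "numeral n"] by simp

lemma eis_0 [simp, intro]: "0 \<in> eis" using eis_of_int[of 0] by simp
lemma eis_1 [simp, intro]: "1 \<in> eis" using eis_of_int[of 1] by simp

lemma eis_rho [simp, intro]: "rho \<in> eis"
  by (rule eisI[of _ 0 1]) simp

lemma eis_add [intro]: "x \<in> eis \<Longrightarrow> y \<in> eis \<Longrightarrow> x + y \<in> eis"
  by (elim eisE) (rule eisI[of _ "_ + _" "_ + _"], simp add: algebra_simps)

lemma eis_uminus [intro]: "x \<in> eis \<Longrightarrow> - x \<in> eis"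
  by (elim eisE) (rule eisI[of _ "- _" "- _"], simp add: algebra_simps)

lemma eis_diff [intro]: "x \<in> eis \<Longrightarrow> y \<in> eis \<Longrightarrow> x - y \<in> eis"
  using eis_add[of x "- y"] eis_uminus[of y] by simp

lemma eis_mult [intro]: "x \<in> eis \<Longrightarrow> y \<in> eis \<Longrightarrow> x * y \<in> eis"
proof (elim eisE)
  fix a b c d :: int
  assume x: "x = of_int a + of_int b * rho" and y: "y = of_int c + of_int d * rho"
  have "x * y = of_int (a * c) + of_int (a * d + b * c) * rho + of_int (b * d) * (rho * rho)"
    unfolding x y by (simp add: algebra_simps)
  also have "\<dots> = of_int (a * c - b * d) + of_int (a * d + b * c - b * d) * rho"
    by (simp add: rho_square' algebra_simps)
  finally show ?thesis by (rule eisI)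
qed

lemma eis_power [intro]: "x \<in> eis \<Longrightarrow> x ^ n \<in> eis"
  by (induction n) auto

lemma eis_sum [intro]: "(\<And>i. i \<in> A \<Longrightarrow> f i \<in> eis) \<Longrightarrow> sum f A \<in> eis"
  by (induction A rule: infinite_finite_induct) auto

lemma eis_cnj [intro]: "x \<in> eis \<Longrightarrow> cnj x \<in> eis"
  by (elim eisE) (auto simp: cnj_rho intro!: eis_add eis_mult eis_diff)

lemma eis_uminus_iff [simp]: "- x \<in> eis \<longleftrightarrow> x \<in> eis"
  using eis_uminus[of x] eis_uminus[of "- x"] by auto

lemma eis_cnj_iff [simp]: "cnj x \<in> eis \<longleftrightarrow> x \<in> eis"
  using eis_cnj[of x] eis_cnj[of "cnj x"] by auto

lemma eis_rho_times_iff [simp]: "rho * x \<in> eis \<longleftrightarrow> x \<in> eis"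
proof
  assume "rho * x \<in> eis"
  then have "rho ^ 2 * (rho * x) \<in> eis" by blast
  then show "x \<in> eis" using rho_cube by (simp add: power2_eq_square power3_eq_cube flip: mult.assoc)
qed auto

lemma eis_add_iff: "w \<in> eis \<Longrightarrow> z + w \<in> eis \<longleftrightarrow> z \<in> eis"
  using eis_add[of z w] eis_diff[of "z + w" w] by auto

section \<open>Norm and discreteness of the lattice\<close>

definition eis_pair :: "int \<times> int \<Rightarrow> complex" where
  "eis_pair = (\<lambda>(a, b). of_int a + of_int b * rho)"

lemma Re_eis_pair: "Re (eis_pair (a, b)) = a - b / 2"
  and Im_eis_pair: "Im (eis_pair (a, b)) = b * sqrt 3 / 2"
  by (simp_all add: eis_pair_def rho_eq)

lemma bij_eis_pair: "bij_betw eis_pair UNIV eis"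
  unfolding bij_betw_def
proof
  show "inj eis_pair"
  proof (rule injI, clarify)
    fix a b c d assume "eis_pair (a, b) = eis_pair (c, d)"
    then have "real_of_int a - b / 2 = c - d / 2" "b * sqrt 3 / 2 = d * sqrt 3 / 2"
      using Re_eis_pair Im_eis_pair by metis+
    then show "a = c \<and> b = d" by simp
  qed
  show "range eis_pair = eis" by (auto simp: eis_pair_def eis_def)
qed

lemma norm_eis_pair: "norm (eis_pair (a, b)) ^ 2 = of_int (a ^ 2 - a * b + b ^ 2)"
  by (simp add: cmod_power2 Re_eis_pair Im_eis_pair power_mult_distrib power_divide power2_diff)

text \<open>The two equations serve different ends: \<open>norm z ^ 2\<close> gives sizes and a
  measure for descent, \<open>z * cnj z\<close> turns divisibility by \<open>lam\<close> into
  divisibility by \<open>ell\<close>.\<close>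

lemma eis_norm_square:
  assumes "z \<in> eis" obtains n :: nat where "norm z ^ 2 = of_nat n" "z * cnj z = of_nat n"
proof -
  obtain a b where ab: "z = eis_pair (a, b)"
    using assms by (auto elim: eisE simp: eis_pair_def)
  have nn: "a ^ 2 - a * b + b ^ 2 \<ge> 0"
    using norm_eis_pair[of a b] by (smt (verit) of_int_0_le_iff zero_le_power2)
  have 1: "norm z ^ 2 = of_nat (nat (a ^ 2 - a * b + b ^ 2))"
    unfolding ab norm_eis_pair using nn by simp
  moreover have "z * cnj z = of_nat (nat (a ^ 2 - a * b + b ^ 2))"
    using 1 by (metis complex_norm_square of_real_of_nat_eq)
  ultimately show ?thesis using that by blast
qed

lemma eis_norm_ge_1: "z \<in> eis \<Longrightarrow> z \<noteq> 0 \<Longrightarrow> norm z \<ge> 1"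
proof (erule eis_norm_square)
  fix n :: nat assume "norm z ^ 2 = of_nat n" "z \<noteq> 0"
  then have "n \<ge> 1" by (metis One_nat_def Suc_leI gr0I norm_eq_zero of_nat_0 power_eq_0_iff)
  then have "norm z ^ 2 \<ge> 1" using \<open>norm z ^ 2 = _\<close> by simp
  then show "norm z \<ge> 1" by (metis norm_ge_zero one_power2 power2_le_imp_le)
qed

lemma eis_dist_ge_1: "z \<in> eis \<Longrightarrow> w \<in> eis \<Longrightarrow> z \<noteq> w \<Longrightarrow> dist z w \<ge> 1"
  using eis_norm_ge_1[of "z - w"] by (auto simp: dist_norm)

lemma closed_subset_eis: "A \<subseteq> eis \<Longrightarrow> closed A"
proof (rule discrete_imp_closed[of 1])
  show "\<forall>x\<in>A. \<forall>y\<in>A. dist y x < 1 \<longrightarrow> y = x" if "A \<subseteq> eis"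
    using eis_dist_ge_1 that by (metis linorder_not_le subset_iff)
qed auto

lemma countable_eis: "countable eis"
  using bij_betw_imp_surj_on[OF bij_eis_pair] by (metis countable_image countableI_type)

lemma open_Compl_eis [simp, intro]: "open (- eis)"
  using closed_subset_eis[of eis] by auto

lemma connected_Compl_countable:
  assumes "countable (A :: complex set)" shows "connected (- A)"
  using path_connected_complement_countable[of A] assms by (simp add: path_connected_imp_connected)

section \<open>Absolute convergence over the lattice\<close>

lemma summable_on_int_powr: "(\<lambda>n::int. (1 + \<bar>real_of_int n\<bar>) powr (- 3 / 2)) summable_on UNIV"
proof -
  let ?f = "\<lambda>n::int. (1 + \<bar>real_of_int n\<bar>) powr (- 3 / 2)"
  have "summable (\<lambda>n. of_nat n powr (- 3 / 2) :: real)"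
    by (simp add: summable_real_powr_iff)
  then have "summable (\<lambda>n. of_nat (Suc n) powr (- 3 / 2) :: real)"
    by (subst summable_Suc_iff)
  then have s: "(\<lambda>n::nat. (1 + real n) powr (- 3 / 2)) summable_on UNIV"
    by (subst summable_on_UNIV_nonneg_real_iff) simp_all
  have 1: "?f summable_on range int"
    using s by (subst summable_on_reindex) (auto simp: o_def)
  have 2: "?f summable_on range (\<lambda>n. - int n)"
    using s by (subst summable_on_reindex) (auto simp: o_def inj_on_def)
  have "?f summable_on (range int \<union> range (\<lambda>n. - int n))"
    by (rule summable_on_union[OF 1 2])
  also have "range int \<union> range (\<lambda>n. - int n) = UNIV"
  proof -
    have "x \<in> range int \<union> range (\<lambda>n. - int n)" for x
      by (cases x rule: int_cases2) auto
    then show ?thesis by blast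
  qed
  finally show ?thesis .
qed

text \<open>With \<open>S = x ^ 2 + y ^ 2\<close> the norm form is at least \<open>S / 2\<close>,
  because \<open>2 * x * y\<close> is at most \<open>S\<close>. In
  \<open>2 * (1 + x) * (1 + y)\<close> the constant and the linear part are at most
  \<open>2 * S\<close> each, since \<open>S\<close> is at least 1 and natural numbers are bounded by
  their squares, and the mixed part is at most \<open>S\<close>; hence the 5.\<close>

lemma eis_pair_bound:
  assumes "(a, b) \<noteq> (0, 0)"
  shows "(1 + \<bar>real_of_int a\<bar>) * (1 + \<bar>real_of_int b\<bar>) \<le> 5 * norm (eis_pair (a, b)) ^ 2"
proof -
  define x y where "x = \<bar>a\<bar>" and "y = \<bar>b\<bar>"
  have sq: "k \<le> k ^ 2" if "k \<ge> 0" for k :: int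
    using that by (cases "k = 0") (auto intro: self_le_power)
  have x: "x \<ge> 0" "x \<le> x ^ 2" "y \<ge> 0" "y \<le> y ^ 2"
    unfolding x_def y_def by (rule abs_ge_zero sq)+
  have "x \<ge> 1 \<or> y \<ge> 1"
    using assms unfolding x_def y_def by auto
  then have pos: "1 \<le> x ^ 2 + y ^ 2"
    using x by linarith
  have xy: "2 * (x * y) \<le> x ^ 2 + y ^ 2"
    using zero_le_power2[of "x - y"] by (simp add: power2_diff)
  have "a * b \<le> x * y" unfolding x_def y_def by (metis abs_ge_self abs_mult)
  then have "2 * (a ^ 2 - a * b + b ^ 2) \<ge> x ^ 2 + y ^ 2"
    using xy unfolding x_def y_def by simp
  moreover have "2 * ((1 + x) * (1 + y)) \<le> 5 * (x ^ 2 + y ^ 2)"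
    using x pos xy by (simp add: algebra_simps)
  moreover have "P \<le> 5 * N" if "S \<le> 2 * N" "2 * P \<le> 5 * S" for P N S :: int
    using that by linarith
  ultimately have "(1 + x) * (1 + y) \<le> 5 * (a ^ 2 - a * b + b ^ 2)" by blast
  then have "real_of_int ((1 + x) * (1 + y)) \<le> real_of_int (5 * (a ^ 2 - a * b + b ^ 2))"
    by (simp only: of_int_le_iff)
  then show ?thesis unfolding norm_eis_pair x_def y_def by simp
qed

text \<open>The terms of the Weierstrass sum decay like \<open>1 / norm w ^ 3\<close>, so this
  series majorises it. By \<open>eis_pair_bound\<close> each term is at most a constant times a
  product of two one-dimensional terms of exponent \<open>3 / 2\<close>, half of 3 and still above
  1.\<close>

lemma summable_eis: "(\<lambda>w. 1 / norm w ^ 3) summable_on (eis - {0})"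
proof -
  let ?f = "\<lambda>n::int. (1 + \<bar>real_of_int n\<bar>) powr (- 3 / 2)"
  have "(\<lambda>x. norm (?f (fst x) * ?f (snd x))) summable_on (UNIV \<times> UNIV)"
    unfolding Infinite_Sum.abs_summable_on_Sigma_iff
  proof (intro conjI ballI)
    show "(\<lambda>y. norm (?f (fst (x, y)) * ?f (snd (x, y)))) summable_on UNIV" for x
      using summable_on_cmult_right[OF summable_on_int_powr, of "?f x"] by (simp add: abs_mult)
    show "(\<lambda>x. norm (\<Sum>\<^sub>\<infinity>y. norm (?f (fst (x, y)) * ?f (snd (x, y))))) summable_on UNIV"
      using summable_on_cmult_left[OF summable_on_int_powr, of "\<bar>infsum ?f UNIV\<bar>"]
      by (simp add: abs_mult infsum_cmult_right')
  qed
  then have "(\<lambda>x. (1 / 5) powr (- 3 / 2) * (?f (fst x) * ?f (snd x))) summable_on UNIV"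
    by (intro summable_on_cmult_right) (subst summable_on_iff_abs_summable_on_real, simp)
  then have 1: "(\<lambda>x. (1 / 5) powr (- 3 / 2) * (?f (fst x) * ?f (snd x))) summable_on (- {(0, 0)})"
    by (rule summable_on_subset_banach) auto
  have "(\<lambda>x. 1 / norm (eis_pair x) ^ 3) summable_on (- {(0, 0)})"
  proof (rule summable_on_comparison_test[OF 1])
    fix x :: "int \<times> int" assume x: "x \<in> - {(0, 0)}"
    obtain a b where ab: "x = (a, b)" by (cases x)
    let ?N = "norm (eis_pair (a, b))"
    have b: "(1 / 5) * ((1 + \<bar>real_of_int a\<bar>) * (1 + \<bar>real_of_int b\<bar>)) \<le> ?N ^ 2"
      using eis_pair_bound[of a b] x ab by simp
    have "0 < (1 / 5) * ((1 + \<bar>real_of_int a\<bar>) * (1 + \<bar>real_of_int b\<bar>))"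
      by (simp add: add_pos_nonneg)
    then have N: "?N > 0" using b by (smt (verit) norm_ge_zero zero_power2)
    have "1 / ?N ^ 3 = ?N powr (- 3)" using N by (simp add: powr_minus_divide)
    also have "\<dots> = (?N powr 2) powr (- 3 / 2)"
      by (simp only: powr_powr) simp
    also have "?N powr 2 = ?N ^ 2" using N by simp
    also have "(?N ^ 2) powr (- 3 / 2) \<le> ((1 / 5) * ((1 + \<bar>real_of_int a\<bar>) * (1 + \<bar>real_of_int b\<bar>))) powr (- 3 / 2)"
      by (rule powr_mono2') (use b in \<open>auto simp: add_pos_nonneg\<close>)
    also have "\<dots> = (1 / 5) powr (- 3 / 2) * (?f a * ?f b)"
      by (simp only: powr_mult)
    finally show "1 / norm (eis_pair x) ^ 3 \<le> (1 / 5) powr (- 3 / 2) * (?f (fst x) * ?f (snd x))"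
      by (simp add: ab)
  qed auto
  moreover have "bij_betw eis_pair (- {(0, 0)}) (eis - {0})"
  proof -
    have "eis_pair (0, 0) = 0" by (simp add: eis_pair_def)
    then have "bij_betw eis_pair (UNIV - {(0, 0)}) (eis - {0})"
      using bij_betw_DiffI[OF bij_eis_pair, of "{(0,0)}" "{0}"] by auto
    then show ?thesis by (simp add: Compl_eq_Diff_UNIV)
  qed
  ultimately show ?thesis
    using summable_on_reindex_bij_betw[of eis_pair "- {(0, 0)}" "eis - {0}" "\<lambda>w. 1 / norm w ^ 3"] by simp
qed

section \<open>The lattice function of the hexagonal lattice\<close>

text \<open>The Weierstrass M-test along the filter of finite subsets: the tail of the series is
  bounded by the tail of \<open>infsum M\<close>, whatever \<open>x\<close> is.\<close>

lemma uniform_limit_infsum: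
  fixes f :: "'a \<Rightarrow> 'b \<Rightarrow> complex"
  assumes bound: "\<And>i x. i \<in> I \<Longrightarrow> x \<in> X \<Longrightarrow> norm (f i x) \<le> M i" and M: "M summable_on I"
  shows "uniform_limit X (\<lambda>F x. \<Sum>i\<in>F. f i x) (\<lambda>x. \<Sum>\<^sub>\<infinity>i\<in>I. f i x) (finite_subsets_at_top I)"
proof (rule uniform_limitI)
  fix e :: real assume e: "e > 0"
  have "(M has_sum infsum M I) I" using M by simp
  then have "\<forall>\<^sub>F F in finite_subsets_at_top I. dist (sum M F) (infsum M I) < e"
    using e by (auto simp: has_sum_def tendsto_iff)
  moreover have "\<forall>\<^sub>F F in finite_subsets_at_top I. finite F \<and> F \<subseteq> I"
    by (intro eventually_finite_subsets_at_top_weakI) auto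
  ultimately show "\<forall>\<^sub>F F in finite_subsets_at_top I. \<forall>x\<in>X. dist (\<Sum>i\<in>F. f i x) (\<Sum>\<^sub>\<infinity>i\<in>I. f i x) < e"
  proof (eventually_elim, safe)
    fix F x assume d: "dist (sum M F) (infsum M I) < e" and F: "finite F" "F \<subseteq> I" and x: "x \<in> X"
    have M': "M summable_on (I - F)" by (rule summable_on_subset_banach[OF M]) auto
    have s: "(\<lambda>i. norm (f i x)) summable_on I"
      by (rule summable_on_comparison_test[OF M]) (use bound x in auto)
    then have s': "(\<lambda>i. norm (f i x)) summable_on (I - F)"
      by (rule summable_on_subset_banach) auto
    have fs: "(\<lambda>i. f i x) summable_on I"
      by (rule abs_summable_summable[OF s])
    have "infsum (\<lambda>i. f i x) (I - F) = infsum (\<lambda>i. f i x) I - infsum (\<lambda>i. f i x) F"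
      by (rule infsum_Diff) (use fs F in auto)
    then have "dist (\<Sum>i\<in>F. f i x) (\<Sum>\<^sub>\<infinity>i\<in>I. f i x) = norm (infsum (\<lambda>i. f i x) (I - F))"
      using F by (simp add: dist_norm norm_minus_commute)
    also have "\<dots> \<le> infsum (\<lambda>i. norm (f i x)) (I - F)"
      by (rule norm_infsum_bound[OF s'])
    also have "\<dots> \<le> infsum M (I - F)"
      by (rule infsum_mono[OF s' M']) (use bound x in auto)
    also have "\<dots> = infsum M I - infsum M F"
      by (rule infsum_Diff) (use M F in auto)
    also have "\<dots> < e" using d F by (auto simp: dist_real_def)
    finally show "dist (\<Sum>i\<in>F. f i x) (\<Sum>\<^sub>\<infinity>i\<in>I. f i x) < e" .
  qed
qed

text \<open>The finite partial sums converge uniformly on a disc, so the Weierstrass convergence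
  theorem applies. It yields the convergence of the differentiated series as well.\<close>

lemma infsum_has_field_derivative:
  fixes f :: "'a \<Rightarrow> complex \<Rightarrow> complex"
  assumes r: "0 < r"
    and der: "\<And>i x. i \<in> I \<Longrightarrow> x \<in> cball z r \<Longrightarrow> (f i has_field_derivative f' i x) (at x)"
    and bound: "\<And>i x. i \<in> I \<Longrightarrow> x \<in> cball z r \<Longrightarrow> norm (f i x) \<le> M i" and M: "M summable_on I"
  shows "\<exists>D. ((\<lambda>x. \<Sum>\<^sub>\<infinity>i\<in>I. f i x) has_field_derivative D) (at z) \<and> ((\<lambda>i. f' i z) has_sum D) I"
proof -
  let ?F = "finite_subsets_at_top I"
  have ev: "\<forall>\<^sub>F F in ?F. finite F \<and> F \<subseteq> I"
    by (intro eventually_finite_subsets_at_top_weakI) auto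
  have 1: "\<forall>\<^sub>F F in ?F. continuous_on (cball z r) (\<lambda>x. \<Sum>i\<in>F. f i x) \<and>
      (\<forall>w\<in>ball z r. ((\<lambda>x. \<Sum>i\<in>F. f i x) has_field_derivative (\<Sum>i\<in>F. f' i w)) (at w))"
    using ev
  proof (eventually_elim, safe)
    fix F assume F: "finite F" "F \<subseteq> I"
    show "continuous_on (cball z r) (\<lambda>x. \<Sum>i\<in>F. f i x)"
      by (intro continuous_on_sum continuous_at_imp_continuous_on ballI DERIV_isCont[OF der]) (use F in auto)
    show "((\<lambda>x. \<Sum>i\<in>F. f i x) has_field_derivative (\<Sum>i\<in>F. f' i w)) (at w)" if "w \<in> ball z r" for w
      by (intro DERIV_sum der) (use F that in auto)
  qed
  show ?thesis
  proof (rule has_complex_derivative_uniform_limit[OF 1 uniform_limit_infsum[OF bound M] _ r])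
    fix g' assume "\<And>w. w \<in> ball z r \<Longrightarrow>
          ((\<lambda>x. \<Sum>\<^sub>\<infinity>i\<in>I. f i x) has_field_derivative g' w) (at w) \<and>
          ((\<lambda>F. \<Sum>i\<in>F. f' i w) \<longlongrightarrow> g' w) ?F"
    from this[of z] show ?thesis using r by (auto simp: has_sum_def)
  qed auto
qed

text \<open>The Weierstrass function without its principal part at 0. It is analytic at 0 and
  carries the Taylor coefficients used throughout.\<close>

definition wrem :: "complex \<Rightarrow> complex" where
  "wrem z = (\<Sum>\<^sub>\<infinity>w\<in>eis - {0}. 1 / (z - w) ^ 2 - 1 / w ^ 2)"

definition wrem' :: "complex \<Rightarrow> complex" where
  "wrem' z = (\<Sum>\<^sub>\<infinity>w\<in>eis - {0}. - 2 / (z - w) ^ 3)"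

text \<open>Over a common denominator the numerator \<open>z * (2 * w - z)\<close> is at most
  \<open>R * (5 / 2) * norm w\<close> and the denominator is at least \<open>norm w ^ 4 / 4\<close>,
  whence the 10.\<close>

lemma wterm_bound:
  fixes z w :: complex
  assumes "norm z \<le> R" "2 * R \<le> norm w" "R > 0"
  shows "norm (1 / (z - w) ^ 2 - 1 / w ^ 2) \<le> 10 * R / norm w ^ 3"
proof -
  have w: "norm w > 0" using assms by linarith
  have zw: "norm (z - w) \<ge> norm w / 2"
    using norm_triangle_ineq2[of w z] assms by (simp add: norm_minus_commute)
  then have nz: "z - w \<noteq> 0" "w \<noteq> 0" using w by auto
  have "1 / (z - w) ^ 2 - 1 / w ^ 2 = z * (2 * w - z) / ((z - w) ^ 2 * w ^ 2)"
    using nz by (simp add: divide_simps) (simp add: power2_eq_square algebra_simps)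
  then have "norm (1 / (z - w) ^ 2 - 1 / w ^ 2) = norm z * norm (2 * w - z) / (norm (z - w) ^ 2 * norm w ^ 2)"
    by (simp add: norm_mult norm_divide norm_power)
  also have "\<dots> \<le> R * (5 / 2 * norm w) / ((norm w / 2) ^ 2 * norm w ^ 2)"
  proof (rule frac_le)
    have "norm (2 * w - z) \<le> 2 * norm w + norm z"
      using norm_triangle_ineq4[of "2 * w" z] by (simp add: norm_mult)
    then show "norm z * norm (2 * w - z) \<le> R * (5 / 2 * norm w)"
      using assms by (intro mult_mono) auto
    show "(norm w / 2)\<^sup>2 * (norm w)\<^sup>2 \<le> (norm (z - w))\<^sup>2 * (norm w)\<^sup>2"
      using zw by (intro mult_right_mono power_mono) auto
  qed (use assms w in auto)
  also have "\<dots> = 10 * R / norm w ^ 3"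
    using w by (simp add: field_simps power2_eq_square power3_eq_cube)
  finally show ?thesis .
qed

text \<open>One summable majorant has to serve on a whole disc and for all nonzero lattice points,
  including the finitely many ones close to the disc, where the decay estimate does not
  apply.\<close>

lemma wterm_majorant:
  assumes "z \<notin> eis - {0}"
  obtains r M where "r > 0" "M summable_on (eis - {0})"
    "\<And>w x. w \<in> eis - {0} \<Longrightarrow> x \<in> cball z r \<Longrightarrow> norm (1 / (x - w) ^ 2 - 1 / w ^ 2) \<le> M w"
    "\<And>w x. w \<in> eis - {0} \<Longrightarrow> x \<in> cball z r \<Longrightarrow> x \<noteq> w"
proof -
  have "open (- (eis - {0}))" by (intro open_Compl closed_subset_eis) auto
  then obtain e where e: "e > 0" "ball z e \<subseteq> - (eis - {0})"
    using assms openE[of "- (eis - {0})" z] by blast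
  define r where "r = e / 3"
  define R where "R = norm z + r"
  have r: "r > 0" using e by (simp add: r_def)
  have R: "R > 0" using r by (simp add: R_def add_nonneg_pos)
  have far: "norm (x - w) \<ge> r" if "w \<in> eis - {0}" "x \<in> cball z r" for x w
  proof -
    have "w \<notin> ball z e" using e that by blast
    then have "e \<le> dist z w" by simp
    also have "\<dots> \<le> dist z x + dist x w" by (rule dist_triangle)
    finally show ?thesis using that e(1) by (simp add: r_def dist_norm)
  qed
  \<comment> \<open>The second summand is for the points with \<open>norm w < 2 * R\<close>: there
    the term is at most \<open>1 / r ^ 2 + 1\<close>, while \<open>(2 * R) ^ 3 / norm w ^ 3\<close>
    is at least 1.\<close>
  define C where "C = 10 * R + (1 / r ^ 2 + 1) * (2 * R) ^ 3"
  have C: "10 * R \<le> C" "(1 / r ^ 2 + 1) * (2 * R) ^ 3 \<le> C"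
    using R r by (auto simp: C_def)
  define M where "M = (\<lambda>w :: complex. C * (1 / norm w ^ 3))"
  show ?thesis
  proof (rule that[OF r])
    show "M summable_on (eis - {0})"
      unfolding M_def by (intro summable_on_cmult_right summable_eis)
  next
    fix w x assume w: "w \<in> eis - {0}" and x: "x \<in> cball z r"
    have w1: "norm w \<ge> 1" using w eis_norm_ge_1 by auto
    have "norm x \<le> norm z + norm (x - z)" using norm_triangle_ineq[of z "x - z"] by simp
    then have xR: "norm x \<le> R" using x by (simp add: R_def dist_norm norm_minus_commute)
    show "norm (1 / (x - w) ^ 2 - 1 / w ^ 2) \<le> M w"
    proof (cases "2 * R \<le> norm w")
      case True
      have "norm (1 / (x - w) ^ 2 - 1 / w ^ 2) \<le> 10 * R / norm w ^ 3"
        by (rule wterm_bound[OF xR True R])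
      also have "\<dots> \<le> C / norm w ^ 3"
        using C(1) by (intro divide_right_mono) auto
      finally show ?thesis by (simp add: M_def)
    next
      case False
      have "norm (1 / (x - w) ^ 2 - 1 / w ^ 2) \<le> norm (1 / (x - w) ^ 2) + norm (1 / w ^ 2)"
        by (rule norm_triangle_ineq4)
      also have "\<dots> \<le> 1 / r ^ 2 + 1"
      proof (rule add_mono)
        show "norm (1 / (x - w) ^ 2) \<le> 1 / r ^ 2"
          using far[OF w x] r by (auto simp: norm_divide norm_power intro!: divide_left_mono power_mono mult_pos_pos)
        show "norm (1 / w ^ 2) \<le> 1"
          using w1 by (simp add: norm_divide norm_power divide_le_eq_1)
      qed
      also have "\<dots> \<le> (1 / r ^ 2 + 1) * ((2 * R) ^ 3 / norm w ^ 3)"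
      proof -
        have "norm w ^ 3 \<le> (2 * R) ^ 3" using False by (intro power_mono) auto
        then have "1 \<le> (2 * R) ^ 3 / norm w ^ 3" using w1 by (auto simp: le_divide_eq)
        then have "(1 / r ^ 2 + 1) * 1 \<le> (1 / r ^ 2 + 1) * ((2 * R) ^ 3 / norm w ^ 3)"
          by (intro mult_left_mono) auto
        then show ?thesis by simp
      qed
      also have "\<dots> = (1 / r ^ 2 + 1) * (2 * R) ^ 3 / norm w ^ 3" by simp
      also have "\<dots> \<le> C / norm w ^ 3"
        using C(2) by (intro divide_right_mono) auto
      finally show ?thesis by (simp add: M_def)
    qed
    show "x \<noteq> w" using far[OF w x] r by auto
  qed
qed

lemma wrem_derivative:
  assumes "z \<notin> eis - {0}"
  shows "(wrem has_field_derivative wrem' z) (at z)"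
    and "(\<lambda>w. - 2 / (z - w) ^ 3) summable_on (eis - {0})"
proof -
  obtain r M where r: "r > 0" "M summable_on (eis - {0})"
    "\<And>w x. w \<in> eis - {0} \<Longrightarrow> x \<in> cball z r \<Longrightarrow> norm (1 / (x - w) ^ 2 - 1 / w ^ 2) \<le> M w"
    "\<And>w x. w \<in> eis - {0} \<Longrightarrow> x \<in> cball z r \<Longrightarrow> x \<noteq> w"
    using wterm_majorant[OF assms] by metis
  have der: "((\<lambda>x. 1 / (x - w) ^ 2 - 1 / w ^ 2) has_field_derivative - 2 / (x - w) ^ 3) (at x)"
    if "x \<noteq> w" for w x :: complex
    by (auto intro!: derivative_eq_intros simp: that) (use that in \<open>simp add: divide_simps eval_nat_numeral\<close>)
  have "\<exists>D. ((\<lambda>x. \<Sum>\<^sub>\<infinity>w\<in>eis - {0}. 1 / (x - w) ^ 2 - 1 / w ^ 2) has_field_derivative D) (at z) \<and>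
     ((\<lambda>w. - 2 / (z - w) ^ 3) has_sum D) (eis - {0})"
    by (rule infsum_has_field_derivative[OF r(1) _ r(3) r(2)]) (use r(4) der in auto)
  then obtain D where D: "((\<lambda>x. \<Sum>\<^sub>\<infinity>w\<in>eis - {0}. 1 / (x - w) ^ 2 - 1 / w ^ 2) has_field_derivative D) (at z)"
     "((\<lambda>w. - 2 / (z - w) ^ 3) has_sum D) (eis - {0})"
    by blast
  then show "(\<lambda>w. - 2 / (z - w) ^ 3) summable_on (eis - {0})" by (auto simp: summable_on_def)
  have "D = wrem' z" using D(2) unfolding wrem'_def by (simp add: infsumI)
  with D(1) show "(wrem has_field_derivative wrem' z) (at z)"
    unfolding wrem_def[abs_def] by simp
qed

lemma wrem_holomorphic: "wrem holomorphic_on - (eis - {0})"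
  unfolding holomorphic_on_def field_differentiable_def
  using wrem_derivative(1) has_field_derivative_at_within by blast

text \<open>The analysis is done on the unscaled lattice \<open>eis\<close>; the period enters
  later, through the scaling that leads to \<open>pp\<close>.\<close>

definition wq :: "complex \<Rightarrow> complex" where "wq = weierstrass_p eis"

lemma wq_eq: "wq z = 1 / z ^ 2 + wrem z"
  by (simp add: wq_def weierstrass_p_def wrem_def)

text \<open>The sum runs over the whole lattice, with 0, so that periodicity is a mere
  reindexing.\<close>

definition wq' :: "complex \<Rightarrow> complex" where "wq' z = (\<Sum>\<^sub>\<infinity>w\<in>eis. - 2 / (z - w) ^ 3)"

lemma wq'_has_sum:
  assumes "z \<notin> eis"
  shows "((\<lambda>w. - 2 / (z - w) ^ 3) has_sum (- 2 / z ^ 3 + wrem' z)) eis"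
proof -
  have "((\<lambda>w. - 2 / (z - w) ^ 3) has_sum wrem' z) (eis - {0})"
    unfolding wrem'_def using assms by (intro has_sum_infsum wrem_derivative) auto
  then have "((\<lambda>w. - 2 / (z - w) ^ 3) has_sum (- 2 / (z - 0) ^ 3 + wrem' z)) (insert 0 (eis - {0}))"
    by (intro has_sum_insert) auto
  then show ?thesis by (simp add: insert_absorb)
qed

lemma wq'_eq: "z \<notin> eis \<Longrightarrow> wq' z = - 2 / z ^ 3 + wrem' z"
  unfolding wq'_def using wq'_has_sum infsumI by blast

lemma wq_derivative:
  assumes "z \<notin> eis" shows "(wq has_field_derivative wq' z) (at z)"
proof -
  have z: "z \<noteq> 0" "z \<notin> eis - {0}" using assms by auto
  have "((\<lambda>z. 1 / z ^ 2 + wrem z) has_field_derivative (- 2 / z ^ 3 + wrem' z)) (at z)"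
    by (rule derivative_eq_intros wrem_derivative(1)[OF z(2)] refl | simp add: z)+
       (use z in \<open>simp add: divide_simps eval_nat_numeral\<close>)
  then show ?thesis by (simp add: wq_eq[abs_def] wq'_eq[OF assms])
qed

section \<open>Symmetries and periodicity\<close>

lemma bij_betw_eis_shift: "w \<in> eis \<Longrightarrow> bij_betw (\<lambda>x. x + w) eis eis"
  by (rule bij_betw_byWitness[of _ "\<lambda>x. x - w"]) auto

lemma bij_betw_eis_uminus: "bij_betw uminus eis eis"
  by (rule bij_betw_byWitness[of _ uminus]) auto

lemma bij_betw_eis_rho: "bij_betw ((*) rho) eis eis"
proof (rule bij_betw_byWitness[of _ "(*) (rho ^ 2)"])
  have "rho ^ 2 * rho = 1" "rho * rho ^ 2 = 1" using rho_cube by (simp_all add: power3_eq_cube power2_eq_square mult.assoc)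
  then show "\<forall>a\<in>eis. rho ^ 2 * (rho * a) = a" "\<forall>a\<in>eis. rho * (rho ^ 2 * a) = a"
    by (metis mult.assoc mult_1)+
qed auto

lemma bij_betw_eis_cnj: "bij_betw cnj eis eis"
  by (rule bij_betw_byWitness[of _ cnj]) auto

lemma bij_betw_minus_0:
  "bij_betw f eis eis \<Longrightarrow> f 0 = 0 \<Longrightarrow> bij_betw f (eis - {0}) (eis - {0 :: complex})"
  by (rule bij_betw_DiffI) auto

lemma wq'_shift: "w \<in> eis \<Longrightarrow> wq' (z + w) = wq' z"
  unfolding wq'_def
  using infsum_reindex_bij_betw[OF bij_betw_eis_shift[of w], of "\<lambda>x. - 2 / (z + w - x) ^ 3"] by simp

lemma wq_uminus: "wq (- z) = wq z"
proof -
  have "wrem (- z) = wrem z"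
    unfolding wrem_def
    using infsum_reindex_bij_betw[OF bij_betw_minus_0[OF bij_betw_eis_uminus], of "\<lambda>x. 1 / (- z - x) ^ 2 - 1 / x ^ 2"]
    by (simp add: power2_commute)
  then show ?thesis by (simp add: wq_eq)
qed

lemma wq'_uminus: "wq' (- z) = - wq' z"
proof -
  have "wq' (- z) = (\<Sum>\<^sub>\<infinity>w\<in>eis. - 2 / (- z + w) ^ 3)"
    unfolding wq'_def
    using infsum_reindex_bij_betw[OF bij_betw_eis_uminus, of "\<lambda>x. - 2 / (- z - x) ^ 3"] by simp
  also have "\<dots> = (\<Sum>\<^sub>\<infinity>w\<in>eis. - (- 2 / (z - w) ^ 3))"
  proof (rule infsum_cong)
    fix w have "(- z + w) ^ 3 = - ((z - w) ^ 3)" by (simp add: power3_eq_cube algebra_simps)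
    then show "- 2 / (- z + w) ^ 3 = - (- 2 / (z - w) ^ 3)" by simp
  qed
  also have "\<dots> = - wq' z" by (simp only: infsum_uminus wq'_def)
  finally show ?thesis .
qed

lemma rho_inverse: "1 / rho ^ 2 = rho"
  using rho_cube by (simp add: divide_simps power3_eq_cube power2_eq_square mult.assoc)

text \<open>Complex multiplication: the lattice is stable under \<open>rho\<close> and the terms are
  homogeneous of degree -2, so the factor is \<open>1 / rho ^ 2 = rho\<close>.\<close>

lemma wq_rho: "wq (rho * z) = rho * wq z"
proof -
  have "wrem (rho * z) = (\<Sum>\<^sub>\<infinity>w\<in>eis - {0}. rho * (1 / (z - w) ^ 2 - 1 / w ^ 2))"
  proof -
    have "1 / (rho * z - rho * w) ^ 2 - 1 / (rho * w) ^ 2 = rho * (1 / (z - w) ^ 2 - 1 / w ^ 2)" for w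
    proof -
      have "1 / (rho * z - rho * w) ^ 2 - 1 / (rho * w) ^ 2 = (1 / rho ^ 2) * (1 / (z - w) ^ 2 - 1 / w ^ 2)"
      proof -
        have "(rho * z - rho * w) ^ 2 = rho ^ 2 * (z - w) ^ 2" by (metis power_mult_distrib right_diff_distrib)
        then show ?thesis by (simp add: power_mult_distrib right_diff_distrib)
      qed
      then show ?thesis by (simp add: rho_inverse)
    qed
    then show ?thesis
      unfolding wrem_def
      using infsum_reindex_bij_betw[OF bij_betw_minus_0[OF bij_betw_eis_rho], of "\<lambda>x. 1 / (rho * z - x) ^ 2 - 1 / x ^ 2"]
      by simp
  qed
  also have "\<dots> = rho * wrem z" unfolding wrem_def by (rule infsum_cmult_right')
  finally have 1: "wrem (rho * z) = rho * wrem z" .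
  have "1 / (rho * z) ^ 2 = (1 / rho ^ 2) * (1 / z ^ 2)" by (simp add: power_mult_distrib)
  then show ?thesis by (simp add: wq_eq 1 rho_inverse distrib_left)
qed

lemma wq'_rho: "wq' (rho * z) = wq' z"
proof -
  have "(rho * z - rho * w) ^ 3 = (z - w) ^ 3" for w
  proof -
    have "(rho * z - rho * w) ^ 3 = rho ^ 3 * (z - w) ^ 3" by (metis power_mult_distrib right_diff_distrib)
    then show ?thesis by (simp add: rho_cube)
  qed
  then show ?thesis unfolding wq'_def
    using infsum_reindex_bij_betw[OF bij_betw_eis_rho, of "\<lambda>x. - 2 / (rho * z - x) ^ 3"] by simp
qed

text \<open>The lattice is stable under conjugation. Hence the function is real at every point that
  conjugation fixes up to sign and periods.\<close>

lemma wq_cnj: "wq (cnj z) = cnj (wq z)"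
proof -
  have "wrem (cnj z) = (\<Sum>\<^sub>\<infinity>w\<in>eis - {0}. cnj (1 / (z - w) ^ 2 - 1 / w ^ 2))"
    unfolding wrem_def
    using infsum_reindex_bij_betw[OF bij_betw_minus_0[OF bij_betw_eis_cnj], of "\<lambda>x. 1 / (cnj z - x) ^ 2 - 1 / x ^ 2"]
    by simp
  also have "\<dots> = cnj (wrem z)" unfolding wrem_def by (rule infsum_cnj)
  finally show ?thesis by (simp add: wq_eq)
qed

lemma wq'_cnj: "wq' (cnj z) = cnj (wq' z)"
proof -
  have "wq' (cnj z) = (\<Sum>\<^sub>\<infinity>w\<in>eis. cnj (- 2 / (z - w) ^ 3))"
    unfolding wq'_def
    using infsum_reindex_bij_betw[OF bij_betw_eis_cnj, of "\<lambda>x. - 2 / (cnj z - x) ^ 3"]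
    by simp
  also have "\<dots> = cnj (wq' z)" unfolding wq'_def by (rule infsum_cnj)
  finally show ?thesis .
qed

lemma DERIV_zero_constant_on:
  fixes f :: "complex \<Rightarrow> complex"
  assumes "open S" "connected S" "\<And>z. z \<in> S \<Longrightarrow> (f has_field_derivative 0) (at z)" "x \<in> S" "y \<in> S"
  shows "f x = f y"
proof -
  obtain c where "\<And>z. z \<in> S \<Longrightarrow> f z = c"
    using has_field_derivative_0_imp_constant_on[of S f] assms has_field_derivative_at_within
    by (metis constant_on_def)
  then show ?thesis using assms by simp
qed

lemma connected_Compl_eis [simp, intro]: "connected (- eis)"
  by (rule connected_Compl_countable[OF countable_eis])

lemma half_not_eis: "1 / 2 \<notin> eis" "rho / 2 \<notin> eis"
proof -
  have "norm (1 / 2 :: complex) < 1" "norm (rho / 2) < 1" by (simp_all add: norm_divide)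
  then show "1 / 2 \<notin> eis" "rho / 2 \<notin> eis"
    using eis_norm_ge_1[of "1 / 2"] eis_norm_ge_1[of "rho / 2"] by auto
qed

text \<open>The difference of both sides has derivative 0 by the periodicity of \<open>wq'\<close>,
  so it is constant on the connected complement of the lattice. Evenness makes it vanish at
  \<open>- (w / 2)\<close>, which must not be a lattice point; the generators 1 and
  \<open>rho\<close> satisfy this.\<close>

lemma wq_shift_aux:
  assumes "w \<in> eis" "w / 2 \<notin> eis" "z \<notin> eis"
  shows "wq (z + w) = wq z"
proof -
  let ?f = "\<lambda>z. wq (z + w) - wq z"
  have "(?f has_field_derivative 0) (at z)" if "z \<in> - eis" for z
  proof -
    have "z + w \<notin> eis" "z \<notin> eis" using that assms eis_add_iff by auto
    then show ?thesis using assms wq'_shift[of w z]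
      by (auto intro!: derivative_eq_intros DERIV_chain2[OF wq_derivative] wq_derivative)
  qed
  moreover have "- (w / 2) \<in> - eis" using assms by simp
  ultimately have "?f z = ?f (- (w / 2))"
    by (intro DERIV_zero_constant_on[of "- eis" ?f]) (use assms in auto)
  also have "\<dots> = 0" using wq_uminus[of "w / 2"] by simp
  finally show ?thesis by simp
qed

lemma shift_multiples:
  fixes f :: "complex \<Rightarrow> complex"
  assumes "\<And>z. z \<notin> eis \<Longrightarrow> f (z + w) = f z" "w \<in> eis" "z \<notin> eis"
  shows "f (z + of_int n * w) = f z"
proof -
  have nat: "f (z + of_nat n * w) = f z" if "z \<notin> eis" for n z
  proof (induction n)
    case (Suc n)
    have "z + of_nat n * w \<notin> eis" using that assms(2) by (subst eis_add_iff) auto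
    then have "f (z + of_nat n * w + w) = f z" using assms(1) Suc by simp
    then show ?case by (simp add: algebra_simps)
  qed simp
  show ?thesis
  proof (cases n rule: int_cases2)
    case (nonneg m) then show ?thesis using nat assms by simp
  next
    case (nonpos m)
    have "z - of_nat m * w \<notin> eis"
      using assms eis_add_iff[of "- of_nat m * w" z] by auto
    then have "f (z - of_nat m * w + of_nat m * w) = f (z - of_nat m * w)" by (rule nat)
    then show ?thesis using nonpos by simp
  qed
qed

lemma wq_shift:
  assumes "w \<in> eis" "z \<notin> eis" shows "wq (z + w) = wq z"
proof -
  obtain a b where w: "w = of_int a + of_int b * rho" using assms by (auto elim: eisE)
  have "z + of_int a * 1 \<notin> eis" using assms by (subst eis_add_iff) auto
  then have "wq (z + of_int a * 1 + of_int b * rho) = wq (z + of_int a * 1)"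
    by (intro shift_multiples wq_shift_aux) (use half_not_eis in auto)
  also have "\<dots> = wq z"
    by (intro shift_multiples wq_shift_aux) (use half_not_eis assms in auto)
  finally show ?thesis by (simp add: w add_ac)
qed

section \<open>Taylor coefficients at the origin\<close>

definition wF :: "complex fps" where "wF = fps_expansion wrem 0"

lemma open_Compl_eis_0 [simp, intro]: "open (- (eis - {0}))"
  by (intro open_Compl closed_subset_eis) auto

lemma wrem_fps: "wrem has_fps_expansion wF"
  unfolding wF_def by (rule has_fps_expansion_fps_expansion[OF open_Compl_eis_0 _ wrem_holomorphic]) simp

lemma wrem_0: "wrem 0 = 0" by (simp add: wrem_def)

lemma wrem_rho: "wrem (rho * z) = rho * wrem z"
proof (cases "z = 0")
  case False
  have "1 / (rho * z) ^ 2 = (1 / rho ^ 2) * (1 / z ^ 2)" by (simp add: power_mult_distrib)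
  then have "1 / (rho * z) ^ 2 = rho * (1 / z ^ 2)" by (simp add: rho_inverse)
  then show ?thesis using wq_rho[of z] by (simp add: wq_eq distrib_left)
qed (simp add: wrem_0)

lemma wrem_uminus: "wrem (- z) = wrem z"
  using wq_uminus[of z] by (simp add: wq_eq)

lemma has_fps_expansion_compose_linear:
  fixes f :: "complex \<Rightarrow> complex"
  assumes "f has_fps_expansion F"
  shows "(\<lambda>z. f (c * z)) has_fps_expansion fps_compose F (fps_const c * fps_X)"
proof -
  have "(\<lambda>z. c * z) has_fps_expansion fps_const c * fps_X"
    by (intro has_fps_expansion_cmult_left has_fps_expansion_fps_X)
  then have "(f \<circ> (\<lambda>z. c * z)) has_fps_expansion fps_compose F (fps_const c * fps_X)"
    by (rule has_fps_expansion_compose[OF assms]) simp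
  then show ?thesis by (simp add: o_def)
qed

lemma wF_rho: "rho ^ n * fps_nth wF n = rho * fps_nth wF n"
proof -
  have "(\<lambda>z. rho * wrem z) has_fps_expansion fps_const rho * wF"
    by (intro fps_expansion_intros wrem_fps)
  moreover have "(\<lambda>z. wrem (rho * z)) has_fps_expansion fps_compose wF (fps_const rho * fps_X)"
    by (intro has_fps_expansion_compose_linear wrem_fps)
  ultimately have "fps_compose wF (fps_const rho * fps_X) = fps_const rho * wF"
    unfolding wrem_rho by (metis fps_expansion_unique_complex)
  then have "fps_nth (fps_compose wF (fps_const rho * fps_X)) n = fps_nth (fps_const rho * wF) n" by simp
  then show ?thesis by simp
qed

lemma wF_uminus: "(- 1) ^ n * fps_nth wF n = fps_nth wF n"
proof -
  have "(\<lambda>z. wrem (- 1 * z)) has_fps_expansion fps_compose wF (fps_const (- 1) * fps_X)"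
    by (intro has_fps_expansion_compose_linear wrem_fps)
  then have "wrem has_fps_expansion fps_compose wF (fps_const (- 1) * fps_X)"
    by (simp add: wrem_uminus del: fps_const_minus)
  then have "fps_compose wF (fps_const (- 1) * fps_X) = wF"
    using wrem_fps by (rule fps_expansion_unique_complex)
  then have "fps_nth (fps_compose wF (fps_const (- 1) * fps_X)) n = fps_nth wF n" by simp
  then show ?thesis by (simp del: fps_const_minus)
qed

lemma rho_neq_1: "rho \<noteq> 1" by (simp add: rho_eq complex_eq_iff)

text \<open>\<open>wF_rho\<close> leaves only exponents congruent to 1 modulo 3 and
  \<open>wF_uminus\<close> only even ones, so 4 is the first possible exponent. The vanishing in
  degree 2 is that of the invariant g2.\<close>

lemma wF_low: "n < 4 \<Longrightarrow> fps_nth wF n = 0"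
proof -
  assume "n < 4"
  then consider "n = 0" | "n = 1" | "n = 2" | "n = 3" by linarith
  then show ?thesis
  proof cases
    case 1 then show ?thesis using wF_rho[of 0] rho_neq_1 by simp
  next
    case 2 then show ?thesis using wF_uminus[of 1] by simp
  next
    case 3 then show ?thesis using wF_rho[of 2] rho_neq_1 by (simp add: power2_eq_square)
  next
    case 4 then show ?thesis using wF_rho[of 3] rho_neq_1 by (simp add: rho_cube)
  qed
qed

section \<open>The differential equation of the lattice function\<close>

definition wq'' :: "complex \<Rightarrow> complex" where "wq'' = deriv wq'"

lemma wq_holomorphic: "wq holomorphic_on - eis"
  unfolding holomorphic_on_def field_differentiable_def
  using wq_derivative has_field_derivative_at_within by blast

lemma deriv_wq: "z \<notin> eis \<Longrightarrow> deriv wq z = wq' z"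
  using wq_derivative DERIV_imp_deriv by blast

lemma wq'_holomorphic: "wq' holomorphic_on - eis"
  by (rule holomorphic_transform[OF holomorphic_deriv[OF wq_holomorphic open_Compl_eis]])
     (use deriv_wq in auto)

lemma wq'_derivative: "z \<notin> eis \<Longrightarrow> (wq' has_field_derivative wq'' z) (at z)"
  unfolding wq''_def by (rule holomorphic_derivI[OF wq'_holomorphic open_Compl_eis]) auto

lemma wq''_shift:
  assumes "w \<in> eis" shows "wq'' (z + w) = wq'' z"
proof -
  have "deriv (\<lambda>z. wq' (z + w)) z = deriv wq' (z + w)"
    unfolding deriv_def by (simp add: DERIV_shift)
  then show ?thesis by (simp add: wq''_def wq'_shift[OF assms])
qed

lemma wq''_near_0:
  assumes "z \<notin> eis" shows "wq'' z = 6 / z ^ 4 + deriv (deriv wrem) z"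
proof -
  have d: "deriv wrem x = wrem' x" if "x \<notin> eis - {0}" for x
    using wrem_derivative(1)[OF that] DERIV_imp_deriv by blast
  have d1: "(deriv wrem has_field_derivative deriv (deriv wrem) z) (at z)"
    by (rule holomorphic_derivI[OF holomorphic_deriv[OF wrem_holomorphic open_Compl_eis_0] open_Compl_eis_0])
       (use assms in auto)
  have "eventually (\<lambda>x. x \<in> - eis) (nhds z)"
    using assms by (intro eventually_nhds_in_open) auto
  then have ev: "eventually (\<lambda>x. wq' x = - 2 / x ^ 3 + deriv wrem x) (nhds z)"
    by eventually_elim (use d wq'_eq in auto)
  have "z \<noteq> 0" using assms by auto
  then have d2: "((\<lambda>x. - 2 / x ^ 3) has_field_derivative 6 / z ^ 4) (at z)"
    by (auto intro!: derivative_eq_intros) (simp add: divide_simps eval_nat_numeral)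
  have "(wq' has_field_derivative 6 / z ^ 4 + deriv (deriv wrem) z) (at z)"
    by (rule DERIV_cong_ev[OF refl ev refl, THEN iffD2, OF DERIV_add[OF d2 d1]])
  then show ?thesis unfolding wq''_def by (rule DERIV_imp_deriv)
qed

text \<open>A crude fundamental domain, obtained by rounding the two coordinates down. It only
  serves to bound a doubly periodic entire function.\<close>

lemma eis_reduce: obtains w where "w \<in> eis" "norm (z - w) \<le> 2"
proof -
  define b where "b = \<lfloor>Im z / (sqrt 3 / 2)\<rfloor>"
  define a where "a = \<lfloor>Re z + b / 2\<rfloor>"
  define w where "w = eis_pair (a, b)"
  have s3: "sqrt 3 < 2" by (rule real_less_lsqrt) auto
  have "\<bar>Im z / (sqrt 3 / 2) - b\<bar> \<le> 1" unfolding b_def by linarith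
  moreover have "Im (z - w) = (sqrt 3 / 2) * (Im z / (sqrt 3 / 2) - b)"
    by (simp add: w_def Im_eis_pair field_simps)
  ultimately have "\<bar>Im (z - w)\<bar> \<le> (sqrt 3 / 2) * 1"
    by (simp only: abs_mult) (intro mult_mono, auto)
  moreover have "\<bar>Re (z - w)\<bar> \<le> 1" unfolding w_def a_def by (simp add: Re_eis_pair) linarith
  ultimately have "norm (z - w) \<le> 2" using cmod_le[of "z - w"] s3 by linarith
  then show ?thesis using that[of w] by (auto simp: w_def eis_pair_def intro!: eis_add eis_mult)
qed

text \<open>Liouville's theorem. At 0 the poles of \<open>wq''\<close> and \<open>6 * wq ^ 2\<close>
  cancel up to \<open>12 * wrem z / z ^ 2\<close>, which is analytic and vanishes at 0 because
  \<open>wrem\<close> has no terms below degree 4. Thus the difference, set to 0 on the lattice, is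
  entire and doubly periodic, hence constant, and its value at 0 is 0.\<close>

lemma wq_square:
  assumes "z \<notin> eis" shows "wq'' z = 6 * wq z ^ 2"
proof -
  define h where "h = (\<lambda>z. if z \<in> eis then 0 else wq'' z - 6 * wq z ^ 2)"
  have h_shift: "h (z + w) = h z" if "w \<in> eis" for z w
    using that by (auto simp: h_def eis_add_iff wq_shift wq''_shift)
  define H where "H = (\<lambda>z. if z = 0 then fps_nth wF 2 else wrem z / z ^ 2)"
  define g where "g = (\<lambda>z. deriv (deriv wrem) z - 12 * H z - 6 * wrem z ^ 2)"
  have sub: "2 \<le> subdegree wF" if "wF \<noteq> 0"
    using that wF_low by (intro subdegree_geI) auto
  have H: "H has_fps_expansion fps_shift 2 wF"
  proof (cases "wF = 0")
    case True
    then have "eventually (\<lambda>z. wrem z = 0) (nhds 0)"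
      using wrem_fps by (auto simp: has_fps_expansion_def elim: eventually_mono)
    then have "eventually (\<lambda>z. H z = 0) (nhds 0)"
      by eventually_elim (use True in \<open>auto simp: H_def\<close>)
    then show ?thesis using True by (auto simp: has_fps_expansion_def elim: eventually_mono)
  next
    case False
    then show ?thesis unfolding H_def by (intro has_fps_expansion_shift wrem_fps sub) auto
  qed
  have g: "g has_fps_expansion fps_deriv (fps_deriv wF) - fps_const 12 * fps_shift 2 wF - fps_const 6 * wF ^ 2"
    unfolding g_def by (intro fps_expansion_intros wrem_fps H)
  have g0: "g 0 = 0"
    using has_fps_expansion_imp_0_eq_fps_nth_0[OF g] wF_low[of 0] wF_low[of 2]
    by (simp add: power2_eq_square numeral_2_eq_2)
  have "eventually (\<lambda>z. z \<in> ball 0 1) (nhds (0 :: complex))"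
    by (intro eventually_nhds_in_open) auto
  then have ev: "eventually (\<lambda>z. h z = g z) (nhds 0)"
  proof eventually_elim
    case (elim z)
    show ?case
    proof (cases "z = 0")
      case False
      then have z: "z \<notin> eis" using elim eis_norm_ge_1[of z] by auto
      show ?thesis using False z
        by (simp add: h_def g_def wq''_near_0[OF z] wq_eq H_def power2_eq_square divide_simps eval_nat_numeral)
           (simp add: algebra_simps)
    qed (simp add: h_def g0)
  qed
  have "g analytic_on {0}" using g by (rule has_fps_expansion_imp_analytic_0)
  then have "h analytic_on {0}" using ev by (subst analytic_at_cong[OF ev refl])
  then have d0: "h field_differentiable at 0" by (rule analytic_on_imp_differentiable_at) auto
  have "h field_differentiable at z" for z
  proof (cases "z \<in> eis")
    case True
    then have "h = (\<lambda>x. h (- z + x))" using h_shift[of "- z"] by (auto simp: add_ac)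
    obtain D where "(h has_field_derivative D) (at 0)" using d0 by (auto simp: field_differentiable_def)
    then have "((\<lambda>x. h (x + - z)) has_field_derivative D) (at z)"
      using DERIV_shift[of h D z "- z"] by simp
    moreover have "(\<lambda>x. h (x + - z)) = h" using h_shift[of "- z"] True by auto
    ultimately show ?thesis by (auto simp: field_differentiable_def)
  next
    case False
    obtain D where "((\<lambda>z. wq'' z - 6 * wq z ^ 2) has_field_derivative D) (at z)"
    proof -
      have "wq'' holomorphic_on - eis" unfolding wq''_def by (intro holomorphic_deriv wq'_holomorphic) auto
      then have "(\<lambda>z. wq'' z - 6 * wq z ^ 2) holomorphic_on - eis"
        by (intro holomorphic_intros wq_holomorphic)
      then have "(\<lambda>z. wq'' z - 6 * wq z ^ 2) field_differentiable at z"
        using False by (meson ComplI holomorphic_on_imp_differentiable_at open_Compl_eis)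
      then show ?thesis using that by (auto simp: field_differentiable_def)
    qed
    moreover have "eventually (\<lambda>x. x \<in> - eis) (nhds z)"
      using False by (intro eventually_nhds_in_open) auto
    then have "eventually (\<lambda>x. h x = wq'' x - 6 * wq x ^ 2) (nhds z)"
      by eventually_elim (auto simp: h_def)
    ultimately have "(h has_field_derivative D) (at z)"
      by (subst DERIV_cong_ev[OF refl _ refl])
    then show ?thesis by (auto simp: field_differentiable_def)
  qed
  then have hol: "h holomorphic_on UNIV" by (simp add: field_differentiable_at_within holomorphic_on_def)
  have "bounded (h ` cball 0 2)"
    by (intro compact_imp_bounded compact_continuous_image holomorphic_on_imp_continuous_on
          holomorphic_on_subset[OF hol]) auto
  moreover have "range h \<subseteq> h ` cball 0 2"
  proof safe
    fix z
    obtain w where w: "w \<in> eis" "norm (z - w) \<le> 2" by (rule eis_reduce)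
    then have "h z = h (z - w)" using h_shift[of "- w" z] by simp
    then show "h z \<in> h ` cball 0 2" using w by auto
  qed
  ultimately have "bounded (range h)" by (rule bounded_subset)
  then have "h constant_on UNIV" by (rule Liouville_theorem[OF hol])
  then have "h z = h 0" by (auto simp: constant_on_def)
  then show ?thesis using assms by (simp add: h_def)
qed

section \<open>The value at the real half period\<close>

definition e1 :: real where "e1 = Re (wq (1 / 2))"

lemma wq_half: "wq (1 / 2) = of_real e1"
  using wq_cnj[of "1 / 2"] by (simp add: e1_def complex_eq_iff)

lemma wq'_half: "wq' (1 / 2) = 0"
  using wq'_shift[of 1 "- 1 / 2"] wq'_uminus[of "1 / 2"] by simp

text \<open>The derivative of \<open>wq' ^ 2 - 4 * wq ^ 3\<close> is
  \<open>2 * wq' * (wq'' - 6 * wq ^ 2) = 0\<close>. The constant is read off at the half period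
  \<open>1 / 2\<close>, a zero of the odd periodic function \<open>wq'\<close>.\<close>

lemma wq'_square:
  assumes "z \<notin> eis" shows "wq' z ^ 2 = 4 * wq z ^ 3 - 4 * of_real e1 ^ 3"
proof -
  define f where "f = (\<lambda>z. wq' z ^ 2 - 4 * wq z ^ 3)"
  have "(f has_field_derivative 0) (at z)" if "z \<in> - eis" for z
    unfolding f_def using that
    by (auto intro!: derivative_eq_intros wq_derivative wq'_derivative simp: wq_square algebra_simps power2_eq_square)
  then have "f z = f (1 / 2)"
    by (rule DERIV_zero_constant_on[OF open_Compl_eis connected_Compl_eis]) (use assms half_not_eis in auto)
  then show ?thesis by (simp add: f_def wq_half wq'_half algebra_simps)
qed

text \<open>By the identity theorem \<open>wq\<close> would vanish off the lattice, whereas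
  \<open>z ^ 2 * wq z\<close> tends to 1 at 0.\<close>

lemma wq_not_identically_0:
  assumes "x \<in> - eis" "x islimpt U" "U \<subseteq> - eis" "\<And>z. z \<in> U \<Longrightarrow> wq z = 0"
  shows False
proof -
  have z: "wq z = 0" if "z \<in> - eis" for z
    by (rule analytic_continuation[OF wq_holomorphic open_Compl_eis connected_Compl_eis assms(3,1,2) assms(4) that])
  have "eventually (\<lambda>z. z \<in> ball 0 1 - {0}) (at (0 :: complex))"
    by (intro eventually_at_in_open) auto
  then have "eventually (\<lambda>z. 1 + z ^ 2 * wrem z = 0) (at 0)"
  proof eventually_elim
    case (elim w)
    then have "w \<notin> eis" using eis_norm_ge_1[of w] by auto
    then have "w ^ 2 * (1 / w ^ 2 + wrem w) = 0" using z[of w] wq_eq[of w] by auto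
    then show ?case using elim by (simp add: distrib_left)
  qed
  then have "((\<lambda>z. 1 + z ^ 2 * wrem z) \<longlongrightarrow> 0) (at 0)" by (rule tendsto_eventually)
  moreover have "isCont wrem 0" using wrem_derivative(1)[of 0] DERIV_isCont by blast
  then have "((\<lambda>z. 1 + z ^ 2 * wrem z) \<longlongrightarrow> 1 + 0 ^ 2 * wrem 0) (at 0)"
    by (intro tendsto_intros) (auto simp: isCont_def)
  ultimately show False using tendsto_unique[of "at (0::complex)"] by fastforce
qed

text \<open>On the vertical segment from 1/2 to the centroid 1/2 + i/(2 sqrt 3) of a lattice
  triangle, \<open>wq\<close> is real, since conjugation acts there as \<open>z\<close> to
  \<open>1 - z\<close>. At the centroid, which \<open>rho\<close> fixes modulo the lattice, it
  vanishes. Along the segment it decreases: the second derivative is \<open>- 6 * f ^ 2\<close> and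
  the first one vanishes at the start. If \<open>e1\<close> were 0, \<open>wq\<close> would vanish
  on the whole segment.\<close>

lemma e1_pos: "e1 > 0"
proof -
  define T where "T = 1 / (2 * sqrt 3)"
  define \<gamma> where "\<gamma> = (\<lambda>t::real. 1 / 2 + \<i> * of_real t)"
  have T: "T > 0" "T ^ 2 = 1 / 12" by (simp_all add: T_def power_mult_distrib power_divide)
  have ne: "\<gamma> t \<notin> eis" if "t \<in> {0..T}" for t
  proof
    assume "\<gamma> t \<in> eis"
    moreover have "\<gamma> t \<noteq> 0" by (simp add: \<gamma>_def complex_eq_iff)
    ultimately have "norm (\<gamma> t) \<ge> 1" by (intro eis_norm_ge_1)
    then have "norm (\<gamma> t) ^ 2 \<ge> 1" by simp
    moreover have "t ^ 2 \<le> T ^ 2" using that by (intro power_mono) auto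
    moreover have "norm (\<gamma> t) ^ 2 = 1 / 4 + t ^ 2"
      unfolding cmod_power2 by (simp add: \<gamma>_def power_divide)
    ultimately show False using T by simp
  qed
  have real: "wq (\<gamma> t) = of_real (Re (wq (\<gamma> t)))" if t: "t \<in> {0..T}" for t
  proof -
    have "cnj (\<gamma> t) = - \<gamma> t + 1" by (simp add: \<gamma>_def complex_eq_iff)
    then have "cnj (wq (\<gamma> t)) = wq (- \<gamma> t + 1)" using wq_cnj[of "\<gamma> t"] by simp
    also have "\<dots> = wq (\<gamma> t)" using ne[OF t] wq_shift[of 1 "- \<gamma> t"] by (simp add: wq_uminus)
    finally show ?thesis by (simp add: complex_eq_iff)
  qed
  have end0: "wq (\<gamma> T) = 0"
  proof -
    have "rho * \<gamma> T = \<gamma> T + (- 1)"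
      by (simp add: \<gamma>_def rho_eq T_def complex_eq_iff field_simps)
    then have "rho * wq (\<gamma> T) = wq (\<gamma> T + (- 1))" using wq_rho[of "\<gamma> T"] by simp
    also have "\<dots> = wq (\<gamma> T)" using ne[of T] T by (intro wq_shift) auto
    finally show ?thesis using rho_neq_1 by simp
  qed
  define f where "f = (\<lambda>t. Re (wq (\<gamma> t)))"
  define f' where "f' = (\<lambda>t. Re (\<i> * wq' (\<gamma> t)))"
  have gd: "(\<gamma> has_vector_derivative \<i>) (at t)" for t
    unfolding \<gamma>_def by (auto intro!: derivative_eq_intros)
  have f: "(f has_real_derivative f' t) (at t)" if "t \<in> {0..T}" for t
  proof -
    have "((wq \<circ> \<gamma>) has_vector_derivative \<i> * wq' (\<gamma> t)) (at t)"
      by (rule field_vector_diff_chain_at[OF gd wq_derivative[OF ne[OF that]]])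
    then show ?thesis unfolding f_def f'_def has_real_derivative_iff_has_vector_derivative
      by (auto dest: bounded_linear.has_vector_derivative[OF bounded_linear_Re] simp: o_def)
  qed
  have f': "(f' has_real_derivative - 6 * f t ^ 2) (at t)" if "t \<in> {0..T}" for t
  proof -
    have "((wq' \<circ> \<gamma>) has_vector_derivative \<i> * wq'' (\<gamma> t)) (at t)"
      by (rule field_vector_diff_chain_at[OF gd wq'_derivative[OF ne[OF that]]])
    then have "((\<lambda>t. \<i> * wq' (\<gamma> t)) has_vector_derivative \<i> * (\<i> * wq'' (\<gamma> t))) (at t)"
      by (intro derivative_intros) (auto simp: o_def)
    then have "(f' has_real_derivative Re (\<i> * (\<i> * wq'' (\<gamma> t)))) (at t)"
      unfolding f'_def has_real_derivative_iff_has_vector_derivative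
      by (rule bounded_linear.has_vector_derivative[OF bounded_linear_Re])
    moreover have "\<i> * (\<i> * wq'' (\<gamma> t)) = of_real (- 6 * f t ^ 2)"
      unfolding wq_square[OF ne[OF that]] by (subst real[OF that]) (simp add: f_def flip: mult.assoc)
    ultimately show ?thesis by (simp only: Re_complex_of_real)
  qed
  have f'0: "f' 0 = 0" by (simp add: f'_def \<gamma>_def wq'_half)
  have f'neg: "f' t \<le> 0" if "t \<in> {0..T}" for t
  proof -
    have "f' t \<le> f' 0"
    proof (rule DERIV_nonpos_imp_nonincreasing[of 0 t f'])
      fix x assume "0 \<le> x" "x \<le> t"
      then have "(f' has_real_derivative - 6 * f x ^ 2) (at x)" using that by (intro f') auto
      then show "\<exists>y. (f' has_real_derivative y) (at x) \<and> y \<le> 0" by (intro exI conjI) auto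
    qed (use that in auto)
    then show ?thesis using f'0 by simp
  qed
  have mono: "f t \<le> f s" if "0 \<le> s" "s \<le> t" "t \<le> T" for s t
  proof (rule DERIV_nonpos_imp_nonincreasing[of s t f])
    fix x assume "s \<le> x" "x \<le> t"
    then have "x \<in> {0..T}" using that by auto
    then show "\<exists>y. (f has_real_derivative y) (at x) \<and> y \<le> 0" using f f'neg by blast
  qed (use that in auto)
  have fT: "f T = 0" using end0 by (simp add: f_def)
  have f0: "f 0 = e1" by (simp add: f_def \<gamma>_def e1_def)
  have "e1 \<ge> 0" using mono[of 0 T] fT f0 T by simp
  moreover have "e1 \<noteq> 0"
  proof
    assume "e1 = 0"
    then have ft: "f t = 0" if "t \<in> {0..T}" for t
      using mono[of 0 t] mono[of t T] that fT f0 by auto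
    have h1: "wq z = 0" if "z \<in> \<gamma> ` {0..T}" for z
      using that ft real by (auto simp: f_def)
    have h2: "\<gamma> ` {0..T} \<subseteq> - eis" using ne by auto
    have h3: "\<gamma> 0 islimpt \<gamma> ` {0..T}"
    proof (rule connected_imp_perfect)
      have "continuous_on {0..T} \<gamma>" unfolding \<gamma>_def by (intro continuous_intros)
      then show "connected (\<gamma> ` {0..T})" by (intro connected_continuous_image) auto
      show "\<gamma> 0 \<in> \<gamma> ` {0..T}" using T by auto
      have "\<gamma> 0 \<noteq> \<gamma> T" using T by (simp add: \<gamma>_def)
      then show "\<And>x. \<gamma> ` {0..T} \<noteq> {x}" using T by (metis atLeastAtMost_iff image_eqI less_imp_le order_refl singletonD)
    qed
    have "\<gamma> 0 \<in> - eis" using ne[of 0] T by auto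
    then show False by (rule wq_not_identically_0[OF _ h3 h2 h1])
  qed
  ultimately show ?thesis by simp
qed

section \<open>Dixon's elliptic functions\<close>

lemma DERIV_transfer_ev:
  "eventually (\<lambda>x. f x = g x) (nhds x) \<Longrightarrow> (g has_field_derivative D) (at x) \<Longrightarrow> (f has_field_derivative D) (at x)"
  by (simp add: DERIV_cong_ev[OF refl _ refl])

lemma isCont_eventually_ne:
  fixes f :: "'a::t2_space \<Rightarrow> 'b::t1_space"
  assumes "isCont f a" "f a \<noteq> c" shows "eventually (\<lambda>x. f x \<noteq> c) (nhds a)"
proof -
  have "eventually (\<lambda>x. f x \<noteq> c) (at a)"
    using tendsto_imp_eventually_ne[of f "f a" "at a" c] assms by (simp add: isCont_def)
  then show ?thesis using assms by (simp add: eventually_nhds_conv_at)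
qed

text \<open>Scaling the lattice by \<open>om\<close> divides the constant \<open>4 * e1 ^ 3\<close>
  by \<open>om ^ 6\<close>, so this is the scaling that turns the equation into
  \<open>pp' ^ 2 = 4 * pp ^ 3 - 27\<close>. It is shown later to be the period
  \<open>varpi\<close>.\<close>

definition om :: real where "om = root 6 (4 * e1 ^ 3 / 27)"

lemma om_pos [simp]: "om > 0" using e1_pos by (simp add: om_def)
lemma om_nonzero [simp]: "om \<noteq> 0" using om_pos by linarith
lemma om_power6: "om ^ 6 = 4 * e1 ^ 3 / 27" using e1_pos by (simp add: om_def)

abbreviation om' :: complex where "om' \<equiv> of_real om"

definition plat :: "complex set" where "plat = {z. z / om' \<in> eis}"
definition pp :: "complex \<Rightarrow> complex" where "pp z = wq (z / om') / om' ^ 2"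
definition pp' :: "complex \<Rightarrow> complex" where "pp' z = wq' (z / om') / om' ^ 3"

lemma plat_0 [simp]: "0 \<in> plat" by (simp add: plat_def)
lemma plat_add_iff: "w \<in> plat \<Longrightarrow> z + w \<in> plat \<longleftrightarrow> z \<in> plat"
  by (simp add: plat_def add_divide_distrib eis_add_iff)
lemma plat_uminus_iff [simp]: "- z \<in> plat \<longleftrightarrow> z \<in> plat" by (simp add: plat_def)
lemma plat_rho_iff [simp]: "rho * z \<in> plat \<longleftrightarrow> z \<in> plat"
  using eis_rho_times_iff[of "z / om'"] by (simp add: plat_def)

lemma plat_eq_image: "plat = (\<lambda>w. om' * w) ` eis"
  by (force simp: plat_def image_iff)

lemma countable_plat: "countable plat"
  unfolding plat_eq_image using countable_eis by blast

lemma open_Compl_plat [simp, intro]: "open (- plat)"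
proof -
  have "- plat = (\<lambda>z. z / om') -` (- eis)" by (auto simp: plat_def)
  also have "open \<dots>" by (intro open_vimage open_Compl_eis continuous_intros) auto
  finally show ?thesis .
qed

lemma connected_Compl_plat [simp, intro]: "connected (- plat)"
  by (rule connected_Compl_countable[OF countable_plat])

lemma pp_derivative: "z \<notin> plat \<Longrightarrow> (pp has_field_derivative pp' z) (at z)"
  unfolding pp_def[abs_def] pp'_def plat_def
  by (auto intro!: derivative_eq_intros DERIV_chain2[OF wq_derivative] simp: power2_eq_square power3_eq_cube)

lemma pp'_derivative: "z \<notin> plat \<Longrightarrow> (pp' has_field_derivative 6 * pp z ^ 2) (at z)"
  unfolding pp_def pp'_def[abs_def] plat_def
  by (auto intro!: derivative_eq_intros DERIV_chain2[OF wq'_derivative]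
        simp: wq_square eval_nat_numeral)

lemma pp'_square:
  assumes "z \<notin> plat" shows "pp' z ^ 2 = 4 * pp z ^ 3 - 27"
proof -
  have om6: "27 * om' ^ 6 = 4 * of_real e1 ^ 3"
    using om_power6 by (metis (mono_tags, lifting) nonzero_mult_div_cancel_left of_real_divide of_real_mult of_real_numeral of_real_power times_divide_eq_right zero_neq_numeral)
  have "pp' z ^ 2 * om' ^ 6 = wq' (z / om') ^ 2"
    by (simp add: pp'_def power_divide flip: power_mult)
  also have "\<dots> = 4 * wq (z / om') ^ 3 - 27 * om' ^ 6"
    using assms unfolding om6 by (intro wq'_square) (simp add: plat_def)
  also have "\<dots> = (4 * pp z ^ 3 - 27) * om' ^ 6"
    by (simp add: pp_def power_divide left_diff_distrib flip: power_mult)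
  finally show ?thesis by simp
qed

lemma pp_uminus: "pp (- z) = pp z" by (simp add: pp_def wq_uminus)
lemma pp'_uminus: "pp' (- z) = - pp' z" by (simp add: pp'_def wq'_uminus)
lemma pp_rho: "pp (rho * z) = rho * pp z" using wq_rho[of "z / om'"] by (simp add: pp_def)
lemma pp'_rho: "pp' (rho * z) = pp' z" using wq'_rho[of "z / om'"] by (simp add: pp'_def)
lemma pp_cnj: "pp (cnj z) = cnj (pp z)" using wq_cnj[of "z / om'"] by (simp add: pp_def)
lemma pp'_cnj: "pp' (cnj z) = cnj (pp' z)" using wq'_cnj[of "z / om'"] by (simp add: pp'_def)
lemma pp_shift: "w \<in> plat \<Longrightarrow> z \<notin> plat \<Longrightarrow> pp (z + w) = pp z"
  using wq_shift[of "w / om'" "z / om'"] by (simp add: pp_def plat_def add_divide_distrib)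
lemma pp'_shift: "w \<in> plat \<Longrightarrow> pp' (z + w) = pp' z"
  using wq'_shift[of "w / om'" "z / om'"] by (simp add: pp'_def plat_def add_divide_distrib)

lemma pp_holomorphic: "pp holomorphic_on - plat"
  unfolding holomorphic_on_def field_differentiable_def
  using pp_derivative has_field_derivative_at_within by blast

lemma pp'_holomorphic: "pp' holomorphic_on - plat"
  unfolding holomorphic_on_def field_differentiable_def
  using pp'_derivative has_field_derivative_at_within by blast

definition prem :: "complex \<Rightarrow> complex" where "prem z = wrem (z / om') / om' ^ 2"

lemma pp_prem: "pp z = 1 / z ^ 2 + prem z"
  by (simp add: pp_def wq_eq prem_def add_divide_distrib power_divide)

lemma prem_derivative:
  assumes "z / om' \<notin> eis - {0}"
  shows "(prem has_field_derivative wrem' (z / om') / om' ^ 3) (at z)"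
  unfolding prem_def[abs_def]
  using DERIV_cdivide[OF DERIV_chain2[where f = wrem and g = "\<lambda>z. z / om'",
      OF wrem_derivative(1)[OF assms] DERIV_cdivide[OF DERIV_ident]], of "om' ^ 2"]
  by (simp add: power2_eq_square power3_eq_cube mult.assoc)

lemma pp'_prem:
  assumes "z \<notin> plat" shows "pp' z = - 2 / z ^ 3 + deriv prem z"
proof -
  have z: "z / om' \<notin> eis" using assms by (simp add: plat_def)
  then have "deriv prem z = wrem' (z / om') / om' ^ 3"
    using prem_derivative DERIV_imp_deriv by blast
  then show ?thesis using wq'_eq[OF z] by (simp add: pp'_def add_divide_distrib power_divide diff_divide_distrib)
qed

lemma prem_analytic: "prem analytic_on {0}"
proof -
  have "wrem analytic_on {0}"
    using wrem_fps by (rule has_fps_expansion_imp_analytic_0)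
  then have "wrem \<circ> (\<lambda>z. z / om') analytic_on {0}"
    by (intro analytic_on_compose analytic_intros) auto
  then show ?thesis unfolding prem_def[abs_def] by (intro analytic_intros) (auto simp: o_def)
qed

lemma eventually_plat: "eventually (\<lambda>z. z \<in> plat \<longrightarrow> z = 0) (nhds 0)"
proof -
  have "eventually (\<lambda>z. z \<in> ball 0 om) (nhds (0::complex))"
    by (intro eventually_nhds_in_open) auto
  then show ?thesis
  proof eventually_elim
    case (elim z)
    then have "norm (z / om') < 1" by (simp add: norm_divide)
    then show ?case using eis_norm_ge_1[of "z / om'"] by (auto simp: plat_def)
  qed
qed

section \<open>Dixon's functions and their differential equations\<close>

definition lat3 :: "complex set" where "lat3 = {v. v / 3 \<in> plat}"

lemma lat3_0 [simp]: "0 \<in> lat3" by (simp add: lat3_def)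
lemma lat3_add_iff: "w \<in> lat3 \<Longrightarrow> z + w \<in> lat3 \<longleftrightarrow> z \<in> lat3"
  by (simp add: lat3_def add_divide_distrib plat_add_iff)
lemma lat3_uminus_iff [simp]: "- z \<in> lat3 \<longleftrightarrow> z \<in> lat3"
  using plat_uminus_iff[of "z / 3"] by (simp add: lat3_def)
lemma lat3_rho_iff [simp]: "rho * z \<in> lat3 \<longleftrightarrow> z \<in> lat3"
  using plat_rho_iff[of "z / 3"] by (simp add: lat3_def)
lemma lat3_iff: "v \<in> lat3 \<longleftrightarrow> v / (3 * om') \<in> eis"
  by (simp add: lat3_def plat_def field_simps)

lemma eventually_lat3: "eventually (\<lambda>z. z \<in> lat3 \<longrightarrow> z = 0) (nhds 0)"
proof -
  have "((\<lambda>z::complex. z / 3) \<longlongrightarrow> 0) (nhds 0)"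
    by (auto intro!: tendsto_eq_intros filterlim_ident)
  then show ?thesis
    using eventually_compose_filterlim[OF eventually_plat] by (fastforce simp: lat3_def elim: eventually_mono)
qed

text \<open>The pair \<open>sm\<close>, \<open>cm\<close> is the birational map from the Weierstrass
  cubic \<open>y ^ 2 = 4 * x ^ 3 - 27\<close> to the Fermat cubic. The argument \<open>v / 3\<close>
  normalises the derivative of \<open>sm\<close> at 0 to 1, and on the lattice the limit values 0
  and 1 are put in.\<close>

definition sm :: "complex \<Rightarrow> complex" where
  "sm v = (if v \<in> lat3 then 0 else 6 * pp (v / 3) / (9 - pp' (v / 3)))"

definition cm :: "complex \<Rightarrow> complex" where
  "cm v = (if v \<in> lat3 then 1 else (pp' (v / 3) + 9) / (pp' (v / 3) - 9))"

text \<open>The complement consists of the common poles of both functions, the points off the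
  lattice with \<open>pp' (v / 3) = 9\<close>.\<close>

definition sdom :: "complex set" where
  "sdom = {v. v \<in> lat3 \<or> pp' (v / 3) \<noteq> 9}"

lemma sm_0 [simp]: "sm 0 = 0" and cm_0 [simp]: "cm 0 = 1" and sdom_0 [simp]: "0 \<in> sdom"
  by (simp_all add: sm_def cm_def sdom_def)

lemma sdom_shift: "w \<in> lat3 \<Longrightarrow> v + w \<in> sdom \<longleftrightarrow> v \<in> sdom"
  and sm_shift: "w \<in> lat3 \<Longrightarrow> sm (v + w) = sm v"
  and cm_shift: "w \<in> lat3 \<Longrightarrow> cm (v + w) = cm v"
  using lat3_add_iff[of w v]
  by (auto simp: sdom_def sm_def cm_def lat3_def add_divide_distrib pp'_shift pp_shift)

lemma sdom_rho: "rho * v \<in> sdom \<longleftrightarrow> v \<in> sdom"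
  and sm_rho: "sm (rho * v) = rho * sm v"
  and cm_rho: "cm (rho * v) = cm v"
  using pp_rho[of "v / 3"] pp'_rho[of "v / 3"]
  by (auto simp: sdom_def sm_def cm_def)

lemma sm_cm_cubes:
  assumes "v \<in> sdom" shows "sm v ^ 3 + cm v ^ 3 = 1"
proof (cases "v \<in> lat3")
  case False
  define p p' where "p = pp (v / 3)" and "p' = pp' (v / 3)"
  have p: "p' ^ 2 = 4 * p ^ 3 - 27" using False pp'_square by (simp add: p_def p'_def lat3_def)
  have ne: "9 - p' \<noteq> 0" using False assms by (simp add: sdom_def p'_def)
  have "(p' + 9) / (p' - 9) = - (p' + 9) / (9 - p')"
    by (metis minus_diff_eq minus_divide_divide)
  then have "sm v ^ 3 + cm v ^ 3 = ((6 * p) ^ 3 + (- (p' + 9)) ^ 3) / (9 - p') ^ 3"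
    using False by (simp add: sm_def cm_def p_def p'_def power_divide add_divide_distrib)
  also have "(6 * p) ^ 3 + (- (p' + 9)) ^ 3 = 54 * (4 * p ^ 3) - (p' + 9) ^ 3"
    by (simp add: power_mult_distrib eval_nat_numeral algebra_simps)
  also have "4 * p ^ 3 = p' ^ 2 + 27" using p by simp
  also have "54 * (p' ^ 2 + 27) - (p' + 9) ^ 3 = (9 - p') ^ 3"
    by (simp add: eval_nat_numeral algebra_simps)
  finally show ?thesis using ne by simp
qed (simp add: sm_def cm_def)

lemma sm_cm_derivative_off:
  assumes "v \<in> sdom" "v \<notin> lat3"
  shows "(sm has_field_derivative cm v ^ 2) (at v)" "(cm has_field_derivative - (sm v ^ 2)) (at v)"
proof -
  have open': "open (- lat3)"
  proof -
    have "- lat3 = (\<lambda>z. z / 3) -` (- plat)" by (auto simp: lat3_def)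
    also have "open \<dots>" by (intro open_vimage open_Compl_plat continuous_intros) auto
    finally show ?thesis .
  qed
  have ev: "eventually (\<lambda>x. x \<in> - lat3) (nhds v)"
    using assms open' by (intro eventually_nhds_in_open) auto
  define p p' where "p = pp (v / 3)" and "p' = pp' (v / 3)"
  have v: "v / 3 \<notin> plat" using assms by (simp add: lat3_def)
  have p: "p' ^ 2 = 4 * p ^ 3 - 27" using v pp'_square by (simp add: p_def p'_def)
  have ne: "9 - p' \<noteq> 0" "p' - 9 \<noteq> 0" using assms by (auto simp: sdom_def p'_def)
  have d1: "((\<lambda>x. pp (x / 3)) has_field_derivative p' / 3) (at v)"
    using DERIV_chain2[where f = pp and g = "\<lambda>x. x / 3", OF pp_derivative[OF v] DERIV_cdivide[OF DERIV_ident]]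
    by (simp add: p'_def)
  have d2: "((\<lambda>x. pp' (x / 3)) has_field_derivative 2 * p ^ 2) (at v)"
    using DERIV_chain2[where f = pp' and g = "\<lambda>x. x / 3", OF pp'_derivative[OF v] DERIV_cdivide[OF DERIV_ident]]
    by (simp add: p_def)
  have cm: "cm v = (p' + 9) / (p' - 9)" using assms by (simp add: cm_def p'_def)
  have sm: "sm v = 6 * p / (9 - p')" using assms by (simp add: sm_def p'_def p_def)
  have eq1: "6 * (p' / 3) * (9 - p') - 6 * p * (0 - 2 * p ^ 2) = (p' + 9) ^ 2"
  proof -
    have "6 * (p' / 3) * (9 - p') - 6 * p * (0 - 2 * p ^ 2) = 18 * p' - 2 * p' ^ 2 + 3 * (4 * p ^ 3)"
      by (simp add: eval_nat_numeral algebra_simps)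
    also have "4 * p ^ 3 = p' ^ 2 + 27" using p by simp
    finally show ?thesis by (simp add: eval_nat_numeral algebra_simps)
  qed
  have "((\<lambda>x. 6 * pp (x / 3) / (9 - pp' (x / 3))) has_field_derivative
         (6 * (p' / 3) * (9 - p') - 6 * p * (0 - 2 * p ^ 2)) / ((9 - p') * (9 - p'))) (at v)"
    using DERIV_divide[OF DERIV_cmult[OF d1, of 6] DERIV_diff[OF DERIV_const[of 9] d2]] ne
    by (simp add: p_def p'_def)
  moreover have "(6 * (p' / 3) * (9 - p') - 6 * p * (0 - 2 * p ^ 2)) / ((9 - p') * (9 - p')) = cm v ^ 2"
    unfolding eq1 cm by (simp add: power_divide) (simp add: power2_eq_square algebra_simps)
  moreover have "eventually (\<lambda>x. sm x = 6 * pp (x / 3) / (9 - pp' (x / 3))) (nhds v)"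
    using ev by eventually_elim (simp add: sm_def)
  ultimately show "(sm has_field_derivative cm v ^ 2) (at v)"
    using DERIV_transfer_ev by simp
  have eq2: "(2 * p ^ 2) * (p' - 9) - (p' + 9) * (2 * p ^ 2) = - ((6 * p) ^ 2)"
    by (simp add: eval_nat_numeral algebra_simps)
  have "((\<lambda>x. (pp' (x / 3) + 9) / (pp' (x / 3) - 9)) has_field_derivative
         ((2 * p ^ 2) * (p' - 9) - (p' + 9) * (2 * p ^ 2)) / ((p' - 9) * (p' - 9))) (at v)"
    using DERIV_divide[OF DERIV_add[OF d2 DERIV_const[of 9]] DERIV_diff[OF d2 DERIV_const[of 9]]] ne
    by (simp add: p_def p'_def)
  moreover have "((2 * p ^ 2) * (p' - 9) - (p' + 9) * (2 * p ^ 2)) / ((p' - 9) * (p' - 9)) = - (sm v ^ 2)"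
    unfolding eq2 sm by (simp add: power_divide) (simp add: power2_eq_square algebra_simps)
  moreover have "eventually (\<lambda>x. cm x = (pp' (x / 3) + 9) / (pp' (x / 3) - 9)) (nhds v)"
    using ev by eventually_elim (simp add: cm_def)
  ultimately show "(cm has_field_derivative - (sm v ^ 2)) (at v)"
    using DERIV_transfer_ev by simp
qed

text \<open>\<open>pA\<close> and \<open>pB\<close> are \<open>z ^ 2 * pp z\<close> and
  \<open>z ^ 3 * pp' z\<close>, continued analytically to 0.\<close>

definition pA :: "complex \<Rightarrow> complex" where "pA z = 1 + z ^ 2 * prem z"
definition pB :: "complex \<Rightarrow> complex" where "pB z = - 2 + z ^ 3 * deriv prem z"

lemma pA_eq: "z \<notin> plat \<Longrightarrow> pA z = z ^ 2 * pp z"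
  by (cases "z = 0") (auto simp: pA_def pp_prem distrib_left)
lemma pB_eq: "z \<notin> plat \<Longrightarrow> pB z = z ^ 3 * pp' z"
  by (cases "z = 0") (auto simp: pB_def pp'_prem right_diff_distrib)

lemma pAB_analytic: "pA analytic_on {0}" "pB analytic_on {0}"
  unfolding pA_def[abs_def] pB_def[abs_def]
  by (intro analytic_intros prem_analytic analytic_deriv)+

lemma pA_pB_compose: "(\<lambda>v. pA (v / 3)) analytic_on {0}" "(\<lambda>v. pB (v / 3)) analytic_on {0}"
proof -
  have "pA \<circ> (\<lambda>v. v / 3) analytic_on {0}" "pB \<circ> (\<lambda>v. v / 3) analytic_on {0}"
    using pAB_analytic by (auto intro!: analytic_on_compose analytic_intros)
  then show "(\<lambda>v. pA (v / 3)) analytic_on {0}" "(\<lambda>v. pB (v / 3)) analytic_on {0}" by (simp_all add: o_def)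
qed

lemma pB_near_0: "eventually (\<lambda>v. 9 * (v / 3) ^ 3 - pB (v / 3) \<noteq> 0) (nhds 0)"
proof -
  have "(\<lambda>v. 9 * (v / 3) ^ 3 - pB (v / 3)) analytic_on {0}"
    by (intro analytic_intros pA_pB_compose) auto
  then have "isCont (\<lambda>v. 9 * (v / 3) ^ 3 - pB (v / 3)) 0"
    by (rule analytic_at_imp_isCont)
  moreover have "9 * (0 / 3) ^ 3 - pB (0 / 3) \<noteq> 0" by (simp add: pB_def)
  ultimately show ?thesis by (rule isCont_eventually_ne)
qed

text \<open>Numerators and denominators are multiplied by \<open>z ^ 3\<close> with
  \<open>z = v / 3\<close>. The new denominators take the values 2 and -2 at 0, so both functions
  are analytic there.\<close>

lemma sm_cm_near_0:
  "eventually (\<lambda>v. v \<in> sdom \<and> sm v = 6 * (v / 3) * pA (v / 3) / (9 * (v / 3) ^ 3 - pB (v / 3)) \<and>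
      cm v = (pB (v / 3) + 9 * (v / 3) ^ 3) / (pB (v / 3) - 9 * (v / 3) ^ 3)) (nhds 0)"
  using eventually_lat3 pB_near_0
proof eventually_elim
  case (elim v)
  show ?case
  proof (cases "v = 0")
    case False
    define z where "z = v / 3"
    have z: "z \<noteq> 0" "z \<notin> plat" using False elim by (auto simp: z_def lat3_def)
    have v: "v \<notin> lat3" using False elim by auto
    have e1: "9 * z ^ 3 - pB z = z ^ 3 * (9 - pp' z)" using z by (simp add: pB_eq algebra_simps)
    have e2: "pB z + 9 * z ^ 3 = z ^ 3 * (pp' z + 9)" using z by (simp add: pB_eq algebra_simps)
    have e3: "pB z - 9 * z ^ 3 = z ^ 3 * (pp' z - 9)" using z by (simp add: pB_eq algebra_simps)
    have e4: "6 * z * pA z = z ^ 3 * (6 * pp z)" using z by (simp add: pA_eq eval_nat_numeral)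
    have "9 * z ^ 3 - pB z \<noteq> 0" using elim(2) by (simp add: z_def)
    then have "pp' z \<noteq> 9" using e1 by auto
    then show ?thesis
      unfolding z_def[symmetric] e1 e2 e3 e4 using z v by (simp add: sm_def cm_def sdom_def z_def)
  qed (simp add: pB_def)
qed

lemma sm_cm_analytic_0: "sm analytic_on {0}" "cm analytic_on {0}"
proof -
  have "(\<lambda>v. 6 * (v / 3) * pA (v / 3) / (9 * (v / 3) ^ 3 - pB (v / 3))) analytic_on {0}"
    by (intro analytic_intros pA_pB_compose) (auto simp: pB_def)
  moreover have "eventually (\<lambda>v. sm v = 6 * (v / 3) * pA (v / 3) / (9 * (v / 3) ^ 3 - pB (v / 3))) (nhds 0)"
    using sm_cm_near_0 by eventually_elim auto
  ultimately show "sm analytic_on {0}" using analytic_at_cong[OF _ refl] by simp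
  have "(\<lambda>v. (pB (v / 3) + 9 * (v / 3) ^ 3) / (pB (v / 3) - 9 * (v / 3) ^ 3)) analytic_on {0}"
    by (intro analytic_intros pA_pB_compose) (auto simp: pB_def)
  moreover have "eventually (\<lambda>v. cm v = (pB (v / 3) + 9 * (v / 3) ^ 3) / (pB (v / 3) - 9 * (v / 3) ^ 3)) (nhds 0)"
    using sm_cm_near_0 by eventually_elim auto
  ultimately show "cm analytic_on {0}" using analytic_at_cong[OF _ refl] by simp
qed

text \<open>Spares a limit computation at the removable singularity: the differential equations are
  verified off the lattice by the quotient rule and pass to 0 because both sides are
  continuous.\<close>

lemma derivative_at_0_by_continuity:
  fixes f g :: "complex \<Rightarrow> complex"
  assumes f: "f analytic_on {0}" and g: "g analytic_on {0}"
    and ev: "eventually (\<lambda>z. (f has_field_derivative g z) (at z)) (at 0)"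
  shows "(f has_field_derivative g 0) (at 0)"
proof -
  have "isCont (deriv f) 0" "isCont g 0"
    using f g by (auto intro: analytic_at_imp_isCont analytic_deriv)
  then have "(deriv f \<longlongrightarrow> deriv f 0) (at 0)" "(g \<longlongrightarrow> g 0) (at 0)" by (auto simp: isCont_def)
  moreover have "eventually (\<lambda>z. deriv f z = g z) (at 0)"
    using ev by eventually_elim (rule DERIV_imp_deriv)
  then have "(deriv f \<longlongrightarrow> g 0) (at 0) \<longleftrightarrow> (g \<longlongrightarrow> g 0) (at 0)" by (rule tendsto_cong)
  ultimately have "deriv f 0 = g 0" using tendsto_unique[of "at (0::complex)"] by (metis at_neq_bot)
  moreover have "f field_differentiable at 0" using f by (rule analytic_on_imp_differentiable_at) auto
  ultimately show ?thesis by (metis DERIV_deriv_iff_field_differentiable)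
qed

lemma sm_cm_derivative:
  assumes "v \<in> sdom"
  shows "(sm has_field_derivative cm v ^ 2) (at v)" "(cm has_field_derivative - (sm v ^ 2)) (at v)"
proof -
  have ev: "eventually (\<lambda>v. v \<in> sdom \<and> v \<notin> lat3) (at 0)"
  proof -
    have "eventually (\<lambda>v. v \<in> sdom \<and> (v \<in> lat3 \<longrightarrow> v = 0)) (nhds 0)"
      using sm_cm_near_0 eventually_lat3 by eventually_elim auto
    then show ?thesis by (auto simp: eventually_at_filter elim: eventually_mono)
  qed
  have 1: "(sm has_field_derivative cm 0 ^ 2) (at 0)"
    by (rule derivative_at_0_by_continuity[of sm "\<lambda>v. cm v ^ 2"])
       (use ev in \<open>auto intro!: sm_cm_analytic_0 analytic_intros sm_cm_derivative_off elim: eventually_mono\<close>)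
  have 2: "(cm has_field_derivative - (sm 0 ^ 2)) (at 0)"
    by (rule derivative_at_0_by_continuity[of cm "\<lambda>v. - (sm v ^ 2)"])
       (use ev in \<open>auto intro!: sm_cm_analytic_0 analytic_intros sm_cm_derivative_off elim: eventually_mono\<close>)
  have "(sm has_field_derivative cm v ^ 2) (at v) \<and> (cm has_field_derivative - (sm v ^ 2)) (at v)"
  proof (cases "v \<in> lat3")
    case True
    have "(\<lambda>x. sm (x + - v)) = sm" "(\<lambda>x. cm (x + - v)) = cm"
      using sm_shift[of "- v"] cm_shift[of "- v"] True by auto
    moreover have "sm v = 0" "cm v = 1" using True by (simp_all add: sm_def cm_def)
    ultimately show ?thesis
      using 1 2 DERIV_shift[of sm _ v "- v"] DERIV_shift[of cm _ v "- v"] by simp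
  qed (use sm_cm_derivative_off assms in auto)
  then show "(sm has_field_derivative cm v ^ 2) (at v)" "(cm has_field_derivative - (sm v ^ 2)) (at v)" by auto
qed

lemma open_sdom [simp, intro]: "open sdom"
proof (rule Topological_Spaces.openI)
  have "eventually (\<lambda>x. x \<in> sdom) (nhds v)" if v: "v \<in> sdom" for v
  proof (cases "v \<in> lat3")
    case True
    have "eventually (\<lambda>x. x \<in> sdom) (nhds 0)" using sm_cm_near_0 by eventually_elim auto
    moreover have "filterlim (\<lambda>x. x + - v) (nhds 0) (nhds v)" by (auto intro!: tendsto_eq_intros filterlim_ident)
    ultimately have "eventually (\<lambda>x. x + - v \<in> sdom) (nhds v)" by (rule eventually_compose_filterlim)
    then show ?thesis using sdom_shift[of "- v"] True by simp
  next
    case False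
    have "isCont (\<lambda>x. pp' (x / 3)) v"
      using False by (auto intro!: DERIV_isCont DERIV_chain2[OF pp'_derivative] derivative_eq_intros simp: lat3_def)
    then have "eventually (\<lambda>x. pp' (x / 3) \<noteq> 9) (nhds v)"
      using v False by (intro isCont_eventually_ne) (auto simp: sdom_def)
    then show ?thesis by eventually_elim (simp add: sdom_def)
  qed
  then show "\<exists>T. open T \<and> x \<in> T \<and> T \<subseteq> sdom" if "x \<in> sdom" for x
    using that unfolding eventually_nhds by (metis subsetI)
qed

section \<open>The addition theorem\<close>

lemma fsigma_open:
  fixes S :: "'a::euclidean_space set"
  assumes "open S" shows "fsigma S"
proof -
  obtain D where D: "countable D" "\<And>X. X \<in> D \<Longrightarrow> \<exists>a b :: 'a. X = cbox a b" "\<Union> D = S"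
    using open_countable_Union_open_cbox[OF assms] by metis
  define F where "F = from_nat_into (insert {} D)"
  have F: "range F = insert {} D"
    using D(1) unfolding F_def by (intro range_from_nat_into) auto
  have "closed (F n)" for n
  proof -
    have "F n \<in> insert {} D" using F by blast
    then show ?thesis using D(2) closed_cbox by (metis closed_empty insertE)
  qed
  then have "fsigma (\<Union> (F ` UNIV))" by (rule fsigma.intros)
  then show ?thesis using F D(3) by simp
qed

text \<open>A countable exceptional set leaves connected domains, as the identity theorem requires.
  A constant \<open>pp'\<close> would be 0 because it is odd, and \<open>pp\<close> would be 0
  because the derivative of \<open>pp'\<close> is \<open>6 * pp ^ 2\<close>; this contradicts
  \<open>pp' ^ 2 = 4 * pp ^ 3 - 27\<close>.\<close>

lemma countable_Compl_sdom: "countable (- sdom)"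
proof -
  have "\<not> (\<lambda>z. pp' z - 9) constant_on - plat"
  proof
    assume "(\<lambda>z. pp' z - 9) constant_on - plat"
    then obtain c where c: "pp' z = c" if "z \<notin> plat" for z
      unfolding constant_on_def by (metis ComplI diff_add_cancel)
    obtain z where z: "z \<notin> plat" using countable_plat uncountable_UNIV_complex by (metis UNIV_eq_I)
    have "eventually (\<lambda>x. pp' x = c) (nhds z)"
      using eventually_nhds_in_open[OF open_Compl_plat, of z] z by (auto elim!: eventually_mono intro: c)
    then have "(pp' has_field_derivative 0) (at z)"
      by (rule DERIV_transfer_ev) (rule DERIV_const)
    then have "pp z = 0" using pp'_derivative[OF z] DERIV_unique by fastforce
    moreover have "pp' z = 0" using c[of z] c[of "- z"] z pp'_uminus[of z] by simp
    ultimately show False using pp'_square[OF z] by simp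
  qed
  then have "countable {z \<in> - plat. pp' z - 9 = 0}"
    by (intro holomorphic_countable_zeros holomorphic_intros pp'_holomorphic) (auto intro: fsigma_open)
  then have "countable ((\<lambda>z. 3 * z) ` {z \<in> - plat. pp' z - 9 = 0})" by (rule countable_image)
  moreover have "- sdom \<subseteq> (\<lambda>z. 3 * z) ` {z \<in> - plat. pp' z - 9 = 0}"
  proof
    fix v assume "v \<in> - sdom"
    then have "v / 3 \<in> {z \<in> - plat. pp' z - 9 = 0}" "v = 3 * (v / 3)" by (auto simp: sdom_def lat3_def)
    then show "v \<in> (\<lambda>z. 3 * z) ` {z \<in> - plat. pp' z - 9 = 0}" by blast
  qed
  ultimately show ?thesis using countable_subset by blast
qed

text \<open>With \<open>u + v\<close> fixed, the quotient of the two sides below has derivative zero in \<open>u\<close>,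
  because of the differential equations; at \<open>v = 0\<close> it equals 1.\<close>
lemma addition_theorem:
  assumes dom: "u \<in> sdom" "v \<in> sdom" "u + v \<in> sdom"
  shows "sm (u + v) * (cm v + sm v ^ 2 * sm u * cm u) = sm u + cm u ^ 2 * sm v * cm v" (is ?S)
    and "cm (u + v) * (cm v + sm v ^ 2 * sm u * cm u) = cm u * cm v ^ 2 - sm u ^ 2 * sm v" (is ?C)
proof -
  define t where "t = u + v"
  define T where "T = sdom \<inter> (\<lambda>x. t - x) -` sdom"
  have openT: "open T" unfolding T_def
    by (intro open_Int open_sdom open_vimage continuous_intros)
  have "- T = - sdom \<union> (\<lambda>x. t - x) ` (- sdom)"
    by (force simp: T_def image_iff)
  then have "countable (- T)" using countable_Compl_sdom by simp
  then have connT: "connected T" using connected_Compl_countable[of "- T"] by simp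
  have refl_der: "((\<lambda>x. f (t - x)) has_field_derivative - D) (at x)"
    if "(f has_field_derivative D) (at (t - x))" for f :: "complex \<Rightarrow> complex" and D x
    using DERIV_chain2[where f = f and g = "\<lambda>x. t - x", OF that DERIV_diff[OF DERIV_const DERIV_ident]] by simp
  define s1 c1 s2 c2 where "s1 = sm" and "c1 = cm" and "s2 = (\<lambda>x. sm (t - x))" and "c2 = (\<lambda>x. cm (t - x))"
  note defs = s1_def c1_def s2_def c2_def
  have d: "(s1 has_field_derivative c1 x ^ 2) (at x)" "(c1 has_field_derivative - (s1 x ^ 2)) (at x)"
     "(s2 has_field_derivative - (c2 x ^ 2)) (at x)" "(c2 has_field_derivative s2 x ^ 2) (at x)"
    and cubes: "s1 x ^ 3 = 1 - c1 x ^ 3" "s2 x ^ 3 = 1 - c2 x ^ 3" if "x \<in> T" for x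
    using that sm_cm_derivative[of x] sm_cm_cubes[of x] sm_cm_cubes[of "t - x"]
      refl_der[OF sm_cm_derivative(1), of x] refl_der[OF sm_cm_derivative(2), of x]
    unfolding defs T_def by (simp_all add: eq_diff_eq)
  define D N M where "D = (\<lambda>x. c2 x + s2 x ^ 2 * s1 x * c1 x)"
    and "N = (\<lambda>x. s1 x + c1 x ^ 2 * s2 x * c2 x)" and "M = (\<lambda>x. c1 x * c2 x ^ 2 - s1 x ^ 2 * s2 x)"
  define D' N' M' where
    "D' = (\<lambda>x. s2 x ^ 2 - 2 * s2 x * c2 x ^ 2 * s1 x * c1 x + s2 x ^ 2 * (c1 x ^ 3 - s1 x ^ 3))"
    and "N' = (\<lambda>x. c1 x ^ 2 - 2 * c1 x * s1 x ^ 2 * s2 x * c2 x + c1 x ^ 2 * (s2 x ^ 3 - c2 x ^ 3))"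
    and "M' = (\<lambda>x. - (s1 x ^ 2 * c2 x ^ 2) + 2 * c1 x * c2 x * s2 x ^ 2 - 2 * s1 x * c1 x ^ 2 * s2 x + s1 x ^ 2 * c2 x ^ 2)"
  have der: "(D has_field_derivative D' x) (at x)" "(N has_field_derivative N' x) (at x)"
     "(M has_field_derivative M' x) (at x)" if "x \<in> T" for x
    unfolding D_def N_def M_def D'_def N'_def M'_def
    by (rule derivative_eq_intros d[OF that] refl | simp add: eval_nat_numeral algebra_simps)+
  have wr: "N' x * D x - N x * D' x = 0" "M' x * D x - M x * D' x = 0" if "x \<in> T" for x
  proof -
    define e1 e2 where "e1 = s1 x ^ 3 + c1 x ^ 3 - 1" and "e2 = s2 x ^ 3 + c2 x ^ 3 - 1"
    have e: "e1 = 0" "e2 = 0" using cubes[OF that] by (simp_all add: e1_def e2_def)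
    \<comment> \<open>The Wronskian lies in the ideal generated by the two Fermat relations; the
      right-hand side displays the cofactors.\<close>
    have "N' x * D x - N x * D' x = (s1 x * s2 x ^ 2 - c1 x ^ 2 * s2 x ^ 3 * c2 x) * e1
        + (s1 x * c1 x ^ 3 * s2 x ^ 2 - c1 x ^ 2 * c2 x) * e2"
      unfolding D_def N_def D'_def N'_def e1_def e2_def by (simp add: algebra_simps eval_nat_numeral)
    then show "N' x * D x - N x * D' x = 0" using e by simp
    have "M' x * D x - M x * D' x = (- (c1 x * s2 x ^ 2 * c2 x ^ 2) - s1 x ^ 2 * s2 x ^ 3) * e1
        + (2 * s1 x * c1 x ^ 2 * s2 x * c2 x) * e2"
      unfolding D_def M_def D'_def M'_def e1_def e2_def by (simp add: algebra_simps eval_nat_numeral)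
    then show "M' x * D x - M x * D' x = 0" using e by simp
  qed
  have hol: "s1 holomorphic_on T" "c1 holomorphic_on T" "s2 holomorphic_on T" "c2 holomorphic_on T"
    using d unfolding holomorphic_on_def field_differentiable_def
    by (blast intro: has_field_derivative_at_within)+
  have t: "t \<in> T" "u \<in> T" using dom by (auto simp: T_def t_def)
  have t0: "D t = 1" "N t = s1 t" "M t = c1 t" by (auto simp: D_def N_def M_def defs)
  have "isCont D t" using der(1)[OF t(1)] DERIV_isCont by blast
  then have "eventually (\<lambda>x. D x \<noteq> 0) (nhds t)" using t0 by (intro isCont_eventually_ne) auto
  then have "eventually (\<lambda>x. D x \<noteq> 0 \<and> x \<in> T) (nhds t)"
    by (intro eventually_conj eventually_nhds_in_open openT t)
  then obtain e where e: "e > 0" "\<And>x. x \<in> ball t e \<Longrightarrow> D x \<noteq> 0 \<and> x \<in> T"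
    by (auto simp: eventually_nhds_metric dist_commute)
  \<comment> \<open>The quotient by \<open>D\<close> is shown to be constant only near
    \<open>t\<close>, where \<open>D\<close> has no zeros. The product form makes sense everywhere
    and spreads over the connected set \<open>T\<close> by analytic continuation.\<close>
  have quot: "F x = F t * D x" if F: "F holomorphic_on T" "\<And>x. x \<in> T \<Longrightarrow> (F has_field_derivative F' x) (at x)"
     "\<And>x. x \<in> T \<Longrightarrow> F' x * D x - F x * D' x = 0" and x: "x \<in> T" for F F' x
  proof -
    have "F y / D y = F t / D t" if "y \<in> ball t e" for y
    proof (rule DERIV_zero_constant_on[of "ball t e" "\<lambda>y. F y / D y"])
      fix z assume "z \<in> ball t e"
      then have z: "D z \<noteq> 0" "z \<in> T" using e by auto
      show "((\<lambda>y. F y / D y) has_field_derivative 0) (at z)"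
        using DERIV_divide[OF F(2)[OF z(2)] der(1)[OF z(2)] z(1)] F(3)[OF z(2)] by simp
    qed (use that e in auto)
    then have near: "F y = F t * D y" if "y \<in> ball t e" for y
      using that e(2)[OF that] t0 by (simp add: divide_simps split: if_splits)
    have hD: "(\<lambda>y. F t * D y) holomorphic_on T"
      unfolding D_def by (intro holomorphic_intros hol)
    have ne: "ball t e \<noteq> {}" using e(1) by simp
    have sub: "ball t e \<subseteq> T" using e(2) by blast
    show ?thesis
      by (rule analytic_continuation_open[OF open_ball openT ne connT sub F(1) hD near x])
  qed
  have hN: "N holomorphic_on T" "M holomorphic_on T"
    unfolding N_def M_def by (intro holomorphic_intros hol)+
  have "N u = s1 t * D u" using quot[OF hN(1) der(2) wr(1) t(2)] t0 by simp
  moreover have "M u = c1 t * D u" using quot[OF hN(2) der(3) wr(2) t(2)] t0 by simp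
  ultimately show ?S ?C by (simp_all add: N_def M_def D_def defs t_def)
qed

section \<open>The real period and Taylor expansions\<close>

lemma Re_of_real_derivative:
  assumes "(f has_field_derivative D) (at (of_real x))"
  shows "((\<lambda>x. Re (f (of_real x))) has_real_derivative Re D) (at x)"
proof -
  have "(complex_of_real has_vector_derivative 1) (at x)" by (auto intro!: derivative_eq_intros)
  from field_vector_diff_chain_at[OF this assms]
  have "((\<lambda>x. f (of_real x)) has_vector_derivative D) (at x)" by (simp add: o_def)
  then show ?thesis
    unfolding has_real_derivative_iff_has_vector_derivative
    by (rule bounded_linear.has_vector_derivative[OF bounded_linear_Re])
qed

lemma plat_cnj_iff [simp]: "cnj z \<in> plat \<longleftrightarrow> z \<in> plat"
  using eis_cnj_iff[of "z / om'"] by (simp add: plat_def)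

lemma lat3_cnj_iff [simp]: "cnj z \<in> lat3 \<longleftrightarrow> z \<in> lat3"
  using plat_cnj_iff[of "z / 3"] by (simp add: lat3_def)

lemma sm_cnj: "sm (cnj v) = cnj (sm v)" and cm_cnj: "cm (cnj v) = cnj (cm v)"
  using pp_cnj[of "v / 3"] pp'_cnj[of "v / 3"] by (simp_all add: sm_def cm_def)

lemma real_if_cnj: "cnj z = z \<Longrightarrow> z = of_real (Re z)"
  by (simp add: complex_eq_iff)

lemma not_plat_real: "0 < x \<Longrightarrow> x < om \<Longrightarrow> complex_of_real x \<notin> plat"
proof
  assume x: "0 < x" "x < om" and "complex_of_real x \<in> plat"
  then have "complex_of_real (x / om) \<in> eis" by (simp add: plat_def)
  then have "norm (complex_of_real (x / om)) \<ge> 1" using x by (intro eis_norm_ge_1) auto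
  then show False using x by (simp add: norm_divide)
qed

definition rp :: "real \<Rightarrow> real" where "rp x = Re (pp (of_real x))"
definition rp' :: "real \<Rightarrow> real" where "rp' x = Re (pp' (of_real x))"

lemma rp: "pp (of_real x) = of_real (rp x)" and rp': "pp' (of_real x) = of_real (rp' x)"
  unfolding rp_def rp'_def using pp_cnj[of "of_real x"] pp'_cnj[of "of_real x"]
  by (intro real_if_cnj; simp)+

lemma rp_square:
  assumes "0 < x" "x < om" shows "rp' x ^ 2 = 4 * rp x ^ 3 - 27"
proof -
  have "complex_of_real (rp' x ^ 2) = of_real (4 * rp x ^ 3 - 27)"
    using pp'_square[OF not_plat_real[OF assms]] by (simp add: rp rp')
  then show ?thesis by (simp only: of_real_eq_iff)
qed

lemma rp_pos:
  assumes "0 < x" "x < om" shows "rp x > 0"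
proof (rule ccontr)
  assume "\<not> ?thesis"
  then have "rp x ^ 3 \<le> 0" by (simp add: power_le_zero_eq)
  then show False using rp_square[OF assms] by (smt (verit) zero_le_power2)
qed

lemma rp'_less:
  assumes "0 < x" "x < y" "y < om" shows "rp' x < rp' y"
proof (rule DERIV_pos_imp_increasing[OF assms(2)])
  fix t assume "x \<le> t" "t \<le> y"
  then have t: "0 < t" "t < om" using assms by auto
  have "(rp' has_real_derivative Re (6 * pp (of_real t) ^ 2)) (at t)"
    unfolding rp'_def[abs_def] by (intro Re_of_real_derivative pp'_derivative not_plat_real t)
  moreover have "Re (6 * pp (of_real t) ^ 2) = 6 * rp t ^ 2"
    by (simp add: rp power2_eq_square)
  ultimately show "\<exists>D. (rp' has_real_derivative D) (at t) \<and> 0 < D"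
    using rp_pos[OF t] by (intro exI[of _ "6 * rp t ^ 2"]) auto
qed

lemma rp'_half: "rp' (om / 2) = 0"
  by (simp add: rp'_def pp'_def wq'_half)

lemma real_not_lat3: "0 < u \<Longrightarrow> u \<le> om \<Longrightarrow> complex_of_real u \<notin> lat3"
  using not_plat_real[of "u / 3"] om_pos by (simp add: lat3_def)

lemma rp'_third_neg: "0 < u \<Longrightarrow> u \<le> om \<Longrightarrow> rp' (u / 3) < 0"
  using rp'_less[of "u / 3" "om / 2"] om_pos rp'_half by simp

lemma real_sdom: "0 \<le> u \<Longrightarrow> u \<le> om \<Longrightarrow> complex_of_real u \<in> sdom"
proof (cases "u = 0")
  case False
  assume u: "0 \<le> u" "u \<le> om"
  have "pp' (complex_of_real u / 3) = of_real (rp' (u / 3))" using rp'[of "u / 3"] by simp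
  moreover have "rp' (u / 3) \<noteq> 9" using rp'_third_neg[of u] u False by simp
  then have "complex_of_real (rp' (u / 3)) \<noteq> 9" by (metis of_real_eq_iff of_real_numeral)
  ultimately show ?thesis unfolding sdom_def by simp
qed simp

definition rs :: "real \<Rightarrow> real" where "rs u = Re (sm (of_real u))"
definition rc :: "real \<Rightarrow> real" where "rc u = Re (cm (of_real u))"

lemma rs: "sm (of_real x) = of_real (rs x)" and rc: "cm (of_real x) = of_real (rc x)"
  unfolding rs_def rc_def using sm_cnj[of "of_real x"] cm_cnj[of "of_real x"]
  by (intro real_if_cnj; simp)+

lemma rs_eq:
  assumes "0 < u" "u \<le> om" shows "rs u = 6 * rp (u / 3) / (9 - rp' (u / 3))"
proof -
  have "sm (of_real u) = of_real (6 * rp (u / 3) / (9 - rp' (u / 3)))"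
    using real_not_lat3[OF assms] rp[of "u / 3"] rp'[of "u / 3"] by (simp add: sm_def)
  then show ?thesis by (simp add: rs_def)
qed

lemma rc_eq:
  assumes "0 < u" "u \<le> om" shows "rc u = (rp' (u / 3) + 9) / (rp' (u / 3) - 9)"
proof -
  have "cm (of_real u) = of_real ((rp' (u / 3) + 9) / (rp' (u / 3) - 9))"
    using real_not_lat3[OF assms] rp[of "u / 3"] rp'[of "u / 3"] by (simp add: cm_def)
  then show ?thesis by (simp add: rc_def)
qed

lemma om_times_lat3: "w \<in> eis \<Longrightarrow> 3 * om' * w \<in> lat3"
  by (simp add: lat3_iff)

text \<open>The point \<open>v = om\<close> is 3-torsion; if \<open>cm v\<close> were nonzero, the duplication formula
  and \<open>sm (2 v) = sm (- v)\<close> would give \<open>3 = 0\<close>.\<close>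
lemma cm_om: "cm om' = 0"
proof (rule ccontr)
  assume c: "cm om' \<noteq> 0"
  define s c where "s = sm om'" and "c = cm om'"
  have nl: "om' \<notin> lat3" using real_not_lat3[of om] by simp
  define p p' where "p = pp (om' / 3)" and "p' = pp' (om' / 3)"
  have dom: "om' \<in> sdom" using real_sdom[of om] less_imp_le[OF om_pos] by simp
  then have ne: "p' - 9 \<noteq> 0" using nl by (auto simp: sdom_def p'_def)
  have cp: "c = (p' + 9) / (p' - 9)" and sp: "s = 6 * p / (9 - p')"
    using nl by (simp_all add: c_def s_def cm_def sm_def p_def p'_def)
  have ne': "p' + 9 \<noteq> 0" using c cp by (auto simp: c_def)
  have mnl: "- om' \<notin> lat3" using nl by simp
  have ms: "sm (- om') = - s / c"
  proof -
    have e: "9 - p' = - (p' - 9)" by simp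
    have "sm (- om') = 6 * p / (9 + p')"
      using mnl pp_uminus[of "om' / 3"] pp'_uminus[of "om' / 3"] by (simp add: sm_def p_def p'_def)
    also have "\<dots> = - s / c" unfolding cp sp e using ne ne' by (simp add: divide_simps) (simp add: algebra_simps)
    finally show ?thesis .
  qed
  have "pp' (- om' / 3) = - p'" using pp'_uminus[of "om' / 3"] by (simp add: p'_def)
  moreover have "- p' \<noteq> 9" using ne' by (metis add.right_inverse)
  ultimately have mdom: "- om' \<in> sdom" by (simp add: sdom_def)
  have shift: "om' + om' = - om' + 3 * om' * 1" by simp
  have d2: "om' + om' \<in> sdom" "sm (om' + om') = - s / c"
    unfolding shift using sdom_shift[OF om_times_lat3[OF eis_1]] sm_shift[OF om_times_lat3[OF eis_1]] mdom ms
    by (metis, metis)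
  have add: "(- s / c) * (c + s ^ 2 * s * c) = s + c ^ 2 * s * c"
    using addition_theorem(1)[OF dom dom d2(1)] d2(2) by (simp add: s_def c_def)
  have c0: "c \<noteq> 0" using c by (simp add: c_def)
  have "(- s / c) * (c + s ^ 2 * s * c) = - s * (1 + s ^ 3)"
    using c0 by (simp add: field_simps eval_nat_numeral)
  with add have "s * (2 + (s ^ 3 + c ^ 3)) = 0" by (simp add: algebra_simps eval_nat_numeral)
  moreover have "s ^ 3 + c ^ 3 = 1" using sm_cm_cubes[OF dom] by (simp add: s_def c_def)
  ultimately have "s = 0" by simp
  moreover have "rs om > 0"
    using rs_eq[of om] rp_pos[of "om / 3"] rp'_third_neg[of om] by simp
  ultimately show False using rs[of om] by (simp add: s_def)
qed

lemma rc_om: "rc om = 0" using rc[of om] cm_om by simp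

lemma rc_pos: "0 \<le> u \<Longrightarrow> u < om \<Longrightarrow> rc u > 0"
proof (cases "u = 0")
  case False
  assume u: "0 \<le> u" "u < om"
  then have u': "0 < u" "u \<le> om" using False by auto
  have "(rp' (om / 3) + 9) / (rp' (om / 3) - 9) = 0" using rc_eq[of om] rc_om by simp
  then have "rp' (om / 3) = - 9" using rp'_third_neg[of om] by (auto simp: divide_eq_0_iff)
  then have "rp' (u / 3) < - 9" using rp'_less[of "u / 3" "om / 3"] u u' by simp
  then show ?thesis unfolding rc_eq[OF u'] by (intro divide_neg_neg) auto
qed (simp add: rc_def)

lemma rs_rc_cubes:
  assumes "0 \<le> u" "u \<le> om" shows "rs u ^ 3 + rc u ^ 3 = 1"
proof -
  have "complex_of_real (rs u ^ 3 + rc u ^ 3) = of_real 1"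
    using sm_cm_cubes[OF real_sdom[OF assms]] by (simp add: rs rc)
  then show ?thesis by (simp only: of_real_eq_iff)
qed

lemma rs_derivative:
  assumes "0 \<le> u" "u \<le> om" shows "(rs has_real_derivative rc u ^ 2) (at u)"
proof -
  have "(rs has_real_derivative Re (cm (of_real u) ^ 2)) (at u)"
    unfolding rs_def[abs_def] by (intro Re_of_real_derivative sm_cm_derivative real_sdom assms)
  then show ?thesis by (simp add: rc power2_eq_square)
qed

text \<open>On the real segment the derivative of \<open>rs\<close> is
  \<open>rc ^ 2 = (1 - rs ^ 3) powr (2 / 3)\<close>, so the inverse function \<open>g\<close> has
  the integrand of \<open>varpi\<close> as its derivative. Since \<open>rc\<close> is positive
  before its zero \<open>om\<close>, \<open>rs\<close> increases from 0 to 1. At the singular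
  endpoint 1 only the continuity of \<open>g\<close> is used.\<close>

lemma varpi_eq: "varpi = om"
proof -
  have cont: "continuous_on {0..om} rs"
    by (intro continuous_at_imp_continuous_on ballI) (use rs_derivative DERIV_isCont in auto)
  have less: "rs a < rs b" if "0 \<le> a" "a < b" "b \<le> om" for a b
  proof (rule DERIV_pos_imp_increasing_open[OF that(2)])
    fix x assume "a < x" "x < b"
    then show "\<exists>y. (rs has_real_derivative y) (at x) \<and> y > 0"
      using rs_derivative[of x] rc_pos[of x] that by (intro exI[of _ "rc x ^ 2"]) auto
  next
    show "continuous_on {a..b} rs" using cont that by (auto intro: continuous_on_subset)
  qed
  have inj: "inj_on rs {0..om}"
  proof (rule inj_onI)
    fix a b assume "a \<in> {0..om}" "b \<in> {0..om}" "rs a = rs b"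
    then show "a = b" using less[of a b] less[of b a] by (cases a b rule: linorder_cases) auto
  qed
  have rs0: "rs 0 = 0" by (simp add: rs_def)
  have om0: "0 \<le> om" using om_pos by linarith
  have rs1: "rs om = 1"
  proof -
    have "rs om > 0" using less[of 0 om] rs0 by simp
    moreover have "rs om ^ 3 = 1 ^ 3" using rs_rc_cubes[of om] rc_om om0 by simp
    ultimately show ?thesis using power_eq_iff_eq_base[of 3 "rs om" 1] by simp
  qed
  have img: "rs ` {0..om} = {0..1}"
  proof safe
    fix x assume x: "x \<in> {0..om}"
    then have "rs 0 \<le> rs x" using less[of 0 x] by (cases "x = 0") auto
    moreover have "rs x \<le> rs om" using x less[of x om] by (cases "x = om") auto
    ultimately show "rs x \<in> {0..1}" using rs0 rs1 by simp
  next
    fix y :: real assume "y \<in> {0..1}"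
    then show "y \<in> rs ` {0..om}" using IVT'[of rs 0 y om] cont rs0 rs1 om0 by auto
  qed
  define g where "g = the_inv_into {0..om} rs"
  have g: "g (rs u) = u" if "u \<in> {0..om}" for u
    unfolding g_def using that by (rule the_inv_into_f_f[OF inj])
  have contg: "continuous_on {0..1} g"
    using continuous_on_inv[OF cont, of g] g img by simp
  have "(g has_vector_derivative (1 - x ^ 3) powr (- 2 / 3)) (at x)" if x: "x \<in> {0<..<1}" for x
  proof -
    have "x \<in> rs ` {0..om}" using x img by auto
    then obtain u where u: "u \<in> {0..om}" "x = rs u" by auto
    have u': "0 < u" "u < om" using u x rs0 rs1 by (cases "u = 0"; cases "u = om"; auto)+
    have c: "rc u > 0" using rc_pos u' by simp
    have "rc u ^ 3 = 1 - x ^ 3" using rs_rc_cubes[of u] u by simp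
    then have "(1 - x ^ 3) powr (2 / 3) = (rc u powr 3) powr (2 / 3)" using c by simp
    also have "\<dots> = rc u powr 2" by (simp only: powr_powr) simp
    also have "\<dots> = rc u ^ 2" using c by simp
    finally have pw: "inverse (rc u ^ 2) = (1 - x ^ 3) powr (- 2 / 3)" by (simp add: powr_minus)
    have "(g has_real_derivative inverse (rc u ^ 2)) (at x)"
    proof (rule DERIV_inverse_function[where f = rs and g = g and x = x and a = 0 and b = 1])
      show "(rs has_real_derivative rc u ^ 2) (at (g x))"
        using u g rs_derivative by auto
      show "rs (g y) = y" if "0 < y" "y < 1" for y
      proof -
        have "y \<in> rs ` {0..om}" using that img by auto
        then show ?thesis using g by auto
      qed
      show "isCont g x" using contg x by (intro continuous_on_interior[OF contg]) auto
    qed (use c x in auto)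
    then show ?thesis unfolding pw has_real_derivative_iff_has_vector_derivative .
  qed
  then have "((\<lambda>x. (1 - x ^ 3) powr (- 2 / 3)) has_integral g 1 - g 0) {0..1}"
    by (intro fundamental_theorem_of_calculus_interior contg) auto
  moreover have "g 1 = om" "g 0 = 0" using g[of om] g[of 0] rs0 rs1 om0 by auto
  ultimately show ?thesis unfolding varpi_def by (simp add: integral_unique)
qed

lemma wp_eq: "wp = pp"
proof
  fix z
  have inj: "inj_on (\<lambda>w. om' * w) (eis - {0})" by (auto intro: inj_onI)
  have img: "(\<lambda>w. om' * w) ` eis - {0} = (\<lambda>w. om' * w) ` (eis - {0})" by auto
  have trm: "1 / (z - om' * w) ^ 2 - 1 / (om' * w) ^ 2 = (1 / (z / om' - w) ^ 2 - 1 / w ^ 2) * (1 / om' ^ 2)" for w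
  proof -
    have "z - om' * w = om' * (z / om' - w)" by (simp add: algebra_simps)
    then show ?thesis by (simp add: power_mult_distrib diff_divide_distrib mult.commute)
  qed
  have "(\<Sum>\<^sub>\<infinity>w\<in>(\<lambda>w. om' * w) ` eis - {0}. 1 / (z - w) ^ 2 - 1 / w ^ 2) = wrem (z / om') * (1 / om' ^ 2)"
    unfolding img infsum_reindex[OF inj] o_def trm wrem_def by (rule infsum_cmult_left')
  then show "wp z = pp z"
    unfolding wp_def varpi_eq weierstrass_p_def pp_prem prem_def by simp
qed

lemma deriv_pp: "z \<notin> plat \<Longrightarrow> deriv pp z = pp' z"
  using pp_derivative DERIV_imp_deriv by blast

text \<open>The 3 undoes the argument \<open>v / 3\<close> in \<open>sm\<close>. The sign comes from
  the oddness of \<open>pp'\<close>: it turns the \<open>9 + pp'\<close> of \<open>phi\<close> into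
  the \<open>9 - pp'\<close> of \<open>sm\<close>.\<close>

lemma phi_eq_sm:
  assumes "u \<notin> eis" shows "phi u = sm (- 3 * om' * u)"
proof -
  have p: "om' * u \<notin> plat" using assms by (simp add: plat_def)
  have n: "- 3 * om' * u \<notin> lat3" using assms by (simp add: lat3_iff)
  have "- 3 * om' * u / 3 = - (om' * u)" by simp
  then show ?thesis
    using n unfolding phi_def wp_eq varpi_eq deriv_pp[OF p] sm_def
    by (simp only: pp_uminus pp'_uminus if_False) simp
qed

lemma sl_eq_sm:
  assumes "v \<notin> lat3" shows "sl v = sm v"
proof -
  have "v / (- 3 * om') \<notin> eis" using assms eis_uminus_iff[of "v / (3 * om')"] by (simp add: lat3_iff)
  then show ?thesis using phi_eq_sm by (simp add: sl_def varpi_eq)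
qed

section \<open>Taylor series of Dixon's functions\<close>

definition smF :: "complex fps" where "smF = fps_expansion sm 0"
definition cmF :: "complex fps" where "cmF = fps_expansion cm 0"

lemma sm_fps: "sm has_fps_expansion smF" and cm_fps: "cm has_fps_expansion cmF"
  unfolding smF_def cmF_def using sm_cm_analytic_0 analytic_at_imp_has_fps_expansion_0 by auto

lemma smF_0 [simp]: "fps_nth smF 0 = 0" and cmF_0 [simp]: "fps_nth cmF 0 = 1"
  using has_fps_expansion_imp_0_eq_fps_nth_0[OF sm_fps] has_fps_expansion_imp_0_eq_fps_nth_0[OF cm_fps] by simp_all

lemma eventually_sdom: "eventually (\<lambda>v. v \<in> sdom) (nhds 0)"
  using eventually_nhds_in_open[OF open_sdom] by simp

lemma has_fps_expansion_eqI:
  fixes f g :: "complex \<Rightarrow> complex"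
  assumes "f has_fps_expansion F" "g has_fps_expansion G" "eventually (\<lambda>x. f x = g x) (nhds 0)"
  shows "F = G"
proof -
  have "f has_fps_expansion F \<longleftrightarrow> g has_fps_expansion F"
    by (rule has_fps_expansion_cong[OF assms(3) refl])
  then show ?thesis using assms fps_expansion_unique_complex by blast
qed

lemma smF_deriv: "fps_deriv smF = cmF ^ 2" and cmF_deriv: "fps_deriv cmF = - (smF ^ 2)"
proof -
  have "eventually (\<lambda>v. deriv sm v = cm v ^ 2) (nhds 0)" "eventually (\<lambda>v. deriv cm v = - (sm v ^ 2)) (nhds 0)"
    using eventually_sdom by (eventually_elim, use sm_cm_derivative DERIV_imp_deriv in blast)+
  note ev = this
  show "fps_deriv smF = cmF ^ 2"
    by (rule has_fps_expansion_eqI[OF _ _ ev(1)]) (intro fps_expansion_intros sm_fps cm_fps)+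
  show "fps_deriv cmF = - (smF ^ 2)"
    by (rule has_fps_expansion_eqI[OF _ _ ev(2)]) (intro fps_expansion_intros sm_fps cm_fps)+
qed

lemma smF_1 [simp]: "fps_nth smF 1 = 1" "fps_nth smF (Suc 0) = 1"
proof -
  have "fps_nth (fps_deriv smF) 0 = 1" by (simp add: smF_deriv fps_power_zeroth)
  then show "fps_nth smF 1 = 1" "fps_nth smF (Suc 0) = 1" by simp_all
qed

lemma smF_cubes: "smF ^ 3 + cmF ^ 3 = 1"
proof (rule has_fps_expansion_eqI)
  show "(\<lambda>v. sm v ^ 3 + cm v ^ 3) has_fps_expansion smF ^ 3 + cmF ^ 3"
    by (intro fps_expansion_intros sm_fps cm_fps)
  show "(\<lambda>v. 1) has_fps_expansion (1 :: complex fps)" by (rule fps_expansion_intros)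
  show "eventually (\<lambda>v. sm v ^ 3 + cm v ^ 3 = 1) (nhds 0)"
    using eventually_sdom by eventually_elim (rule sm_cm_cubes)
qed

text \<open>The expansion of \<open>f (c * z)\<close>. For an Eisenstein integer \<open>c\<close> it
  represents multiplication by \<open>c\<close> on the cubic.\<close>

definition fps_scale :: "complex \<Rightarrow> complex fps \<Rightarrow> complex fps" where
  "fps_scale c F = fps_compose F (fps_const c * fps_X)"

lemma fps_scale_nth: "fps_nth (fps_scale c F) n = c ^ n * fps_nth F n"
  by (simp add: fps_scale_def)

lemma fps_scale_expansion:
  fixes f :: "complex \<Rightarrow> complex"
  shows "f has_fps_expansion F \<Longrightarrow> (\<lambda>z. f (c * z)) has_fps_expansion fps_scale c F"
  unfolding fps_scale_def by (rule has_fps_expansion_compose_linear)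

text \<open>The addition theorem restricted to the line \<open>(a * z, b * z)\<close>. Series in one
  variable suffice, because all division points are multiples of a single parameter.\<close>

lemma fps_addition_theorem:
  fixes a b :: complex
  shows "fps_scale (a + b) smF * (fps_scale b cmF + fps_scale b smF ^ 2 * fps_scale a smF * fps_scale a cmF)
      = fps_scale a smF + fps_scale a cmF ^ 2 * fps_scale b smF * fps_scale b cmF" (is ?S)
    and "fps_scale (a + b) cmF * (fps_scale b cmF + fps_scale b smF ^ 2 * fps_scale a smF * fps_scale a cmF)
      = fps_scale a cmF * fps_scale b cmF ^ 2 - fps_scale a smF ^ 2 * fps_scale b smF" (is ?C)
proof -
  have tl: "filterlim (\<lambda>z. c * z) (nhds 0) (nhds 0)" for c :: complex
    by (auto intro!: tendsto_eq_intros filterlim_ident)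
  have ev: "eventually (\<lambda>z. a * z \<in> sdom \<and> b * z \<in> sdom \<and> a * z + b * z \<in> sdom) (nhds 0)"
    using eventually_compose_filterlim[OF eventually_sdom tl, of a]
      eventually_compose_filterlim[OF eventually_sdom tl, of b]
      eventually_compose_filterlim[OF eventually_sdom tl, of "a + b"]
    by eventually_elim (simp add: distrib_right)
  note exps = fps_expansion_intros fps_scale_expansion[OF sm_fps] fps_scale_expansion[OF cm_fps]
  show ?S
  proof (rule has_fps_expansion_eqI)
    show "eventually (\<lambda>z. sm ((a + b) * z) * (cm (b * z) + sm (b * z) ^ 2 * sm (a * z) * cm (a * z)) =
        sm (a * z) + cm (a * z) ^ 2 * sm (b * z) * cm (b * z)) (nhds 0)"
      using ev by eventually_elim (simp add: distrib_right addition_theorem(1))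
  qed (intro exps)+
  show ?C
  proof (rule has_fps_expansion_eqI)
    show "eventually (\<lambda>z. cm ((a + b) * z) * (cm (b * z) + sm (b * z) ^ 2 * sm (a * z) * cm (a * z)) =
        cm (a * z) * cm (b * z) ^ 2 - sm (a * z) ^ 2 * sm (b * z)) (nhds 0)"
      using ev by eventually_elim (simp add: distrib_right addition_theorem(2))
  qed (intro exps)+
qed

lemma sl_laurent: "sl has_laurent_expansion fps_to_fls smF"
proof -
  have "eventually (\<lambda>v. sl v = sm v) (at 0)"
    using eventually_lat3 sl_eq_sm by (auto simp: eventually_at_filter elim: eventually_mono)
  then show ?thesis
    using has_laurent_expansion_fps[OF sm_fps] has_laurent_expansion_cong by blast
qed

lemma C_coeff_eq: "C_coeff n = fps_nth smF n"
  unfolding C_coeff_def laurent_expansion_0_eqI[OF sl_laurent] by simp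

lemma smF_shift: "smF = fps_X * fps_shift 1 smF"
  by (rule fps_ext) (simp add: fps_X_mult_nth split: nat.split)

text \<open>The index moves by 1 because \<open>1 / sl u\<close> is \<open>1 / u\<close> times the
  inverse of the unit series \<open>smF / u\<close>.\<close>

lemma D_coeff_eq: "D_coeff n = fps_nth (inverse (fps_shift 1 smF)) (n + 1)"
proof -
  define E where "E = fps_shift 1 smF"
  have E: "fps_nth E 0 \<noteq> 0" by (simp add: E_def)
  have "(\<lambda>u. inverse (sl u)) has_laurent_expansion inverse (fps_to_fls smF)"
    by (intro laurent_expansion_intros sl_laurent)
  then have 1: "D_coeff n = fls_nth (inverse (fps_to_fls smF)) (int n)"
    unfolding D_coeff_def by (simp add: laurent_expansion_0_eqI)
  have "inverse (fps_to_fls smF) = fls_X_inv * fps_to_fls (inverse E)"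
  proof (rule inverse_unique)
    have "fps_to_fls smF = fls_X * fps_to_fls E"
      by (subst smF_shift) (simp add: E_def fls_times_fps_to_fls)
    moreover have "fps_to_fls E * fps_to_fls (inverse E) = 1"
      using E by (simp add: inverse_mult_eq_1' flip: fls_times_fps_to_fls)
    moreover have "fls_X * fls_X_inv = (1 :: complex fls)" by (simp add: fls_X_times_conv_shift)
    moreover have "x * e * (x' * e') = (x * x') * (e * e')" for x e x' e' :: "complex fls"
      by (simp add: mult_ac)
    ultimately show "fps_to_fls smF * (fls_X_inv * fps_to_fls (inverse E)) = 1"
      by (simp only: mult_1)
  qed
  then show ?thesis unfolding 1 E_def
    by (simp add: fls_X_inv_times_conv_shift nat_add_distrib)
qed

section \<open>Taylor coefficients of the scaled Weierstrass function\<close>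

definition pF :: "complex fps" where "pF = fps_expansion prem 0"

lemma prem_fps: "prem has_fps_expansion pF"
  unfolding pF_def using prem_analytic analytic_at_imp_has_fps_expansion_0 by auto

text \<open>The definition of \<open>sm (3 * z)\<close> with denominators cleared. The second factor
  has constant term 2, so integrality passes from \<open>pF\<close> to \<open>smF\<close>.\<close>

lemma smF_pF: "fps_scale 3 smF * (fps_const 9 * fps_X ^ 3 - (fps_const (- 2) + fps_X ^ 3 * fps_deriv pF))
   = fps_const 6 * fps_X * (1 + fps_X ^ 2 * pF)"
proof (rule has_fps_expansion_eqI)
  have tl: "filterlim (\<lambda>z. 3 * z) (nhds 0) (nhds (0::complex))"
    by (auto intro!: tendsto_eq_intros filterlim_ident)
  have pl: "filterlim (\<lambda>z. z / 3 * 3) (nhds 0) (nhds (0::complex))"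
    by (auto intro!: tendsto_eq_intros filterlim_ident)
  show "eventually (\<lambda>z. sm (3 * z) * (9 * z ^ 3 - (- 2 + z ^ 3 * deriv prem z)) = 6 * z * (1 + z ^ 2 * prem z)) (nhds 0)"
    using eventually_compose_filterlim[OF sm_cm_near_0 tl] eventually_compose_filterlim[OF pB_near_0 tl]
    by eventually_elim (simp add: pA_def pB_def)
qed (intro fps_expansion_intros fps_scale_expansion[OF sm_fps] prem_fps)+

lemma pF_nth: "fps_nth pF n = fps_nth wF n / om' ^ (n + 2)"
proof -
  have "(\<lambda>z. inverse (om' ^ 2) * wrem (inverse om' * z)) has_fps_expansion fps_const (inverse (om' ^ 2)) * fps_scale (inverse om') wF"
    by (intro fps_expansion_intros fps_scale_expansion wrem_fps)
  moreover have "(\<lambda>z. inverse (om' ^ 2) * wrem (inverse om' * z)) = prem"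
    by (auto simp: prem_def field_simps)
  ultimately have "pF = fps_const (inverse (om' ^ 2)) * fps_scale (inverse om') wF"
    using prem_fps fps_expansion_unique_complex by metis
  then have "fps_nth pF n = inverse (om' ^ 2) * (inverse om' ^ n * fps_nth wF n)"
    using fps_mult_left_const_nth[of "inverse (om' ^ 2)" "fps_scale (inverse om') wF" n]
    by (simp only: fps_scale_nth)
  then show ?thesis by (simp add: power_add power2_eq_square divide_simps mult.assoc)
qed

lemma pF_low: "n < 4 \<Longrightarrow> fps_nth pF n = 0" by (simp add: pF_nth wF_low)

lemma eventually_at_0_nhds: "eventually P (at (0::complex)) \<Longrightarrow> P 0 \<Longrightarrow> eventually P (nhds 0)"
  by (simp add: eventually_nhds_conv_at)

lemma eventually_not_plat: "eventually (\<lambda>z. z \<noteq> 0 \<and> z \<notin> plat) (at 0)"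
  using eventually_plat by (auto simp: eventually_at_filter elim: eventually_mono)

text \<open>The equation \<open>pp'' = 6 * pp ^ 2\<close> freed of its poles. It gives a recursion
  whose leading factor \<open>n * (n - 1) - 12\<close> vanishes at \<open>n = 4\<close> only, so the
  coefficient of degree 4 has to come from the first-order equation.\<close>

lemma pF_ode: "fps_X ^ 2 * fps_deriv (fps_deriv pF) = fps_const 12 * pF + fps_const 6 * (fps_X ^ 2 * pF ^ 2)"
proof (rule has_fps_expansion_eqI)
  have p0: "prem 0 = 0" by (simp add: prem_def wrem_0)
  show "eventually (\<lambda>z. z ^ 2 * deriv (deriv prem) z = 12 * prem z + 6 * (z ^ 2 * prem z ^ 2)) (nhds 0)"
  proof (rule eventually_at_0_nhds)
    show "eventually (\<lambda>z. z ^ 2 * deriv (deriv prem) z = 12 * prem z + 6 * (z ^ 2 * prem z ^ 2)) (at 0)"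
      using eventually_not_plat
    proof eventually_elim
      case (elim z)
      then have z: "z \<noteq> 0" "z \<notin> plat" by auto
      have ev: "eventually (\<lambda>x. deriv prem x = pp' x + 2 / x ^ 3) (nhds z)"
        using eventually_nhds_in_open[OF open_Compl_plat, of z] z
        by (auto elim!: eventually_mono simp: pp'_prem)
      have "((\<lambda>x. pp' x + 2 / x ^ 3) has_field_derivative 6 * pp z ^ 2 + (- 6 / z ^ 4)) (at z)"
      proof (rule DERIV_add[OF pp'_derivative[OF z(2)]])
        show "((\<lambda>x. 2 / x ^ 3) has_field_derivative (- 6 / z ^ 4)) (at z)"
          using z(1) by (auto intro!: derivative_eq_intros) (simp add: divide_simps eval_nat_numeral)
      qed
      then have "(deriv prem has_field_derivative 6 * pp z ^ 2 + (- 6 / z ^ 4)) (at z)"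
        by (rule DERIV_transfer_ev[OF ev])
      then have "deriv (deriv prem) z = 6 * pp z ^ 2 + (- 6 / z ^ 4)" by (rule DERIV_imp_deriv)
      then have "z ^ 2 * deriv (deriv prem) z = z ^ 2 * (6 * (1 / z ^ 2 + prem z) ^ 2 - 6 / z ^ 4)"
        by (simp add: pp_prem)
      also have "\<dots> = 12 * prem z + 6 * (z ^ 2 * prem z ^ 2)"
        using z(1) by (simp add: field_simps power2_eq_square eval_nat_numeral)
      finally show ?case .
    qed
  qed (simp add: p0)
qed (intro fps_expansion_intros prem_fps)+

lemma pF_first_order: "(fps_const (- 2) + fps_X ^ 3 * fps_deriv pF) ^ 2
    = fps_const 4 * (1 + fps_X ^ 2 * pF) ^ 3 - fps_const 27 * fps_X ^ 6"
proof (rule has_fps_expansion_eqI)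
  show "eventually (\<lambda>z. (- 2 + z ^ 3 * deriv prem z) ^ 2 = 4 * (1 + z ^ 2 * prem z) ^ 3 - 27 * z ^ 6) (nhds 0)"
  proof (rule eventually_at_0_nhds)
    show "eventually (\<lambda>z. (- 2 + z ^ 3 * deriv prem z) ^ 2 = 4 * (1 + z ^ 2 * prem z) ^ 3 - 27 * z ^ 6) (at 0)"
      using eventually_not_plat
    proof eventually_elim
      case (elim z)
      have "(- 2 + z ^ 3 * deriv prem z) ^ 2 = z ^ 6 * pp' z ^ 2"
        using pB_eq[of z] elim by (simp add: pB_def power_mult_distrib flip: power_mult)
      also have "\<dots> = 4 * (z ^ 2 * pp z) ^ 3 - 27 * z ^ 6"
        using elim by (simp add: pp'_square power_mult_distrib algebra_simps flip: power_mult)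
      finally show ?case using pA_eq[of z] elim by (simp add: pA_def)
    qed
  qed simp
qed (intro fps_expansion_intros prem_fps)+

text \<open>Comparing the coefficients of \<open>fps_X ^ 6\<close> in \<open>pF_first_order\<close>
  gives \<open>- 16 * a = 12 * a - 27\<close>; the value is the classical \<open>g3 / 28\<close>
  with \<open>g3 = 27\<close>.\<close>

lemma pF_4: "fps_nth pF 4 = 27 / 28"
proof -
  define U where "U = fps_shift 4 pF"
  have pF: "pF = fps_X ^ 4 * U"
    by (rule fps_ext) (use pF_low in \<open>auto simp: fps_X_power_mult_nth U_def\<close>)
  define V where "V = fps_const 4 * U + fps_X * fps_deriv U"
  have dV: "fps_X ^ 3 * fps_deriv pF = fps_X ^ 6 * V"
    unfolding pF V_def by (simp add: fps_deriv_power fps_const_mult_apply_left[symmetric] algebra_simps eval_nat_numeral flip: fps_numeral_fps_const)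
  have "fps_nth ((fps_const (- 2) + fps_X ^ 6 * V) ^ 2) 6 = fps_nth (fps_const 4 * (1 + fps_X ^ 6 * U) ^ 3 - fps_const 27 * fps_X ^ 6) 6"
    using pF_first_order unfolding dV unfolding pF
    by (simp add: mult.assoc[symmetric] flip: power_add)
  moreover have "(fps_const (- 2) + fps_X ^ 6 * V) ^ 2 = fps_const 4 - fps_X ^ 6 * (fps_const 4 * V) + fps_X ^ 12 * V ^ 2"
  proof -
    have 1: "fps_const (- 2 :: complex) = - 2" and 2: "fps_const (4 :: complex) = 4"
      by (simp_all flip: fps_numeral_fps_const fps_const_neg)
    have 3: "(fps_X :: complex fps) ^ 12 = fps_X ^ 6 * fps_X ^ 6" by (simp flip: power_add)
    show ?thesis unfolding 1 2 3 by (simp add: power2_eq_square algebra_simps)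
  qed
  moreover have "fps_const 4 * (1 + fps_X ^ 6 * U) ^ 3 - fps_const 27 * fps_X ^ 6
     = fps_const 4 + fps_X ^ 6 * (fps_const 12 * U - fps_const 27) + fps_X ^ 12 * (fps_const 12 * U ^ 2 + fps_const 4 * (fps_X ^ 6 * U ^ 3))"
    by (simp add: eval_nat_numeral algebra_simps flip: fps_numeral_fps_const)
  ultimately have "- 4 * fps_nth V 0 = 12 * fps_nth U 0 - 27"
    by (simp add: fps_X_power_mult_nth)
  moreover have "fps_nth V 0 = 4 * fps_nth U 0" by (simp add: V_def)
  ultimately show ?thesis by (simp add: U_def field_simps)
qed

section \<open>Residues and the cubic character\<close>

definition eisQ :: "complex set" where "eisQ = {x / s |x s. x \<in> eis \<and> s \<in> eis \<and> s \<noteq> 0}"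

lemma eisQ_I: "x \<in> eis \<Longrightarrow> s \<in> eis \<Longrightarrow> s \<noteq> 0 \<Longrightarrow> x / s \<in> eisQ"
  unfolding eisQ_def by blast

lemma eisQ_E:
  assumes "z \<in> eisQ" obtains x s where "x \<in> eis" "s \<in> eis" "s \<noteq> 0" "z = x / s"
  using assms unfolding eisQ_def by blast

lemma eisQ_eis [simp, intro]: "x \<in> eis \<Longrightarrow> x \<in> eisQ" using eisQ_I[of x 1] by simp

lemma eisQ_add [intro]: "x \<in> eisQ \<Longrightarrow> y \<in> eisQ \<Longrightarrow> x + y \<in> eisQ"
  by (elim eisQ_E) (auto simp: add_frac_eq intro!: eisQ_I)

lemma eisQ_mult [intro]: "x \<in> eisQ \<Longrightarrow> y \<in> eisQ \<Longrightarrow> x * y \<in> eisQ"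
  by (elim eisQ_E) (auto intro!: eisQ_I)

lemma eisQ_uminus [intro]: "x \<in> eisQ \<Longrightarrow> - x \<in> eisQ"
  using eisQ_mult[of "- 1" x] by auto

lemma eisQ_diff [intro]: "x \<in> eisQ \<Longrightarrow> y \<in> eisQ \<Longrightarrow> x - y \<in> eisQ"
  using eisQ_add[of x "- y"] by auto

lemma eisQ_inverse [intro]: "x \<in> eisQ \<Longrightarrow> inverse x \<in> eisQ"
proof (elim eisQ_E)
  fix y s assume ys: "y \<in> eis" "s \<in> eis" "s \<noteq> 0" "x = y / s"
  then show ?thesis using eisQ_I[of s y] by (cases "y = 0") auto
qed

lemma eisQ_divide [intro]: "x \<in> eisQ \<Longrightarrow> y \<in> eisQ \<Longrightarrow> x / y \<in> eisQ"
  by (simp add: divide_inverse eisQ_inverse eisQ_mult)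

lemma eisQ_power [intro]: "x \<in> eisQ \<Longrightarrow> x ^ n \<in> eisQ" by (induction n) auto

lemma eisQ_sum [intro]: "(\<And>i. i \<in> A \<Longrightarrow> f i \<in> eisQ) \<Longrightarrow> sum f A \<in> eisQ"
  by (induction A rule: infinite_finite_induct) auto

lemma eis_dvdI: "z \<in> eis \<Longrightarrow> y = x * z \<Longrightarrow> eis_dvd x y" unfolding eis_dvd_def by blast
lemma eis_dvdE: "eis_dvd x y \<Longrightarrow> (\<And>z. z \<in> eis \<Longrightarrow> y = x * z \<Longrightarrow> P) \<Longrightarrow> P" unfolding eis_dvd_def by blast

lemma eis_dvd_add: "eis_dvd x y \<Longrightarrow> eis_dvd x z \<Longrightarrow> eis_dvd x (y + z)"
  by (elim eis_dvdE) (rule eis_dvdI[of "_ + _"], auto simp: distrib_left)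
lemma eis_dvd_mult: "eis_dvd x y \<Longrightarrow> z \<in> eis \<Longrightarrow> eis_dvd x (y * z)"
proof (elim eis_dvdE)
  fix w assume "z \<in> eis" "w \<in> eis" "y = x * w"
  then show ?thesis by (intro eis_dvdI[of "w * z"]) auto
qed
lemma eis_dvd_mult2: "eis_dvd x y \<Longrightarrow> z \<in> eis \<Longrightarrow> eis_dvd x (z * y)"
  using eis_dvd_mult[of x y z] by (simp add: mult.commute)
lemma eis_dvd_uminus: "eis_dvd x y \<Longrightarrow> eis_dvd x (- y)"
  by (elim eis_dvdE) (rule eis_dvdI[of "- _"], auto)
lemma eis_dvd_diff: "eis_dvd x y \<Longrightarrow> eis_dvd x z \<Longrightarrow> eis_dvd x (y - z)"
  using eis_dvd_add[of x y "- z"] eis_dvd_uminus by simp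
lemma eis_dvd_0 [simp]: "eis_dvd x 0" by (rule eis_dvdI[of 0]) auto
lemma eis_dvd_self: "eis_dvd x x" by (rule eis_dvdI[of 1]) auto

lemma eis_cong_refl [simp]: "eis_cong m x x" by (simp add: eis_cong_def)
lemma eis_cong_sym: "eis_cong m x y \<Longrightarrow> eis_cong m y x"
  unfolding eis_cong_def using eis_dvd_uminus by fastforce
lemma eis_cong_trans: "eis_cong m x y \<Longrightarrow> eis_cong m y z \<Longrightarrow> eis_cong m x z"
  unfolding eis_cong_def using eis_dvd_add by fastforce
lemma eis_cong_common: "eis_cong m x z \<Longrightarrow> eis_cong m y z \<Longrightarrow> eis_cong m x y"
  by (rule eis_cong_trans[OF _ eis_cong_sym])
lemma eis_cong_mult:
  assumes "eis_cong m x y" "eis_cong m x' y'" "x' \<in> eis" "y \<in> eis"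
  shows "eis_cong m (x * x') (y * y')"
proof -
  have "x * x' - y * y' = (x - y) * x' + y * (x' - y')" by (simp add: algebra_simps)
  then show ?thesis unfolding eis_cong_def
    using assms by (simp add: eis_cong_def eis_dvd_add eis_dvd_mult eis_dvd_mult2)
qed
lemma eis_cong_power:
  assumes "eis_cong m x y" "x \<in> eis" "y \<in> eis" shows "eis_cong m (x ^ n) (y ^ n)"
  by (induction n) (use assms in \<open>auto intro!: eis_cong_mult\<close>)

section \<open>Arithmetic modulo a prime of norm \<open>ell\<close>\<close>

locale eis_prime =
  fixes ell :: nat and lam :: complex
  assumes prime_ell: "prime ell" and lam_eis: "lam \<in> eis" and lam_norm: "lam * cnj lam = of_nat ell"
begin

lemma ell_pos: "ell > 0" using prime_ell prime_gt_0_nat by blast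
lemma ell_gt_1: "ell > 1" using prime_ell prime_gt_1_nat by blast
lemma lam_nonzero: "lam \<noteq> 0" using lam_norm ell_pos by auto

lemma norm_lam: "norm lam ^ 2 = real ell"
  using lam_norm by (metis complex_norm_square of_real_eq_iff of_real_of_nat_eq)

lemma lam_dvd_ell: "eis_dvd lam (of_nat ell)"
  by (rule eis_dvdI[of "cnj lam"]) (use lam_eis lam_norm in auto)

text \<open>Taking norms: a multiple \<open>n\<close> of \<open>lam\<close> has norm
  \<open>n * n\<close> divisible by the prime \<open>ell\<close>.\<close>

lemma lam_dvd_int: "eis_dvd lam (of_int n) \<longleftrightarrow> int ell dvd n"
proof
  assume "eis_dvd lam (of_int n)"
  then obtain z where z: "z \<in> eis" "of_int n = lam * z" by (rule eis_dvdE)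
  obtain k where k: "z * cnj z = of_nat k" using z(1) by (rule eis_norm_square)
  have "of_int (n * n) = (lam * z) * cnj (lam * z)" using z(2) by (metis complex_cnj_of_int of_int_mult)
  also have "\<dots> = (lam * cnj lam) * (z * cnj z)" by (simp add: mult_ac)
  also have "\<dots> = of_int (int ell * int k)" using lam_norm k by simp
  finally have "n * n = int ell * int k" by (simp only: of_int_eq_iff)
  then have "int ell dvd n * n" by simp
  then show "int ell dvd n" using prime_ell by (simp add: prime_dvd_mult_iff)
next
  assume "int ell dvd n"
  then obtain k where "n = int ell * k" by blast
  then show "eis_dvd lam (of_int n)" using eis_dvd_mult[OF lam_dvd_ell, of "of_int k"] by simp
qed

lemma lam_dvd_nat: "eis_dvd lam (of_nat n) \<longleftrightarrow> ell dvd n"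
  using lam_dvd_int[of "int n"] by simp

lemma lam_not_dvd_1: "\<not> eis_dvd lam 1" using lam_dvd_nat[of 1] ell_gt_1 by simp

text \<open>If \<open>lam = a + b * rho\<close> and \<open>b\<close> is prime to \<open>ell\<close>,
  then \<open>rho\<close> is \<open>- a / b\<close> modulo \<open>lam\<close>. Were \<open>b\<close>
  divisible by \<open>ell\<close>, so would be \<open>a\<close>, and \<open>lam = ell * w\<close>
  would make \<open>lam\<close> a unit.\<close>

lemma lam_cong_rho: "\<exists>k. eis_cong lam rho (of_int k)"
proof -
  obtain a b where ab: "lam = of_int a + of_int b * rho" using lam_eis by (rule eisE)
  have nb: "\<not> int ell dvd b"
  proof
    assume b: "int ell dvd b"
    have "of_int a = lam - of_int b * rho" by (simp add: ab)
    moreover have "eis_dvd lam (of_int b * rho)" using b lam_dvd_int by (intro eis_dvd_mult) auto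
    ultimately have "eis_dvd lam (of_int a)" using eis_dvd_diff[OF eis_dvd_self] by metis
    then have "int ell dvd a" by (simp add: lam_dvd_int)
    with b obtain c d where "a = int ell * c" "b = int ell * d" by blast
    then have "lam = of_nat ell * (of_int c + of_int d * rho)" by (simp add: ab algebra_simps)
    moreover have "of_int c + of_int d * rho \<in> eis" by auto
    ultimately obtain w where w: "w \<in> eis" "lam = of_nat ell * w" by blast
    then have "1 = cnj lam * w"
      using lam_norm lam_nonzero by (metis mult.assoc mult_cancel_left mult_1_right)
    then have "1 = lam * cnj w" by (metis complex_cnj_cnj complex_cnj_mult complex_cnj_one)
    then show False using lam_not_dvd_1 w eis_dvdI[of "cnj w" 1 lam] by auto
  qed
  then have "coprime b (int ell)" using prime_ell
    by (metis coprime_commute prime_imp_coprime prime_int_nat_transfer of_nat_0_le_iff nat_int)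
  then obtain b' where b': "[b * b' = 1] (mod int ell)" using cong_solve_coprime_int by blast
  then have "int ell dvd 1 - b * b'" by (meson cong_iff_dvd_diff cong_sym)
  then have "eis_dvd lam (of_int (1 - b * b'))" by (simp only: lam_dvd_int)
  then have "eis_dvd lam (of_int (1 - b * b') * rho + lam * of_int b')"
    by (intro eis_dvd_add eis_dvd_mult eis_dvd_self eis_rho eis_of_int)
  moreover have "of_int (1 - b * b') * rho + lam * of_int b' = rho - of_int (- (a * b'))"
    by (simp add: ab algebra_simps)
  ultimately show ?thesis unfolding eis_cong_def by metis
qed

text \<open>The residue field of \<open>lam\<close> is the prime field. This is what lets every sum
  over residue classes be written over \<open>{1..<ell}\<close>.\<close>

lemma eis_cong_nat:
  assumes "z \<in> eis" obtains n where "n < ell" "eis_cong lam z (of_nat n)"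
proof -
  obtain c d where z: "z = of_int c + of_int d * rho" using assms by (rule eisE)
  obtain k where k: "eis_cong lam rho (of_int k)" using lam_cong_rho by blast
  define m where "m = (c + d * k) mod int ell"
  have m: "0 \<le> m" "m < int ell" using ell_pos by (auto simp: m_def)
  have "int ell dvd c + d * k - m" by (simp add: m_def)
  then have "eis_dvd lam (of_int (c + d * k - m))" by (simp only: lam_dvd_int)
  then have "eis_dvd lam (of_int d * (rho - of_int k) + of_int (c + d * k - m))"
    using k by (intro eis_dvd_add eis_dvd_mult2 eis_of_int) (auto simp: eis_cong_def)
  moreover have "of_int d * (rho - of_int k) + of_int (c + d * k - m) = z - of_nat (nat m)"
    using m(1) by (simp add: z algebra_simps)
  ultimately have "eis_cong lam z (of_nat (nat m))" by (simp only: eis_cong_def)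
  then show ?thesis using m by (intro that[of "nat m"]) auto
qed

lemma lam_prime:
  assumes "eis_dvd lam (x * y)" "x \<in> eis" "y \<in> eis" shows "eis_dvd lam x \<or> eis_dvd lam y"
proof -
  obtain m where m: "eis_cong lam x (of_nat m)" using assms(2) by (rule eis_cong_nat)
  obtain n where n: "eis_cong lam y (of_nat n)" using assms(3) by (rule eis_cong_nat)
  have "eis_cong lam (x * y) (of_nat m * of_nat n)" using m n assms by (intro eis_cong_mult) auto
  then have "eis_dvd lam (of_nat (m * n))"
    using eis_dvd_diff[OF assms(1)] by (fastforce simp: eis_cong_def)
  then have "ell dvd m \<or> ell dvd n" using prime_ell lam_dvd_nat prime_dvd_mult_iff by metis
  moreover have "eis_dvd lam x" if "ell dvd m"
  proof -
    have "eis_dvd lam ((x - of_nat m) + of_nat m)"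
      using m that lam_dvd_nat by (intro eis_dvd_add) (auto simp: eis_cong_def)
    then show ?thesis by simp
  qed
  moreover have "eis_dvd lam y" if "ell dvd n"
  proof -
    have "eis_dvd lam ((y - of_nat n) + of_nat n)"
      using n that lam_dvd_nat by (intro eis_dvd_add) (auto simp: eis_cong_def)
    then show ?thesis by simp
  qed
  ultimately show ?thesis by blast
qed

lemma eis_cong_dvd: "eis_cong lam x y \<Longrightarrow> eis_dvd lam x \<longleftrightarrow> eis_dvd lam y"
  unfolding eis_cong_def using eis_dvd_diff[of lam x "x - y"] eis_dvd_add[of lam "x - y" y] by auto

lemma nat_cong_unique: "m < ell \<Longrightarrow> n < ell \<Longrightarrow> eis_cong lam (of_nat m) (of_nat n) \<Longrightarrow> m = n"
proof -
  assume mn: "m < ell" "n < ell" and c: "eis_cong lam (of_nat m) (of_nat n)"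
  have "eis_dvd lam (of_int (int m - int n))" using c by (simp add: eis_cong_def)
  then have "int ell dvd int m - int n" by (simp only: lam_dvd_int)
  then have "[int m = int n] (mod int ell)" by (simp add: cong_iff_dvd_diff)
  then show "m = n" using mn by (simp add: cong_int_iff cong_less_modulus_unique_nat)
qed

lemma eis_inverse_mod:
  assumes "z \<in> eis" "\<not> eis_dvd lam z" obtains w where "w \<in> eis" "eis_cong lam (z * w) 1"
proof -
  obtain n where n: "eis_cong lam z (of_nat n)" using assms(1) by (rule eis_cong_nat)
  then have "\<not> ell dvd n" using assms(2) eis_cong_dvd lam_dvd_nat by blast
  then have "coprime n ell" using prime_ell by (metis coprime_commute prime_imp_coprime)
  then obtain m where m: "[n * m = 1] (mod ell)" using cong_solve_coprime_nat by auto
  have "eis_cong lam (of_nat (n * m)) 1"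
  proof -
    have "int ell dvd int (n * m) - 1" using m by (metis cong_iff_dvd_diff cong_int_iff of_nat_1)
    then have "eis_dvd lam (of_int (int (n * m) - 1))" by (simp only: lam_dvd_int)
    then show ?thesis by (simp add: eis_cong_def)
  qed
  moreover have "eis_cong lam (z * of_nat m) (of_nat n * of_nat m)"
    using n by (intro eis_cong_mult) auto
  ultimately have "eis_cong lam (z * of_nat m) 1"
    using eis_cong_trans[of lam "z * of_nat m" "of_nat n * of_nat m" 1] by simp
  then show ?thesis by (intro that[of "of_nat m"]) auto
qed

lemma eis_coprime_eq: "eis_coprime lam = {z \<in> eis. \<not> eis_dvd lam z}"
proof safe
  fix r assume r: "r \<in> eis_coprime lam"
  then show "r \<in> eis" by (simp add: eis_coprime_def)
  assume "eis_dvd lam r"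
  moreover obtain s where s: "s \<in> eis" "eis_cong lam (r * s) 1" using r by (auto simp: eis_coprime_def)
  ultimately have "eis_dvd lam (r * s)" by (intro eis_dvd_mult)
  then show False using lam_not_dvd_1 eis_cong_dvd[OF s(2)] by blast
next
  fix z assume "z \<in> eis" "\<not> eis_dvd lam z"
  then show "z \<in> eis_coprime lam" using eis_inverse_mod unfolding eis_coprime_def by blast
qed

section \<open>Units modulo \<open>lam\<close> and functions of residue classes\<close>

abbreviation "U \<equiv> eis_coprime lam"

lemma U_mult: "x \<in> U \<Longrightarrow> y \<in> U \<Longrightarrow> x * y \<in> U"
  unfolding eis_coprime_eq using lam_prime by auto

lemma nat_U: "of_nat n \<in> U \<longleftrightarrow> \<not> ell dvd n"
  by (simp add: eis_coprime_eq lam_dvd_nat)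

lemma nat_U': "n \<in> {1..<ell} \<Longrightarrow> of_nat n \<in> U"
  using nat_U[of n] by (auto dest: dvd_imp_le)

lemma rho_U: "rho \<in> U"
proof -
  have "\<not> eis_dvd lam rho"
  proof
    assume "eis_dvd lam rho"
    then have "eis_dvd lam (rho * rho ^ 2)" by (rule eis_dvd_mult) auto
    moreover have "rho * rho ^ 2 = 1" using rho_cube by (simp add: power2_eq_square power3_eq_cube mult.assoc)
    ultimately show False using lam_not_dvd_1 by simp
  qed
  then show ?thesis by (simp add: eis_coprime_eq)
qed

lemma U_rep: assumes "z \<in> U" obtains n where "n \<in> {1..<ell}" "eis_cong lam z (of_nat n)"
proof -
  obtain n where n: "n < ell" "eis_cong lam z (of_nat n)" using assms eis_cong_nat by (auto simp: eis_coprime_eq)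
  then have "\<not> ell dvd n" using assms eis_cong_dvd lam_dvd_nat by (auto simp: eis_coprime_eq)
  then have "n \<noteq> 0" by (metis dvd_0_right)
  then show ?thesis using that[of n] n by auto
qed

text \<open>Well-definedness on residue classes. For such functions the arbitrary
  \<open>representative\<close> of a class may be replaced by the integer in
  \<open>{1..<ell}\<close>.\<close>

definition resp :: "(complex \<Rightarrow> 'a) \<Rightarrow> bool" where
  "resp F \<longleftrightarrow> (\<forall>x\<in>U. \<forall>y\<in>U. eis_cong lam x y \<longrightarrow> F x = F y)"

lemma respD: "resp F \<Longrightarrow> x \<in> U \<Longrightarrow> y \<in> U \<Longrightarrow> eis_cong lam x y \<Longrightarrow> F x = F y"
  unfolding resp_def by blast

definition cl :: "complex \<Rightarrow> complex set" where "cl z = {w \<in> U. eis_cong lam z w}"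

lemma residue_units_eq: "residue_units lam = (\<lambda>n. cl (of_nat n)) ` {1..<ell}"
proof safe
  fix X assume "X \<in> residue_units lam"
  then obtain z where z: "z \<in> U" "X = {(r, s). r \<in> U \<and> s \<in> U \<and> eis_cong lam r s} `` {z}"
    unfolding residue_units_def by (auto elim: quotientE)
  obtain n where n: "n \<in> {1..<ell}" "eis_cong lam z (of_nat n)" using z(1) by (rule U_rep)
  have "X = cl (of_nat n)" using z n(2) eis_cong_trans eis_cong_sym unfolding cl_def by fast
  then show "X \<in> (\<lambda>n. cl (of_nat n)) ` {1..<ell}" using n by blast
next
  fix n assume "n \<in> {1..<ell}"
  then have n: "of_nat n \<in> U" by (rule nat_U')
  have "cl (of_nat n) = {(r, s). r \<in> U \<and> s \<in> U \<and> eis_cong lam r s} `` {of_nat n}"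
    using n unfolding cl_def by auto
  then show "cl (of_nat n) \<in> residue_units lam" unfolding residue_units_def using n by (simp only: quotientI)
qed

lemma representative_cl:
  assumes "n \<in> {1..<ell}"
  shows "representative (cl (of_nat n)) \<in> U" "eis_cong lam (of_nat n) (representative (cl (of_nat n)))"
proof -
  have "of_nat n \<in> cl (of_nat n)" using nat_U'[OF assms] by (simp add: cl_def)
  then have "representative (cl (of_nat n)) \<in> cl (of_nat n)"
    unfolding representative_def by (rule someI)
  then show "representative (cl (of_nat n)) \<in> U" "eis_cong lam (of_nat n) (representative (cl (of_nat n)))"
    by (auto simp: cl_def)
qed

lemma inj_cl: "inj_on (\<lambda>n. cl (of_nat n)) {1..<ell}"
proof (rule inj_onI)
  fix m n assume mn: "m \<in> {1..<ell}" "n \<in> {1..<ell}" and eq: "cl (of_nat m) = cl (of_nat n)"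
  have "of_nat m \<in> cl (of_nat m)" using nat_U'[OF mn(1)] by (simp add: cl_def)
  then have "eis_cong lam (of_nat n) (of_nat m)" unfolding eq by (simp add: cl_def)
  then show "m = n" using nat_cong_unique[of n m] mn by auto
qed

lemma representative_resp:
  assumes "resp F" "n \<in> {1..<ell}" shows "F (representative (cl (of_nat n))) = F (of_nat n)"
  using respD[OF assms(1) nat_U'[OF assms(2)] representative_cl[OF assms(2)]] by simp

lemma sum_residue_units:
  assumes "resp F" shows "(\<Sum>c\<in>residue_units lam. F (representative c)) = (\<Sum>n\<in>{1..<ell}. F (of_nat n))"
  unfolding residue_units_eq sum.reindex[OF inj_cl] o_def
  by (intro sum.cong refl representative_resp assms)

lemma prod_residue_units:
  fixes F :: "complex \<Rightarrow> complex" and G :: "complex \<Rightarrow> complex"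
  assumes "resp F" "resp G"
  shows "(\<Prod>c | c \<in> residue_units lam \<and> G (representative c) = 1. F (representative c))
     = (\<Prod>n | n \<in> {1..<ell} \<and> G (of_nat n) = 1. F (of_nat n))"
proof -
  have G: "G (representative (cl (of_nat n))) = G (of_nat n)"
    and F: "F (representative (cl (of_nat n))) = F (of_nat n)" if "n \<in> {1..<ell}" for n
    using that assms representative_resp by blast+
  have "{c. c \<in> residue_units lam \<and> G (representative c) = 1}
      = (\<lambda>n. cl (of_nat n)) ` {n. n \<in> {1..<ell} \<and> G (of_nat n) = 1}"
    unfolding residue_units_eq using G by auto
  moreover have "inj_on (\<lambda>n. cl (of_nat n)) {n. n \<in> {1..<ell} \<and> G (of_nat n) = 1}"
    by (rule inj_on_subset[OF inj_cl]) auto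
  ultimately show ?thesis
    using F by (simp only: prod.reindex o_def) (auto intro!: prod.cong)
qed

definition rep :: "complex \<Rightarrow> nat" where "rep z = (THE n. n \<in> {1..<ell} \<and> eis_cong lam z (of_nat n))"

lemma rep: assumes "z \<in> U" shows "rep z \<in> {1..<ell}" "eis_cong lam z (of_nat (rep z))"
proof -
  obtain n where n: "n \<in> {1..<ell}" "eis_cong lam z (of_nat n)" using assms by (rule U_rep)
  have "\<exists>!n. n \<in> {1..<ell} \<and> eis_cong lam z (of_nat n)"
    using n by (intro ex1I[of _ n]) (auto intro!: nat_cong_unique intro: eis_cong_trans eis_cong_sym)
  from theI'[OF this] show "rep z \<in> {1..<ell}" "eis_cong lam z (of_nat (rep z))"
    unfolding rep_def by auto
qed

lemma rep_eqI: "z \<in> U \<Longrightarrow> n \<in> {1..<ell} \<Longrightarrow> eis_cong lam z (of_nat n) \<Longrightarrow> rep z = n"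
  using rep[of z] nat_cong_unique[of "rep z" n]
    eis_cong_common[of lam "of_nat (rep z)" z "of_nat n"] eis_cong_sym[of lam z] by auto

lemma bij_rep_mult:
  assumes "s \<in> U" shows "bij_betw (\<lambda>n. rep (s * of_nat n)) {1..<ell} {1..<ell}"
proof -
  have s: "s \<in> eis" "\<not> eis_dvd lam s" using assms by (auto simp: eis_coprime_eq)
  have "inj_on (\<lambda>n. rep (s * of_nat n)) {1..<ell}"
  proof (rule inj_onI)
    fix m n assume mn: "m \<in> {1..<ell}" "n \<in> {1..<ell}" and eq: "rep (s * of_nat m) = rep (s * of_nat n)"
    have "eis_cong lam (s * of_nat m) (s * of_nat n)"
      using rep(2)[OF U_mult[OF assms nat_U'[OF mn(1)]]] rep(2)[OF U_mult[OF assms nat_U'[OF mn(2)]]]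
      unfolding eq using eis_cong_trans eis_cong_sym by blast
    then have "eis_dvd lam (s * (of_nat m - of_nat n))" by (simp add: eis_cong_def right_diff_distrib)
    then have "eis_dvd lam (of_nat m - of_nat n)" using lam_prime s by blast
    then show "m = n" using mn by (intro nat_cong_unique) (auto simp: eis_cong_def)
  qed
  moreover have "(\<lambda>n. rep (s * of_nat n)) ` {1..<ell} \<subseteq> {1..<ell}"
    using rep(1) U_mult[OF assms] nat_U' by blast
  ultimately show ?thesis by (simp add: bij_betw_def endo_inj_surj)
qed

lemma resp_rep:
  assumes "resp F" "z \<in> U" shows "F (of_nat (rep z)) = F z"
  using respD[OF assms nat_U'[OF rep(1)[OF assms(2)]] rep(2)[OF assms(2)]] by simp

text \<open>Translation invariance on the group of units; it is behind the symmetries of the traces,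
  power sums and Gauss sums below.\<close>

lemma sum_mult_reindex:
  assumes "s \<in> U" "resp F"
  shows "(\<Sum>n\<in>{1..<ell}. F (s * of_nat n)) = (\<Sum>n\<in>{1..<ell}. F (of_nat n))"
proof -
  have "(\<Sum>n\<in>{1..<ell}. F (of_nat n)) = (\<Sum>n\<in>{1..<ell}. F (of_nat (rep (s * of_nat n))))"
    using sum.reindex_bij_betw[OF bij_rep_mult[OF assms(1)], of "\<lambda>n. F (of_nat n)"] by simp
  also have "\<dots> = (\<Sum>n\<in>{1..<ell}. F (s * of_nat n))"
    by (intro sum.cong refl resp_rep assms U_mult nat_U')
  finally show ?thesis by simp
qed

text \<open>Descent on the norm of the denominator, which is divided by \<open>ell\<close> each time
  \<open>lam\<close> cancels.\<close>

lemma eisQ_reduced: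
  assumes "z \<in> eisQ"
  shows "\<exists>x s. x \<in> eis \<and> s \<in> eis \<and> s \<noteq> 0 \<and> z = x / s \<and> \<not> (eis_dvd lam x \<and> eis_dvd lam s)"
proof -
  obtain x s where xs: "x \<in> eis" "s \<in> eis" "s \<noteq> 0" "z = x / s" using assms by (rule eisQ_E)
  obtain n where "norm s ^ 2 = real n" using xs(2) by (rule eis_norm_square)
  with xs show ?thesis
  proof (induction n arbitrary: x s rule: less_induct)
    case (less n)
    show ?case
    proof (cases "eis_dvd lam x \<and> eis_dvd lam s")
      case True
      then obtain x' s' where x': "x' \<in> eis" "x = lam * x'" "s' \<in> eis" "s = lam * s'" by (auto elim!: eis_dvdE)
      then have s': "s' \<noteq> 0" "z = x' / s'" using less.prems lam_nonzero by auto
      obtain m where m: "norm s' ^ 2 = real m" using x'(3) by (rule eis_norm_square)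
      have "real n = real ell * real m"
        using less.prems(5) m norm_lam by (simp add: x'(4) norm_mult power_mult_distrib)
      moreover have "m > 0" using m s' by (cases m) auto
      ultimately have "n = ell * m" "m > 0" by (simp_all flip: of_nat_mult)
      then have "m < n" using ell_gt_1 by simp
      then show ?thesis using less.IH[of m x' s'] x' s' m by blast
    qed (use less.prems in blast)
  qed
qed

text \<open>The dichotomy of a discrete valuation ring: an element of the field outside the
  localization has its inverse in \<open>lam\<close> times the localization. Therefore
  \<open>eis_loc lam\<close> is all that a valuation ring above \<open>lam\<close> can contain of
  \<open>eisQ\<close>.\<close>

lemma eisQ_cases:
  assumes "z \<in> eisQ" "z \<notin> eis_loc lam"
  obtains w where "w \<in> eis_loc lam" "z * (lam * w) = 1"
proof -
  obtain x s where xs: "x \<in> eis" "s \<in> eis" "s \<noteq> 0" "z = x / s" "\<not> (eis_dvd lam x \<and> eis_dvd lam s)"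
    using eisQ_reduced[OF assms(1)] by blast
  have "eis_dvd lam s" using assms(2) xs unfolding eis_loc_def by blast
  then obtain s' where s': "s' \<in> eis" "s = lam * s'" by (rule eis_dvdE)
  have "\<not> eis_dvd lam x" using xs \<open>eis_dvd lam s\<close> by blast
  then have "s' / x \<in> eis_loc lam" using s' xs unfolding eis_loc_def by blast
  moreover have "x \<noteq> 0" using \<open>\<not> eis_dvd lam x\<close> by auto
  then have "z * (lam * (s' / x)) = 1" using xs s' by simp
  ultimately show ?thesis by (rule that)
qed

lemma fermat:
  assumes "z \<in> U" shows "eis_cong lam (z ^ (ell - 1)) 1"
proof -
  obtain n where n: "n \<in> {1..<ell}" "eis_cong lam z (of_nat n)" using assms by (rule U_rep)
  have "\<not> ell dvd n" using n(1) by (auto dest: dvd_imp_le)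
  then have "[n ^ (ell - 1) = 1] (mod ell)" using fermat_theorem[OF prime_ell] by blast
  then have "int ell dvd int (n ^ (ell - 1)) - 1" by (metis cong_iff_dvd_diff cong_int_iff of_nat_1)
  then have "eis_dvd lam (of_int (int (n ^ (ell - 1)) - 1))" by (simp only: lam_dvd_int)
  then have "eis_cong lam (of_nat n ^ (ell - 1)) 1" by (simp add: eis_cong_def)
  moreover have "eis_cong lam (z ^ (ell - 1)) (of_nat n ^ (ell - 1))"
    using n assms by (intro eis_cong_power) (auto simp: eis_coprime_eq)
  ultimately show ?thesis using eis_cong_trans by blast
qed

end

section \<open>The cubic residue character\<close>

lemma cube_roots_factor: "(z::complex) ^ 3 - 1 = (z - 1) * (z - rho) * (z - rho ^ 2)"
proof -
  have "(z - 1) * (z - rho) * (z - rho ^ 2) = z ^ 3 - z ^ 2 * (1 + rho + rho ^ 2) + z * (rho * (1 + rho + rho ^ 2)) - rho ^ 3"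
    by (simp add: algebra_simps eval_nat_numeral)
  then show ?thesis by (simp add: rho_sum rho_cube)
qed

lemma cube_roots: "(z::complex) ^ 3 = 1 \<longleftrightarrow> z = 1 \<or> z = rho \<or> z = rho ^ 2"
proof -
  have "(z - 1) * (z - rho) * (z - rho ^ 2) = z ^ 3 - z ^ 2 * (1 + rho + rho ^ 2) + z * (rho * (1 + rho + rho ^ 2)) - rho ^ 3"
    by (simp add: algebra_simps eval_nat_numeral)
  then have "(z - 1) * (z - rho) * (z - rho ^ 2) = z ^ 3 - 1" by (simp add: rho_sum rho_cube)
  then show ?thesis by (metis eq_iff_diff_eq_0 mult_eq_0_iff)
qed

lemma cube_root_eis: "z ^ 3 = 1 \<Longrightarrow> z \<in> eis"
  unfolding cube_roots by auto

locale eis_prime3 = eis_prime +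
  assumes ell_mod: "ell mod 3 = 1"
begin

definition kk :: nat where "kk = (ell - 1) div 3"

lemma ell_kk: "ell = 3 * kk + 1"
  using ell_mod unfolding kk_def by presburger

lemma lam_not_dvd_3: "\<not> eis_dvd lam 3"
proof
  assume "eis_dvd lam 3"
  then have "ell dvd 3" using lam_dvd_nat[of 3] by simp
  then have "ell \<le> 3" by (rule dvd_imp_le) simp
  then have "ell = 2 \<or> ell = 3" using ell_gt_1 by linarith
  then show False using ell_mod by auto
qed

lemma rho_diff_norm: "(1 - rho) * (1 - rho ^ 2) = 3"
  unfolding rho_square by (simp add: algebra_simps rho_square')

text \<open>The quotient of two distinct cube roots of unity is \<open>rho\<close> or
  \<open>rho ^ 2\<close>, and \<open>1 - rho\<close> and \<open>1 - rho ^ 2\<close> divide 3, which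
  is prime to \<open>lam\<close>. So the value of \<open>cubic_char\<close> is unique.\<close>

lemma cube_roots_cong:
  assumes "z ^ 3 = 1" "w ^ 3 = 1" "eis_cong lam z w" shows "z = w"
proof (rule ccontr)
  assume ne: "z \<noteq> w"
  have z0: "z \<noteq> 0" "w \<noteq> 0" using assms by auto
  \<comment> \<open>\<open>z ^ 2\<close> is the inverse of \<open>z\<close>, so \<open>t\<close> is
    \<open>w / z\<close>.\<close>
  define t where "t = w * z ^ 2"
  have "(z ^ 2) ^ 3 = (z ^ 3) ^ 2" by (simp flip: power_mult)
  then have t3: "t ^ 3 = 1" using assms by (simp add: t_def power_mult_distrib)
  have zz: "z * z ^ 2 = 1" using assms by (simp add: power3_eq_cube power2_eq_square mult.assoc)
  have t1: "t \<noteq> 1"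
  proof
    assume "t = 1" then have "z * t = z" by simp
    then show False using ne zz unfolding t_def by (metis mult.left_commute mult_1_right)
  qed
  have "eis_dvd lam ((z - w) * z ^ 2)"
    using assms cube_root_eis[OF assms(1)] by (intro eis_dvd_mult) (auto simp: eis_cong_def)
  moreover have "(z - w) * z ^ 2 = 1 - t" using zz by (simp add: t_def left_diff_distrib)
  ultimately have d: "eis_dvd lam (1 - t)" by simp
  from t3 t1 have "t = rho \<or> t = rho ^ 2" unfolding cube_roots by blast
  then have "eis_dvd lam ((1 - rho) * (1 - rho ^ 2))"
  proof
    assume "t = rho" then show ?thesis using d by (intro eis_dvd_mult) auto
  next
    assume "t = rho ^ 2" then show ?thesis using d by (intro eis_dvd_mult2) auto
  qed
  then show False using lam_not_dvd_3 rho_diff_norm by simp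
qed

abbreviation "cres \<equiv> cubic_char ell lam"

text \<open>By Fermat \<open>v ^ kk\<close> is a root of \<open>X ^ 3 - 1\<close> modulo
  \<open>lam\<close>; this polynomial splits over \<open>eis\<close>, and \<open>lam\<close> is
  prime.\<close>

lemma chi_ex: assumes "v \<in> U" shows "\<exists>z. z ^ 3 = 1 \<and> eis_cong lam z (v ^ kk)"
proof -
  define w where "w = v ^ kk"
  have v: "v \<in> eis" using assms by (simp add: eis_coprime_eq)
  then have w: "w \<in> eis" by (auto simp: w_def)
  have "ell - 1 = kk * 3" using ell_kk by simp
  then have "w ^ 3 = v ^ (ell - 1)" by (simp add: w_def flip: power_mult)
  then have "eis_cong lam (w ^ 3) 1" using fermat[OF assms] by simp
  moreover have "w ^ 3 - 1 = (w - 1) * ((w - rho) * (w - rho ^ 2))"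
    unfolding cube_roots_factor mult.assoc ..
  ultimately have "eis_dvd lam ((w - 1) * ((w - rho) * (w - rho ^ 2)))" by (simp add: eis_cong_def)
  then have "eis_dvd lam (w - 1) \<or> eis_dvd lam (w - rho) \<or> eis_dvd lam (w - rho ^ 2)"
    using lam_prime w by (meson eis_1 eis_diff eis_mult eis_power eis_rho)
  then have "\<exists>z. z ^ 3 = 1 \<and> eis_cong lam w z" unfolding eis_cong_def cube_roots by blast
  then show ?thesis using eis_cong_sym w_def by blast
qed

lemma chi: assumes "v \<in> U" shows "cres v ^ 3 = 1" "eis_cong lam (cres v) (v ^ kk)"
proof -
  obtain z where z: "z ^ 3 = 1" "eis_cong lam z (v ^ kk)" using chi_ex[OF assms] by blast
  have "\<exists>!z. z ^ 3 = 1 \<and> eis_cong lam z (v ^ kk)"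
  proof (rule ex1I[of _ z])
    fix w assume "w ^ 3 = 1 \<and> eis_cong lam w (v ^ kk)"
    then show "w = z" using cube_roots_cong[of w z] eis_cong_common[of lam w "v ^ kk" z] z by blast
  qed (use z in auto)
  from theI'[OF this] show "cres v ^ 3 = 1" "eis_cong lam (cres v) (v ^ kk)"
    unfolding cubic_char_def kk_def by auto
qed

lemma chi_eqI: "v \<in> U \<Longrightarrow> z ^ 3 = 1 \<Longrightarrow> eis_cong lam z (v ^ kk) \<Longrightarrow> cres v = z"
  using chi[of v] cube_roots_cong[of "cres v" z] eis_cong_common[of lam "cres v" "v ^ kk" z] by blast

lemma chi_eis: "v \<in> U \<Longrightarrow> cres v \<in> eis" using chi cube_root_eis by blast

lemma chi_resp: "resp cres"
  unfolding resp_def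
proof (intro ballI impI)
  fix x y assume x: "x \<in> U" "y \<in> U" "eis_cong lam x y"
  then have "eis_cong lam (x ^ kk) (y ^ kk)" by (intro eis_cong_power) (auto simp: eis_coprime_eq)
  then show "cres x = cres y" using chi[of y] x by (intro chi_eqI) (auto intro: eis_cong_trans eis_cong_sym)
qed

lemma chi_mult: assumes "x \<in> U" "y \<in> U" shows "cres (x * y) = cres x * cres y"
proof (rule chi_eqI)
  show "x * y \<in> U" using assms by (rule U_mult)
  show "(cres x * cres y) ^ 3 = 1" using chi assms by (simp add: power_mult_distrib)
  show "eis_cong lam (cres x * cres y) ((x * y) ^ kk)"
    unfolding power_mult_distrib using assms chi chi_eis
    by (intro eis_cong_mult) (auto simp: eis_coprime_eq)
qed

text \<open>An equality and not just a congruence, because \<open>rho ^ kk\<close> is itself a cube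
  root of unity.\<close>

lemma chi_rho: "cres rho = rho ^ kk"
proof (rule chi_eqI[OF rho_U])
  have "(rho ^ kk) ^ 3 = (rho ^ 3) ^ kk" by (simp only: mult.commute flip: power_mult)
  then show "(rho ^ kk) ^ 3 = 1" by (simp add: rho_cube)
qed simp

end

section \<open>Traces of division values\<close>

text \<open>Every lattice point is \<open>lam * w - n\<close> for exactly one \<open>w\<close> and
  one \<open>n < ell\<close>, so the series of \<open>wq' (lam * u)\<close> regroups into those at
  the shifted points. The regrouping rests on the summability of the terms of degree -3, which is
  why the formula is proved for \<open>wq'\<close>.\<close>

lemma wq'_multiplication:
  fixes lam :: complex and ell :: nat
  assumes "eis_prime ell lam" "lam * u \<notin> eis"
  shows "(\<Sum>n<ell. wq' (u + of_nat n / lam)) = lam ^ 3 * wq' (lam * u)"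
proof -
  interpret eis_prime ell lam by fact
  define g where "g = (\<lambda>x. lam ^ 3 * (- 2 / (lam * u - x) ^ 3))"
  define h where "h = (\<lambda>(n, w). lam * w - of_nat n)"
  have bij: "bij_betw h ({..<ell} \<times> eis) eis"
    unfolding bij_betw_def
  proof
    show "inj_on h ({..<ell} \<times> eis)"
    proof (rule inj_onI)
      fix x y assume xy: "x \<in> {..<ell} \<times> eis" "y \<in> {..<ell} \<times> eis" "h x = h y"
      obtain m w n w' where "x = (m, w)" "y = (n, w')" by (cases x, cases y)
      then have *: "m \<in> {..<ell}" "w \<in> eis" "n \<in> {..<ell}" "w' \<in> eis" "h (m, w) = h (n, w')" "x = (m, w)" "y = (n, w')"
        using xy by auto
      then have eq: "of_nat m - of_nat n = lam * (w - w')" by (simp add: h_def algebra_simps)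
      then have "eis_cong lam (of_nat m) (of_nat n)" unfolding eis_cong_def using * by (intro eis_dvdI[of "w - w'"]) auto
      then have "m = n" using * by (intro nat_cong_unique) auto
      then show "x = y" using eq lam_nonzero * by simp
    qed
    show "h ` ({..<ell} \<times> eis) = eis"
    proof safe
      fix n w assume "w \<in> eis" then show "h (n, w) \<in> eis" using lam_eis by (auto simp: h_def)
    next
      fix x assume x: "x \<in> eis"
      obtain n where n: "n < ell" "eis_cong lam (- x) (of_nat n)" using eis_cong_nat[of "- x"] x by blast
      obtain z where z: "z \<in> eis" "- x - of_nat n = lam * z" using n(2) unfolding eis_cong_def by (rule eis_dvdE)
      have "- (- x - of_nat n) - of_nat n = x" by simp
      then have "x = h (n, - z)" unfolding z(2) by (simp add: h_def)
      then show "x \<in> h ` ({..<ell} \<times> eis)" using n z by blast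
    qed
  qed
  have "(g has_sum (lam ^ 3 * (- 2 / (lam * u) ^ 3 + wrem' (lam * u)))) eis"
    unfolding g_def by (intro has_sum_cmult_right wq'_has_sum assms)
  then have s: "(g has_sum (lam ^ 3 * wq' (lam * u))) eis"
    using wq'_eq[OF assms(2)] by simp
  then have "((\<lambda>x. g (h x)) has_sum (lam ^ 3 * wq' (lam * u))) ({..<ell} \<times> eis)"
    using has_sum_reindex_bij_betw[OF bij] by blast
  then have sum: "(\<lambda>x. g (h x)) summable_on ({..<ell} \<times> eis)"
    and inf: "infsum (\<lambda>x. g (h x)) ({..<ell} \<times> eis) = lam ^ 3 * wq' (lam * u)"
    by (auto simp: summable_on_def infsumI)
  have gh: "g (h (n, w)) = - 2 / (u + of_nat n / lam - w) ^ 3" for n w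
  proof -
    have "lam * u - (lam * w - of_nat n) = lam * (u + of_nat n / lam - w)"
      using lam_nonzero by (simp add: algebra_simps)
    then show ?thesis using lam_nonzero by (simp add: g_def h_def power_mult_distrib)
  qed
  have "lam ^ 3 * wq' (lam * u) = infsum (\<lambda>n. infsum (\<lambda>w. g (h (n, w))) eis) {..<ell}"
    using infsum_Sigma_banach[OF sum] inf by simp
  also have "\<dots> = (\<Sum>n<ell. wq' (u + of_nat n / lam))"
    by (simp add: gh wq'_def)
  finally show ?thesis by simp
qed

section \<open>Derivatives of \<open>pp\<close> and polynomials in \<open>pp\<close> and
  \<open>pp'\<close>\<close>

definition dpp :: "nat \<Rightarrow> complex \<Rightarrow> complex" where "dpp k = (deriv ^^ k) pp"

lemma dpp_holomorphic: "dpp k holomorphic_on - plat"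
  unfolding dpp_def by (intro holomorphic_higher_deriv pp_holomorphic) auto

lemma dpp_derivative: "z \<notin> plat \<Longrightarrow> (dpp k has_field_derivative dpp (Suc k) z) (at z)"
  using holomorphic_derivI[OF dpp_holomorphic[of k] open_Compl_plat, of z] by (simp add: dpp_def)

lemma dpp_0: "dpp 0 = pp" by (simp add: dpp_def)
lemma dpp_1: "z \<notin> plat \<Longrightarrow> dpp 1 z = pp' z" by (simp add: dpp_def deriv_pp)

lemma prem_holomorphic: "prem holomorphic_on - (plat - {0})"
proof -
  have "z / om' \<notin> eis - {0}" if "z \<in> - (plat - {0})" for z using that by (auto simp: plat_def)
  then show ?thesis
    unfolding holomorphic_on_def field_differentiable_def
    using prem_derivative has_field_derivative_at_within by blast
qed

lemma open_Compl_plat_0 [simp, intro]: "open (- (plat - {0}))"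
proof -
  have "- (plat - {0}) = (\<lambda>z. z / om') -` (- (eis - {0}))" by (auto simp: plat_def)
  also have "open \<dots>" by (intro open_vimage open_Compl_eis_0 continuous_intros) auto
  finally show ?thesis .
qed

lemma dprem_holomorphic: "(deriv ^^ k) prem holomorphic_on - (plat - {0})"
  by (intro holomorphic_higher_deriv prem_holomorphic open_Compl_plat_0)

lemma dprem_0: "(deriv ^^ k) prem 0 = fact k * fps_nth pF k"
  by (simp add: pF_def fps_expansion_def)

lemma eventually_Compl_plat: "z \<notin> plat \<Longrightarrow> eventually (\<lambda>x. x \<notin> plat) (nhds z)"
  using eventually_nhds_in_open[OF open_Compl_plat, of z] by simp

lemma dpp_eq: "z \<notin> plat \<Longrightarrow> dpp k z = (- 1) ^ k * fact (k + 1) / z ^ (k + 2) + (deriv ^^ k) prem z"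
proof (induction k arbitrary: z)
  case 0 then show ?case by (simp add: dpp_0 pp_prem power2_eq_square)
next
  case (Suc k)
  define c where "c = (- 1) ^ k * (fact (k + 1) :: complex)"
  have z: "z \<noteq> 0" using Suc.prems by auto
  have ev: "eventually (\<lambda>x. dpp k x = c / x ^ (k + 2) + (deriv ^^ k) prem x) (nhds z)"
    using eventually_Compl_plat[OF Suc.prems] by eventually_elim (simp add: Suc.IH c_def)
  have "((\<lambda>x. inverse (x ^ (k + 2))) has_field_derivative
       - (inverse (z ^ (k + 2)) * (of_nat (k + 2) * z ^ (k + 1)) * inverse (z ^ (k + 2)))) (at z)"
  proof -
    have "((\<lambda>x. inverse (x ^ N)) has_field_derivative
       - (inverse (z ^ N) * (of_nat N * z ^ (N - 1)) * inverse (z ^ N))) (at z)" for N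
      using z by (auto intro!: derivative_eq_intros)
    from this[of "k + 2"] show ?thesis by simp
  qed
  from DERIV_cmult[OF this, of c]
  have "((\<lambda>x. c / x ^ (k + 2)) has_field_derivative
       c * - (inverse (z ^ (k + 2)) * (of_nat (k + 2) * z ^ (k + 1)) * inverse (z ^ (k + 2)))) (at z)"
    by (simp add: divide_inverse)
  moreover have "c * - (inverse (z ^ (k + 2)) * (of_nat (k + 2) * z ^ (k + 1)) * inverse (z ^ (k + 2)))
      = (- 1) ^ Suc k * fact (Suc k + 1) / z ^ (Suc k + 2)"
    using z by (simp add: c_def field_simps)
  ultimately have d1: "((\<lambda>x. c / x ^ (k + 2)) has_field_derivative (- 1) ^ Suc k * fact (Suc k + 1) / z ^ (Suc k + 2)) (at z)"
    by simp
  have "z \<in> - (plat - {0})" using Suc.prems by auto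
  then have d2: "((deriv ^^ k) prem has_field_derivative (deriv ^^ Suc k) prem z) (at z)"
    using holomorphic_derivI[OF dprem_holomorphic[of k] open_Compl_plat_0, of z] by simp
  have "(dpp k has_field_derivative (- 1) ^ Suc k * fact (Suc k + 1) / z ^ (Suc k + 2) + (deriv ^^ Suc k) prem z) (at z)"
    by (rule DERIV_transfer_ev[OF ev DERIV_add[OF d1 d2]])
  then show ?case using dpp_derivative[OF Suc.prems] DERIV_unique by blast
qed

text \<open>Polynomials in \<open>pp\<close> and \<open>pp'\<close> over \<open>R\<close>. The case
  \<open>R = eis\<close> serves integrality, the case \<open>R = eisQ\<close> rationality.\<close>

inductive_set PQ :: "complex set \<Rightarrow> (complex \<Rightarrow> complex) set" for R where
  PQ_const: "c \<in> R \<Longrightarrow> (\<lambda>_. c) \<in> PQ R"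
| PQ_p: "pp \<in> PQ R"
| PQ_p': "pp' \<in> PQ R"
| PQ_add: "f \<in> PQ R \<Longrightarrow> g \<in> PQ R \<Longrightarrow> (\<lambda>z. f z + g z) \<in> PQ R"
| PQ_mult: "f \<in> PQ R \<Longrightarrow> g \<in> PQ R \<Longrightarrow> (\<lambda>z. f z * g z) \<in> PQ R"

lemma PQ_derivative:
  assumes "f \<in> PQ R" "0 \<in> R" "6 \<in> R"
  shows "\<exists>g\<in>PQ R. \<forall>z. z \<notin> plat \<longrightarrow> (f has_field_derivative g z) (at z)"
  using assms(1)
proof induction
  case (PQ_const c)
  then show ?case using assms PQ.PQ_const[of 0 R] by (intro bexI[of _ "\<lambda>_. 0"]) auto
next
  case PQ_p
  then show ?case using pp_derivative by (intro bexI[of _ pp'] PQ.PQ_p') auto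
next
  case PQ_p'
  have "(\<lambda>z. 6 * (pp z * pp z)) \<in> PQ R" using assms by (intro PQ.intros)
  then show ?case using pp'_derivative by (intro bexI[of _ "\<lambda>z. 6 * (pp z * pp z)"]) (auto simp: power2_eq_square)
next
  case (PQ_add f g)
  then obtain f' g' where "f' \<in> PQ R" "g' \<in> PQ R"
    "\<And>z. z \<notin> plat \<Longrightarrow> (f has_field_derivative f' z) (at z)" "\<And>z. z \<notin> plat \<Longrightarrow> (g has_field_derivative g' z) (at z)" by blast
  then show ?case by (intro bexI[of _ "\<lambda>z. f' z + g' z"] PQ.PQ_add) (auto intro: DERIV_add)
next
  case (PQ_mult f g)
  then obtain f' g' where fg: "f' \<in> PQ R" "g' \<in> PQ R"
    "\<And>z. z \<notin> plat \<Longrightarrow> (f has_field_derivative f' z) (at z)" "\<And>z. z \<notin> plat \<Longrightarrow> (g has_field_derivative g' z) (at z)" by blast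
  have "(\<lambda>z. f' z * g z + g' z * f z) \<in> PQ R" using fg PQ_mult by (intro PQ.intros)
  then show ?case using fg by (intro bexI[of _ "\<lambda>z. f' z * g z + g' z * f z"]) (auto intro: DERIV_mult)
qed

text \<open>The ring \<open>PQ R\<close> is closed under differentiation because
  \<open>pp'' = 6 * pp ^ 2\<close>. With \<open>R = eis\<close>, all derivatives at a point are
  integral as soon as \<open>pp\<close> and \<open>pp'\<close> are.\<close>

lemma dpp_PQ:
  assumes "0 \<in> R" "6 \<in> R" shows "\<exists>f\<in>PQ R. \<forall>z. z \<notin> plat \<longrightarrow> dpp k z = f z"
proof (induction k)
  case 0 then show ?case by (intro bexI[of _ pp] PQ.PQ_p) (auto simp: dpp_0)
next
  case (Suc k)
  then obtain f where f: "f \<in> PQ R" "\<And>z. z \<notin> plat \<Longrightarrow> dpp k z = f z" by blast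
  obtain g where g: "g \<in> PQ R" "\<And>z. z \<notin> plat \<Longrightarrow> (f has_field_derivative g z) (at z)"
    using PQ_derivative[OF f(1) assms] by blast
  have "dpp (Suc k) z = g z" if "z \<notin> plat" for z
  proof -
    have "eventually (\<lambda>x. dpp k x = f x) (nhds z)"
      using eventually_Compl_plat[OF that] by eventually_elim (rule f)
    then have "(dpp k has_field_derivative g z) (at z)" by (rule DERIV_transfer_ev) (rule g(2)[OF that])
    then show ?thesis using dpp_derivative[OF that] DERIV_unique by blast
  qed
  then show ?case using g by blast
qed

text \<open>The span of the constants and the derivatives of \<open>pp\<close>, that is, functions
  whose sum over the division points is given explicitly by \<open>dpp_trace\<close>.\<close>

inductive_set WD :: "(complex \<Rightarrow> complex) set" where
  WD_const: "c \<in> eisQ \<Longrightarrow> (\<lambda>_. c) \<in> WD"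
| WD_dpp: "c \<in> eisQ \<Longrightarrow> (\<lambda>z. c * dpp k z) \<in> WD"
| WD_add: "f \<in> WD \<Longrightarrow> g \<in> WD \<Longrightarrow> (\<lambda>z. f z + g z) \<in> WD"

text \<open>Equality is asked for off the lattice only, where the values of \<open>pp\<close> and
  its derivatives are meaningful.\<close>

definition inW :: "(complex \<Rightarrow> complex) \<Rightarrow> bool" where
  "inW f \<longleftrightarrow> (\<exists>g\<in>WD. \<forall>z. z \<notin> plat \<longrightarrow> f z = g z)"

lemma inW_add: "inW f \<Longrightarrow> inW g \<Longrightarrow> inW (\<lambda>z. f z + g z)"
  unfolding inW_def by (metis (no_types, lifting) WD_add)

lemma inW_cong: "inW f \<Longrightarrow> (\<And>z. z \<notin> plat \<Longrightarrow> g z = f z) \<Longrightarrow> inW g"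
  unfolding inW_def by metis

lemma WD_cmult: "f \<in> WD \<Longrightarrow> c \<in> eisQ \<Longrightarrow> inW (\<lambda>z. c * f z)"
proof (induction rule: WD.induct)
  case (WD_const d)
  then have "(\<lambda>_. c * d) \<in> WD" by (intro WD.intros eisQ_mult)
  then show ?case unfolding inW_def by (intro bexI[of _ "\<lambda>_. c * d"]) auto
next
  case (WD_dpp d k)
  then have "(\<lambda>z. (c * d) * dpp k z) \<in> WD" by (intro WD.intros eisQ_mult)
  then show ?case unfolding inW_def by (auto simp: mult.assoc)
next
  case (WD_add f g)
  then show ?case using inW_add[of "\<lambda>z. c * f z" "\<lambda>z. c * g z"] by (simp add: distrib_left)
qed

lemma inW_cmult:
  assumes "inW f" "c \<in> eisQ" shows "inW (\<lambda>z. c * f z)"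
proof -
  obtain g where "g \<in> WD" "\<And>z. z \<notin> plat \<Longrightarrow> f z = g z" using assms unfolding inW_def by blast
  then show ?thesis using WD_cmult[OF _ assms(2)] inW_cong[of "\<lambda>z. c * g z" "\<lambda>z. c * f z"] by simp
qed

lemma inW_derivative:
  assumes "inW f" "\<And>z. z \<notin> plat \<Longrightarrow> (f has_field_derivative f' z) (at z)" shows "inW f'"
proof -
  have WD: "\<exists>g'. inW g' \<and> (\<forall>z. z \<notin> plat \<longrightarrow> (g has_field_derivative g' z) (at z))" if "g \<in> WD" for g
    using that
  proof induction
    case (WD_const c)
    have "inW (\<lambda>_. 0)" unfolding inW_def by (intro bexI[of _ "\<lambda>_. 0"] WD.intros) auto
    then show ?case by (intro exI[of _ "\<lambda>_. 0"]) auto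
  next
    case (WD_dpp c k)
    then have "inW (\<lambda>z. c * dpp (Suc k) z)" unfolding inW_def by (intro bexI[of _ "\<lambda>z. c * dpp (Suc k) z"] WD.intros) auto
    then show ?case by (intro exI[of _ "\<lambda>z. c * dpp (Suc k) z"]) (auto intro: DERIV_cmult dpp_derivative)
  next
    case (WD_add f g)
    then obtain f' g' where "inW f'" "inW g'"
     "\<And>z. z \<notin> plat \<Longrightarrow> (f has_field_derivative f' z) (at z)" "\<And>z. z \<notin> plat \<Longrightarrow> (g has_field_derivative g' z) (at z)" by blast
    then show ?case by (intro exI[of _ "\<lambda>z. f' z + g' z"]) (auto intro: DERIV_add inW_add)
  qed
  obtain g where g: "g \<in> WD" "\<And>z. z \<notin> plat \<Longrightarrow> f z = g z" using assms unfolding inW_def by blast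
  obtain g' where g': "inW g'" "\<And>z. z \<notin> plat \<Longrightarrow> (g has_field_derivative g' z) (at z)" using WD[OF g(1)] by blast
  show ?thesis
  proof (rule inW_cong[OF g'(1)])
    fix z assume z: "z \<notin> plat"
    have "eventually (\<lambda>x. f x = g x) (nhds z)"
      using eventually_Compl_plat[OF z] by eventually_elim (rule g)
    then have "(f has_field_derivative g' z) (at z)" by (rule DERIV_transfer_ev) (rule g'(2)[OF z])
    then show "f' z = g' z" using assms(2)[OF z] DERIV_unique by blast
  qed
qed

text \<open>Strong induction on the pole order: \<open>(pp ^ (i + 1))' = (i + 1) pp ^ i pp'\<close> and
  \<open>(pp ^ i pp')' = (4 i + 6) pp ^ (i + 2) - 27 i pp ^ (i - 1)\<close>.\<close>
lemma inW_monomials: "inW (\<lambda>z. pp z ^ i)" "inW (\<lambda>z. pp z ^ i * pp' z)"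
proof -
  have "(\<forall>i. n = 2 * i \<longrightarrow> inW (\<lambda>z. pp z ^ i)) \<and> (\<forall>i. n = 2 * i + 3 \<longrightarrow> inW (\<lambda>z. pp z ^ i * pp' z))" for n
  proof (induction n rule: less_induct)
    case (less n)
    have "inW (\<lambda>z. pp z ^ i)" if i: "n = 2 * i" for i
    proof -
      consider "i = 0" | "i = 1" | j where "i = j + 2" by (metis add_2_eq_Suc' less_2_cases not_less_eq One_nat_def not0_implies_Suc)
      then show ?thesis
      proof cases
        case 1
        then show ?thesis unfolding inW_def by (intro bexI[of _ "\<lambda>_. 1"] WD.intros) auto
      next
        case 2
        have "(\<lambda>z. 1 * dpp 0 z) \<in> WD" by (intro WD.intros) auto
        then show ?thesis unfolding inW_def 2 by (auto simp: dpp_0)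
      next
        case (3 j)
        have w1: "inW (\<lambda>z. pp z ^ j * pp' z)" using less[of "2 * j + 3"] 3 i by auto
        have w2: "inW (\<lambda>z. of_nat j * pp z ^ (j - 1))"
        proof (cases j)
          case 0
          then show ?thesis unfolding inW_def by (intro bexI[of _ "\<lambda>_. 0"] WD.intros) auto
        next
          case (Suc k)
          have "inW (\<lambda>z. pp z ^ k)" using less[of "2 * k"] 3 i Suc by auto
          then show ?thesis using inW_cmult[of _ "of_nat j"] Suc by auto
        qed
        have w3: "inW (\<lambda>z. (4 * of_nat j + 6) * pp z ^ (j + 2) - 27 * (of_nat j * pp z ^ (j - 1)))"
        proof (rule inW_derivative[OF w1])
          fix z assume z: "z \<notin> plat"
          have "((\<lambda>z. pp z ^ j * pp' z) has_field_derivative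
              (of_nat j * pp z ^ (j - 1) * pp' z) * pp' z + 6 * pp z ^ 2 * pp z ^ j) (at z)"
            by (rule derivative_eq_intros pp_derivative[OF z] pp'_derivative[OF z] refl | simp)+
          moreover have "(of_nat j * pp z ^ (j - 1) * pp' z) * pp' z + 6 * pp z ^ 2 * pp z ^ j
             = of_nat j * pp z ^ (j - 1) * (pp' z ^ 2) + 6 * pp z ^ (j + 2)"
            by (simp add: power2_eq_square power_add)
          moreover have "\<dots> = (4 * of_nat j + 6) * pp z ^ (j + 2) - 27 * (of_nat j * pp z ^ (j - 1))"
            unfolding pp'_square[OF z] by (cases j) (simp_all add: algebra_simps eval_nat_numeral)
          ultimately show "((\<lambda>z. pp z ^ j * pp' z) has_field_derivative
              (4 * of_nat j + 6) * pp z ^ (j + 2) - 27 * (of_nat j * pp z ^ (j - 1))) (at z)" by simp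
        qed
        have c: "(4 * of_nat j + 6 :: complex) \<noteq> 0"
          by (metis of_nat_eq_0_iff of_nat_add of_nat_mult of_nat_numeral add_is_0 zero_neq_numeral)
        have "inW (\<lambda>z. (1 / (4 * of_nat j + 6)) * (((4 * of_nat j + 6) * pp z ^ (j + 2) - 27 * (of_nat j * pp z ^ (j - 1)))
             + 27 * (of_nat j * pp z ^ (j - 1))))"
          by (intro inW_cmult inW_add w3 w2 eisQ_divide eisQ_eis eis_add eis_mult eis_of_nat eis_numeral eis_1)
        then show ?thesis using c 3 by simp
      qed
    qed
    moreover have "inW (\<lambda>z. pp z ^ i * pp' z)" if i: "n = 2 * i + 3" for i
    proof -
      have "2 * (i + 1) < n" using i by simp
      from less[OF this] have w: "inW (\<lambda>z. pp z ^ (i + 1))" by blast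
      have "inW (\<lambda>z. of_nat (i + 1) * pp z ^ i * pp' z)"
        by (rule inW_derivative[OF w]) (use DERIV_power[OF pp_derivative, of _ "i + 1"] in \<open>simp add: mult_ac\<close>)
      then have "inW (\<lambda>z. (1 / of_nat (i + 1)) * (of_nat (i + 1) * pp z ^ i * pp' z))"
        by (rule inW_cmult) (auto intro!: eisQ_divide)
      moreover have "(1 / of_nat (i + 1)) * (of_nat (i + 1) * pp z ^ i * pp' z) = pp z ^ i * pp' z" for z
        by (simp del: of_nat_add of_nat_Suc)
      ultimately show ?thesis by (simp only:)
    qed
    ultimately show ?case by blast
  qed
  then show "inW (\<lambda>z. pp z ^ i)" "inW (\<lambda>z. pp z ^ i * pp' z)" by blast+
qed

text \<open>The statement to be shown by induction over \<open>PQ\<close>: it quantifies over the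
  monomials in front of \<open>h\<close>, so that it survives multiplication by \<open>pp\<close>
  and \<open>pp'\<close>.\<close>

definition multW :: "(complex \<Rightarrow> complex) \<Rightarrow> bool" where
  "multW h \<longleftrightarrow> (\<forall>i. inW (\<lambda>z. pp z ^ i * h z) \<and> inW (\<lambda>z. pp z ^ i * pp' z * h z))"

lemma PQ_multW: "f \<in> PQ eisQ \<Longrightarrow> multW h \<Longrightarrow> multW (\<lambda>z. f z * h z)"
proof (induction arbitrary: h rule: PQ.induct)
  case (PQ_const c)
  have "inW (\<lambda>z. c * (pp z ^ i * h z))" "inW (\<lambda>z. c * (pp z ^ i * pp' z * h z))" for i
    using PQ_const by (auto simp: multW_def intro!: inW_cmult)
  then show ?case by (simp add: multW_def mult_ac)
next
  case PQ_p
  have "inW (\<lambda>z. pp z ^ Suc i * h z)" "inW (\<lambda>z. pp z ^ Suc i * pp' z * h z)" for i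
    using PQ_p unfolding multW_def by blast+
  then show ?case by (simp add: multW_def mult_ac)
next
  case PQ_p'
  show ?case unfolding multW_def
  proof (intro allI conjI)
    fix i
    show "inW (\<lambda>z. pp z ^ i * (pp' z * h z))" using PQ_p' unfolding multW_def by (simp add: mult.assoc)
    have "inW (\<lambda>z. 4 * (pp z ^ (i + 3) * h z) + (- 27) * (pp z ^ i * h z))"
      using PQ_p' unfolding multW_def by (intro inW_add inW_cmult) auto
    then show "inW (\<lambda>z. pp z ^ i * pp' z * (pp' z * h z))"
    proof (rule inW_cong)
      fix z assume z: "z \<notin> plat"
      have "pp z ^ i * pp' z * (pp' z * h z) = pp z ^ i * pp' z ^ 2 * h z" by (simp add: power2_eq_square)
      then show "pp z ^ i * pp' z * (pp' z * h z) = 4 * (pp z ^ (i + 3) * h z) + (- 27) * (pp z ^ i * h z)"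
        unfolding pp'_square[OF z] by (simp add: power_add algebra_simps)
    qed
  qed
next
  case (PQ_add f g)
  have "multW (\<lambda>z. f z * h z)" "multW (\<lambda>z. g z * h z)" using PQ_add by auto
  then show ?case unfolding multW_def distrib_right distrib_left using inW_add by blast
next
  case (PQ_mult f g)
  then show ?case by (simp add: mult.assoc)
qed

lemma PQ_inW: assumes "f \<in> PQ eisQ" shows "inW f"
proof -
  have "multW (\<lambda>_. 1)" using inW_monomials by (simp add: multW_def)
  then have "multW (\<lambda>z. f z * 1)" by (rule PQ_multW[OF assms])
  then have "inW (\<lambda>z. pp z ^ 0 * (f z * 1))" unfolding multW_def by blast
  then show ?thesis by simp
qed

section \<open>Sums over the division points\<close>

context eis_prime
begin

definition tp :: "complex \<Rightarrow> complex" where "tp x = om' * x / lam"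

lemma tp_plat_iff:
  assumes "x \<in> eis" shows "tp x \<in> plat \<longleftrightarrow> eis_dvd lam x"
proof -
  have "tp x \<in> plat \<longleftrightarrow> x / lam \<in> eis" by (simp add: tp_def plat_def)
  also have "\<dots> \<longleftrightarrow> eis_dvd lam x"
  proof
    assume "x / lam \<in> eis"
    then show "eis_dvd lam x" using lam_nonzero by (intro eis_dvdI[of "x / lam"]) auto
  qed (use lam_nonzero in \<open>auto elim!: eis_dvdE\<close>)
  finally show ?thesis .
qed

lemma tp_U: "x \<in> U \<Longrightarrow> tp x \<notin> plat" by (auto simp: tp_plat_iff eis_coprime_eq)

lemma tp_diff_plat: "eis_cong lam x y \<Longrightarrow> tp x - tp y \<in> plat"
proof (unfold eis_cong_def, erule eis_dvdE)
  fix z assume "z \<in> eis" "x - y = lam * z"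
  then show "tp x - tp y \<in> plat" using lam_nonzero
    by (simp add: tp_def plat_def flip: diff_divide_distrib right_diff_distrib)
qed

lemma resp_tp:
  assumes "\<And>z w. w \<in> plat \<Longrightarrow> z \<notin> plat \<Longrightarrow> f (z + w) = f z" shows "resp (\<lambda>x. f (tp x))"
  unfolding resp_def
proof (intro ballI impI)
  fix x y assume xy: "x \<in> U" "y \<in> U" "eis_cong lam x y"
  then have "f (tp y + (tp x - tp y)) = f (tp y)" by (intro assms tp_diff_plat tp_U)
  then show "f (tp x) = f (tp y)" by simp
qed

lemma resp_pp: "resp (\<lambda>x. pp (tp x))" by (rule resp_tp) (rule pp_shift)

text \<open>Differentiating the formula for \<open>wq'\<close> brings out one factor
  \<open>lam\<close> each time.\<close>

lemma dpp_multiplication: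
  assumes "k \<ge> 1" "lam * u \<notin> plat"
  shows "(\<Sum>n<ell. dpp k (u + tp (of_nat n))) = lam ^ (k + 2) * dpp k (lam * u)"
  using assms
proof (induction k arbitrary: u rule: nat_induct_at_least)
  case base
  have nu: "u + tp (of_nat n) \<notin> plat" for n
  proof
    assume "u + tp (of_nat n) \<in> plat"
    then have "lam * ((u + tp (of_nat n)) / om') - of_nat n \<in> eis"
      unfolding plat_def by (intro eis_diff eis_mult lam_eis eis_of_nat) simp
    moreover have "lam * ((u + tp (of_nat n)) / om') - of_nat n = lam * u / om'"
      using lam_nonzero by (simp add: tp_def field_simps)
    ultimately show False using base by (simp add: plat_def)
  qed
  have 1: "(u + tp (of_nat n)) / om' = u / om' + of_nat n / lam" for n by (simp add: tp_def field_simps)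
  have "(\<Sum>n<ell. dpp 1 (u + tp (of_nat n))) = (\<Sum>n<ell. wq' (u / om' + of_nat n / lam)) / om' ^ 3"
    unfolding sum_divide_distrib by (intro sum.cong refl) (simp add: dpp_1[OF nu, simplified] pp'_def 1)
  also have "\<dots> = lam ^ 3 * wq' (lam * (u / om')) / om' ^ 3"
    using base by (subst wq'_multiplication[OF eis_prime_axioms]) (auto simp: plat_def)
  also have "\<dots> = lam ^ (1 + 2) * dpp 1 (lam * u)"
    using base by (simp add: dpp_1[simplified] pp'_def power3_eq_cube)
  finally show ?case .
next
  case (Suc k)
  have nu: "u + tp (of_nat n) \<notin> plat" for n
  proof
    assume "u + tp (of_nat n) \<in> plat"
    then have "lam * ((u + tp (of_nat n)) / om') - of_nat n \<in> eis"
      unfolding plat_def by (intro eis_diff eis_mult lam_eis eis_of_nat) simp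
    moreover have "lam * ((u + tp (of_nat n)) / om') - of_nat n = lam * u / om'"
      using lam_nonzero by (simp add: tp_def field_simps)
    ultimately show False using Suc.prems by (simp add: plat_def)
  qed
  have "open ((\<lambda>x. lam * x) -` (- plat))" by (intro open_vimage open_Compl_plat continuous_intros)
  then have "eventually (\<lambda>x. x \<in> (\<lambda>x. lam * x) -` (- plat)) (nhds u)"
    using Suc.prems by (intro eventually_nhds_in_open) auto
  then have ev: "eventually (\<lambda>x. (\<Sum>n<ell. dpp k (x + tp (of_nat n))) = lam ^ (k + 2) * dpp k (lam * x)) (nhds u)"
    by eventually_elim (use Suc.IH in auto)
  have d1: "((\<lambda>x. dpp k (x + tp (of_nat n))) has_field_derivative dpp (Suc k) (u + tp (of_nat n))) (at u)" for n
    using dpp_derivative[OF nu[of n], of k] by (simp add: DERIV_shift)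
  have "((\<lambda>x. \<Sum>n<ell. dpp k (x + tp (of_nat n))) has_field_derivative (\<Sum>n<ell. dpp (Suc k) (u + tp (of_nat n)))) (at u)"
    by (rule DERIV_sum) (rule d1)
  moreover have "((\<lambda>x. dpp k (lam * x)) has_field_derivative dpp (Suc k) (lam * u) * lam) (at u)"
    using DERIV_chain2[where f = "dpp k" and g = "\<lambda>x. lam * x", OF dpp_derivative[OF Suc.prems] DERIV_cmult_Id] .
  from DERIV_cmult[OF this, of "lam ^ (k + 2)"]
  have "((\<lambda>x. \<Sum>n<ell. dpp k (x + tp (of_nat n))) has_field_derivative lam ^ (k + 2) * (dpp (Suc k) (lam * u) * lam)) (at u)"
    by (rule DERIV_transfer_ev[OF ev])
  ultimately have "(\<Sum>n<ell. dpp (Suc k) (u + tp (of_nat n))) = lam ^ (k + 2) * (dpp (Suc k) (lam * u) * lam)"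
    by (rule DERIV_unique)
  then show ?case by (simp add: mult_ac)
qed

lemma sum_lessThan_split: "(\<Sum>n<ell. f n) = f 0 + (\<Sum>n\<in>{1..<ell}. f n)" for f :: "nat \<Rightarrow> complex"
proof -
  have "{..<ell} = insert 0 {1..<ell}" using ell_pos by auto
  then show ?thesis by simp
qed

text \<open>The limit of the multiplication formula for \<open>u\<close> to 0: the principal parts
  of the summand with \<open>n = 0\<close> and of the right-hand side cancel, which leaves Taylor
  coefficients of \<open>prem\<close>. That formula starts at \<open>k = 1\<close>; for
  \<open>k = 0\<close> rotation by \<open>rho\<close> shows that the sum vanishes, as does the
  coefficient.\<close>

lemma dpp_trace: "(\<Sum>n\<in>{1..<ell}. dpp k (tp (of_nat n))) = (lam ^ (k + 2) - 1) * (fact k * fps_nth pF k)"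
proof (cases "k = 0")
  case True
  define S where "S = (\<Sum>n\<in>{1..<ell}. pp (tp (of_nat n)))"
  have "S = (\<Sum>n\<in>{1..<ell}. pp (tp (rho * of_nat n)))"
    unfolding S_def using sum_mult_reindex[OF rho_U resp_pp] by simp
  also have "\<dots> = rho * S"
  proof -
    have "tp (rho * of_nat n) = rho * tp (of_nat n)" for n by (simp add: tp_def)
    then show ?thesis by (simp add: pp_rho S_def sum_distrib_left)
  qed
  finally have "S = 0" using rho_neq_1 by simp
  then show ?thesis using True pF_low[of 0] by (simp add: S_def dpp_0)
next
  case False
  define L where "L = (\<lambda>u. \<Sum>n\<in>{1..<ell}. dpp k (u + tp (of_nat n)))"
  define R where "R = (\<lambda>u. lam ^ (k + 2) * (deriv ^^ k) prem (lam * u) - (deriv ^^ k) prem u)"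
  have tl: "filterlim (\<lambda>u. lam * u) (nhds 0) (nhds 0)" by (auto intro!: tendsto_eq_intros filterlim_ident)
  have "eventually (\<lambda>u. u \<noteq> 0 \<and> (u \<in> plat \<longrightarrow> u = 0) \<and> (lam * u \<in> plat \<longrightarrow> lam * u = 0)) (at 0)"
    using eventually_plat eventually_compose_filterlim[OF eventually_plat tl]
    unfolding eventually_at_filter by eventually_elim auto
  then have ev: "eventually (\<lambda>u. L u = R u) (at 0)"
  proof eventually_elim
    case (elim u)
    then have u: "u \<noteq> 0" "u \<notin> plat" "lam * u \<notin> plat" using lam_nonzero by auto
    define c where "c = (- 1) ^ k * (fact (k + 1) :: complex)"
    have "dpp k u + L u = lam ^ (k + 2) * dpp k (lam * u)"
      using dpp_multiplication[of k u] False u unfolding sum_lessThan_split L_def by (simp add: tp_def)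
    also have "dpp k (lam * u) = c / (lam * u) ^ (k + 2) + (deriv ^^ k) prem (lam * u)"
      unfolding c_def by (rule dpp_eq[OF u(3)])
    also have "lam ^ (k + 2) * (c / (lam * u) ^ (k + 2) + (deriv ^^ k) prem (lam * u))
       = c / u ^ (k + 2) + lam ^ (k + 2) * (deriv ^^ k) prem (lam * u)"
    proof -
      have "lam ^ (k + 2) * (c / (lam * u) ^ (k + 2)) = c / u ^ (k + 2)"
        using lam_nonzero by (simp only: power_mult_distrib) simp
      then show ?thesis by (simp only: distrib_left)
    qed
    also have "c / u ^ (k + 2) = dpp k u - (deriv ^^ k) prem u"
      using dpp_eq[OF u(2), of k] by (simp add: c_def)
    finally show ?case by (simp add: R_def algebra_simps)
  qed
  have "isCont (\<lambda>x. dpp k (x + tp (of_nat n))) 0" if "n \<in> {1..<ell}" for n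
  proof -
    from that have "0 + tp (of_nat n) \<notin> plat" using tp_U nat_U' by simp
    then have "((\<lambda>x. dpp k (x + tp (of_nat n))) has_field_derivative dpp (Suc k) (0 + tp (of_nat n))) (at 0)"
      using dpp_derivative[of "0 + tp (of_nat n)" k] unfolding DERIV_shift by simp
    then show "isCont (\<lambda>x. dpp k (x + tp (of_nat n))) 0" by (rule DERIV_isCont)
  qed
  then have "isCont L 0" unfolding L_def by (intro continuous_sum)
  then have l1: "(L \<longlongrightarrow> L 0) (at 0)" by (simp add: isCont_def)
  have "0 \<in> - (plat - {0})" by simp
  then have cp: "isCont ((deriv ^^ k) prem) 0"
    using holomorphic_on_imp_continuous_on[OF dprem_holomorphic[of k]]
      continuous_on_eq_continuous_at[OF open_Compl_plat_0] by blast
  have "isCont (\<lambda>u. (deriv ^^ k) prem (lam * u)) 0"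
    by (rule isCont_o2[where g = "(deriv ^^ k) prem" and f = "\<lambda>u. lam * u"]) (simp_all add: cp)
  then have "isCont R 0" unfolding R_def
    by (rule continuous_diff[OF continuous_mult[OF continuous_const] cp])
  then have "(R \<longlongrightarrow> R 0) (at 0)" by (simp add: isCont_def)
  then have "(L \<longlongrightarrow> R 0) (at 0)" using tendsto_cong[OF ev] by blast
  then have "L 0 = R 0" using l1 tendsto_unique[of "at (0::complex)"] by (metis at_neq_bot)
  then show ?thesis by (simp add: L_def R_def dprem_0 left_diff_distrib)
qed

end

lemma pF_eisQ: "fps_nth pF n \<in> eisQ"
proof (induction n rule: less_induct)
  case (less n)
  consider "n < 4" | "n = 4" | "n > 4" by linarith
  then show ?case
  proof cases
    case 1 then show ?thesis by (simp add: pF_low)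
  next
    case 2
    have "(27 / 28 :: complex) \<in> eisQ" by (intro eisQ_divide eisQ_eis) auto
    then show ?thesis unfolding 2 pF_4 .
  next
    case 3
    define m where "m = n - 2"
    have m: "n = m + 2" "m > 2" using 3 by (simp_all add: m_def)
    have "fps_nth (fps_X ^ 2 * fps_deriv (fps_deriv pF)) n = fps_nth (fps_const 12 * pF + fps_const 6 * (fps_X ^ 2 * pF ^ 2)) n"
      by (simp only: pF_ode)
    then have "of_nat (m + 1) * of_nat (m + 2) * fps_nth pF n = 12 * fps_nth pF n + 6 * fps_nth (pF ^ 2) m"
      by (simp add: m fps_X_power_mult_nth fps_X_power_mult_right_nth mult_ac del: of_nat_Suc)
    then have eq: "(of_nat (m + 1) * of_nat (m + 2) - 12) * fps_nth pF n = 6 * fps_nth (pF ^ 2) m"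
      by (simp add: left_diff_distrib)
    have ne: "(of_nat (m + 1) * of_nat (m + 2) - 12 :: complex) \<noteq> 0"
    proof
      assume "of_nat (m + 1) * of_nat (m + 2) - 12 = (0 :: complex)"
      then have "of_nat ((m + 1) * (m + 2)) = (of_nat 12 :: complex)"
        by (simp only: of_nat_mult right_minus_eq) simp
      then have "(m + 1) * (m + 2) = 12" by (simp only: of_nat_eq_iff)
      moreover have "4 * 5 \<le> (m + 1) * (m + 2)" using m by (intro mult_le_mono) auto
      ultimately show False by simp
    qed
    have "fps_nth (pF ^ 2) m = (\<Sum>i=0..m. fps_nth pF i * fps_nth pF (m - i))"
      by (simp add: power2_eq_square fps_mult_nth)
    also have "\<dots> \<in> eisQ" using m by (intro eisQ_sum eisQ_mult less.IH) auto
    finally have "fps_nth (pF ^ 2) m \<in> eisQ" .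
    from eisQ_mult[OF eisQ_eis[OF eis_numeral] this]
    have "6 * fps_nth (pF ^ 2) m / (of_nat (m + 1) * of_nat (m + 2) - 12) \<in> eisQ"
      by (intro eisQ_divide eisQ_eis[OF eis_diff] eis_mult eis_of_nat eis_numeral)
    moreover have "fps_nth pF n = 6 * fps_nth (pF ^ 2) m / (of_nat (m + 1) * of_nat (m + 2) - 12)"
      using eq ne by (simp add: field_simps)
    ultimately show ?thesis by simp
  qed
qed

context eis_prime
begin

text \<open>Plays the part of Galois descent: after reduction to \<open>WD\<close> the sum over the
  division points is explicit, with Taylor coefficients from \<open>eisQ\<close>.\<close>

lemma PQ_trace:
  assumes "f \<in> PQ eisQ" shows "(\<Sum>n\<in>{1..<ell}. f (tp (of_nat n))) \<in> eisQ"
proof -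
  have WD: "(\<Sum>n\<in>{1..<ell}. g (tp (of_nat n))) \<in> eisQ" if "g \<in> WD" for g
    using that
  proof induction
    case (WD_const c) then show ?case by (intro eisQ_sum)
  next
    case (WD_dpp c k)
    have "(\<Sum>n\<in>{1..<ell}. c * dpp k (tp (of_nat n))) = c * ((lam ^ (k + 2) - 1) * (fact k * fps_nth pF k))"
      using dpp_trace[of k] by (simp flip: sum_distrib_left)
    also have "fact k = (of_nat (fact k) :: complex)" by simp
    finally show ?case using WD_dpp lam_eis
      by (auto intro!: eisQ_mult pF_eisQ eisQ_diff eisQ_power simp del: of_nat_fact power_Suc)
  next
    case (WD_add f g) then show ?case by (auto simp: sum.distrib)
  qed
  obtain g where g: "g \<in> WD" "\<And>z. z \<notin> plat \<Longrightarrow> f z = g z"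
    using PQ_inW[OF assms] unfolding inW_def by blast
  have "(\<Sum>n\<in>{1..<ell}. f (tp (of_nat n))) = (\<Sum>n\<in>{1..<ell}. g (tp (of_nat n)))"
    by (intro sum.cong refl g tp_U nat_U')
  then show ?thesis using WD[OF g(1)] by simp
qed

end

text \<open>Newton's identity: the power sums of the roots determine the coefficients of the polynomial.\<close>
lemma prod_coeffs_eisQ:
  fixes a :: "'s \<Rightarrow> complex"
  assumes fin: "finite S" and tr: "\<And>k. (\<Sum>s\<in>S. a s ^ Suc k) \<in> eisQ"
  shows "Polynomial.coeff (\<Prod>s\<in>S. [:1, - a s:]) n \<in> eisQ"
proof -
  define E where "E = (\<Prod>s\<in>S. [:1, - a s:])"
  define F where "F = (\<lambda>s. \<Prod>t\<in>S - {s}. [:1, - a t:])"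
  have E: "E = [:1, - a s:] * F s" if "s \<in> S" for s
    unfolding E_def F_def by (rule prod.remove[OF fin that])
  \<comment> \<open>\<open>F s\<close> is \<open>E\<close> divided by the linear factor
    \<open>1 - a s * X\<close>, that is, multiplied by its geometric series.\<close>
  have F: "Polynomial.coeff (F s) n = (\<Sum>k\<le>n. Polynomial.coeff E (n - k) * a s ^ k)" if s: "s \<in> S" for s n
  proof (induction n)
    case 0 then show ?case using E[OF s] by (simp add: mult.commute)
  next
    case (Suc n)
    have "Polynomial.coeff E (Suc n) = Polynomial.coeff (F s) (Suc n) - a s * Polynomial.coeff (F s) n"
      unfolding E[OF s] by simp
    then have "Polynomial.coeff (F s) (Suc n) = Polynomial.coeff E (Suc n) + a s * (\<Sum>k\<le>n. Polynomial.coeff E (n - k) * a s ^ k)"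
      using Suc by simp
    also have "\<dots> = (\<Sum>k\<le>Suc n. Polynomial.coeff E (Suc n - k) * a s ^ k)"
      unfolding sum.atMost_Suc_shift sum_distrib_left by (simp add: mult_ac)
    finally show ?case .
  qed
  have newton: "of_nat (Suc n) * Polynomial.coeff E (Suc n) = - (\<Sum>k\<le>n. Polynomial.coeff E (n - k) * (\<Sum>s\<in>S. a s ^ Suc k))" for n
  proof -
    have "pderiv E = (\<Sum>s\<in>S. F s * pderiv [:1, - a s:])"
      unfolding E_def F_def by (simp add: pderiv_prod)
    then have "Polynomial.coeff (pderiv E) n = (\<Sum>s\<in>S. - a s * Polynomial.coeff (F s) n)"
      by (simp add: coeff_sum pderiv_pCons mult.commute)
    also have "\<dots> = (\<Sum>s\<in>S. \<Sum>k\<le>n. - (Polynomial.coeff E (n - k) * a s ^ Suc k))"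
      by (intro sum.cong refl) (simp add: F sum_distrib_left sum_negf mult_ac)
    also have "\<dots> = - (\<Sum>k\<le>n. Polynomial.coeff E (n - k) * (\<Sum>s\<in>S. a s ^ Suc k))"
      by (subst sum.swap) (simp add: sum_negf sum_distrib_left)
    finally show ?thesis by (simp add: coeff_pderiv)
  qed
  have "Polynomial.coeff E n \<in> eisQ"
  proof (induction n rule: less_induct)
    case (less n)
    show ?case
    proof (cases n)
      case 0
      have "Polynomial.coeff E 0 = (\<Prod>s\<in>S. 1)" unfolding E_def by (simp add: poly_0_coeff_0[symmetric] poly_prod)
      then show ?thesis using 0 by simp
    next
      case (Suc m)
      have "Polynomial.coeff E n = - (\<Sum>k\<le>m. Polynomial.coeff E (m - k) * (\<Sum>s\<in>S. a s ^ Suc k)) / of_nat (Suc m)"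
        using newton[of m] Suc by (simp add: field_simps del: of_nat_Suc)
      also have "\<dots> \<in> eisQ"
        using Suc by (intro eisQ_divide eisQ_uminus eisQ_sum eisQ_mult less.IH tr eisQ_eis eis_of_nat) auto
      finally show ?thesis .
    qed
  qed
  then show ?thesis by (simp add: E_def)
qed

text \<open>Each \<open>1 / a s\<close> is a root of \<open>E\<close>. Multiplied by
  \<open>a s ^ m\<close> this is an equation of degree \<open>m\<close> for \<open>a s\<close> whose
  constant term, the leading coefficient of \<open>E\<close>, is nonzero; solving for that term
  writes the inverse as a polynomial in \<open>a s\<close>. By Newton's identities its coefficients
  are in \<open>eisQ\<close>, so the algebra contains the inverse.\<close>

lemma inverse_in_algebra:
  fixes B :: "('s \<Rightarrow> complex) set"
  assumes fin: "finite S" and const: "\<And>c. c \<in> eisQ \<Longrightarrow> (\<lambda>_. c) \<in> B"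
    and add: "\<And>f g. f \<in> B \<Longrightarrow> g \<in> B \<Longrightarrow> (\<lambda>s. f s + g s) \<in> B"
    and mult: "\<And>f g. f \<in> B \<Longrightarrow> g \<in> B \<Longrightarrow> (\<lambda>s. f s * g s) \<in> B"
    and tr: "\<And>f. f \<in> B \<Longrightarrow> (\<Sum>s\<in>S. f s) \<in> eisQ"
    and a: "a \<in> B" and nz: "\<And>s. s \<in> S \<Longrightarrow> a s \<noteq> 0"
  shows "\<exists>h\<in>B. \<forall>s\<in>S. h s = inverse (a s)"
proof -
  have pow: "(\<lambda>s. a s ^ k) \<in> B" for k
    by (induction k) (use const[of 1] mult a in auto)
  define E where "E = (\<Prod>s\<in>S. [:1, - a s:])"
  define m where "m = card S"
  have E: "Polynomial.coeff E n \<in> eisQ" for n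
    unfolding E_def by (rule prod_coeffs_eisQ[OF fin]) (rule tr[OF pow])
  have deg: "degree E = m"
    unfolding E_def m_def using nz by (subst degree_prod_eq_sum_degree) auto
  have E0: "E \<noteq> 0" unfolding E_def using fin by (simp add: prod_zero_iff)
  then have lead: "Polynomial.coeff E m \<noteq> 0" using deg by auto
  define h where "h = (\<lambda>s. (- 1 / Polynomial.coeff E m) * (\<Sum>n<m. Polynomial.coeff E n * a s ^ (m - 1 - n)))"
  have sum_B: "(\<lambda>s. \<Sum>n<N. Polynomial.coeff E n * a s ^ (m - 1 - n)) \<in> B" for N
    by (induction N) (use const[of 0] const[OF E] add mult pow in auto)
  have "h \<in> B" unfolding h_def
    by (intro mult sum_B const) (use E in \<open>auto intro!: eisQ_divide\<close>)
  moreover have "h s = inverse (a s)" if s: "s \<in> S" for s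
  proof -
    have "poly E (1 / a s) = 0"
      unfolding E_def poly_prod using fin s nz[OF s] by (intro prod_zero) (auto intro!: bexI[of _ s])
    then have "(\<Sum>n\<le>m. Polynomial.coeff E n * (1 / a s) ^ n) * a s ^ m = 0"
      by (simp add: poly_altdef deg)
    then have "(\<Sum>n\<le>m. Polynomial.coeff E n * a s ^ (m - n)) = 0"
      unfolding sum_distrib_right using nz[OF s] by (simp add: power_diff power_one_over)
    then have eq: "(\<Sum>n<m. Polynomial.coeff E n * a s ^ (m - n)) = - Polynomial.coeff E m"
      by (simp add: lessThan_Suc_atMost[symmetric] add_eq_0_iff)
    have "(\<Sum>n<m. Polynomial.coeff E n * a s ^ (m - n)) = a s * (\<Sum>n<m. Polynomial.coeff E n * a s ^ (m - 1 - n))"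
      unfolding sum_distrib_left
    proof (intro sum.cong refl)
      fix n assume "n \<in> {..<m}"
      then have "m - n = Suc (m - 1 - n)" by auto
      then show "Polynomial.coeff E n * a s ^ (m - n) = a s * (Polynomial.coeff E n * a s ^ (m - 1 - n))" by simp
    qed
    then have "a s * (\<Sum>n<m. Polynomial.coeff E n * a s ^ (m - 1 - n)) = - Polynomial.coeff E m"
      using eq by simp
    moreover have "a s * h s = (- 1 / Polynomial.coeff E m) * (a s * (\<Sum>n<m. Polynomial.coeff E n * a s ^ (m - 1 - n)))"
      by (simp add: h_def)
    ultimately have "a s * h s = 1" using lead by simp
    then show ?thesis by (metis inverse_unique)
  qed
  ultimately show ?thesis by blast
qed

section \<open>A valuation ring above lam and the Hasse invariant\<close>

definition cring_set :: "complex set \<Rightarrow> bool" where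
  "cring_set V \<longleftrightarrow> 1 \<in> V \<and> (\<forall>x\<in>V. \<forall>y\<in>V. x - y \<in> V \<and> x * y \<in> V)"

lemma cring_setD:
  assumes "cring_set V"
  shows "1 \<in> V" "0 \<in> V" "x \<in> V \<Longrightarrow> - x \<in> V" "x \<in> V \<Longrightarrow> y \<in> V \<Longrightarrow> x - y \<in> V"
    "x \<in> V \<Longrightarrow> y \<in> V \<Longrightarrow> x + y \<in> V" "x \<in> V \<Longrightarrow> y \<in> V \<Longrightarrow> x * y \<in> V"
proof -
  show 1: "1 \<in> V" and d: "x \<in> V \<Longrightarrow> y \<in> V \<Longrightarrow> x - y \<in> V"
    and "x \<in> V \<Longrightarrow> y \<in> V \<Longrightarrow> x * y \<in> V" for x y
    using assms by (auto simp: cring_set_def)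
  show 0: "0 \<in> V" using d[OF 1 1] by simp
  show m: "- x \<in> V" if "x \<in> V" for x using d[OF 0 that] by simp
  show "x + y \<in> V" if "x \<in> V" "y \<in> V" for x y using d[OF that(1) m[OF that(2)]] by simp
qed

lemma cring_set_sum: "cring_set V \<Longrightarrow> (\<And>i. i \<in> A \<Longrightarrow> f i \<in> V) \<Longrightarrow> sum f A \<in> V"
  by (induction A rule: infinite_finite_induct) (auto simp: cring_setD)

lemma cring_set_power: "cring_set V \<Longrightarrow> x \<in> V \<Longrightarrow> x ^ n \<in> V"
  by (induction n) (auto simp: cring_setD)

definition adjoin :: "complex set \<Rightarrow> complex \<Rightarrow> complex set" where
  "adjoin V x = {poly p x |p. \<forall>n. Polynomial.coeff p n \<in> V}"

lemma cring_set_adjoin: assumes "cring_set V" shows "cring_set (adjoin V x)"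
  unfolding cring_set_def
proof (intro conjI ballI)
  have "poly 1 x \<in> adjoin V x" unfolding adjoin_def
    using assms by (intro CollectI exI[of _ 1]) (auto simp: cring_setD coeff_1)
  then show "1 \<in> adjoin V x" by simp
  fix a b assume "a \<in> adjoin V x" "b \<in> adjoin V x"
  then obtain p q where p: "a = poly p x" "\<And>n. Polynomial.coeff p n \<in> V"
    and q: "b = poly q x" "\<And>n. Polynomial.coeff q n \<in> V" unfolding adjoin_def by blast
  have "poly (p - q) x \<in> adjoin V x" unfolding adjoin_def
    using p q assms by (intro CollectI exI[of _ "p - q"]) (auto simp: cring_setD)
  then show "a - b \<in> adjoin V x" by (simp add: p q)
  have "poly (p * q) x \<in> adjoin V x" unfolding adjoin_def
    using p q assms by (intro CollectI exI[of _ "p * q"]) (auto simp: coeff_mult cring_setD intro!: cring_set_sum)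
  then show "a * b \<in> adjoin V x" by (simp add: p q)
qed

lemma adjoin_superset:
  assumes "cring_set V" shows "V \<subseteq> adjoin V x" "x \<in> adjoin V x"
proof
  fix c assume "c \<in> V"
  then have "poly [:c:] x \<in> adjoin V x" unfolding adjoin_def
    using assms by (intro CollectI exI[of _ "[:c:]"]) (auto simp: coeff_pCons cring_setD split: nat.split)
  then show "c \<in> adjoin V x" by simp
next
  have "poly [:0, 1:] x \<in> adjoin V x" unfolding adjoin_def
    using assms by (intro CollectI exI[of _ "[:0, 1:]"]) (auto simp: coeff_pCons cring_setD split: nat.split)
  then show "x \<in> adjoin V x" by simp
qed

text \<open>A subring maximal among those in which \<open>p\<close> is not invertible is a valuation ring
  (Chevalley's extension theorem for the field of complex numbers).\<close>
theorem valuation_ring_exists: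
  assumes R: "cring_set R" "p \<in> R" "\<And>x. x \<in> R \<Longrightarrow> p * x \<noteq> 1"
  obtains V where "cring_set V" "R \<subseteq> V" "\<And>x. x \<in> V \<Longrightarrow> p * x \<noteq> 1" "\<And>x. x \<notin> V \<Longrightarrow> inverse x \<in> V"
proof -
  define A where "A = {V. cring_set V \<and> R \<subseteq> V \<and> (\<forall>x\<in>V. p * x \<noteq> 1)}"
  have "\<exists>M\<in>A. \<forall>X\<in>A. M \<subseteq> X \<longrightarrow> X = M"
  proof (rule subset_Zorn_nonempty)
    show "A \<noteq> {}" using R by (auto simp: A_def)
    fix C assume C: "C \<noteq> {}" "subset.chain A C"
    then have CA: "C \<subseteq> A" and tot: "\<And>X Y. X \<in> C \<Longrightarrow> Y \<in> C \<Longrightarrow> X \<subseteq> Y \<or> Y \<subseteq> X"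
      by (auto simp: subset.chain_def)
    have "cring_set (\<Union>C)" unfolding cring_set_def
    proof (intro conjI ballI)
      obtain X where "X \<in> C" "cring_set X" using C(1) CA by (auto simp: A_def)
      then show "1 \<in> \<Union>C" using cring_setD(1) by blast
      fix x y assume "x \<in> \<Union>C" "y \<in> \<Union>C"
      then obtain X Y where XY: "X \<in> C" "Y \<in> C" "x \<in> X" "y \<in> Y" by blast
      then obtain Z where Z: "Z \<in> C" "x \<in> Z" "y \<in> Z" using tot[of X Y] by blast
      then have "cring_set Z" using CA by (auto simp: A_def)
      then have "x - y \<in> Z" "x * y \<in> Z" using cring_setD(4,6) Z by auto
      then show "x - y \<in> \<Union>C" "x * y \<in> \<Union>C" using Z(1) by auto
    qed
    then show "\<Union>C \<in> A" using C(1) CA unfolding A_def by blast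
  qed
  then obtain V where "V \<in> A" and max: "\<And>X. X \<in> A \<Longrightarrow> V \<subseteq> X \<Longrightarrow> X = V" by blast
  then have V: "cring_set V" "R \<subseteq> V" "\<And>x. x \<in> V \<Longrightarrow> p * x \<noteq> 1" by (auto simp: A_def)
  note [simp] = cring_setD[OF V(1)] cring_set_power[OF V(1)]
  have pV: "p \<in> V" using R V by auto
  \<comment> \<open>\<open>rp x n\<close>: a relation of degree at most \<open>n\<close> that makes
    \<open>p\<close> invertible after adjoining \<open>x\<close>.\<close>
  define rp where "rp = (\<lambda>x n. \<exists>c. (\<forall>i. c i \<in> V) \<and> p * (\<Sum>i\<le>n. c i * x ^ i) = 1)"
  have ex: "\<exists>n. rp x n" if x: "x \<notin> V" for x
  proof -
    have "adjoin V x \<noteq> V" using adjoin_superset[OF V(1), of x] x by auto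
    then have "adjoin V x \<notin> A" using max adjoin_superset[OF V(1)] by blast
    then obtain y where "y \<in> adjoin V x" "p * y = 1"
      using cring_set_adjoin[OF V(1)] adjoin_superset[OF V(1), of x] V(2) unfolding A_def by blast
    then show ?thesis unfolding adjoin_def rp_def poly_altdef by blast
  qed
  \<comment> \<open>If the inverse of \<open>s = 1 - p * b\<close> were missing from
    \<open>V\<close>, adjoining it would make \<open>p\<close> invertible. Multiplying that relation
    by \<open>s ^ n\<close>, which is 1 modulo \<open>p\<close>, would make \<open>p\<close>
    invertible in \<open>V\<close> itself.\<close>
  have unit: "inverse (1 - p * b) \<in> V" if b: "b \<in> V" for b
  proof (rule ccontr)
    define s where "s = 1 - p * b"
    have s: "s \<in> V" "s \<noteq> 0" using b pV V(3)[OF b] by (auto simp: s_def)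
    assume "inverse (1 - p * b) \<notin> V"
    then obtain n c where c: "\<And>i. c i \<in> V" "p * (\<Sum>i\<le>n. c i * inverse s ^ i) = 1"
      using ex[of "inverse s"] unfolding rp_def s_def by blast
    have "\<exists>d\<in>V. s ^ n = 1 - p * d"
    proof (induction n)
      case (Suc n)
      then obtain d where "d \<in> V" "s ^ n = 1 - p * d" by blast
      then have "s ^ Suc n = s * (1 - p * d)" by simp
      also have "\<dots> = 1 - p * (b + d - p * b * d)" by (simp add: s_def algebra_simps)
      finally have "s ^ Suc n = 1 - p * (b + d - p * b * d)" .
      moreover have "b + d - p * b * d \<in> V" using b pV \<open>d \<in> V\<close> by simp
      ultimately show ?case by blast
    qed (auto intro!: bexI[of _ 0])
    then obtain d where d: "d \<in> V" "s ^ n = 1 - p * d" by blast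
    have "s ^ n = p * (\<Sum>i\<le>n. c i * inverse s ^ i) * s ^ n" using c by simp
    also have "\<dots> = p * (\<Sum>i\<le>n. c i * s ^ (n - i))"
      unfolding mult.assoc sum_distrib_right using s(2)
      by (intro arg_cong[of _ _ "(*) p"] sum.cong refl) (simp add: power_diff field_simps)
    finally have "p * ((\<Sum>i\<le>n. c i * s ^ (n - i)) + d) = 1" using d by (simp add: algebra_simps)
    moreover have "(\<Sum>i\<le>n. c i * s ^ (n - i)) + d \<in> V"
      using c(1) d(1) s(1) by (intro cring_setD(5)[OF V(1)] cring_set_sum[OF V(1)]) auto
    ultimately show False using V(3) by blast
  qed
  have rp0: "\<not> rp x 0" for x using V(3) unfolding rp_def by auto
  \<comment> \<open>The relation for \<open>inverse x\<close>, multiplied by \<open>x ^ n\<close>,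
    expresses \<open>x ^ n\<close> by lower powers, since \<open>1 - p * b 0\<close> is a unit; this
    is substituted for the leading term. For two relations of minimal degree it is a
    contradiction.\<close>
  have descend: "rp x (n - 1)" if n: "rp x n" and m: "rp (inverse x) m" and mn: "m \<le> n" and x: "x \<noteq> 0" for x n m
  proof -
    obtain c where c: "\<And>i. c i \<in> V" "p * (\<Sum>i\<le>n. c i * x ^ i) = 1" using n unfolding rp_def by blast
    obtain b where b: "\<And>i. b i \<in> V" "p * (\<Sum>i\<le>m. b i * inverse x ^ i) = 1" using m unfolding rp_def by blast
    have n0: "n > 0" using n rp0 by (cases n) auto
    define w where "w = inverse (1 - p * b 0)"
    have w: "w \<in> V" "w * (1 - p * b 0) = 1" using unit[OF b(1)] V(3)[OF b(1)] by (auto simp: w_def)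
    have "(\<Sum>i\<le>m. b i * inverse x ^ i) = b 0 + (\<Sum>j\<in>{1..m}. b j * inverse x ^ j)"
      by (simp add: atMost_atLeast0 sum.atLeast_Suc_atMost)
    then have "1 - p * b 0 = p * (\<Sum>j\<in>{1..m}. b j * inverse x ^ j)"
      using b(2) by (simp add: algebra_simps)
    then have "1 = w * (p * (\<Sum>j\<in>{1..m}. b j * inverse x ^ j))" using w(2) by simp
    then have "x ^ n = w * (p * (\<Sum>j\<in>{1..m}. b j * inverse x ^ j)) * x ^ n" by simp
    also have "\<dots> = w * p * (\<Sum>j\<in>{1..m}. b j * x ^ (n - j))"
      unfolding mult.assoc sum_distrib_right using x mn
      by (intro arg_cong[of _ _ "(*) w"] arg_cong[of _ _ "(*) p"] sum.cong refl) (simp add: power_diff field_simps)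
    also have "(\<Sum>j\<in>{1..m}. b j * x ^ (n - j)) = (\<Sum>i\<in>{n - m..<n}. b (n - i) * x ^ i)"
      by (rule sum.reindex_bij_witness[of _ "\<lambda>i. n - i" "\<lambda>j. n - j"]) (use mn in auto)
    also have "\<dots> = (\<Sum>i<n. (if n - m \<le> i then b (n - i) else 0) * x ^ i)"
      by (rule sum.mono_neutral_cong_left) auto
    finally have xn: "x ^ n = w * p * (\<Sum>i<n. (if n - m \<le> i then b (n - i) else 0) * x ^ i)" .
    define d where "d = (\<lambda>i. c i + c n * (w * p * (if n - m \<le> i then b (n - i) else 0)))"
    have "(\<Sum>i\<le>n. c i * x ^ i) = (\<Sum>i<n. c i * x ^ i) + c n * x ^ n"
      by (simp flip: lessThan_Suc_atMost)
    also have "\<dots> = (\<Sum>i<n. d i * x ^ i)"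
      unfolding xn d_def by (simp add: distrib_right sum.distrib sum_distrib_left mult.assoc)
    also have "{..<n} = {..n - 1}" using n0 by auto
    finally have "p * (\<Sum>i\<le>n - 1. d i * x ^ i) = 1" using c(2) by simp
    moreover have "d i \<in> V" for i using b(1) c(1) w pV by (auto simp: d_def)
    ultimately show ?thesis unfolding rp_def by blast
  qed
  have "inverse x \<in> V" if x: "x \<notin> V" for x
  proof (rule ccontr)
    assume ix: "inverse x \<notin> V"
    have x0: "x \<noteq> 0" using x by auto
    define n m where "n = (LEAST n. rp x n)" and "m = (LEAST m. rp (inverse x) m)"
    have n: "rp x n" and m: "rp (inverse x) m"
      unfolding n_def m_def using ex[OF x] ex[OF ix] by (auto intro: LeastI_ex)
    have pos: "n > 0" "m > 0" using n m rp0 by (cases n; cases m; auto)+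
    show False
    proof (cases "m \<le> n")
      case True
      have "rp x (n - 1)" by (rule descend[OF n m True x0])
      then have "n \<le> n - 1" unfolding n_def by (rule Least_le)
      then show False using pos by simp
    next
      case False
      have "rp (inverse x) (m - 1)" using descend[OF m, of n] n False x0 by simp
      then have "m \<le> m - 1" unfolding m_def by (rule Least_le)
      then show False using pos by simp
    qed
  qed
  then show ?thesis using that V by blast
qed

lemma cring_set_eis: "cring_set eis" by (auto simp: cring_set_def)

section \<open>The valuation ring and its maximal ideal\<close>

locale eis_val = eis_prime3 +
  fixes V :: "complex set"
  assumes V_ring: "cring_set V" and V_eis: "eis \<subseteq> V" and V_lam: "x \<in> V \<Longrightarrow> lam * x \<noteq> 1"
    and V_val: "x \<notin> V \<Longrightarrow> inverse x \<in> V"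
begin

lemmas V_simps [simp, intro] = cring_setD[OF V_ring] cring_set_power[OF V_ring]
lemmas V_sum = cring_set_sum[OF V_ring]
lemma V_eis' [simp, intro]: "x \<in> eis \<Longrightarrow> x \<in> V" using V_eis by blast

definition mm :: "complex set" where "mm = {x \<in> V. \<forall>y\<in>V. x * y \<noteq> 1}"

lemma mmI: "x \<in> V \<Longrightarrow> (\<And>y. y \<in> V \<Longrightarrow> x * y \<noteq> 1) \<Longrightarrow> x \<in> mm"
  by (simp only: mm_def mem_Collect_eq Ball_def) iprover
lemma mm_V [simp, intro]: "x \<in> mm \<Longrightarrow> x \<in> V"
  by (simp only: mm_def mem_Collect_eq)
lemma mmD: "x \<in> mm \<Longrightarrow> y \<in> V \<Longrightarrow> x * y \<noteq> 1"
  by (simp only: mm_def mem_Collect_eq Ball_def) iprover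
lemma mm_0 [simp, intro]: "0 \<in> mm" by (rule mmI) auto
lemma mm_1: "1 \<notin> mm" using mmD[of 1 1] by auto
lemma lam_mm: "lam \<in> mm" using V_lam lam_eis by (intro mmI) auto

lemma mm_mult: "x \<in> mm \<Longrightarrow> y \<in> V \<Longrightarrow> x * y \<in> mm"
proof (rule mmI)
  fix z assume "x \<in> mm" "y \<in> V" "z \<in> V"
  then show "x * y * z \<noteq> 1" using mmD[of x "y * z"] by (simp add: mult.assoc)
qed auto
lemma mm_mult': "x \<in> mm \<Longrightarrow> y \<in> V \<Longrightarrow> y * x \<in> mm"
  using mm_mult[of x y] by (simp add: mult.commute)

lemma unitI: "x \<in> V \<Longrightarrow> x \<notin> mm \<Longrightarrow> x \<noteq> 0 \<and> inverse x \<in> V"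
proof -
  assume "x \<in> V" "x \<notin> mm"
  then obtain y where y: "y \<in> V" "x * y = 1" using mmI by blast
  then have "inverse x = y" by (metis inverse_unique)
  then show ?thesis using y by auto
qed

lemma mm_inverse: "x \<notin> V \<Longrightarrow> inverse x \<in> mm"
proof -
  assume x: "x \<notin> V"
  then have "x \<noteq> 0" by auto
  then show ?thesis using V_val[OF x] unitI[of "inverse x"] x by auto
qed

text \<open>Of \<open>x / y\<close> and \<open>y / x\<close> at least one is in \<open>V\<close>, so
  the sum is one of the two elements times an element of \<open>V\<close>.\<close>

lemma mm_add: assumes "x \<in> mm" "y \<in> mm" shows "x + y \<in> mm"
proof -
  have *: "a + b \<in> mm" if "a \<in> mm" "b \<in> mm" "a / b \<in> V" "b \<noteq> 0" for a b
  proof -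
    have "a + b = b * (a / b + 1)" using that by (simp add: field_simps)
    then show ?thesis using that by (simp add: mm_mult)
  qed
  show ?thesis
  proof (cases "x = 0 \<or> y = 0")
    case False
    then show ?thesis using *[OF assms] *[OF assms(2,1)] V_val[of "x / y"] by (auto simp: add.commute)
  qed (use assms in auto)
qed

lemma mm_uminus: "x \<in> mm \<Longrightarrow> - x \<in> mm" using mm_mult[of x "- 1"] by simp
lemma mm_diff: "x \<in> mm \<Longrightarrow> y \<in> mm \<Longrightarrow> x - y \<in> mm" using mm_add[of x "- y"] mm_uminus by simp
lemma mm_sum: "(\<And>i. i \<in> A \<Longrightarrow> f i \<in> mm) \<Longrightarrow> sum f A \<in> mm"
  by (induction A rule: infinite_finite_induct) (auto simp: mm_add)

lemma unit_plus_mm: "u \<in> V \<Longrightarrow> u \<notin> mm \<Longrightarrow> x - u \<in> mm \<Longrightarrow> x \<in> V \<and> x \<notin> mm \<and> x \<noteq> 0 \<and> inverse x \<in> V"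
proof -
  assume u: "u \<in> V" "u \<notin> mm" "x - u \<in> mm"
  have x: "x \<in> V" using V_simps(5)[OF u(1) mm_V[OF u(3)]] by simp
  moreover have "x \<notin> mm" using mm_diff[of x "x - u"] u by auto
  ultimately show ?thesis using unitI by blast
qed

lemma mm_prime: "x * y \<in> mm \<Longrightarrow> x \<in> V \<Longrightarrow> y \<in> V \<Longrightarrow> x \<in> mm \<or> y \<in> mm"
proof (rule ccontr)
  assume xy: "x * y \<in> mm" "x \<in> V" "y \<in> V" "\<not> (x \<in> mm \<or> y \<in> mm)"
  then have x: "x \<noteq> 0" "inverse x \<in> V" using unitI by auto
  have "inverse x * (x * y) \<in> mm" using mm_mult'[OF xy(1) x(2)] .
  moreover have "inverse x * (x * y) = y" using x by simp
  ultimately show False using xy by simp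
qed

lemma V_integrally_closed: "x ^ Suc n \<in> V \<Longrightarrow> x \<in> V"
proof (rule ccontr)
  assume x: "x ^ Suc n \<in> V" "x \<notin> V"
  then have "inverse x ^ n * x ^ Suc n \<in> V" using V_val by auto
  moreover have "x \<noteq> 0" using x by auto
  then have "inverse x ^ n * x ^ Suc n = x" by (simp add: power_inverse field_simps)
  ultimately show False using x by (simp del: power_Suc)
qed

lemma eis_unit: "x \<in> eis \<Longrightarrow> \<not> eis_dvd lam x \<Longrightarrow> x \<notin> mm"
proof
  assume x: "x \<in> eis" "\<not> eis_dvd lam x" "x \<in> mm"
  obtain w where w: "w \<in> eis" "eis_cong lam (x * w) 1" using x by (blast intro: eis_inverse_mod)
  then obtain c where c: "c \<in> eis" "x * w - 1 = lam * c" unfolding eis_cong_def by (blast elim: eis_dvdE)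
  have "x * w - lam * c \<in> mm" using x w c lam_mm by (intro mm_diff mm_mult) auto
  moreover have "x * w - lam * c = 1" unfolding c(2)[symmetric] by simp
  ultimately show False using mm_1 by simp
qed

lemma eis_dvd_mm: "eis_dvd lam x \<Longrightarrow> x \<in> mm"
  by (erule eis_dvdE) (auto intro: mm_mult lam_mm)

lemma nat_unit: "\<not> ell dvd n \<Longrightarrow> of_nat n \<notin> mm"
  using eis_unit[of "of_nat n"] lam_dvd_nat by auto

lemma nat_inverse: "\<not> ell dvd n \<Longrightarrow> inverse (of_nat n) \<in> V"
  using unitI[OF _ nat_unit] by auto

lemma ell_not_dvd_small: "0 < n \<Longrightarrow> n < ell \<Longrightarrow> \<not> ell dvd n" by (auto dest: dvd_imp_le)

lemma ell_mm: "of_nat ell \<in> mm" using eis_dvd_mm[OF lam_dvd_ell] .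

lemma kk_pos: "kk > 0" using ell_kk ell_gt_1 by (cases kk) auto

lemma ell_ge_7: "ell \<ge> 7"
proof (rule ccontr)
  assume "\<not> ?thesis"
  then have "ell = 4" using ell_kk kk_pos by presburger
  then have "prime (2 * 2 :: nat)" using prime_ell by simp
  then show False using prime_product[of 2 "2 :: nat"] by simp
qed

lemma unit_2: "inverse 2 \<in> V" and unit_3: "inverse 3 \<in> V" and unit_4: "inverse 4 \<in> V"
  using nat_inverse[OF ell_not_dvd_small[of 2]] nat_inverse[OF ell_not_dvd_small[of 3]]
    nat_inverse[OF ell_not_dvd_small[of 4]] ell_ge_7 by auto

lemma fact_unit: "k < ell \<Longrightarrow> inverse (fact k) \<in> V"
  using nat_inverse[of "fact k"] prime_dvd_fact_iff[OF prime_ell, of k] by simp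

lemma eis_loc_V: "eis_loc lam \<subseteq> V"
proof
  fix z assume "z \<in> eis_loc lam"
  then obtain x s where "x \<in> eis" "s \<in> eis" "\<not> eis_dvd lam s" "z = x / s" unfolding eis_loc_def by blast
  then show "z \<in> V" using unitI[of s] eis_unit[of s] by (auto simp: divide_inverse)
qed

lemma eisQ_V: "z \<in> eisQ \<Longrightarrow> z \<in> V \<Longrightarrow> z \<in> eis_loc lam"
proof (rule ccontr)
  assume z: "z \<in> eisQ" "z \<in> V" "z \<notin> eis_loc lam"
  obtain w where w: "w \<in> eis_loc lam" "z * (lam * w) = 1" using z by (blast intro: eisQ_cases)
  have "lam * (z * w) = 1" using w(2) by (simp add: mult_ac)
  moreover have "z * w \<in> V" using z w eis_loc_V by auto
  ultimately show False using V_lam by blast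
qed

lemma eisQ_mm:
  assumes "z \<in> eisQ" "z \<in> mm" shows "\<exists>w\<in>eis_loc lam. z = lam * w"
proof -
  have "z / lam \<in> eis_loc lam"
  proof (rule ccontr)
    assume "z / lam \<notin> eis_loc lam"
    moreover have "z / lam \<in> eisQ" using assms lam_eis by auto
    ultimately obtain w where w: "w \<in> eis_loc lam" "z / lam * (lam * w) = 1" by (blast intro: eisQ_cases)
    then have "z * w = 1" using lam_nonzero by simp
    moreover have "w \<in> V" using w(1) eis_loc_V by blast
    ultimately show False using mmD[OF assms(2)] by blast
  qed
  then show ?thesis using lam_nonzero by (intro bexI[of _ "z / lam"]) auto
qed

section \<open>Power series with integral coefficients below a given degree\<close>

definition VF :: "nat \<Rightarrow> complex fps \<Rightarrow> bool" where "VF N F \<longleftrightarrow> (\<forall>n<N. fps_nth F n \<in> V)"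

lemma VF_mult: "VF N F \<Longrightarrow> VF N G \<Longrightarrow> VF N (F * G)"
  unfolding VF_def fps_mult_nth by (auto intro!: V_sum)
lemma VF_add: "VF N F \<Longrightarrow> VF N G \<Longrightarrow> VF N (F + G)" unfolding VF_def by auto
lemma VF_diff: "VF N F \<Longrightarrow> VF N G \<Longrightarrow> VF N (F - G)" unfolding VF_def by auto
lemma VF_const: "c \<in> V \<Longrightarrow> VF N (fps_const c)" unfolding VF_def by auto
lemma VF_1: "VF N 1" unfolding VF_def by auto
lemma VF_X: "VF N fps_X" unfolding VF_def by (auto simp: fps_X_def)
lemma VF_power: "VF N F \<Longrightarrow> VF N (F ^ k)" by (induction k) (auto simp: VF_1 VF_mult)
lemma VF_mono: "VF N F \<Longrightarrow> M \<le> N \<Longrightarrow> VF M F" unfolding VF_def by auto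

lemma VF_divide:
  assumes "VF N D" "VF N A" "F * D = A" "inverse (fps_nth D 0) \<in> V" "fps_nth D 0 \<noteq> 0"
  shows "VF N F"
proof -
  have "n < N \<longrightarrow> fps_nth F n \<in> V" for n
  proof (induction n rule: less_induct)
    case (less n)
    show ?case
    proof
      assume n: "n < N"
      have "fps_nth A n = (\<Sum>i=0..n. fps_nth F i * fps_nth D (n - i))"
        unfolding assms(3)[symmetric] by (rule fps_mult_nth)
      also have "\<dots> = fps_nth F n * fps_nth D 0 + (\<Sum>i<n. fps_nth F i * fps_nth D (n - i))"
        by (simp add: atLeast0AtMost flip: lessThan_Suc_atMost)
      finally have "fps_nth F n = (fps_nth A n - (\<Sum>i<n. fps_nth F i * fps_nth D (n - i))) * inverse (fps_nth D 0)"
        using assms(5) by (simp add: field_simps)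
      also have "\<dots> \<in> V"
        using less n assms by (intro V_simps(6) V_simps(4) V_sum) (auto simp: VF_def)
      finally show "fps_nth F n \<in> V" .
    qed
  qed
  then show ?thesis by (simp add: VF_def)
qed

text \<open>It divides \<open>fact (2 * kk)\<close>, and \<open>2 * kk\<close> is less than the
  prime \<open>ell\<close>.\<close>

lemma binomial_unit: "of_nat (2 * kk choose kk) \<notin> mm"
proof (rule nat_unit)
  have "fact kk * fact kk * (2 * kk choose kk) = fact (2 * kk)"
    using binomial_fact_lemma[of kk "2 * kk"] by (simp add: mult_2)
  then have "(2 * kk choose kk) dvd fact (2 * kk)" by (metis dvd_triv_right)
  moreover have "\<not> ell dvd fact (2 * kk)"
    using prime_dvd_fact_iff[OF prime_ell, of "2 * kk"] ell_kk by simp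
  ultimately show "\<not> ell dvd (2 * kk choose kk)" using dvd_trans by blast
qed

text \<open>Non-vanishing of the Hasse invariant: compare the coefficients of index \<open>ell - 1\<close> in
  \<open>cm ^ (2 ell) = sm' (1 - sm ^ 3) ^ (2 kk)\<close>.\<close>
lemma smF_not_integral: "\<not> VF (Suc ell) smF"
proof
  assume S: "VF (Suc ell) smF"
  have C: "fps_nth cmF n \<in> V" if "n < ell" for n
  proof (cases n)
    case (Suc m)
    have "fps_nth (fps_deriv cmF) m = - fps_nth (smF ^ 2) m" by (simp add: cmF_deriv)
    then have "of_nat (Suc m) * fps_nth cmF n = - fps_nth (smF ^ 2) m" using Suc by simp
    then have "fps_nth cmF n = - fps_nth (smF ^ 2) m * inverse (of_nat (Suc m))"
      by (simp add: field_simps del: of_nat_Suc)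
    also have "\<dots> \<in> V"
      using VF_power[OF S, of 2] that Suc nat_inverse[OF ell_not_dvd_small[of "Suc m"]]
      by (intro V_simps) (auto simp: VF_def simp del: of_nat_Suc)
    finally show ?thesis .
  qed auto
  then have CV: "VF ell cmF" by (simp add: VF_def)
  have ell: "ell = Suc (3 * kk)" using ell_kk by simp
  have eq: "cmF ^ (2 * ell) = fps_deriv smF * (1 - smF ^ 3) ^ (2 * kk)"
  proof -
    have "2 * ell = 2 + 3 * (2 * kk)" using ell by simp
    then have "cmF ^ (2 * ell) = cmF ^ 2 * (cmF ^ 3) ^ (2 * kk)" by (simp only: power_add power_mult)
    moreover have "cmF ^ 3 = 1 - smF ^ 3" using smF_cubes by (simp add: eq_diff_eq add.commute)
    ultimately show ?thesis by (simp add: smF_deriv)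
  qed
  \<comment> \<open>The derivative of an \<open>ell\<close>-th power is a multiple of
    \<open>ell\<close>, and its coefficient of index \<open>ell - 2\<close> is
    \<open>ell - 1\<close>, a unit, times the coefficient wanted.\<close>
  have L: "fps_nth (cmF ^ (2 * ell)) (ell - 1) \<in> mm"
  proof -
    have "fps_nth (fps_deriv (cmF ^ (2 * ell))) (ell - 2) = of_nat (ell - 1) * fps_nth (cmF ^ (2 * ell)) (ell - 1)"
    proof -
      have "Suc (ell - 2) = ell - 1" using ell_ge_7 by simp
      then show ?thesis using fps_deriv_nth[of "cmF ^ (2 * ell)" "ell - 2"] by simp
    qed
    moreover have "fps_deriv (cmF ^ (2 * ell)) = fps_const (of_nat (2 * ell)) * (fps_deriv cmF * cmF ^ (2 * ell - 1))"
      by (simp add: fps_deriv_power fps_of_nat mult_ac)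
    ultimately have "of_nat (ell - 1) * fps_nth (cmF ^ (2 * ell)) (ell - 1)
        = of_nat (2 * ell) * fps_nth (fps_deriv cmF * cmF ^ (2 * ell - 1)) (ell - 2)"
      by (simp only: fps_mult_left_const_nth)
    moreover have "of_nat (2 * ell) * fps_nth (fps_deriv cmF * cmF ^ (2 * ell - 1)) (ell - 2) \<in> mm"
    proof -
      have "VF ell (fps_deriv cmF * cmF ^ (2 * ell - 1))"
        unfolding cmF_deriv using VF_mult[OF VF_diff[OF VF_const[of 0] VF_power[OF VF_mono[OF S]]] VF_power[OF CV]] by simp
      then have "fps_nth (fps_deriv cmF * cmF ^ (2 * ell - 1)) (ell - 2) \<in> V" using ell_gt_1 by (auto simp: VF_def)
      moreover have "of_nat (2 * ell) \<in> mm" using mm_mult'[OF ell_mm, of 2] by simp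
      ultimately show ?thesis by (rule mm_mult[rotated])
    qed
    ultimately have "of_nat (ell - 1) * fps_nth (cmF ^ (2 * ell)) (ell - 1) \<in> mm" by simp
    moreover have "fps_nth (cmF ^ (2 * ell)) (ell - 1) \<in> V"
      using VF_power[OF CV, of "2 * ell"] ell_pos by (simp add: VF_def)
    ultimately show ?thesis
      using mm_prime[of "of_nat (ell - 1)"] nat_unit[OF ell_not_dvd_small[of "ell - 1"]] ell_gt_1 by auto
  qed
  define c where "c = (\<lambda>j. of_nat (2 * kk choose j) * (- 1) ^ j :: complex)"
  have "(1 - smF ^ 3) ^ (2 * kk) = (\<Sum>j\<le>2 * kk. fps_const (c j) * smF ^ (3 * j))"
  proof -
    have "(1 - smF ^ 3) ^ (2 * kk) = (- (smF ^ 3) + 1) ^ (2 * kk)" by simp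
    also have "\<dots> = (\<Sum>j\<le>2 * kk. of_nat (2 * kk choose j) * (- (smF ^ 3)) ^ j)"
      unfolding binomial_ring by simp
    also have "\<dots> = (\<Sum>j\<le>2 * kk. fps_const (c j) * smF ^ (3 * j))"
    proof (intro sum.cong refl)
      fix j
      have "(- (smF ^ 3)) ^ j = (- 1) ^ j * smF ^ (3 * j)" by (metis power_minus power_mult)
      moreover have "fps_const (c j) = of_nat (2 * kk choose j) * (- 1) ^ j"
        by (simp add: c_def fps_of_nat[symmetric] fps_const_power[symmetric] flip: fps_const_mult fps_const_neg)
      ultimately show "of_nat (2 * kk choose j) * (- (smF ^ 3)) ^ j = fps_const (c j) * smF ^ (3 * j)"
        by (simp add: mult.assoc)
    qed
    finally show ?thesis .
  qed
  then have R: "fps_nth (cmF ^ (2 * ell)) (ell - 1) = (\<Sum>j\<le>2 * kk. c j * fps_nth (fps_deriv smF * smF ^ (3 * j)) (ell - 1))"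
    unfolding eq by (simp add: sum_distrib_left fps_sum_nth mult.left_commute[of "fps_deriv smF"])
  \<comment> \<open>\<open>sm' * sm ^ (3 * j)\<close> is the derivative of
    \<open>sm ^ (3 * j + 1)\<close> divided by \<open>3 * j + 1\<close>. Its coefficient of index
    \<open>ell - 1\<close> therefore carries the factor \<open>ell\<close>, unless
    \<open>ell\<close> divides \<open>3 * j + 1\<close>; in the range up to \<open>2 * kk\<close>
    this happens for \<open>j = kk\<close> only.\<close>
  have trm: "of_nat (3 * j + 1) * fps_nth (fps_deriv smF * smF ^ (3 * j)) (ell - 1) = of_nat ell * fps_nth (smF ^ (3 * j + 1)) ell" for j
  proof -
    have "fps_deriv (smF ^ (3 * j + 1)) = fps_const (of_nat (3 * j + 1)) * (fps_deriv smF * smF ^ (3 * j))"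
      unfolding fps_deriv_power by (simp only: add_diff_cancel_right' mult.assoc)
    moreover have "fps_nth (fps_deriv (smF ^ (3 * j + 1))) (ell - 1) = of_nat ell * fps_nth (smF ^ (3 * j + 1)) ell"
      using ell_pos fps_deriv_nth[of "smF ^ (3 * j + 1)" "ell - 1"] by simp
    ultimately show ?thesis by (simp only: fps_mult_left_const_nth)
  qed
  have SV: "fps_nth (smF ^ i) ell \<in> V" for i using VF_power[OF S, of i] by (simp add: VF_def)
  have small: "c j * fps_nth (fps_deriv smF * smF ^ (3 * j)) (ell - 1) \<in> mm" if j: "j \<le> 2 * kk" "j \<noteq> kk" for j
  proof -
    have nd: "\<not> ell dvd 3 * j + 1"
    proof
      assume "ell dvd 3 * j + 1"
      then obtain q where q: "3 * j + 1 = ell * q" by blast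
      have "ell * q < ell * 2" unfolding q[symmetric] using j ell by simp
      then have "q < 2" by simp
      moreover have "q \<noteq> 0" using q by (cases q) auto
      ultimately have "q = 1" by simp
      then show False using q j ell by simp
    qed
    have "fps_nth (fps_deriv smF * smF ^ (3 * j)) (ell - 1)
        = inverse (of_nat (3 * j + 1)) * (of_nat ell * fps_nth (smF ^ (3 * j + 1)) ell)"
      unfolding trm[symmetric] by (simp add: field_simps del: of_nat_Suc)
    also have "\<dots> \<in> mm" using nat_inverse[OF nd] SV ell_mm by (intro mm_mult' mm_mult)
    finally show ?thesis by (intro mm_mult') (auto simp: c_def)
  qed
  \<comment> \<open>Here \<open>3 * kk + 1 = ell\<close> cancels the factor \<open>ell\<close>, and
    \<open>smF ^ ell\<close> begins with \<open>fps_X ^ ell\<close>.\<close>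
  have main: "fps_nth (fps_deriv smF * smF ^ (3 * kk)) (ell - 1) = 1"
  proof -
    have "of_nat ell * fps_nth (fps_deriv smF * smF ^ (3 * kk)) (ell - 1) = of_nat ell * fps_nth (smF ^ ell) ell"
      using trm[of kk] ell by simp
    also have "fps_nth (smF ^ ell) ell = 1" by (subst startsby_zero_power_nth_same) auto
    finally have "of_nat ell * fps_nth (fps_deriv smF * smF ^ (3 * kk)) (ell - 1) = of_nat ell * (1 :: complex)" .
    moreover have "of_nat ell \<noteq> (0 :: complex)" using ell_pos by simp
    ultimately show ?thesis by (simp only: mult_cancel_left) simp
  qed
  have "c kk = fps_nth (cmF ^ (2 * ell)) (ell - 1)
     - (\<Sum>j\<in>{..2 * kk} - {kk}. c j * fps_nth (fps_deriv smF * smF ^ (3 * j)) (ell - 1))"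
  proof -
    have "(\<Sum>j\<le>2 * kk. c j * fps_nth (fps_deriv smF * smF ^ (3 * j)) (ell - 1))
        = c kk * fps_nth (fps_deriv smF * smF ^ (3 * kk)) (ell - 1)
          + (\<Sum>j\<in>{..2 * kk} - {kk}. c j * fps_nth (fps_deriv smF * smF ^ (3 * j)) (ell - 1))"
      by (rule sum.remove) auto
    then show ?thesis unfolding R main by simp
  qed
  also have "\<dots> \<in> mm" using L small by (intro mm_diff mm_sum) auto
  finally have "c kk * (- 1) ^ kk \<in> mm" by (intro mm_mult) auto
  moreover have "c kk * (- 1) ^ kk = of_nat (2 * kk choose kk)" by (simp add: c_def mult.assoc flip: power_mult_distrib)
  ultimately show False using binomial_unit by simp
qed

lemma PQ_V: "f \<in> PQ eis \<Longrightarrow> pp z \<in> V \<Longrightarrow> pp' z \<in> V \<Longrightarrow> f z \<in> V"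
  by (induction rule: PQ.induct) auto

text \<open>In \<open>dpp_trace\<close> the factors \<open>lam ^ (k + 2) - 1\<close> and
  \<open>fact k\<close> are units for \<open>k < ell\<close>. If all division values were integral,
  the coefficients of \<open>pF\<close> below degree \<open>ell\<close> would thus be integral, and
  those of \<open>smF\<close> up to degree \<open>ell\<close>.\<close>

lemma exists_formal: "\<exists>n\<in>{1..<ell}. pp (tp (of_nat n)) \<notin> V"
proof (rule ccontr)
  assume "\<not> ?thesis"
  then have p: "pp (tp (of_nat n)) \<in> V" if "n \<in> {1..<ell}" for n using that by blast
  have p': "pp' (tp (of_nat n)) \<in> V" if n: "n \<in> {1..<ell}" for n
  proof -
    have "pp' (tp (of_nat n)) ^ Suc 1 \<in> V"
      using pp'_square[OF tp_U[OF nat_U'[OF n]]] p[OF n] by (simp add: power2_eq_square)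
    then show ?thesis by (rule V_integrally_closed)
  qed
  have a: "fps_nth pF k \<in> V" if k: "k < ell" for k
  proof -
    obtain f where f: "f \<in> PQ eis" "\<And>z. z \<notin> plat \<Longrightarrow> dpp k z = f z" using dpp_PQ[of eis k] by auto
    have "(\<Sum>n\<in>{1..<ell}. dpp k (tp (of_nat n))) \<in> V"
      by (intro V_sum) (use f tp_U nat_U' PQ_V p p' in metis)
    then have *: "(lam ^ (k + 2) - 1) * (fact k * fps_nth pF k) \<in> V" unfolding dpp_trace .
    have "(lam ^ (k + 2) - 1) - (- 1) \<in> mm" using mm_mult[OF lam_mm, of "lam ^ (k + 1)"] lam_eis by auto
    then have u: "lam ^ (k + 2) - 1 \<noteq> 0 \<and> inverse (lam ^ (k + 2) - 1) \<in> V"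
      using unit_plus_mm[of "- 1" "lam ^ (k + 2) - 1"] mm_uminus[of "- 1"] mm_1 by auto
    have "fps_nth pF k = inverse (lam ^ (k + 2) - 1) * inverse (fact k) * ((lam ^ (k + 2) - 1) * (fact k * fps_nth pF k))"
      using u by (simp add: field_simps)
    also have "\<dots> \<in> V" using u fact_unit[OF k] by (intro V_simps(6)[OF V_simps(6) *]) auto
    finally show ?thesis .
  qed
  have pV: "VF ell pF" using a by (simp add: VF_def)
  define D where "D = fps_const 9 * fps_X ^ 3 - (fps_const (- 2) + fps_X ^ 3 * fps_deriv pF)"
  define A where "A = fps_const 6 * fps_X * (1 + fps_X ^ 2 * pF)"
  \<comment> \<open>The powers of \<open>fps_X\<close> gain two degrees: coefficients of
    \<open>pF\<close> below \<open>ell\<close> control these products up to and including degree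
    \<open>ell\<close>, as \<open>smF_not_integral\<close> requires.\<close>
  have X3: "VF (Suc ell) (fps_X ^ 3 * fps_deriv pF)"
    unfolding VF_def fps_X_power_mult_nth using a by (auto intro!: V_simps V_eis')
  have X2: "VF (Suc ell) (fps_X ^ 2 * pF)"
    unfolding VF_def fps_X_power_mult_nth using a by auto
  have "VF (Suc ell) D" "VF (Suc ell) A" unfolding D_def A_def
    by (intro VF_diff VF_add VF_mult VF_const VF_power VF_X VF_1 X3 X2; simp)+
  moreover have "fps_scale 3 smF * D = A" using smF_pF unfolding D_def A_def .
  moreover have "fps_nth D 0 = 2" by (simp add: D_def)
  ultimately have T: "VF (Suc ell) (fps_scale 3 smF)" using VF_divide[of "Suc ell" D A "fps_scale 3 smF"] unit_2 by simp
  have "VF (Suc ell) smF" unfolding VF_def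
  proof (intro allI impI)
    fix n assume "n < Suc ell"
    then have "3 ^ n * fps_nth smF n \<in> V" using T by (simp add: VF_def fps_scale_nth)
    then have "inverse 3 ^ n * (3 ^ n * fps_nth smF n) \<in> V" using unit_3 by blast
    moreover have "inverse 3 ^ n * (3 ^ n * fps_nth smF n) = fps_nth smF n"
      by (simp flip: mult.assoc power_mult_distrib)
    ultimately show "fps_nth smF n \<in> V" by (simp only:)
  qed
  then show False using smF_not_integral by simp
qed

section \<open>The kernel of reduction: points congruent to the origin (0, 1) of the cubic\<close>

definition formal :: "complex \<Rightarrow> bool" where
  "formal v \<longleftrightarrow> v \<in> sdom \<and> sm v \<in> mm \<and> cm v - 1 \<in> mm"

lemma formal_lat3: "v \<in> lat3 \<Longrightarrow> formal v" by (simp add: formal_def sdom_def sm_def cm_def)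

lemma formal_shift: "w \<in> lat3 \<Longrightarrow> formal (v + w) \<longleftrightarrow> formal v"
  by (simp add: formal_def sdom_shift sm_shift cm_shift)

lemma formal_rho: "formal v \<Longrightarrow> formal (rho * v)"
  by (auto simp: formal_def sdom_rho sm_rho cm_rho intro: mm_mult')

lemma formal_cm: "formal v \<Longrightarrow> cm v \<in> V \<and> cm v \<noteq> 0 \<and> inverse (cm v) \<in> V"
  using unit_plus_mm[of 1 "cm v"] mm_1 by (auto simp: formal_def)

text \<open>If \<open>pp\<close> is not integral, neither is \<open>pp'\<close>, and
  \<open>pp / pp'\<close> is in \<open>mm\<close>, for otherwise
  \<open>(pp' / pp) ^ 2 = 4 * pp - 27 / pp ^ 2\<close> would make \<open>pp\<close> integral. Up to
  factors in \<open>V\<close>, \<open>sm\<close> and \<open>cm - 1\<close> are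
  \<open>pp / pp'\<close> and \<open>1 / pp'\<close>.\<close>

lemma formal_pole:
  assumes z: "z \<notin> plat" "pp z \<notin> V" shows "formal (3 * z)"
proof -
  define p p' where "p = pp z" and "p' = pp' z"
  have eq: "p' ^ 2 = 4 * p ^ 3 - 27" using pp'_square[OF z(1)] by (simp add: p_def p'_def)
  have p: "p \<notin> V" "p \<noteq> 0" using z by (auto simp: p_def)
  have p': "p' \<notin> V"
  proof
    assume "p' \<in> V"
    then have "inverse 4 * (p' ^ 2 + 27) \<in> V" using unit_4 by (intro V_simps) auto
    then have "p ^ 3 \<in> V" unfolding eq by simp
    then have "p ^ Suc 2 \<in> V" by (simp add: eval_nat_numeral)
    then show False using V_integrally_closed p by blast
  qed
  have p'0: "p' \<noteq> 0" using p' by auto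
  have i': "inverse p' \<in> mm" using mm_inverse[OF p'] .
  have "inverse (p / p') \<notin> V"
  proof
    assume "inverse (p / p') \<in> V"
    then have "p' / p \<in> V" by simp
    then have "(p' / p) ^ 2 \<in> V" by (rule cring_set_power[OF V_ring])
    moreover have "(p' / p) ^ 2 = 4 * p - 27 * inverse p ^ 2"
    proof -
      have "(p' / p) ^ 2 = (4 * p ^ 3 - 27) / p ^ 2" unfolding power_divide eq ..
      then show ?thesis using p by (simp add: field_simps eval_nat_numeral)
    qed
    moreover have "inverse p \<in> V" using V_val p by blast
    ultimately have "(4 * p - 27 * inverse p ^ 2) + 27 * inverse p ^ 2 \<in> V"
      by (intro V_simps(5) V_simps(6) V_simps(7)) auto
    then have "4 * p \<in> V" by simp
    then have "inverse 4 * (4 * p) \<in> V" by (rule V_simps(6)[OF unit_4])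
    moreover have "inverse 4 * (4 * p) = p" by simp
    ultimately show False using p by (simp only:)
  qed
  then have q: "p / p' \<in> mm" using mm_inverse[of "inverse (p / p')"] by simp
  have 9: "9 * inverse p' \<in> mm" using i' by (intro mm_mult') auto
  have u: "9 * inverse p' - 1 \<noteq> 0" "inverse (9 * inverse p' - 1) \<in> V"
    using unit_plus_mm[of "- 1" "9 * inverse p' - 1"] 9 mm_uminus[of "- 1"] mm_1 by auto
  have nl: "3 * z \<notin> lat3" using z by (simp add: lat3_def)
  have ne: "p' \<noteq> 9" using p' by auto
  have "sm (3 * z) = 6 * (p / p') * inverse (9 * inverse p' - 1)"
    using nl p'0 ne by (simp add: sm_def p_def p'_def field_simps)
  moreover have "6 * (p / p') * inverse (9 * inverse p' - 1) \<in> mm"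
    using q u by (intro mm_mult mm_mult') auto
  moreover have "cm (3 * z) - 1 = (- 18) * (inverse p' * inverse (9 * inverse p' - 1))"
    using nl p'0 ne by (simp add: cm_def p'_def divide_simps)
  moreover have "(- 18) * (inverse p' * inverse (9 * inverse p' - 1)) \<in> mm"
    using i' u by (intro mm_mult mm_mult') auto
  moreover have "3 * z \<in> sdom" using ne by (simp add: sdom_def p'_def)
  ultimately show ?thesis by (simp add: formal_def)
qed

text \<open>On the cubic the negative of \<open>(s, c)\<close> is \<open>(- s / c, 1 / c)\<close>,
  and \<open>c\<close> is a unit here.\<close>

lemma formal_uminus: assumes "formal v" shows "formal (- v)"
proof (cases "v \<in> lat3")
  case True then show ?thesis using formal_lat3[of "- v"] by simp
next
  case False
  define p p' where "p = pp (v / 3)" and "p' = pp' (v / 3)"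
  have c: "cm v = (p' + 9) / (p' - 9)" and s: "sm v = 6 * p / (9 - p')"
    using False by (simp_all add: cm_def sm_def p_def p'_def)
  have c0: "cm v \<noteq> 0" "inverse (cm v) \<in> V" using formal_cm[OF assms] by auto
  have n1: "p' \<noteq> 9" using assms False by (auto simp: formal_def sdom_def p'_def)
  have n2: "p' + 9 \<noteq> 0" using c0 c by auto
  have n3: "9 - p' \<noteq> 0" "p' - 9 \<noteq> 0" using n1 by auto
  have m: "pp (- v / 3) = p" "pp' (- v / 3) = - p'"
    using pp_uminus[of "v / 3"] pp'_uminus[of "v / 3"] by (simp_all add: p_def p'_def)
  have ml: "- v \<notin> lat3" using False by simp
  have "- p' \<noteq> 9" using n2 by (metis add.right_inverse)
  then have dom: "- v \<in> sdom" using m by (simp add: sdom_def)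
  have e9: "9 - p' = - (p' - 9)" by simp
  have "sm (- v) = - (sm v * inverse (cm v))"
    unfolding c s e9 using ml m n2 n3 by (simp add: sm_def divide_simps) (simp add: algebra_simps)
  then have sV: "sm (- v) \<in> mm" using assms c0 by (auto simp: formal_def intro: mm_uminus mm_mult)
  have "cm (- v) = inverse (cm v)"
  proof -
    have "cm (- v) = (- p' + 9) / (- p' - 9)" using ml m by (simp add: cm_def)
    also have "\<dots> = (- (p' - 9)) / (- (p' + 9))" by simp
    also have "\<dots> = (p' - 9) / (p' + 9)" by (rule minus_divide_divide)
    finally show ?thesis by (simp add: c)
  qed
  then have "cm (- v) - 1 = - (inverse (cm v) * (cm v - 1))" using c0 by (simp add: algebra_simps)
  then have "cm (- v) - 1 \<in> mm" using assms c0 by (auto simp: formal_def intro: mm_uminus mm_mult')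
  then show ?thesis using sV dom by (simp add: formal_def)
qed

text \<open>The addition theorem presupposes that the sum is not a pole. If it were,
  \<open>w = - (u + v)\<close> would satisfy \<open>cm w = 0\<close> and
  \<open>sm w ^ 3 = 1\<close>; the addition theorem for \<open>w + u = - v\<close> then reads
  \<open>sm (- v) * cm u = sm w\<close>, with the left side in \<open>mm\<close> and the right side
  a unit.\<close>

lemma formal_sdom_add: assumes "formal u" "formal v" shows "u + v \<in> sdom"
proof (rule ccontr)
  assume no: "u + v \<notin> sdom"
  define w where "w = - (u + v)"
  have uv: "u + v \<notin> lat3" "pp' ((u + v) / 3) = 9" using no by (auto simp: sdom_def)
  have "pp' (w / 3) = - 9" using pp'_uminus[of "(u + v) / 3"] uv by (simp add: w_def minus_divide_left)
  moreover have "w \<notin> lat3" using uv(1) unfolding w_def lat3_uminus_iff .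
  ultimately have w: "w \<in> sdom" "cm w = 0" by (simp_all add: sdom_def cm_def)
  have s3: "sm w ^ 3 = 1" using sm_cm_cubes[OF w(1)] w(2) by simp
  have sum: "w + u = - v" by (simp add: w_def)
  have mv: "formal (- v)" by (rule formal_uminus[OF assms(2)])
  have "sm (- v) * cm u = sm w"
    using addition_theorem(1)[of w u] w assms mv unfolding sum by (simp add: formal_def)
  moreover have "sm (- v) * cm u \<in> mm" using mv formal_cm[OF assms(1)] by (intro mm_mult) (auto simp: formal_def)
  ultimately have "sm w \<in> mm" by simp
  then have "sm w * sm w ^ 2 \<in> mm" by (intro mm_mult) auto
  moreover have "sm w * sm w ^ 2 = sm w ^ 3" by (simp add: eval_nat_numeral)
  ultimately show False using s3 mm_1 by simp
qed

lemma formal_den: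
  assumes "formal u" "formal v"
  shows "cm v + sm v ^ 2 * sm u * cm u - 1 \<in> mm"
proof -
  have "cm v + sm v ^ 2 * sm u * cm u - 1 = (cm v - 1) + sm u * (sm v ^ 2 * cm u)" by (simp add: mult_ac)
  moreover have "\<dots> \<in> mm"
    using assms formal_cm[OF assms(1)] by (intro mm_add mm_mult) (auto simp: formal_def)
  ultimately show ?thesis by (simp only:)
qed

lemma formal_add: assumes "formal u" "formal v" shows "formal (u + v)"
proof -
  define D where "D = cm v + sm v ^ 2 * sm u * cm u"
  have dom: "u + v \<in> sdom" "u \<in> sdom" "v \<in> sdom" using assms formal_sdom_add by (auto simp: formal_def)
  have D: "D - 1 \<in> mm" using formal_den[OF assms] by (simp add: D_def)
  have D': "D \<in> V" "D \<noteq> 0" "inverse D \<in> V" using unit_plus_mm[of 1 D] D mm_1 by auto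
  have s: "sm (u + v) = (sm u + cm u ^ 2 * sm v * cm v) * inverse D"
    using addition_theorem(1)[OF dom(2,3,1)] D' by (simp add: D_def field_simps)
  have c: "cm (u + v) = (cm u * cm v ^ 2 - sm u ^ 2 * sm v) * inverse D"
    using addition_theorem(2)[OF dom(2,3,1)] D' by (simp add: D_def field_simps)
  have V: "sm u \<in> mm" "sm v \<in> mm" "cm u \<in> V" "cm v \<in> V" "cm u - 1 \<in> mm" "cm v - 1 \<in> mm"
    using assms formal_cm by (auto simp: formal_def)
  have "sm (u + v) \<in> mm" unfolding s using V D'
    by (intro mm_mult[of _ "inverse D"] mm_add mm_mult[of _ "cm v"] mm_mult') auto
  moreover have "cm (u + v) - 1 = ((cm u - 1) * cm v ^ 2 + (cm v - 1) * (cm v + 1) - sm v * sm u ^ 2 - (D - 1)) * inverse D"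
    unfolding c using D' by (simp add: field_simps power2_eq_square)
  moreover have "\<dots> \<in> mm"
    using mm_mult[OF V(5), of "cm v ^ 2"] mm_mult[OF V(6), of "cm v + 1"] mm_mult[OF V(2), of "sm u ^ 2"] V D D'
    by (intro mm_mult[of _ "inverse D"] mm_diff[OF mm_diff[OF mm_add]]) auto
  ultimately show ?thesis using dom by (simp add: formal_def)
qed

text \<open>A zero of \<open>sm\<close> in the kernel has \<open>cm v\<close> a cube root of unity
  congruent to 1, hence equal to 1 because 3 is a unit; but off the lattice \<open>cm\<close> never
  takes the value 1.\<close>

lemma formal_nonzero: "formal v \<Longrightarrow> v \<notin> lat3 \<Longrightarrow> sm v \<noteq> 0"
proof
  assume v: "formal v" "v \<notin> lat3" "sm v = 0"
  have "cm v ^ 3 = 1" using sm_cm_cubes[of v] v by (simp add: formal_def)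
  then have "(cm v - 1) * (cm v ^ 2 + cm v + 1) = 0" by (simp add: algebra_simps eval_nat_numeral)
  moreover have "cm v ^ 2 + cm v + 1 \<noteq> 0"
  proof -
    have "cm v ^ 2 + cm v + 1 - 3 = (cm v - 1) * (cm v + 2)" by (simp add: algebra_simps eval_nat_numeral)
    also have "\<dots> \<in> mm" using v formal_cm[OF v(1)] by (intro mm_mult) (auto simp: formal_def)
    finally show ?thesis using unit_plus_mm[of 3] nat_unit[OF ell_not_dvd_small[of 3]] ell_ge_7 by auto
  qed
  ultimately have "cm v = 1" by simp
  then have "(pp' (v / 3) + 9) = (pp' (v / 3) - 9)" using v by (auto simp: cm_def formal_def sdom_def divide_eq_1_iff)
  then show False by simp
qed

text \<open>With this sign \<open>phi (x / lam)\<close> is \<open>sm (x * v1)\<close>.\<close>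

definition v1 :: complex where "v1 = - 3 * om' / lam"

lemma v1_tp: "x * v1 = 3 * - tp x" by (simp add: v1_def tp_def)

lemma formal_multiple: assumes "formal v" "k \<in> eis" shows "formal (k * v)"
proof -
  have nat: "formal (of_nat n * w)" if "formal w" for n w
  proof (induction n)
    case (Suc n)
    have "formal (of_nat n * w + w)" by (rule formal_add[OF Suc that])
    then show ?case by (simp add: algebra_simps)
  qed (use formal_lat3[of 0] in auto)
  have int: "formal (of_int n * w)" if "formal w" for n w
  proof (cases n rule: int_cases2)
    case (nonneg m) then show ?thesis using nat[OF that] by simp
  next
    case (nonpos m) then show ?thesis using formal_uminus[OF nat[OF that, of m]] by simp
  qed
  obtain a b where "k = of_int a + of_int b * rho" using assms(2) by (rule eisE)
  then have "k * v = of_int a * v + of_int b * (rho * v)" by (simp add: algebra_simps)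
  then show ?thesis using formal_add[OF int[OF assms(1)] int[OF formal_rho[OF assms(1)]]] by simp
qed

text \<open>The kernel of reduction is stable under multiplication by \<open>eis\<close>, and the
  class \<open>r\<close> found by \<open>exists_formal\<close> is invertible modulo
  \<open>lam\<close>. So one division point in the kernel brings in all of them.\<close>

lemma formal_v1: "formal v1"
proof -
  obtain r where r: "r \<in> {1..<ell}" "pp (tp (of_nat r)) \<notin> V" using exists_formal by blast
  have f: "formal (3 * - tp (of_nat r))"
    using r tp_U[OF nat_U'[OF r(1)]] by (intro formal_pole) (simp_all add: pp_uminus)
  obtain w where w: "w \<in> eis" "eis_cong lam (of_nat r * w) 1"
    using nat_U'[OF r(1)] by (auto simp: eis_coprime_eq intro: eis_inverse_mod)
  have fw: "formal (w * (3 * - tp (of_nat r)))" by (rule formal_multiple[OF f w(1)])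
  have "tp (of_nat r * w) - tp 1 \<in> plat" by (rule tp_diff_plat[OF w(2)])
  moreover have "3 * (tp (of_nat r * w) - tp 1) / 3 = tp (of_nat r * w) - tp 1" by simp
  ultimately have l: "3 * (tp (of_nat r * w) - tp 1) \<in> lat3" unfolding lat3_def by (simp only: mem_Collect_eq)
  have "w * (3 * - tp (of_nat r)) + 3 * (tp (of_nat r * w) - tp 1) = v1"
    using v1_tp[of 1] by (simp add: tp_def algebra_simps)
  then show ?thesis using formal_shift[OF l, of "w * (3 * - tp (of_nat r))"] fw by simp
qed

lemma formal_k: "k \<in> eis \<Longrightarrow> formal (k * v1)"
  using formal_multiple[OF formal_v1] .

lemma lat3_k: "k \<in> eis \<Longrightarrow> k * v1 \<in> lat3 \<longleftrightarrow> eis_dvd lam k"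
  unfolding v1_tp lat3_def by (simp add: tp_plat_iff)

lemma sm_k_nonzero: "k \<in> U \<Longrightarrow> sm (k * v1) \<noteq> 0"
  using formal_nonzero[OF formal_k] lat3_k by (auto simp: eis_coprime_eq)

end

section \<open>The formal parameter\<close>

context eis_prime
begin

text \<open>The rational numbers integral at \<open>ell\<close>. Membership covers both the
  rationality and the denominator claimed for the coefficients, and \<open>Zl\<close> is contained
  in \<open>eis_loc lam\<close> and hence in \<open>V\<close>.\<close>

definition Zl :: "complex set" where "Zl = {of_int a / of_nat b |a b. \<not> ell dvd b}"

lemma Zl_I: "\<not> ell dvd b \<Longrightarrow> of_int a / of_nat b \<in> Zl" unfolding Zl_def by blast

lemma Zl_of_int: "of_int a \<in> Zl" using Zl_I[of 1 a] ell_gt_1 by simp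

lemma Zl_ring: "cring_set Zl"
  unfolding cring_set_def
proof (intro conjI ballI)
  show "1 \<in> Zl" using Zl_of_int[of 1] by simp
  fix x y assume "x \<in> Zl" "y \<in> Zl"
  then obtain a b c d where xy: "x = of_int a / of_nat b" "\<not> ell dvd b" "y = of_int c / of_nat d" "\<not> ell dvd d"
    unfolding Zl_def by blast
  then have bd: "\<not> ell dvd b * d" using prime_dvd_mult_iff[OF prime_ell] by blast
  have nz: "b \<noteq> 0" "d \<noteq> 0" using xy by (metis dvd_0_right)+
  have "x - y = of_int (a * int d - c * int b) / of_nat (b * d)" unfolding xy(1,3) using nz by (simp add: diff_frac_eq)
  then show "x - y \<in> Zl" using Zl_I[OF bd] by metis
  have "x * y = of_int (a * c) / of_nat (b * d)" using xy by simp
  then show "x * y \<in> Zl" using Zl_I[OF bd] by metis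
qed

lemma Zl_inverse: "\<not> ell dvd n \<Longrightarrow> inverse (of_nat n) \<in> Zl"
  using Zl_I[of n 1] by (simp add: inverse_eq_divide)

text \<open>The reduced denominator divides every denominator, in particular
  \<open>b\<close>.\<close>

lemma Zl_rat:
  assumes "x \<in> Zl" shows "\<exists>q::rat. x = of_rat q \<and> \<not> int ell dvd snd (quotient_of q)"
proof -
  obtain a b where ab: "x = of_int a / of_nat b" "\<not> ell dvd b" using assms unfolding Zl_def by blast
  have b0: "b \<noteq> 0" using ab by (metis dvd_0_right)
  define q :: rat where "q = of_int a / of_nat b"
  have x: "x = of_rat q" by (simp add: q_def ab of_rat_divide)
  obtain u w where uw: "quotient_of q = (u, w)" by (cases "quotient_of q")
  have w: "w > 0" "coprime u w" "q = of_int u / of_int w"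
    using uw quotient_of_denom_pos quotient_of_coprime quotient_of_div by blast+
  have "(of_int (a * w) :: rat) = of_int (u * int b)"
    using w(1,3) b0 by (simp add: q_def field_simps)
  then have "a * w = u * int b" by (simp only: of_int_eq_iff)
  then have "w dvd u * int b" by (metis dvd_triv_right)
  then have "w dvd int b" using w(2) by (simp add: coprime_commute coprime_dvd_mult_right_iff)
  then have "\<not> int ell dvd w" using ab(2) by (meson dvd_trans int_dvd_int_iff)
  then show ?thesis using x uw by auto
qed

lemma Zl_loc: "Zl \<subseteq> eis_loc lam"
proof
  fix x assume "x \<in> Zl"
  then obtain a b where ab: "x = of_int a / of_nat b" "\<not> ell dvd b" unfolding Zl_def by blast
  then have "\<not> eis_dvd lam (of_nat b)" by (simp add: lam_dvd_nat)
  then show "x \<in> eis_loc lam" unfolding eis_loc_def ab(1) by blast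
qed

text \<open>The recursion given by the differential equations divides only by indices below
  \<open>ell\<close>.\<close>

lemma smF_cmF_Zl: "n < ell \<Longrightarrow> fps_nth smF n \<in> Zl \<and> fps_nth cmF n \<in> Zl"
proof (induction n rule: less_induct)
  case (less n)
  show ?case
  proof (cases n)
    case 0 then show ?thesis using cring_setD(1,2)[OF Zl_ring] by simp
  next
    case (Suc m)
    have inv: "inverse (of_nat (Suc m)) \<in> Zl" using less.prems Suc by (intro Zl_inverse) (auto dest: dvd_imp_le)
    have sq: "fps_nth (F ^ 2) m \<in> Zl" if "\<And>i. i < n \<Longrightarrow> fps_nth F i \<in> Zl" for F
      unfolding power2_eq_square fps_mult_nth using that Suc
      by (intro cring_set_sum[OF Zl_ring] cring_setD(6)[OF Zl_ring]) auto
    have "fps_nth (fps_deriv smF) m = fps_nth (cmF ^ 2) m" "fps_nth (fps_deriv cmF) m = - fps_nth (smF ^ 2) m"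
      by (simp_all add: smF_deriv cmF_deriv)
    then have "of_nat (Suc m) * fps_nth smF n = fps_nth (cmF ^ 2) m" "of_nat (Suc m) * fps_nth cmF n = - fps_nth (smF ^ 2) m"
      using Suc by simp_all
    then have "fps_nth smF n = inverse (of_nat (Suc m)) * fps_nth (cmF ^ 2) m"
       "fps_nth cmF n = inverse (of_nat (Suc m)) * - fps_nth (smF ^ 2) m"
      by (simp_all add: field_simps del: of_nat_Suc)
    moreover have "fps_nth (cmF ^ 2) m \<in> Zl" "fps_nth (smF ^ 2) m \<in> Zl"
      using less by (intro sq; simp)+
    ultimately show ?thesis using inv cring_setD(3,6)[OF Zl_ring] by simp
  qed
qed

text \<open>The bound is one less than for \<open>smF\<close>, since the shift uses up one
  coefficient.\<close>

lemma inverse_shift_Zl: "n < ell - 1 \<Longrightarrow> fps_nth (inverse (fps_shift 1 smF)) n \<in> Zl"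
proof (induction n rule: less_induct)
  case (less n)
  show ?case
  proof (cases "n = 0")
    case True then show ?thesis using cring_setD(1)[OF Zl_ring] by simp
  next
    case False
    have "fps_shift 1 smF * inverse (fps_shift 1 smF) = 1" by (intro inverse_mult_eq_1') simp
    then have "fps_nth (fps_shift 1 smF * inverse (fps_shift 1 smF)) n = 0" using False by simp
    then have "fps_nth (inverse (fps_shift 1 smF)) n
      + (\<Sum>i=1..n. fps_nth (fps_shift 1 smF) i * fps_nth (inverse (fps_shift 1 smF)) (n - i)) = 0"
      unfolding fps_mult_nth by (simp add: sum.atLeast_Suc_atMost)
    then have "fps_nth (inverse (fps_shift 1 smF)) n
       = - (\<Sum>i=1..n. fps_nth (fps_shift 1 smF) i * fps_nth (inverse (fps_shift 1 smF)) (n - i))"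
      by (simp only: eq_neg_iff_add_eq_0)
    also have "\<dots> \<in> Zl" using less smF_cmF_Zl
      by (intro cring_setD(3)[OF Zl_ring] cring_set_sum[OF Zl_ring] cring_setD(6)[OF Zl_ring]) auto
    finally show ?thesis .
  qed
qed

text \<open>Multiplying the classes by a primitive root \<open>g\<close> multiplies the sum by
  \<open>g ^ k\<close>, which is not 1 modulo \<open>lam\<close> unless \<open>ell - 1\<close>
  divides \<open>k\<close>; in that case every term is 1 and the sum is
  \<open>ell - 1\<close>.\<close>

lemma power_sum_cong:
  "eis_cong lam (\<Sum>n\<in>{1..<ell}. of_nat n ^ k) (if (ell - 1) dvd k then - 1 else 0)"
proof -
  have cong_sum: "eis_cong lam (\<Sum>n\<in>{1..<ell}. f n) (\<Sum>n\<in>{1..<ell}. g n)"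
    if "\<And>n. n \<in> {1..<ell} \<Longrightarrow> eis_cong lam (f n) (g n)" for f g :: "nat \<Rightarrow> complex"
  proof -
    have "eis_dvd lam (\<Sum>n\<in>A. f n - g n)" if "A \<subseteq> {1..<ell}" for A
      using that \<open>\<And>n. n \<in> {1..<ell} \<Longrightarrow> eis_cong lam (f n) (g n)\<close>
      by (induction A rule: infinite_finite_induct) (auto intro!: eis_dvd_add simp: eis_cong_def)
    then show ?thesis by (simp add: eis_cong_def sum_subtractf)
  qed
  show ?thesis
  proof (cases "(ell - 1) dvd k")
    case True
    then obtain q where q: "k = (ell - 1) * q" by blast
    have "eis_cong lam (of_nat n ^ k) 1" if "n \<in> {1..<ell}" for n
      using eis_cong_power[OF fermat[OF nat_U'[OF that]], of q] by (auto simp: q power_mult)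
    then have "eis_cong lam (\<Sum>n\<in>{1..<ell}. of_nat n ^ k) (\<Sum>n\<in>{1..<ell}. 1)" by (rule cong_sum)
    also have "(\<Sum>n\<in>{1..<ell}. (1::complex)) = of_nat ell - 1" using ell_gt_1 by simp
    finally have 1: "eis_cong lam (\<Sum>n\<in>{1..<ell}. of_nat n ^ k) (of_nat ell - 1)" .
    have 2: "eis_cong lam (of_nat ell - 1) (- 1)" using lam_dvd_ell by (simp add: eis_cong_def)
    show ?thesis using True eis_cong_trans[OF 1 2] by simp
  next
    case False
    obtain g where g: "residue_primroot ell g" using prime_primitive_root_exists[of ell] prime_ell prime_gt_1_nat by blast
    then have ordg: "ord ell g = ell - 1" "coprime ell g"
      using prime_ell by (auto simp: residue_primroot_def totient_prime)
    have gk: "\<not> [g ^ k = 1] (mod ell)" using False ord_divides[of g k ell] ordg by simp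
    have gU: "of_nat g \<in> U"
      using ordg(2) prime_ell by (simp add: nat_U) (metis coprime_absorb_left not_prime_unit)
    define S :: complex where "S = (\<Sum>n\<in>{1..<ell}. of_nat n ^ k)"
    \<comment> \<open>Powers of representatives instead of powers of the argument: this makes the
      summand a function of the residue class, as the reindexing lemma demands.\<close>
    define F where "F = (\<lambda>x. of_nat (rep x) ^ k :: complex)"
    have Fr: "resp F" unfolding resp_def F_def
    proof (intro ballI impI)
      fix x y assume xy: "x \<in> U" "y \<in> U" "eis_cong lam x y"
      have "rep x = rep y" using rep[OF xy(2)] xy eis_cong_trans by (intro rep_eqI) blast+
      then show "(of_nat (rep x) :: complex) ^ k = of_nat (rep y) ^ k" by simp
    qed
    have "S = (\<Sum>n\<in>{1..<ell}. F (of_nat n))"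
      unfolding S_def F_def using rep_eqI[OF nat_U'] by (intro sum.cong refl) (simp add: rep_eqI nat_U')
    also have "\<dots> = (\<Sum>n\<in>{1..<ell}. F (of_nat g * of_nat n))" using sum_mult_reindex[OF gU Fr] by simp
    finally have S: "S = (\<Sum>n\<in>{1..<ell}. F (of_nat g * of_nat n))" .
    have "eis_cong lam (\<Sum>n\<in>{1..<ell}. F (of_nat g * of_nat n)) (\<Sum>n\<in>{1..<ell}. of_nat g ^ k * of_nat n ^ k)"
    proof (rule cong_sum)
      fix n assume "n \<in> {1..<ell}"
      then have "of_nat g * of_nat n \<in> U" using U_mult gU nat_U' by blast
      then have "eis_cong lam ((of_nat g * of_nat n) ^ k) (of_nat (rep (of_nat g * of_nat n)) ^ k)"
        using rep by (intro eis_cong_power) (auto simp: eis_coprime_eq)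
      then show "eis_cong lam (F (of_nat g * of_nat n)) (of_nat g ^ k * of_nat n ^ k)"
        unfolding F_def power_mult_distrib by (rule eis_cong_sym)
    qed
    then have "eis_cong lam S (of_nat g ^ k * S)"
      unfolding S[symmetric] sum_distrib_left[symmetric] S_def[symmetric] .
    then have "eis_dvd lam ((1 - of_nat g ^ k) * S)" by (simp add: eis_cong_def left_diff_distrib)
    moreover have "\<not> eis_dvd lam (1 - of_nat g ^ k)"
    proof
      assume "eis_dvd lam (1 - of_nat g ^ k)"
      then have "eis_dvd lam (of_int (1 - int (g ^ k)))" by simp
      then have "int ell dvd 1 - int (g ^ k)" by (simp only: lam_dvd_int)
      then have "[int (g ^ k) = int 1] (mod int ell)" by (simp add: cong_iff_dvd_diff cong_sym dvd_diff_commute)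
      then have "[g ^ k = 1] (mod ell)" by (simp only: cong_int_iff)
      then show False using gk by simp
    qed
    moreover have "S \<in> eis" unfolding S_def by auto
    moreover have "1 - of_nat g ^ k \<in> eis" by auto
    ultimately have "eis_dvd lam S" using lam_prime by blast
    then show ?thesis using False by (simp add: eis_cong_def S_def)
  qed
qed

end

section \<open>Values of truncated power series\<close>

context eis_val
begin

lemma Zl_V: "Zl \<subseteq> V" using Zl_loc eis_loc_V by blast

lemma VF_smF: "VF ell smF" and VF_cmF: "VF ell cmF"
  unfolding VF_def using smF_cmF_Zl Zl_V by blast+

lemma VF_scale: "VF N F \<Longrightarrow> k \<in> V \<Longrightarrow> VF N (fps_scale k F)"
  unfolding VF_def fps_scale_nth by auto

definition ev :: "complex \<Rightarrow> nat \<Rightarrow> complex fps \<Rightarrow> complex" where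
  "ev t N F = (\<Sum>n<N. fps_nth F n * t ^ n)"

text \<open>\<open>a\<close> is the value of \<open>F\<close> at \<open>t\<close> up to
  \<open>t ^ N * V\<close>. This stands in for convergence and, for integral series, is compatible
  with sums, products and quotients by units.\<close>

definition rel :: "complex \<Rightarrow> nat \<Rightarrow> complex fps \<Rightarrow> complex \<Rightarrow> bool" where
  "rel t N F a \<longleftrightarrow> (\<exists>c\<in>V. a = ev t N F + t ^ N * c)"

lemma relI: "c \<in> V \<Longrightarrow> a = ev t N F + t ^ N * c \<Longrightarrow> rel t N F a" unfolding rel_def by blast
lemma relE: "rel t N F a \<Longrightarrow> (\<And>c. c \<in> V \<Longrightarrow> a = ev t N F + t ^ N * c \<Longrightarrow> P) \<Longrightarrow> P" unfolding rel_def by blast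

lemma ev_V: "t \<in> V \<Longrightarrow> VF N F \<Longrightarrow> ev t N F \<in> V"
  unfolding ev_def VF_def by (auto intro!: V_sum)

lemma rel_ev: "rel t N F (ev t N F)" by (rule relI[of 0]) auto

lemma rel_add: "rel t N F a \<Longrightarrow> rel t N G b \<Longrightarrow> rel t N (F + G) (a + b)"
  by (elim relE) (rule relI[of "_ + _"], auto simp: ev_def distrib_right sum.distrib distrib_left)

lemma rel_uminus: "rel t N F a \<Longrightarrow> rel t N (- F) (- a)"
  by (elim relE) (rule relI[of "- _"], auto simp: ev_def sum_negf)

lemma rel_diff: "rel t N F a \<Longrightarrow> rel t N G b \<Longrightarrow> rel t N (F - G) (a - b)"
  using rel_add[of t N F a "- G" "- b"] rel_uminus by simp

lemma rel_const: "N > 0 \<Longrightarrow> rel t N (fps_const c) c"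
proof (rule relI[of 0])
  assume "N > 0"
  then have "ev t N (fps_const c) = (\<Sum>n\<in>{0}. fps_nth (fps_const c) n * t ^ n)"
    unfolding ev_def by (intro sum.mono_neutral_right) auto
  then show "c = ev t N (fps_const c) + t ^ N * 0" by simp
qed simp

text \<open>The pairs with \<open>i + j < N\<close> give the truncated product; the others carry
  \<open>t ^ N\<close> with an integral cofactor.\<close>

lemma ev_mult:
  assumes "t \<in> V" "VF N F" "VF N G"
  shows "\<exists>c\<in>V. ev t N F * ev t N G = ev t N (F * G) + t ^ N * c"
proof -
  define g where "g = (\<lambda>i j. (fps_nth F i * fps_nth G j) * t ^ (i + j))"
  define c where "c = (\<Sum>(i, j)\<in>{(i, j). i < N \<and> j < N \<and> N \<le> i + j}. (fps_nth F i * fps_nth G j) * t ^ (i + j - N))"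
  have fin: "finite {(i, j). i < N \<and> j < N \<and> N \<le> i + j}" "finite {(i, j). i + j < N}"
    by (rule finite_subset[of _ "{..<N} \<times> {..<N}"]; auto)+
  have "ev t N F * ev t N G = (\<Sum>i<N. \<Sum>j<N. g i j)"
    unfolding ev_def sum_product g_def by (intro sum.cong refl) (simp add: power_add mult_ac)
  also have "\<dots> = (\<Sum>(i, j)\<in>{..<N} \<times> {..<N}. g i j)" by (rule sum.cartesian_product)
  also have "{..<N} \<times> {..<N} = {(i, j). i + j < N} \<union> {(i, j). i < N \<and> j < N \<and> N \<le> i + j}" by auto
  also have "(\<Sum>(i, j)\<in>\<dots>. g i j) = (\<Sum>(i, j)\<in>{(i, j). i + j < N}. g i j) + (\<Sum>(i, j)\<in>{(i, j). i < N \<and> j < N \<and> N \<le> i + j}. g i j)"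
    by (rule sum.union_disjoint) (use fin in auto)
  also have "(\<Sum>(i, j)\<in>{(i, j). i + j < N}. g i j) = (\<Sum>k<N. \<Sum>i\<le>k. g i (k - i))"
    by (rule sum.triangle_reindex)
  also have "\<dots> = ev t N (F * G)"
    unfolding ev_def fps_mult_nth g_def by (intro sum.cong refl) (simp add: sum_distrib_right atLeast0AtMost)
  also have "(\<Sum>(i, j)\<in>{(i, j). i < N \<and> j < N \<and> N \<le> i + j}. g i j) = t ^ N * c"
    unfolding c_def sum_distrib_left g_def
    by (intro sum.cong refl) (auto simp: mult_ac simp flip: power_add)
  finally have "ev t N F * ev t N G = ev t N (F * G) + t ^ N * c" .
  moreover have "c \<in> V" unfolding c_def using assms by (intro V_sum) (auto simp: VF_def)
  ultimately show ?thesis by blast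
qed

lemma rel_mult:
  assumes "t \<in> V" "VF N F" "VF N G" "rel t N F a" "rel t N G b" shows "rel t N (F * G) (a * b)"
proof -
  obtain c where c: "c \<in> V" "a = ev t N F + t ^ N * c" using assms(4) by (rule relE)
  obtain d where d: "d \<in> V" "b = ev t N G + t ^ N * d" using assms(5) by (rule relE)
  obtain e where e: "e \<in> V" "ev t N F * ev t N G = ev t N (F * G) + t ^ N * e" using ev_mult[OF assms(1-3)] by blast
  have "a * b = ev t N (F * G) + t ^ N * (e + ev t N F * d + c * ev t N G + t ^ N * c * d)"
    unfolding c d using e(2) by (simp add: algebra_simps)
  moreover have "e + ev t N F * d + c * ev t N G + t ^ N * c * d \<in> V"
    using c d e ev_V[OF assms(1,2)] ev_V[OF assms(1,3)] assms(1) by auto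
  ultimately show ?thesis by (intro relI)
qed

lemma rel_power:
  assumes "t \<in> V" "VF N F" "rel t N F a" "N > 0" shows "rel t N (F ^ k) (a ^ k)"
proof (induction k)
  case 0 then show ?case using rel_const[OF assms(4), of t 1] by simp
next
  case (Suc k) then show ?case using rel_mult[OF assms(1,2) VF_power[OF assms(2)] assms(3)] by simp
qed

lemma rel_unique:
  assumes "rel t N F a" "rel t N F b" shows "\<exists>c\<in>V. a - b = t ^ N * c"
proof -
  obtain c d where "c \<in> V" "a = ev t N F + t ^ N * c" "d \<in> V" "b = ev t N F + t ^ N * d"
    using assms by (auto elim!: relE)
  then show ?thesis by (intro bexI[of _ "c - d"]) (auto simp: right_diff_distrib)
qed

lemma rel_divide:
  assumes "t \<in> V" "VF N F" "VF N D" "F * D = A" "rel t N D d" "rel t N A (f * d)" "d \<noteq> 0" "inverse d \<in> V"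
  shows "rel t N F f"
proof -
  have "rel t N A (ev t N F * d)" using rel_mult[OF assms(1-3) rel_ev assms(5)] assms(4) by simp
  then obtain c where c: "c \<in> V" "f * d - ev t N F * d = t ^ N * c" using rel_unique assms(6) by blast
  then have "f = ev t N F + t ^ N * (c * inverse d)" using assms(7) by (simp add: field_simps)
  then show ?thesis using c assms(8) by (intro relI[of "c * inverse d"]) auto
qed

lemma rel_linear:
  assumes t: "t \<in> V" and F: "VF N F" "fps_nth F 0 = 0" and r: "rel t N F a" and N: "N \<ge> 2"
  shows "\<exists>g\<in>V. a = t * (fps_nth F 1 + t * g)"
proof -
  obtain c where c: "c \<in> V" "a = ev t N F + t ^ N * c" using r by (rule relE)
  define g where "g = (\<Sum>n\<in>{2..<N}. fps_nth F n * t ^ (n - 2)) + t ^ (N - 2) * c"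
  have "{..<N} = insert 0 (insert 1 {2..<N})" using N by auto
  then have "ev t N F = fps_nth F 1 * t + (\<Sum>n\<in>{2..<N}. fps_nth F n * t ^ n)"
    unfolding ev_def using F(2) by simp
  also have "(\<Sum>n\<in>{2..<N}. fps_nth F n * t ^ n) = t * (t * (\<Sum>n\<in>{2..<N}. fps_nth F n * t ^ (n - 2)))"
    unfolding sum_distrib_left
  proof (intro sum.cong refl)
    fix n assume "n \<in> {2..<N}"
    then have "n = Suc (Suc (n - 2))" by auto
    then have "t ^ n = t * (t * t ^ (n - 2))" by (metis power_Suc)
    then show "fps_nth F n * t ^ n = t * (t * (fps_nth F n * t ^ (n - 2)))" by simp
  qed
  finally have e: "ev t N F = fps_nth F 1 * t + t * (t * (\<Sum>n\<in>{2..<N}. fps_nth F n * t ^ (n - 2)))" .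
  have "N = Suc (Suc (N - 2))" using N by auto
  then have tN: "t ^ N = t * (t * t ^ (N - 2))" by (metis power_Suc)
  have "a = t * (fps_nth F 1 + t * g)" unfolding c(2) e tN g_def by (simp add: algebra_simps)
  moreover have "g \<in> V" unfolding g_def using F t c by (auto simp: VF_def intro!: V_sum V_simps)
  ultimately show ?thesis by blast
qed

text \<open>The difference quotient of a series \<open>X + ...\<close> on arguments divisible by
  \<open>x\<close> is 1 modulo \<open>x\<close>, which drives the Newton iteration.\<close>

lemma ev_difference:
  assumes F: "VF N F" "fps_nth F 0 = 0" "fps_nth F 1 = 1" "N \<ge> 2" and x: "x \<in> V" "a \<in> V" "b \<in> V"
  shows "\<exists>g\<in>V. ev (x * a) N F - ev (x * b) N F = (x * a - x * b) * (1 + x * g)"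
proof -
  define h where "h = (\<lambda>n. \<Sum>i<n. b ^ (n - Suc i) * a ^ i)"
  define g where "g = (\<Sum>n\<in>{2..<N}. fps_nth F n * (x ^ (n - 2) * h n))"
  have hp: "(x * a) ^ n - (x * b) ^ n = (x * a - x * b) * (x * (x ^ (n - 2) * h n))" if "n \<ge> 2" for n
  proof -
    have n: "n = Suc (Suc (n - 2))" using that by simp
    have "(x * a) ^ n - (x * b) ^ n = x ^ n * ((a - b) * h n)"
      unfolding h_def power_diff_sumr2[symmetric] by (simp add: power_mult_distrib right_diff_distrib)
    also have "x ^ n = x * (x * x ^ (n - 2))" using n by (metis power_Suc)
    finally show ?thesis by (simp add: algebra_simps)
  qed
  have split: "{..<N} = insert 0 (insert 1 {2..<N})" using F(4) by auto
  have "ev (x * a) N F - ev (x * b) N F = (\<Sum>n<N. fps_nth F n * ((x * a) ^ n - (x * b) ^ n))"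
    unfolding ev_def by (simp add: sum_subtractf right_diff_distrib)
  also have "\<dots> = (x * a - x * b) + (\<Sum>n\<in>{2..<N}. fps_nth F n * ((x * a) ^ n - (x * b) ^ n))"
    unfolding split using F by simp
  also have "(\<Sum>n\<in>{2..<N}. fps_nth F n * ((x * a) ^ n - (x * b) ^ n)) = (x * a - x * b) * (x * g)"
    unfolding g_def sum_distrib_left
  proof (intro sum.cong refl)
    fix n assume "n \<in> {2..<N}"
    then have n: "n \<ge> 2" by simp
    show "fps_nth F n * ((x * a) ^ n - (x * b) ^ n) = (x * a - x * b) * (x * (fps_nth F n * (x ^ (n - 2) * h n)))"
      unfolding hp[OF n] by (simp only: mult_ac)
  qed
  finally have "ev (x * a) N F - ev (x * b) N F = (x * a - x * b) * (1 + x * g)" by (simp add: distrib_left)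
  moreover have "h n \<in> V" for n unfolding h_def using x by (intro V_sum) auto
  then have "g \<in> V" unfolding g_def using F x by (intro V_sum) (auto simp: VF_def)
  ultimately show ?thesis by blast
qed

text \<open>Newton iteration for the equation \<open>F t = x\<close>, modulo \<open>x ^ (k + 1)\<close>.\<close>
lemma solve_power_series:
  assumes F: "VF N F" "fps_nth F 0 = 0" "fps_nth F 1 = 1" "N \<ge> 2" and x: "x \<in> V"
  shows "\<exists>e\<in>V. \<exists>c\<in>V. x - ev (x * (1 + x * e)) N F = x ^ (Suc (Suc k)) * c"
proof (induction k)
  case 0
  obtain g where g: "g \<in> V" "ev (x * 1) N F - ev (x * 0) N F = (x * 1 - x * 0) * (1 + x * g)"
    using ev_difference[OF F x, of 1 0] by auto
  have "ev (x * 0) N F = 0" unfolding ev_def using F(2) by (intro sum.neutral) (auto simp: power_0_left)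
  then have "x - ev (x * (1 + x * 0)) N F = x ^ (Suc (Suc 0)) * (- g)" using g(2) by (simp add: algebra_simps)
  then show ?case using g(1) by (intro bexI[of _ 0] bexI[of _ "- g"]) auto
next
  case (Suc k)
  then obtain e c where ec: "e \<in> V" "c \<in> V" "x - ev (x * (1 + x * e)) N F = x ^ (Suc (Suc k)) * c" by blast
  \<comment> \<open>The argument \<open>x * (1 + x * e)\<close> is corrected by the whole remaining
    error, as the derivative is 1 modulo \<open>x\<close>.\<close>
  define e' where "e' = e + x ^ k * c"
  have e': "e' \<in> V" using ec x by (auto simp: e'_def)
  have d: "x * (1 + x * e') - x * (1 + x * e) = x ^ (Suc (Suc k)) * c" by (simp add: e'_def algebra_simps)
  obtain g where g: "g \<in> V" "ev (x * (1 + x * e')) N F - ev (x * (1 + x * e)) N F = (x * (1 + x * e') - x * (1 + x * e)) * (1 + x * g)"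
    using ev_difference[OF F x, of "1 + x * e'" "1 + x * e"] e' ec x by auto
  then have "x - ev (x * (1 + x * e')) N F = x ^ (Suc (Suc k)) * c - x ^ (Suc (Suc k)) * c * (1 + x * g)"
    unfolding d using ec(3) by (simp add: algebra_simps)
  also have "\<dots> = x ^ (Suc (Suc (Suc k))) * (- (c * g))" by (simp add: algebra_simps)
  finally show ?case using e' ec g by (intro bexI[of _ e'] bexI[of _ "- (c * g)"]) auto
qed

text \<open>The solution is \<open>x * u\<close> with \<open>u\<close> a unit, so an error in
  \<open>x ^ ell * V\<close> is the same as one in the \<open>ell\<close>-th power of the parameter
  times \<open>V\<close>.\<close>

lemma exists_parameter: "\<exists>t\<in>mm. t \<noteq> 0 \<and> rel t ell smF (sm v1)"
proof -
  define x where "x = sm v1"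
  have x: "x \<in> mm" "x \<noteq> 0" using formal_k[of 1] sm_k_nonzero[of 1] lam_not_dvd_1
    by (auto simp: formal_def x_def eis_coprime_eq)
  define k where "k = ell - 2"
  have k: "ell = Suc (Suc k)" using ell_ge_7 by (simp add: k_def)
  obtain e c where ec: "e \<in> V" "c \<in> V" "x - ev (x * (1 + x * e)) ell smF = x ^ ell * c"
    using solve_power_series[OF VF_smF _ _ _ mm_V[OF x(1)], of k] k ell_ge_7 by auto
  define u where "u = 1 + x * e"
  have "u - 1 \<in> mm" using x ec by (auto simp: u_def intro: mm_mult)
  then have u: "u \<noteq> 0" "inverse u \<in> V" "u \<in> V" using unit_plus_mm[of 1 u] mm_1 by auto
  have "x = ev (x * u) ell smF + (x * u) ^ ell * (inverse u ^ ell * c)"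
  proof -
    have "(x * u) ^ ell * (inverse u ^ ell * c) = x ^ ell * c * (u * inverse u) ^ ell"
      unfolding power_mult_distrib by (simp only: mult_ac)
    then have "(x * u) ^ ell * (inverse u ^ ell * c) = x ^ ell * c" using u(1) by simp
    then show ?thesis using ec(3) unfolding u_def[symmetric] by (simp only: diff_eq_eq add.commute)
  qed
  then have "rel (x * u) ell smF x" using u ec by (intro relI[of "inverse u ^ ell * c"]) auto
  then show ?thesis using x u by (intro bexI[of _ "x * u"]) (auto simp: x_def intro: mm_mult)
qed

definition tt :: complex where "tt = (SOME t. t \<in> mm \<and> t \<noteq> 0 \<and> rel t ell smF (sm v1))"

lemma tt: "tt \<in> mm" "tt \<noteq> 0" "rel tt ell smF (sm v1)" "tt \<in> V"
proof -
  have "\<exists>t. t \<in> mm \<and> t \<noteq> 0 \<and> rel t ell smF (sm v1)" using exists_parameter by blast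
  from someI_ex[OF this] show "tt \<in> mm" "tt \<noteq> 0" "rel tt ell smF (sm v1)" unfolding tt_def by auto
  then show "tt \<in> V" by simp
qed

text \<open>\<open>tt\<close> behaves like a logarithm of \<open>v1\<close>: multiplying the point
  by \<open>k\<close> is scaling the parameter by \<open>k\<close>.\<close>

definition good :: "complex \<Rightarrow> bool" where
  "good k \<longleftrightarrow> k \<in> eis \<and> rel tt ell (fps_scale k smF) (sm (k * v1)) \<and> rel tt ell (fps_scale k cmF) (cm (k * v1))"

lemma fps_scale_1: "fps_scale 1 F = F" by (rule fps_ext) (simp add: fps_scale_nth)

text \<open>The choice of \<open>tt\<close> only fixes \<open>sm v1\<close>. The value
  \<open>cm v1\<close> and the truncated series are both congruent to 1 and their cubes agree modulo
  \<open>tt ^ ell\<close>; the cofactor of their difference is congruent to 3, a unit.\<close>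

lemma good_1: "good 1"
proof -
  have f: "formal v1" by (rule formal_v1)
  define c where "c = cm v1"
  define c' where "c' = ev tt ell cmF"
  have r1: "rel tt ell (smF ^ 3) (sm v1 ^ 3)" by (rule rel_power[OF tt(4) VF_smF tt(3) ell_pos])
  have "rel tt ell (1 - smF ^ 3) (1 - sm v1 ^ 3)"
    using rel_diff[OF rel_const[OF ell_pos, of tt 1] r1] by simp
  moreover have "1 - smF ^ 3 = cmF ^ 3" using smF_cubes by (simp add: algebra_simps)
  moreover have "1 - sm v1 ^ 3 = c ^ 3" using sm_cm_cubes[of v1] f by (simp add: formal_def c_def algebra_simps)
  ultimately have "rel tt ell (cmF ^ 3) (c ^ 3)" by simp
  moreover have "rel tt ell (cmF ^ 3) (c' ^ 3)" unfolding c'_def by (rule rel_power[OF tt(4) VF_cmF rel_ev ell_pos])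
  ultimately obtain d where d: "d \<in> V" "c ^ 3 - c' ^ 3 = tt ^ ell * d" using rel_unique by blast
  have c1: "c - 1 \<in> mm" using f by (simp add: formal_def c_def)
  have c'V: "c' \<in> V" unfolding c'_def by (rule ev_V[OF tt(4) VF_cmF])
  have c'1: "c' - 1 \<in> mm"
  proof -
    have "{..<ell} = insert 0 {1..<ell}" using ell_pos by auto
    then have "c' - 1 = (\<Sum>n\<in>{1..<ell}. fps_nth cmF n * tt ^ n)" unfolding c'_def ev_def by simp
    also have "\<dots> \<in> mm"
    proof (intro mm_sum mm_mult')
      fix n assume n: "n \<in> {1..<ell}"
      then have "tt ^ n = tt * tt ^ (n - 1)" by (cases n) auto
      then show "tt ^ n \<in> mm" using tt mm_mult by simp
      show "fps_nth cmF n \<in> V" using n VF_cmF by (simp add: VF_def)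
    qed
    finally show ?thesis .
  qed
  define q where "q = c ^ 2 + c * c' + c' ^ 2"
  have "q - 3 = (c - 1) * (c + 1 + c') + (c' - 1) * (c' + 2)" by (simp add: q_def algebra_simps power2_eq_square)
  moreover have "c \<in> V" using formal_cm[OF f] by (simp add: c_def)
  ultimately have "q - 3 \<in> mm" using c1 c'1 c'V by (auto intro!: mm_add mm_mult)
  then have q: "q \<noteq> 0" "inverse q \<in> V"
    using unit_plus_mm[of 3 q] nat_unit[OF ell_not_dvd_small[of 3]] ell_ge_7 by auto
  have "(c - c') * q = tt ^ ell * d" unfolding d(2)[symmetric] q_def by (simp add: algebra_simps eval_nat_numeral)
  then have "c = ev tt ell cmF + tt ^ ell * (d * inverse q)" using q unfolding c'_def[symmetric] by (simp add: field_simps)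
  then have "rel tt ell cmF c" using d q by (intro relI[of "d * inverse q"]) auto
  then show ?thesis using tt(3) by (simp add: good_def fps_scale_1 c_def)
qed

lemma smF_rho: "rho ^ n * fps_nth smF n = rho * fps_nth smF n" and cmF_rho: "rho ^ n * fps_nth cmF n = fps_nth cmF n"
proof -
  have "(\<lambda>z. sm (rho * z)) has_fps_expansion fps_scale rho smF" by (rule fps_scale_expansion[OF sm_fps])
  moreover have "(\<lambda>z. rho * sm z) has_fps_expansion fps_const rho * smF" by (intro fps_expansion_intros sm_fps)
  ultimately have "fps_scale rho smF = fps_const rho * smF" unfolding sm_rho by (metis fps_expansion_unique_complex)
  then have "fps_nth (fps_scale rho smF) n = fps_nth (fps_const rho * smF) n" by simp
  then show "rho ^ n * fps_nth smF n = rho * fps_nth smF n" by (simp add: fps_scale_nth)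
  have "(\<lambda>z. cm (rho * z)) has_fps_expansion fps_scale rho cmF" by (rule fps_scale_expansion[OF cm_fps])
  then have "fps_scale rho cmF = cmF" unfolding cm_rho using cm_fps by (metis fps_expansion_unique_complex)
  then have "fps_nth (fps_scale rho cmF) n = fps_nth cmF n" by simp
  then show "rho ^ n * fps_nth cmF n = fps_nth cmF n" by (simp add: fps_scale_nth)
qed

lemma good_rho: assumes "good k" shows "good (rho * k)"
proof -
  have s: "fps_scale (rho * k) smF = fps_const rho * fps_scale k smF"
    by (rule fps_ext) (use smF_rho in \<open>simp add: fps_scale_nth power_mult_distrib mult.left_commute mult.assoc\<close>)
  have c: "fps_scale (rho * k) cmF = fps_scale k cmF"
    by (rule fps_ext) (use cmF_rho in \<open>simp add: fps_scale_nth power_mult_distrib mult.left_commute mult.assoc\<close>)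
  have "rel tt ell (fps_const rho * fps_scale k smF) (rho * sm (k * v1))"
    using assms tt by (intro rel_mult rel_const VF_const VF_scale VF_smF ell_pos) (auto simp: good_def)
  then show ?thesis using assms sm_rho[of "k * v1"] cm_rho[of "k * v1"]
    by (auto simp: good_def s c mult.assoc)
qed

text \<open>The formal and the actual addition theorem have matching right-hand sides, and their
  denominators match as well; the actual one is a unit and can be divided out.\<close>

lemma good_add: assumes "good a" "good b" shows "good (a + b)"
proof -
  have ab: "a \<in> eis" "b \<in> eis" using assms by (auto simp: good_def)
  then have V: "a \<in> V" "b \<in> V" "a + b \<in> V" by auto
  note VS = VF_scale[OF VF_smF] VF_scale[OF VF_cmF]
  have f: "formal (a * v1)" "formal (b * v1)" "formal ((a + b) * v1)" using ab formal_k by auto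
  define D where "D = fps_scale b cmF + fps_scale b smF ^ 2 * fps_scale a smF * fps_scale a cmF"
  define d where "d = cm (b * v1) + sm (b * v1) ^ 2 * sm (a * v1) * cm (a * v1)"
  define A where "A = fps_scale a smF + fps_scale a cmF ^ 2 * fps_scale b smF * fps_scale b cmF"
  define A' where "A' = fps_scale a cmF * fps_scale b cmF ^ 2 - fps_scale a smF ^ 2 * fps_scale b smF"
  have r: "rel tt ell (fps_scale a smF) (sm (a * v1))" "rel tt ell (fps_scale a cmF) (cm (a * v1))"
    "rel tt ell (fps_scale b smF) (sm (b * v1))" "rel tt ell (fps_scale b cmF) (cm (b * v1))"
    using assms by (auto simp: good_def)
  note ri = rel_add rel_diff rel_mult[OF tt(4)] rel_power[OF tt(4) _ _ ell_pos] r VF_mult VF_power VS V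
  have D: "rel tt ell D d" unfolding D_def d_def by (intro ri)
  have VD: "VF ell D" unfolding D_def by (intro VF_add VF_mult VF_power VS V)
  have "d - 1 \<in> mm" unfolding d_def by (rule formal_den[OF f(1,2)])
  then have d: "d \<noteq> 0" "inverse d \<in> V" using unit_plus_mm[of 1 d] mm_1 by auto
  have add: "(a + b) * v1 = a * v1 + b * v1" by (simp add: distrib_right)
  have dom: "a * v1 \<in> sdom" "b * v1 \<in> sdom" "a * v1 + b * v1 \<in> sdom" using f unfolding add formal_def by auto
  have "rel tt ell A (sm ((a + b) * v1) * d)"
    unfolding A_def d_def add addition_theorem(1)[OF dom] by (intro ri)
  then have 1: "rel tt ell (fps_scale (a + b) smF) (sm ((a + b) * v1))"
    by (intro rel_divide[OF tt(4) VS(1)[OF V(3)] VD _ D _ d]) (simp_all add: D_def A_def fps_addition_theorem(1))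
  have "rel tt ell A' (cm ((a + b) * v1) * d)"
    unfolding A'_def d_def add addition_theorem(2)[OF dom] by (intro ri)
  then have 2: "rel tt ell (fps_scale (a + b) cmF) (cm ((a + b) * v1))"
    by (intro rel_divide[OF tt(4) VS(2)[OF V(3)] VD _ D _ d]) (simp_all add: D_def A'_def fps_addition_theorem(2))
  show ?thesis using 1 2 ab by (auto simp: good_def)
qed

lemma good_eis: assumes "k \<in> eis" shows "good k"
proof -
  have m: "good (- k)" if "good k" for k
  proof -
    \<comment> \<open>Negation reduces to rotations and one addition:
      \<open>- k = rho * k + rho ^ 2 * k\<close>.\<close>
    have "good (rho * k + rho * (rho * k))" by (intro good_add good_rho that)
    moreover have "rho * k + rho * (rho * k) = - k"
    proof -
      have "rho * k + rho * (rho * k) = (rho + rho * rho) * k" by (simp only: distrib_right mult.assoc)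
      also have "rho + rho * rho = - 1" using rho_square' by (simp add: power2_eq_square)
      finally show ?thesis by simp
    qed
    ultimately show ?thesis by simp
  qed
  have 0: "good 0" using good_add[OF good_1 m[OF good_1]] by simp
  have nat: "good (of_nat n * k)" if "good k" for n k
  proof (induction n)
    case (Suc n)
    have "good (of_nat n * k + k)" by (rule good_add[OF Suc that])
    then show ?case by (simp add: algebra_simps)
  qed (use 0 in simp)
  have int: "good (of_int n * k)" if "good k" for n k
  proof (cases n rule: int_cases2)
    case (nonneg j) then show ?thesis using nat[OF that] by simp
  next
    case (nonpos j) then show ?thesis using m[OF nat[OF that, of j]] by simp
  qed
  obtain a b where "k = of_int a + of_int b * rho" using assms by (rule eisE)
  then show ?thesis using good_add[OF int[OF good_1, of a] int[OF good_rho[OF good_1], of b]] by simp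
qed

lemma lam_tt: "\<exists>c\<in>V. lam = tt ^ (ell - 1) * c"
proof -
  have "rel tt ell (fps_scale lam smF) (sm (lam * v1))" using good_eis[OF lam_eis] by (simp add: good_def)
  moreover have "lam * v1 \<in> lat3" using lat3_k[OF lam_eis] eis_dvd_self by simp
  ultimately have "rel tt ell (fps_scale lam smF) 0" by (simp add: sm_def)
  then obtain c where c: "c \<in> V" "0 = ev tt ell (fps_scale lam smF) + tt ^ ell * c" by (rule relE)
  obtain g where g: "g \<in> V" "ev (lam * tt) ell smF = (lam * tt) * (1 + (lam * tt) * g)"
    using rel_linear[OF _ VF_smF _ rel_ev, of "lam * tt"] ell_ge_7 tt(4) lam_eis by auto
  have "ev tt ell (fps_scale lam smF) = ev (lam * tt) ell smF"
    unfolding ev_def fps_scale_nth by (simp add: power_mult_distrib mult_ac)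
  then have eq: "(lam * tt) * (1 + (lam * tt) * g) = - (tt ^ ell * c)" using c(2) g(2) by (simp add: eq_neg_iff_add_eq_0)
  define w where "w = 1 + (lam * tt) * g"
  have "w - 1 \<in> mm" using lam_mm tt g by (auto simp: w_def intro!: mm_mult)
  then have w: "w \<noteq> 0" "inverse w \<in> V" using unit_plus_mm[of 1 w] mm_1 by auto
  have "tt ^ ell = tt * tt ^ (ell - 1)" using ell_pos by (metis power_eq_if neq0_conv)
  then have "tt * (lam * w) = tt * (tt ^ (ell - 1) * (- c))" using eq unfolding w_def[symmetric] by (simp add: mult_ac)
  then have "lam * w = tt ^ (ell - 1) * (- c)" using tt(2) by (simp only: mult_cancel_left) simp
  then have "lam = tt ^ (ell - 1) * (- c * inverse w)" using w by (simp add: field_simps)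
  then show ?thesis using c w by blast
qed

text \<open>The weight is \<open>n ^ e\<close> modulo \<open>lam\<close>, so the coefficient of
  degree \<open>j\<close> of the series is multiplied by the power sum of exponent
  \<open>e + j\<close>: -1 for \<open>j = j0\<close> and 0 otherwise, modulo \<open>lam\<close>.
  Multiples of \<open>lam\<close> are absorbed in the error, since \<open>Suc j0\<close> is at most
  \<open>ell - 1\<close>. The parameters \<open>e\<close> and \<open>N\<close> allow for both
  \<open>sm\<close> and its inverse.\<close>

lemma main_sum:
  assumes w: "\<And>n. n \<in> {1..<ell} \<Longrightarrow> w n \<in> V" "\<And>n. n \<in> {1..<ell} \<Longrightarrow> \<exists>d\<in>V. w n = of_nat n ^ e + lam * d"
    and Y: "\<And>n. n \<in> {1..<ell} \<Longrightarrow> rel tt N (fps_scale (of_nat n) F) (Y n)" and F: "VF N F"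
    and j0: "j0 < N" "Suc j0 \<le> ell - 1" "\<And>j. j < N \<Longrightarrow> (ell - 1) dvd (e + j) \<longleftrightarrow> j = j0"
  shows "\<exists>c\<in>V. (\<Sum>n\<in>{1..<ell}. w n * Y n) = - fps_nth F j0 * tt ^ j0 + tt ^ Suc j0 * c"
proof -
  let ?S = "{1..<ell}"
  have "\<forall>n\<in>?S. \<exists>c\<in>V. Y n = ev tt N (fps_scale (of_nat n) F) + tt ^ N * c" using Y unfolding rel_def by blast
  then obtain c where c: "\<And>n. n \<in> ?S \<Longrightarrow> c n \<in> V" "\<And>n. n \<in> ?S \<Longrightarrow> Y n = ev tt N (fps_scale (of_nat n) F) + tt ^ N * c n"
    unfolding Bex_def Ball_def by metis
  obtain l where l: "l \<in> V" "lam = tt ^ (ell - 1) * l" using lam_tt by blast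
  have "\<exists>d\<in>V. (\<Sum>n\<in>?S. w n * of_nat n ^ j) = (if (ell - 1) dvd (e + j) then - 1 else 0) + lam * d" for j
  proof -
    obtain d where d: "\<And>n. n \<in> ?S \<Longrightarrow> d n \<in> V" "\<And>n. n \<in> ?S \<Longrightarrow> w n = of_nat n ^ e + lam * d n"
      using w(2) unfolding Bex_def by metis
    obtain z where z: "z \<in> eis" "(\<Sum>n\<in>?S. of_nat n ^ (e + j)) - (if (ell - 1) dvd (e + j) then - 1 else 0) = lam * z"
      using power_sum_cong[of "e + j"] unfolding eis_cong_def by (rule eis_dvdE)
    have "(\<Sum>n\<in>?S. w n * of_nat n ^ j) = (\<Sum>n\<in>?S. of_nat n ^ (e + j) + lam * (d n * of_nat n ^ j))"
      by (intro sum.cong refl) (simp add: d(2) power_add algebra_simps)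
    also have "\<dots> = (\<Sum>n\<in>?S. of_nat n ^ (e + j)) + lam * (\<Sum>n\<in>?S. d n * of_nat n ^ j)"
      by (simp add: sum.distrib sum_distrib_left)
    also have "(\<Sum>n\<in>?S. of_nat n ^ (e + j)) = (if (ell - 1) dvd (e + j) then - 1 else 0) + lam * z"
      using z(2) by (simp add: algebra_simps)
    finally have "(\<Sum>n\<in>?S. w n * of_nat n ^ j) = (if (ell - 1) dvd (e + j) then - 1 else 0) + lam * (z + (\<Sum>n\<in>?S. d n * of_nat n ^ j))"
      by (simp add: distrib_left)
    moreover have "z + (\<Sum>n\<in>?S. d n * of_nat n ^ j) \<in> V" using z d by (intro V_simps(5) V_sum) auto
    ultimately show ?thesis by blast
  qed
  then obtain d where d: "\<And>j. d j \<in> V"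
    "\<And>j. (\<Sum>n\<in>?S. w n * of_nat n ^ j) = (if (ell - 1) dvd (e + j) then - 1 else 0) + lam * d j"
    unfolding Bex_def by metis
  have "(\<Sum>n\<in>?S. w n * Y n) = (\<Sum>n\<in>?S. \<Sum>j<N. w n * (of_nat n ^ j * (fps_nth F j * tt ^ j))) + tt ^ N * (\<Sum>n\<in>?S. w n * c n)"
    by (simp add: c(2) ev_def fps_scale_nth distrib_left sum.distrib sum_distrib_left mult_ac)
  also have "(\<Sum>n\<in>?S. \<Sum>j<N. w n * (of_nat n ^ j * (fps_nth F j * tt ^ j))) = (\<Sum>j<N. (\<Sum>n\<in>?S. w n * of_nat n ^ j) * (fps_nth F j * tt ^ j))"
    by (subst sum.swap) (simp add: sum_distrib_right mult.assoc)
  also have "\<dots> = (\<Sum>j<N. (if j = j0 then - 1 else 0) * (fps_nth F j * tt ^ j) + lam * (d j * (fps_nth F j * tt ^ j)))"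
  proof (intro sum.cong refl)
    fix j assume "j \<in> {..<N}"
    then show "(\<Sum>n\<in>?S. w n * of_nat n ^ j) * (fps_nth F j * tt ^ j)
       = (if j = j0 then - 1 else 0) * (fps_nth F j * tt ^ j) + lam * (d j * (fps_nth F j * tt ^ j))"
      unfolding d(2) using j0(3)[of j] by (simp add: distrib_right mult.assoc)
  qed
  also have "\<dots> = - fps_nth F j0 * tt ^ j0 + lam * (\<Sum>j<N. d j * (fps_nth F j * tt ^ j))"
  proof -
    have "(\<Sum>j<N. (if j = j0 then - 1 else 0) * (fps_nth F j * tt ^ j)) = (\<Sum>j\<in>{j0}. - 1 * (fps_nth F j * tt ^ j))"
      by (rule sum.mono_neutral_cong_right) (use j0 in auto)
    then show ?thesis by (simp add: sum.distrib sum_distrib_left)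
  qed
  finally have sum: "(\<Sum>n\<in>?S. w n * Y n) = - fps_nth F j0 * tt ^ j0 + lam * (\<Sum>j<N. d j * (fps_nth F j * tt ^ j)) + tt ^ N * (\<Sum>n\<in>?S. w n * c n)" .
  have p1: "tt ^ (ell - 1) = tt ^ Suc j0 * tt ^ (ell - 1 - Suc j0)" and p2: "tt ^ N = tt ^ Suc j0 * tt ^ (N - Suc j0)"
    using j0 by (simp_all only: le_add_diff_inverse Suc_leI flip: power_add)
  define q where "q = tt ^ (ell - 1 - Suc j0) * l * (\<Sum>j<N. d j * (fps_nth F j * tt ^ j)) + tt ^ (N - Suc j0) * (\<Sum>n\<in>?S. w n * c n)"
  define W W' where "W = (\<Sum>j<N. d j * (fps_nth F j * tt ^ j))" and "W' = (\<Sum>n\<in>?S. w n * c n)"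
  have "lam * W = (tt ^ (ell - 1) * l) * W" by (rule arg_cong[OF l(2), of "\<lambda>y. y * W"])
  then have lW: "lam * W = tt ^ Suc j0 * (tt ^ (ell - 1 - Suc j0) * l * W)" unfolding p1 by (simp only: mult.assoc)
  have tW: "tt ^ N * W' = tt ^ Suc j0 * (tt ^ (N - Suc j0) * W')" by (subst p2) (rule mult.assoc)
  have "(\<Sum>n\<in>?S. w n * Y n) = - fps_nth F j0 * tt ^ j0 + tt ^ Suc j0 * q"
    unfolding sum q_def W_def[symmetric] W'_def[symmetric] lW tW by (simp only: distrib_left add.assoc)
  moreover have "q \<in> V" unfolding q_def using l d F w c tt(4)
    by (intro V_simps(5) V_simps(6) V_sum cring_set_power[OF V_ring]) (auto simp: VF_def)
  ultimately show ?thesis by blast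
qed

section \<open>The two character sums\<close>

lemma chi_V_cong: "n \<in> {1..<ell} \<Longrightarrow> \<exists>d\<in>V. cres (of_nat n) = of_nat n ^ kk + lam * d"
proof -
  assume "n \<in> {1..<ell}"
  then have "eis_cong lam (cres (of_nat n)) (of_nat n ^ kk)" using chi nat_U' by blast
  then obtain z where "z \<in> eis" "cres (of_nat n) - of_nat n ^ kk = lam * z" unfolding eis_cong_def by (rule eis_dvdE)
  then show ?thesis by (intro bexI[of _ z]) (auto simp: algebra_simps)
qed

lemma kk_ge_2: "kk \<ge> 2" using ell_kk ell_ge_7 by linarith

lemma ell_minus_1: "ell - 1 = 3 * kk" using ell_kk by simp

lemma dvd_small_multiple:
  assumes "kk > 0" "3 * kk dvd m" "0 < m" "m < 6 * kk" shows "m = 3 * kk"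
proof -
  obtain q where q: "m = 3 * kk * q" using assms(2) by blast
  have "q < 2"
  proof (rule ccontr)
    assume "\<not> q < 2"
    then have "3 * kk * 2 \<le> 3 * kk * q" by (intro mult_left_mono) auto
    then show False using assms(4) q by linarith
  qed
  moreover have "q \<noteq> 0" using assms q by auto
  ultimately show ?thesis using q by (cases q) auto
qed

lemma C_sum: "\<exists>c\<in>V. (\<Sum>n\<in>{1..<ell}. cres (of_nat n) * sm (of_nat n * v1)) = - fps_nth smF (2 * kk) * tt ^ (2 * kk) + tt ^ Suc (2 * kk) * c"
proof (rule main_sum[of _ kk ell])
  show "\<And>n. n \<in> {1..<ell} \<Longrightarrow> cres (of_nat n) \<in> V" using chi_eis nat_U' by blast
  show "\<And>n. n \<in> {1..<ell} \<Longrightarrow> \<exists>d\<in>V. cres (of_nat n) = of_nat n ^ kk + lam * d" by (rule chi_V_cong)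
  show "\<And>n. n \<in> {1..<ell} \<Longrightarrow> rel tt ell (fps_scale (of_nat n) smF) (sm (of_nat n * v1))"
    using good_eis by (auto simp: good_def)
  show "VF ell smF" by (rule VF_smF)
  show "2 * kk < ell" "Suc (2 * kk) \<le> ell - 1" using ell_kk kk_pos by auto
  fix j assume "j < ell"
  then have j: "kk + j < 6 * kk" using ell_kk kk_ge_2 by linarith
  show "ell - 1 dvd kk + j \<longleftrightarrow> j = 2 * kk" unfolding ell_minus_1
    using dvd_small_multiple[of "kk + j"] j kk_pos by auto
qed

text \<open>The pole of \<open>1 / sm\<close> is removed by a factor \<open>n * tt\<close>, which
  leads to the inverse of the unit series \<open>smF / X\<close>. The compensating
  \<open>1 / n\<close> is \<open>n ^ (ell - 2)\<close> modulo \<open>lam\<close> and changes the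
  exponent of the weight to \<open>kk + (ell - 2)\<close>; the factor \<open>tt\<close> is cancelled
  at the end, which turns degree \<open>2 * kk + 1\<close> into \<open>2 * kk\<close>.\<close>

lemma D_sum: "\<exists>c\<in>V. (\<Sum>n\<in>{1..<ell}. cres (of_nat n) * inverse (sm (of_nat n * v1)))
   = - fps_nth (inverse (fps_shift 1 smF)) (2 * kk + 1) * tt ^ (2 * kk) + tt ^ Suc (2 * kk) * c"
proof -
  define E where "E = fps_shift 1 smF"
  define I where "I = inverse E"
  define X where "X = (\<lambda>n. sm (of_nat n * v1))"
  have E0: "fps_nth E 0 = 1" by (simp add: E_def)
  have IE: "I * E = 1" unfolding I_def using E0 by (intro inverse_mult_eq_1) simp
  have VE: "VF (ell - 1) E" using VF_smF by (auto simp: VF_def E_def)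
  have VI: "VF (ell - 1) I" unfolding VF_def I_def E_def using inverse_shift_Zl Zl_V by blast
  have nn: "of_nat n \<noteq> (0::complex)" "inverse (of_nat n) \<in> V" "of_nat n \<in> U" if "n \<in> {1..<ell}" for n
    using that nat_inverse[OF ell_not_dvd_small[of n]] nat_U' by auto
  have X0: "X n \<noteq> 0" if "n \<in> {1..<ell}" for n unfolding X_def using sm_k_nonzero nn(3)[OF that] by blast
  have l1: "ell - 1 > 0" using ell_gt_1 by simp
  have rY: "rel tt (ell - 1) (fps_scale (of_nat n) I) (of_nat n * tt / X n)" if n: "n \<in> {1..<ell}" for n
  proof -
    let ?n = "of_nat n :: complex"
    have "rel tt ell (fps_scale ?n smF) (X n)" using good_eis[of ?n] by (simp add: good_def X_def)
    then obtain c where c: "c \<in> V" "X n = ev tt ell (fps_scale ?n smF) + tt ^ ell * c" by (rule relE)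
    have ell': "ell = Suc (ell - 1)" using ell_pos by simp
    have "ev tt ell (fps_scale ?n smF) = (\<Sum>j<ell - 1. (?n * tt) * (fps_nth (fps_scale ?n E) j * tt ^ j))"
      unfolding ev_def by (subst ell', subst sum.lessThan_Suc_shift) (simp add: fps_scale_nth E_def mult_ac)
    then have e: "ev tt ell (fps_scale ?n smF) = ?n * tt * ev tt (ell - 1) (fps_scale ?n E)"
      by (simp add: ev_def sum_distrib_left)
    have "tt ^ ell = tt * tt ^ (ell - 1)" using ell' by (metis power_Suc)
    then have Xn: "X n / (?n * tt) = ev tt (ell - 1) (fps_scale ?n E) + tt ^ (ell - 1) * (c * inverse ?n)"
      unfolding c(2) e using nn[OF n] tt(2) by (simp add: field_simps)
    then have r: "rel tt (ell - 1) (fps_scale ?n E) (X n / (?n * tt))"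
      using c nn[OF n] by (intro relI[of "c * inverse ?n"]) auto
    have VnE: "VF (ell - 1) (fps_scale ?n E)" and VnI: "VF (ell - 1) (fps_scale ?n I)"
      using VF_scale VE VI by auto
    have prod: "fps_scale ?n I * fps_scale ?n E = 1"
    proof -
      have "fps_scale ?n I * fps_scale ?n E = fps_scale ?n (I * E)"
        unfolding fps_scale_def by (rule fps_compose_mult_distrib[symmetric]) simp
      then show ?thesis unfolding IE by (simp add: fps_scale_def)
    qed
    have d0: "X n / (?n * tt) \<noteq> 0" using X0[OF n] nn[OF n] tt(2) by simp
    have dV: "inverse (X n / (?n * tt)) \<in> V"
    proof -
      obtain g where g: "g \<in> V" "X n = tt * (fps_nth (fps_scale ?n smF) 1 + tt * g)"
        using rel_linear[OF tt(4) VF_scale[OF VF_smF] _ \<open>rel tt ell (fps_scale ?n smF) (X n)\<close>] ell_ge_7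
        by (auto simp: fps_scale_nth)
      then have "X n / (?n * tt) - 1 = tt * (g * inverse ?n)" using nn[OF n] tt(2) by (simp add: fps_scale_nth field_simps)
      also have "\<dots> \<in> mm" using tt g nn[OF n] by (intro mm_mult) auto
      finally show ?thesis using unit_plus_mm[of 1 "X n / (?n * tt)"] mm_1 by auto
    qed
    have "rel tt (ell - 1) 1 (of_nat n * tt / X n * (X n / (?n * tt)))"
      using rel_const[OF l1, of tt 1] X0[OF n] nn[OF n] tt(2) by simp
    then show ?thesis by (rule rel_divide[OF tt(4) VnI VnE prod r _ d0 dV])
  qed
  have "\<exists>c\<in>V. (\<Sum>n\<in>{1..<ell}. (cres (of_nat n) * inverse (of_nat n)) * (of_nat n * tt / X n))
      = - fps_nth I (2 * kk + 1) * tt ^ (2 * kk + 1) + tt ^ Suc (2 * kk + 1) * c"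
  proof (rule main_sum[of _ "kk + (ell - 2)" "ell - 1"])
    fix n assume n: "n \<in> {1..<ell}"
    let ?n = "of_nat n :: complex"
    show "cres ?n * inverse ?n \<in> V" using nn[OF n] chi_eis by auto
    obtain d where d: "d \<in> V" "cres ?n = ?n ^ kk + lam * d" using chi_V_cong[OF n] by blast
    obtain z where z: "z \<in> eis" "?n ^ (ell - 1) - 1 = lam * z"
      using fermat[OF nn(3)[OF n]] unfolding eis_cong_def by (rule eis_dvdE)
    have "?n ^ (ell - 1) = ?n * ?n ^ (ell - 2)" using ell_gt_1 by (metis Suc_diff_Suc numeral_2_eq_2 One_nat_def power_Suc)
    then have "inverse ?n = ?n ^ (ell - 2) - lam * (z * inverse ?n)"
      using z(2) nn[OF n] by (simp add: field_simps)
    then have "?n ^ kk * inverse ?n = ?n ^ kk * (?n ^ (ell - 2) - lam * (z * inverse ?n))" by (rule arg_cong)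
    then have "cres ?n * inverse ?n = ?n ^ (kk + (ell - 2)) + lam * (d * inverse ?n - ?n ^ kk * (z * inverse ?n))"
      unfolding d(2) power_add distrib_right by (simp only: right_diff_distrib mult_ac) (simp only: diff_add_eq add_diff_eq diff_conv_add_uminus add_ac)
    moreover have "d * inverse ?n - ?n ^ kk * (z * inverse ?n) \<in> V" using d z nn[OF n] by auto
    ultimately show "\<exists>d\<in>V. cres ?n * inverse ?n = ?n ^ (kk + (ell - 2)) + lam * d" by blast
    show "rel tt (ell - 1) (fps_scale ?n I) (?n * tt / X n)" by (rule rY[OF n])
  next
    show "VF (ell - 1) I" by (rule VI)
    show "2 * kk + 1 < ell - 1" "Suc (2 * kk + 1) \<le> ell - 1" unfolding ell_minus_1 using kk_ge_2 by auto
    fix j assume "j < ell - 1"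
    then have j: "j < 3 * kk" unfolding ell_minus_1 .
    have e: "kk + (ell - 2) + j = 3 * kk + (kk + j - 1)" using ell_kk kk_pos by simp
    have "3 * kk dvd kk + (ell - 2) + j \<longleftrightarrow> 3 * kk dvd kk + j - 1" unfolding e by simp
    also have "\<dots> \<longleftrightarrow> j = 2 * kk + 1"
    proof
      assume "3 * kk dvd kk + j - 1"
      then have "kk + j - 1 = 3 * kk" using j kk_ge_2 by (intro dvd_small_multiple) auto
      then show "j = 2 * kk + 1" using kk_ge_2 by linarith
    qed simp
    finally show "ell - 1 dvd kk + (ell - 2) + j \<longleftrightarrow> j = 2 * kk + 1" unfolding ell_minus_1 .
  qed
  then obtain c where c: "c \<in> V" "(\<Sum>n\<in>{1..<ell}. (cres (of_nat n) * inverse (of_nat n)) * (of_nat n * tt / X n))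
      = - fps_nth I (2 * kk + 1) * tt ^ (2 * kk + 1) + tt ^ Suc (2 * kk + 1) * c" by blast
  have "(\<Sum>n\<in>{1..<ell}. (cres (of_nat n) * inverse (of_nat n)) * (of_nat n * tt / X n)) = tt * (\<Sum>n\<in>{1..<ell}. cres (of_nat n) * inverse (X n))"
    unfolding sum_distrib_left using nn(1) by (intro sum.cong refl) (simp add: field_simps)
  then have "tt * (\<Sum>n\<in>{1..<ell}. cres (of_nat n) * inverse (X n)) = tt * (- fps_nth I (2 * kk + 1) * tt ^ (2 * kk) + tt ^ Suc (2 * kk) * c)"
    using c(2) by (simp add: algebra_simps)
  then have "(\<Sum>n\<in>{1..<ell}. cres (of_nat n) * inverse (X n)) = - fps_nth I (2 * kk + 1) * tt ^ (2 * kk) + tt ^ Suc (2 * kk) * c"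
    using tt(2) by (simp only: mult_cancel_left) simp
  then show ?thesis using c(1) unfolding X_def I_def E_def by blast
qed

end

section \<open>The Gauss sum\<close>

context eis_prime3
begin

definition CC :: "nat set" where "CC = {n. n \<in> {1..<ell} \<and> cres (of_nat n) = 1}"

lemma CC_D: "n \<in> CC \<Longrightarrow> n \<in> {1..<ell}" "n \<in> CC \<Longrightarrow> of_nat n \<in> U" "n \<in> CC \<Longrightarrow> cres (of_nat n) = 1"
  using nat_U' by (auto simp: CC_def)

lemma finite_CC [simp, intro]: "finite CC" by (simp add: CC_def)

lemma one_U: "1 \<in> U" using nat_U'[of 1] ell_gt_1 by simp

lemma chi_1: "cres 1 = 1" by (rule chi_eqI[OF one_U]) auto

lemma prod_CC_reindex:
  assumes a: "a \<in> U" "cres a = 1" and F: "resp (F :: complex \<Rightarrow> complex)"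
  shows "(\<Prod>n\<in>CC. F (a * of_nat n)) = (\<Prod>n\<in>CC. F (of_nat n))"
proof -
  define p where "p = (\<lambda>n. rep (a * of_nat n))"
  have pU: "a * of_nat n \<in> U" if "n \<in> CC" for n using U_mult a CC_D that by blast
  have "cres (of_nat (p n)) = 1" if "n \<in> CC" for n
    using resp_rep[OF chi_resp pU[OF that]] chi_mult[OF a(1) CC_D(2)[OF that]] a(2) CC_D(3)[OF that]
    by (simp add: p_def)
  then have "p ` CC \<subseteq> CC" using rep(1)[OF pU] unfolding CC_def p_def by blast
  moreover have "inj_on p CC"
    using bij_rep_mult[OF a(1)] unfolding bij_betw_def p_def by (auto intro: inj_on_subset simp: CC_def)
  ultimately have im: "p ` CC = CC" and inj: "inj_on p CC" by (simp_all add: endo_inj_surj)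
  have "(\<Prod>n\<in>CC. F (of_nat n)) = (\<Prod>n\<in>p ` CC. F (of_nat n))" unfolding im ..
  also have "\<dots> = (\<Prod>n\<in>CC. F (of_nat (p n)))" using inj by (simp add: prod.reindex)
  also have "\<dots> = (\<Prod>n\<in>CC. F (a * of_nat n))"
    unfolding p_def by (intro prod.cong refl resp_rep[OF F] pU)
  finally show ?thesis by simp
qed

lemma exists_inverse_CC:
  assumes n: "n \<in> CC" shows "\<exists>d\<in>CC. eis_cong lam (of_nat n * of_nat d) 1"
proof -
  define z :: complex where "z = of_nat n ^ (ell - 2)"
  have "Suc (ell - 2) = ell - 1" using ell_gt_1 by linarith
  then have "of_nat n * z = of_nat n ^ (ell - 1)" unfolding z_def by (metis power_Suc)
  then have nz: "eis_cong lam (of_nat n * z) 1" using fermat[OF CC_D(2)[OF n]] by simp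
  have z: "z \<in> U" using nz unfolding eis_coprime_def
    by (intro CollectI conjI bexI[of _ "of_nat n"]) (auto simp: z_def mult.commute)
  have r: "rep z \<in> {1..<ell}" "eis_cong lam z (of_nat (rep z))" using rep[OF z] by auto
  have "eis_cong lam (of_nat n * z) (of_nat n * of_nat (rep z))"
    using r z by (intro eis_cong_mult) (auto simp: eis_coprime_eq)
  then have c: "eis_cong lam (of_nat n * of_nat (rep z)) 1" using nz eis_cong_trans eis_cong_sym by blast
  have "cres (of_nat n * of_nat (rep z)) = cres 1"
    using c CC_D(2)[OF n] nat_U'[OF r(1)] by (intro respD[OF chi_resp] U_mult one_U)
  then have "cres (of_nat (rep z)) = 1"
    using chi_mult[OF CC_D(2)[OF n] nat_U'[OF r(1)]] CC_D(3)[OF n] chi_1 by simp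
  then show ?thesis using c r by (auto simp: CC_def)
qed

text \<open>Pairs every cubic residue with its inverse. In the square of \<open>lambda_tilde\<close>
  the factors can then be grouped so that the leading residues multiply to 1.\<close>

lemma CC_involution:
  obtains j where "\<And>n. n \<in> CC \<Longrightarrow> eis_cong lam (of_nat n * of_nat (j n)) 1" "bij_betw j CC CC"
proof -
  obtain j where j: "\<And>n. n \<in> CC \<Longrightarrow> j n \<in> CC" "\<And>n. n \<in> CC \<Longrightarrow> eis_cong lam (of_nat n * of_nat (j n)) 1"
    using exists_inverse_CC by metis
  have "inj_on j CC"
  proof (rule inj_onI)
    fix m n assume mn: "m \<in> CC" "n \<in> CC" "j m = j n"
    have "eis_cong lam (of_nat m * of_nat (j n)) (of_nat n * of_nat (j n))"
      using j(2)[OF mn(1)] j(2)[OF mn(2)] unfolding mn(3) by (rule eis_cong_common)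
    then have "eis_dvd lam ((of_nat m - of_nat n) * of_nat (j n))"
      unfolding eis_cong_def by (simp only: left_diff_distrib)
    then have "eis_dvd lam (of_nat m - of_nat n) \<or> eis_dvd lam (of_nat (j n))"
      by (rule lam_prime) auto
    moreover have "\<not> eis_dvd lam (of_nat (j n))" using CC_D(2)[OF j(1)[OF mn(2)]] by (simp add: eis_coprime_eq)
    ultimately show "m = n" using nat_cong_unique[of m n] CC_D(1) mn by (auto simp: eis_cong_def)
  qed
  moreover have "j ` CC \<subseteq> CC" using j(1) by blast
  ultimately have "bij_betw j CC CC" by (simp add: bij_betw_def endo_inj_surj)
  then show ?thesis using that j(2) by blast
qed

end

text \<open>Since \<open>ell = 3 * kk + 1\<close>, this is the condition that \<open>ell\<close> is
  4 or 7 modulo 9; it makes the character nontrivial on \<open>rho\<close>.\<close>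

locale eis_val9 = eis_val +
  assumes kk_mod: "kk mod 3 \<noteq> 0"
begin

lemma chi_rho_cases: "cres rho = rho \<or> cres rho = rho ^ 2"
proof -
  have "rho ^ kk = rho ^ (3 * (kk div 3) + kk mod 3)" by simp
  also have "\<dots> = (rho ^ 3) ^ (kk div 3) * rho ^ (kk mod 3)" by (simp only: power_add power_mult)
  finally have "rho ^ kk = rho ^ (kk mod 3)" by (simp add: rho_cube)
  moreover have "kk mod 3 = 1 \<or> kk mod 3 = 2" using kk_mod by linarith
  ultimately show ?thesis using chi_rho by auto
qed

text \<open>The value \<open>cres rho\<close> generates the cube roots of unity, so a power of
  \<open>rho\<close> compensates \<open>cres x\<close>.\<close>

lemma rho_normalize:
  assumes "x \<in> U" shows "\<exists>i. cres (rho ^ i * x) = 1"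
proof -
  have c: "cres x = 1 \<or> cres x = rho \<or> cres x = rho ^ 2" using chi(1)[OF assms] unfolding cube_roots .
  have r1: "cres (rho * y) = cres rho * cres y" if "y \<in> U" for y using chi_mult[OF rho_U that] .
  have r2: "cres (rho ^ 2 * y) = cres rho ^ 2 * cres y" if "y \<in> U" for y
    using r1[OF that] r1[OF U_mult[OF rho_U that]] by (simp add: power2_eq_square mult.assoc)
  have p: "rho * rho ^ 2 = 1" "rho ^ 2 * rho = 1" "rho ^ 2 * rho ^ 2 = rho" "(rho ^ 2) ^ 2 = rho"
    using rho_cube by (simp_all add: eval_nat_numeral mult.assoc)
  show ?thesis
    using c chi_rho_cases
  proof (elim disjE)
    assume "cres x = 1" then show ?thesis by (intro exI[of _ 0]) simp
  next
    assume "cres x = rho" "cres rho = rho"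
    then show ?thesis using r2[OF assms] p by (intro exI[of _ 2]) simp
  next
    assume "cres x = rho" "cres rho = rho ^ 2"
    then show ?thesis using r1[OF assms] p by (intro exI[of _ 1]) simp
  next
    assume "cres x = rho ^ 2" "cres rho = rho"
    then show ?thesis using r1[OF assms] p by (intro exI[of _ 1]) simp
  next
    assume "cres x = rho ^ 2" "cres rho = rho ^ 2"
    then have "cres (rho ^ 2 * x) = (rho ^ 2) ^ 2 * rho ^ 2" using r2[OF assms] by (simp only:)
    then have "cres (rho ^ 2 * x) = 1" by (simp only: p)
    then show ?thesis by blast
  qed (auto intro: exI[of _ 0])
qed

lemma chi_power: "x \<in> U \<Longrightarrow> x ^ i \<in> U \<and> cres (x ^ i) = cres x ^ i"
  by (induction i) (auto simp: one_U chi_1 U_mult chi_mult)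

lemma rho_neq_1: "rho \<noteq> 1" and rho_square_neq_1: "rho ^ 2 \<noteq> 1"
  using rho_diff_norm by auto

text \<open>Orthogonality: \<open>1 + c + c ^ 2\<close> is 3 or 0 according as the character value
  \<open>c\<close> is 1 or not, and the character and its square sum to 0 because neither is 1 at
  \<open>rho\<close>.\<close>

lemma card_CC: "card CC = kk"
proof -
  define w where "w = cres rho"
  have w: "w \<noteq> 1" "w ^ 2 \<noteq> 1"
  proof -
    have "(rho ^ 2) ^ 2 = rho" using rho_cube by (simp add: eval_nat_numeral mult.assoc)
    then show "w \<noteq> 1" "w ^ 2 \<noteq> 1" using chi_rho_cases rho_neq_1 rho_square_neq_1 by (auto simp: w_def)
  qed
  have vanish: "(\<Sum>n\<in>{1..<ell}. cres (of_nat n) ^ k) = 0" if "w ^ k \<noteq> 1" for k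
  proof -
    have r: "resp (\<lambda>x. cres x ^ k)" using respD[OF chi_resp] unfolding resp_def by metis
    have "(\<Sum>n\<in>{1..<ell}. cres (of_nat n) ^ k) = (\<Sum>n\<in>{1..<ell}. cres (rho * of_nat n) ^ k)"
      using sum_mult_reindex[OF rho_U r] by simp
    also have "\<dots> = (\<Sum>n\<in>{1..<ell}. w ^ k * cres (of_nat n) ^ k)"
      by (intro sum.cong refl) (simp add: chi_mult[OF rho_U nat_U'] w_def power_mult_distrib)
    finally show ?thesis using that by (simp flip: sum_distrib_left)
  qed
  have "(1 + cres (of_nat n) ^ 1 + cres (of_nat n) ^ 2 :: complex) = (if n \<in> CC then 3 else 0)" if n: "n \<in> {1..<ell}" for n
  proof (cases "n \<in> CC")
    case False
    then have "cres (of_nat n) = rho \<or> cres (of_nat n) = rho ^ 2"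
      using chi(1)[OF nat_U'[OF n]] n unfolding cube_roots CC_def by blast
    moreover have "(rho ^ 2) ^ 2 = rho" using rho_cube by (simp add: eval_nat_numeral mult.assoc)
    ultimately show ?thesis using False rho_sum by (auto simp: add_ac)
  qed (simp add: CC_def)
  then have "(\<Sum>n\<in>{1..<ell}. 1 + cres (of_nat n) ^ 1 + cres (of_nat n) ^ 2) = (\<Sum>n\<in>{1..<ell}. if n \<in> CC then 3 else 0)"
    by (rule sum.cong[OF refl])
  also have "\<dots> = (\<Sum>n\<in>CC. 3)"
    by (rule sum.mono_neutral_cong_right) (auto simp: CC_def)
  also have "\<dots> = 3 * of_nat (card CC)" by simp
  finally have "(\<Sum>n\<in>{1..<ell}. (1::complex)) = 3 * of_nat (card CC)"
    unfolding sum.distrib using vanish[of 1] vanish[of 2] w by simp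
  moreover have "(\<Sum>n\<in>{1..<ell}. (1::complex)) = 3 * of_nat kk"
    unfolding sum_constant card_atLeastLessThan ell_minus_1 by simp
  ultimately have "(of_nat (card CC) :: complex) = of_nat kk" by simp
  then show ?thesis by (simp only: of_nat_eq_iff)
qed

lemma resp_sm: "resp (\<lambda>x. sm (x * v1))"
  unfolding resp_def
proof (intro ballI impI)
  fix x y assume xy: "x \<in> U" "y \<in> U" "eis_cong lam x y"
  then have "(x - y) * v1 \<in> lat3" using lat3_k[of "x - y"] by (auto simp: eis_cong_def eis_coprime_eq)
  then have "sm (y * v1 + (x - y) * v1) = sm (y * v1)" by (rule sm_shift)
  then show "sm (x * v1) = sm (y * v1)" by (simp add: algebra_simps)
qed

lemma phi_sm: assumes "x \<in> U" shows "phi (x / lam) = sm (x * v1)"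
proof -
  have "x / lam \<notin> eis" using tp_U[OF assms] by (simp add: tp_def plat_def)
  from phi_eq_sm[OF this] show ?thesis by (simp add: v1_def mult_ac)
qed

text \<open>\<open>PP s\<close> and \<open>NN f s\<close> are \<open>lambda_tilde\<close> and three
  times the Gauss sum with all division points multiplied by \<open>s\<close>.\<close>

definition PP :: "complex \<Rightarrow> complex" where "PP s = (\<Prod>n\<in>CC. sm (s * of_nat n * v1))"

definition NN :: "(complex \<Rightarrow> complex) \<Rightarrow> complex \<Rightarrow> complex" where
  "NN f s = (\<Sum>n\<in>{1..<ell}. cres (of_nat n) * f (sm (s * of_nat n * v1)))"

lemma PP_nonzero: "s \<in> U \<Longrightarrow> PP s \<noteq> 0"
  unfolding PP_def using sm_k_nonzero U_mult CC_D(2) by simp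

text \<open>If \<open>rho ^ i * s\<close> is a cubic residue, it permutes the factors, and the
  \<open>kk\<close> rotations contribute \<open>rho ^ (i * kk)\<close>, which is the character of
  \<open>rho ^ i\<close>.\<close>

lemma PP_s: assumes "s \<in> U" shows "PP s = cres s * PP 1"
proof -
  obtain i where i: "cres (rho ^ i * s) = 1" using rho_normalize[OF assms] by blast
  have ri: "rho ^ i \<in> U" "cres (rho ^ i) = cres rho ^ i" using chi_power[OF rho_U] by auto
  have sm_i: "sm (rho ^ i * z) = rho ^ i * sm z" for z
    by (induction i) (simp_all add: mult.assoc sm_rho)
  have "PP 1 = (\<Prod>n\<in>CC. sm ((rho ^ i * s) * of_nat n * v1))"
    unfolding PP_def using prod_CC_reindex[OF U_mult[OF ri(1) assms] i resp_sm] by simp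
  also have "\<dots> = (\<Prod>n\<in>CC. rho ^ i * sm (s * of_nat n * v1))"
    by (intro prod.cong refl) (simp only: mult.assoc sm_i)
  also have "\<dots> = (rho ^ i) ^ kk * PP s" by (simp add: prod.distrib card_CC PP_def)
  also have "(rho ^ i) ^ kk = cres (rho ^ i)" unfolding ri(2) chi_rho by (simp add: mult.commute flip: power_mult)
  finally have "cres s * PP 1 = (cres s * cres (rho ^ i)) * PP s" by simp
  also have "cres s * cres (rho ^ i) = 1" using i chi_mult[OF ri(1) assms] by (simp add: mult.commute)
  finally show ?thesis by simp
qed

lemma NN_s: assumes "s \<in> U" shows "cres s * NN f s = NN f 1"
proof -
  have r: "resp (\<lambda>x. cres x * f (sm (x * v1)))"
    using respD[OF chi_resp] respD[OF resp_sm] unfolding resp_def by metis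
  have "cres s * NN f s = (\<Sum>n\<in>{1..<ell}. cres (s * of_nat n) * f (sm (s * of_nat n * v1)))"
    unfolding NN_def sum_distrib_left
    by (intro sum.cong refl) (simp add: chi_mult[OF assms nat_U'] mult.assoc)
  also have "\<dots> = NN f 1" unfolding NN_def using sum_mult_reindex[OF assms r] by simp
  finally show ?thesis .
qed

text \<open>\<open>NN f s\<close> carries the inverse of \<open>cres s\<close> and
  \<open>PP s ^ 2\<close> its square; these agree for cube roots of unity.\<close>

lemma quotient_s: assumes "s \<in> U" shows "NN f s / PP s ^ 2 = NN f 1 / PP 1 ^ 2"
proof -
  have c: "cres s ^ 3 = 1" using chi(1)[OF assms] .
  then have c0: "cres s \<noteq> 0" by auto
  have "NN f s / PP s ^ 2 = (cres s * NN f s) / (cres s ^ 3 * PP 1 ^ 2)"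
    using c0 by (simp add: PP_s[OF assms] power_mult_distrib eval_nat_numeral mult.assoc)
  then show ?thesis unfolding NN_s[OF assms] c by simp
qed

text \<open>The functions on the residue classes that are values of rational functions of the
  \<open>lam\<close>-division points; the trace argument descends them to the base field.\<close>
definition BB :: "(nat \<Rightarrow> complex) set" where
  "BB = {g. \<exists>f\<in>PQ eisQ. \<forall>s\<in>{1..<ell}. g s = f (tp (of_nat s))}"

lemma BB_I: "f \<in> PQ eisQ \<Longrightarrow> (\<And>s. s \<in> {1..<ell} \<Longrightarrow> g s = f (tp (of_nat s))) \<Longrightarrow> g \<in> BB"
  unfolding BB_def by blast

lemma BB_E: "g \<in> BB \<Longrightarrow> (\<And>f. f \<in> PQ eisQ \<Longrightarrow> (\<And>s. s \<in> {1..<ell} \<Longrightarrow> g s = f (tp (of_nat s))) \<Longrightarrow> P) \<Longrightarrow> P"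
  unfolding BB_def by blast

lemma BB_const: "c \<in> eisQ \<Longrightarrow> (\<lambda>_. c) \<in> BB"
  by (rule BB_I[OF PQ_const]) auto

lemma BB_add: assumes "g \<in> BB" "h \<in> BB" shows "(\<lambda>s. g s + h s) \<in> BB"
  using assms(1)
proof (rule BB_E)
  fix f assume f: "f \<in> PQ eisQ" "\<And>s. s \<in> {1..<ell} \<Longrightarrow> g s = f (tp (of_nat s))"
  obtain f' where "f' \<in> PQ eisQ" "\<And>s. s \<in> {1..<ell} \<Longrightarrow> h s = f' (tp (of_nat s))" using assms(2) unfolding BB_def by blast
  then show ?thesis using f by (intro BB_I[OF PQ_add[of f _ f']]) simp_all
qed

lemma BB_mult: assumes "g \<in> BB" "h \<in> BB" shows "(\<lambda>s. g s * h s) \<in> BB"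
  using assms(1)
proof (rule BB_E)
  fix f assume f: "f \<in> PQ eisQ" "\<And>s. s \<in> {1..<ell} \<Longrightarrow> g s = f (tp (of_nat s))"
  obtain f' where "f' \<in> PQ eisQ" "\<And>s. s \<in> {1..<ell} \<Longrightarrow> h s = f' (tp (of_nat s))" using assms(2) unfolding BB_def by blast
  then show ?thesis using f by (intro BB_I[OF PQ_mult[of f _ f']]) simp_all
qed

lemma BB_cong: "g \<in> BB \<Longrightarrow> (\<And>s. s \<in> {1..<ell} \<Longrightarrow> h s = g s) \<Longrightarrow> h \<in> BB"
  unfolding BB_def by fastforce

lemma BB_trace: "g \<in> BB \<Longrightarrow> (\<Sum>s\<in>{1..<ell}. g s) \<in> eisQ"
  by (erule BB_E) (use PQ_trace in simp)

lemma BB_inverse: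
  assumes "g \<in> BB" "\<And>s. s \<in> {1..<ell} \<Longrightarrow> g s \<noteq> 0" shows "(\<lambda>s. inverse (g s)) \<in> BB"
proof -
  have "\<exists>h\<in>BB. \<forall>s\<in>{1..<ell}. h s = inverse (g s)"
    by (rule inverse_in_algebra[OF finite_atLeastLessThan BB_const BB_add BB_mult BB_trace assms])
  then show ?thesis using BB_cong by metis
qed

lemma BB_diff: assumes "g \<in> BB" "h \<in> BB" shows "(\<lambda>s. g s - h s) \<in> BB"
proof -
  have "(\<lambda>s. g s + (- 1) * h s) \<in> BB" by (intro BB_add BB_mult BB_const assms) auto
  then show ?thesis by simp
qed

lemma BB_power: "g \<in> BB \<Longrightarrow> (\<lambda>s. g s ^ k) \<in> BB"
  by (induction k) (auto intro: BB_const BB_mult)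

lemma BB_sum: "finite A \<Longrightarrow> (\<And>i. i \<in> A \<Longrightarrow> g i \<in> BB) \<Longrightarrow> (\<lambda>s. \<Sum>i\<in>A. g i s) \<in> BB"
  by (induction A rule: finite_induct) (auto intro: BB_const BB_add)

lemma BB_prod: "finite A \<Longrightarrow> (\<And>i. i \<in> A \<Longrightarrow> g i \<in> BB) \<Longrightarrow> (\<lambda>s. \<Prod>i\<in>A. g i s) \<in> BB"
  by (induction A rule: finite_induct) (auto intro: BB_const BB_mult)

lemma BB_sm_cm_1: "(\<lambda>s. sm (of_nat s * v1)) \<in> BB" "(\<lambda>s. cm (of_nat s * v1)) \<in> BB"
proof -
  have p: "(\<lambda>s. pp (tp (of_nat s))) \<in> BB" "(\<lambda>s. pp' (tp (of_nat s))) \<in> BB"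
    by (rule BB_I[OF PQ_p] BB_I[OF PQ_p']; simp)+
  have c: "(\<lambda>s. 6) \<in> BB" "(\<lambda>s. 9) \<in> BB" by (rule BB_const; simp)+
  have nl: "of_nat s * v1 \<notin> lat3" if "s \<in> {1..<ell}" for s
    using lat3_k[of "of_nat s"] nat_U'[OF that] by (auto simp: eis_coprime_eq)
  have third: "of_nat s * v1 / 3 = - tp (of_nat s)" for s by (simp add: v1_tp)
  have ne: "9 + pp' (tp (of_nat s)) \<noteq> 0" if "s \<in> {1..<ell}" for s
  proof -
    have "of_nat s * v1 \<in> sdom" using formal_k[of "of_nat s"] by (simp add: formal_def)
    then have "- pp' (tp (of_nat s)) \<noteq> 9" using nl[OF that] unfolding sdom_def mem_Collect_eq third pp'_uminus by blast
    then show ?thesis by (metis add.commute add_eq_0_iff)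
  qed
  have i: "(\<lambda>s. inverse (9 + pp' (tp (of_nat s)))) \<in> BB" using ne by (intro BB_inverse BB_add c p)
  have "(\<lambda>s. 6 * pp (tp (of_nat s)) * inverse (9 + pp' (tp (of_nat s)))) \<in> BB" by (intro BB_mult c p i)
  then show "(\<lambda>s. sm (of_nat s * v1)) \<in> BB"
  proof (rule BB_cong)
    fix s assume "s \<in> {1..<ell}"
    then show "sm (of_nat s * v1) = 6 * pp (tp (of_nat s)) * inverse (9 + pp' (tp (of_nat s)))"
      using nl[of s] unfolding sm_def third pp_uminus pp'_uminus by (simp only: if_False diff_minus_eq_add divide_inverse)
  qed
  have "(\<lambda>s. (pp' (tp (of_nat s)) - 9) * inverse (9 + pp' (tp (of_nat s)))) \<in> BB" by (intro BB_mult BB_diff c p i)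
  then show "(\<lambda>s. cm (of_nat s * v1)) \<in> BB"
  proof (rule BB_cong)
    fix s assume s: "s \<in> {1..<ell}"
    have "cm (of_nat s * v1) = (- (pp' (tp (of_nat s)) - 9)) / (- (9 + pp' (tp (of_nat s))))"
      using nl[OF s] by (simp add: cm_def third pp'_uminus)
    then show "cm (of_nat s * v1) = (pp' (tp (of_nat s)) - 9) * inverse (9 + pp' (tp (of_nat s)))"
      unfolding minus_divide_divide by (simp only: divide_inverse)
  qed
qed

text \<open>Induction by the addition theorem. Inverting its denominators inside \<open>BB\<close>
  requires that they vanish at no \<open>s\<close>, and this comes from the valuation: they are
  congruent to 1 modulo \<open>mm\<close>.\<close>

lemma BB_sm_cm: "(\<lambda>s. sm (of_nat s * of_nat n * v1)) \<in> BB \<and> (\<lambda>s. cm (of_nat s * of_nat n * v1)) \<in> BB"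
proof (induction n)
  case 0 then show ?case by (simp add: BB_const)
next
  case (Suc n)
  define a b x y where "a = (\<lambda>s. sm (of_nat s * of_nat n * v1))" and "b = (\<lambda>s. cm (of_nat s * of_nat n * v1))"
    and "x = (\<lambda>s::nat. sm (of_nat s * v1))" and "y = (\<lambda>s::nat. cm (of_nat s * v1))"
  have B: "a \<in> BB" "b \<in> BB" "x \<in> BB" "y \<in> BB" using Suc BB_sm_cm_1 by (simp_all add: a_def b_def x_def y_def)
  define D where "D = (\<lambda>s. y s + x s ^ 2 * a s * b s)"
  have f: "formal (of_nat s * of_nat n * v1)" "formal (of_nat s * v1)" for s
    using formal_k[OF eis_of_nat, of "s * n"] formal_k[OF eis_of_nat, of s] by simp_all
  have D0: "D s \<noteq> 0" for s
  proof -
    have "D s - 1 \<in> mm" unfolding D_def a_def b_def x_def y_def by (rule formal_den[OF f])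
    then show ?thesis using unit_plus_mm[of 1 "D s"] mm_1 by auto
  qed
  have DB: "D \<in> BB" unfolding D_def by (intro BB_add BB_mult BB_power B)
  then have iB: "(\<lambda>s. inverse (D s)) \<in> BB" using D0 by (rule BB_inverse)
  have e: "of_nat s * of_nat (Suc n) * v1 = of_nat s * of_nat n * v1 + of_nat s * v1" for s
    by (simp add: algebra_simps)
  have dom: "of_nat s * of_nat n * v1 \<in> sdom" "of_nat s * v1 \<in> sdom" "of_nat s * of_nat n * v1 + of_nat s * v1 \<in> sdom" for s
    using f[of s] formal_sdom_add by (auto simp: formal_def)
  have s: "sm (of_nat s * of_nat (Suc n) * v1) = (a s + b s ^ 2 * x s * y s) * inverse (D s)" for s
  proof -
    have "sm (of_nat s * of_nat (Suc n) * v1) * D s = a s + b s ^ 2 * x s * y s"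
      unfolding e D_def a_def b_def x_def y_def by (rule addition_theorem(1)[OF dom])
    then show ?thesis using D0[of s] by (simp add: field_simps)
  qed
  have c: "cm (of_nat s * of_nat (Suc n) * v1) = (b s * y s ^ 2 - a s ^ 2 * x s) * inverse (D s)" for s
  proof -
    have "cm (of_nat s * of_nat (Suc n) * v1) * D s = b s * y s ^ 2 - a s ^ 2 * x s"
      unfolding e D_def a_def b_def x_def y_def by (rule addition_theorem(2)[OF dom])
    then show ?thesis using D0[of s] by (simp add: field_simps)
  qed
  show ?case unfolding s c by (intro conjI BB_mult BB_add BB_diff BB_power B iB)
qed

lemma quotient_eisQ:
  assumes f: "\<And>n. n \<in> {1..<ell} \<Longrightarrow> (\<lambda>s. f (sm (of_nat s * of_nat n * v1))) \<in> BB"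
  shows "1 / 3 * NN f 1 / PP 1 ^ 2 \<in> eisQ"
proof -
  have N: "(\<lambda>s. NN f (of_nat s)) \<in> BB" unfolding NN_def
    by (intro BB_sum BB_mult BB_const f eisQ_eis chi_eis nat_U') auto
  have P: "(\<lambda>s. PP (of_nat s)) \<in> BB" unfolding PP_def using BB_sm_cm by (intro BB_prod) auto
  have P0: "PP (of_nat s) ^ 2 \<noteq> 0" if "s \<in> {1..<ell}" for s using PP_nonzero[OF nat_U'[OF that]] by simp
  have "(\<lambda>s. NN f (of_nat s) * inverse (PP (of_nat s) ^ 2)) \<in> BB" by (intro BB_mult N BB_inverse BB_power P P0)
  then have "(\<Sum>s\<in>{1..<ell}. NN f (of_nat s) * inverse (PP (of_nat s) ^ 2)) \<in> eisQ" by (rule BB_trace)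
  also have "(\<Sum>s\<in>{1..<ell}. NN f (of_nat s) * inverse (PP (of_nat s) ^ 2)) = (\<Sum>s\<in>{1..<ell}. NN f 1 / PP 1 ^ 2)"
    by (intro sum.cong refl) (metis quotient_s[OF nat_U'] divide_inverse)
  also have "\<dots> = of_nat (3 * kk) * (NN f 1 / PP 1 ^ 2)"
    unfolding sum_constant card_atLeastLessThan ell_minus_1 ..
  finally have "of_nat (3 * kk) * (NN f 1 / PP 1 ^ 2) \<in> eisQ" .
  \<comment> \<open>\<open>9 * kk\<close> is the number \<open>3 * kk\<close> of classes times the 3
    in the normalisation of the Gauss sum.\<close>
  then have "inverse (of_nat (9 * kk)) * (of_nat (3 * kk) * (NN f 1 / PP 1 ^ 2)) \<in> eisQ"
    by (rule eisQ_mult[OF eisQ_inverse[OF eisQ_eis[OF eis_of_nat]]])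
  moreover have "inverse (of_nat (9 * kk)) * (of_nat (3 * kk) * (NN f 1 / PP 1 ^ 2)) = 1 / 3 * NN f 1 / PP 1 ^ 2"
    using kk_pos by (simp add: field_simps)
  ultimately show ?thesis by (simp only:)
qed

section \<open>The congruence modulo the maximal ideal\<close>

lemma prod_mm_1: "finite A \<Longrightarrow> (\<And>i. i \<in> A \<Longrightarrow> g i - 1 \<in> mm) \<Longrightarrow> prod g A - 1 \<in> mm"
proof (induction A rule: finite_induct)
  case (insert i A)
  have "(\<Prod>i\<in>A. g i) - 1 \<in> mm" "g i - 1 \<in> mm" using insert by auto
  moreover have "(\<Prod>i\<in>A. g i) = ((\<Prod>i\<in>A. g i) - 1) + 1" by simp
  ultimately have "(g i - 1) * (\<Prod>i\<in>A. g i) + ((\<Prod>i\<in>A. g i) - 1) \<in> mm"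
    by (metis V_simps(1) V_simps(5) mm_V mm_add mm_mult)
  then show ?case using insert by (simp add: algebra_simps)
qed simp

text \<open>Each of the \<open>kk\<close> factors is \<open>tt * (n + tt * g n)\<close>; pairing
  \<open>n\<close> with its inverse \<open>j n\<close> makes the cofactors of \<open>tt\<close>
  multiply to 1 modulo \<open>mm\<close>.\<close>

lemma PP_square: "\<exists>y. y - 1 \<in> mm \<and> PP 1 ^ 2 = tt ^ (2 * kk) * y"
proof -
  obtain j where j: "\<And>n. n \<in> CC \<Longrightarrow> eis_cong lam (of_nat n * of_nat (j n)) 1" "bij_betw j CC CC"
    using CC_involution by blast
  define X where "X = (\<lambda>n::nat. sm (of_nat n * v1))"
  have "\<exists>g\<in>V. X n = tt * (of_nat n + tt * g)" for n
  proof -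
    have "rel tt ell (fps_scale (of_nat n) smF) (X n)" using good_eis[of "of_nat n"] by (simp add: good_def X_def)
    from rel_linear[OF tt(4) VF_scale[OF VF_smF] _ this] ell_ge_7 show ?thesis by (auto simp: fps_scale_nth)
  qed
  then obtain g where g: "\<And>n. g n \<in> V" "\<And>n. X n = tt * (of_nat n + tt * g n)" by metis
  define y where "y = (\<lambda>n. (of_nat n + tt * g n) * (of_nat (j n) + tt * g (j n)))"
  have PX: "PP 1 = (\<Prod>n\<in>CC. X n)" by (simp add: PP_def X_def)
  also have "\<dots> = (\<Prod>n\<in>CC. X (j n))" using prod.reindex_bij_betw[OF j(2)] by metis
  finally have "PP 1 ^ 2 = (\<Prod>n\<in>CC. X n) * (\<Prod>n\<in>CC. X (j n))" using PX by (simp add: power2_eq_square)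
  also have "\<dots> = (\<Prod>n\<in>CC. X n * X (j n))" by (rule prod.distrib[symmetric])
  also have "\<dots> = (\<Prod>n\<in>CC. tt ^ 2 * y n)"
    by (intro prod.cong refl) (simp only: g(2) y_def power2_eq_square mult_ac)
  also have "\<dots> = tt ^ (2 * kk) * prod y CC" by (simp add: prod.distrib card_CC power_mult)
  finally have "PP 1 ^ 2 = tt ^ (2 * kk) * prod y CC" .
  moreover have "prod y CC - 1 \<in> mm"
  proof (rule prod_mm_1)
    fix n assume n: "n \<in> CC"
    have "of_nat n * of_nat (j n) - 1 \<in> mm" using j(1)[OF n] eis_dvd_mm by (simp add: eis_cong_def)
    moreover have "tt * (g n * of_nat (j n) + of_nat n * g (j n) + tt * g n * g (j n)) \<in> mm"
      using tt g by (intro mm_mult) auto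
    ultimately have "(of_nat n * of_nat (j n) - 1) + tt * (g n * of_nat (j n) + of_nat n * g (j n) + tt * g n * g (j n)) \<in> mm"
      by (rule mm_add)
    moreover have "y n - 1 = (of_nat n * of_nat (j n) - 1) + tt * (g n * of_nat (j n) + of_nat n * g (j n) + tt * g n * g (j n))"
      unfolding y_def by (simp add: algebra_simps)
    ultimately show "y n - 1 \<in> mm" by (simp only:)
  qed simp
  ultimately show ?thesis by blast
qed

text \<open>The powers \<open>tt ^ (2 * kk)\<close> in numerator and denominator are equal, so after
  cancellation the error is a multiple of \<open>tt\<close> and lies in \<open>mm\<close>.\<close>

lemma quotient_mm:
  assumes N: "\<exists>d\<in>V. NN f 1 = - c * tt ^ (2 * kk) + tt ^ Suc (2 * kk) * d" and c: "c \<in> V"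
  shows "1 / 3 * NN f 1 / PP 1 ^ 2 - (- (1 / 3) * c) \<in> mm"
proof -
  obtain d where d: "d \<in> V" "NN f 1 = - c * tt ^ (2 * kk) + tt ^ Suc (2 * kk) * d" using N by blast
  obtain y where y: "y - 1 \<in> mm" "PP 1 ^ 2 = tt ^ (2 * kk) * y" using PP_square by blast
  then have y': "y \<noteq> 0" "inverse y \<in> V" using unit_plus_mm[of 1 y] mm_1 by auto
  have "1 / 3 * NN f 1 / PP 1 ^ 2 = inverse 3 * ((tt ^ (2 * kk) * (- c + tt * d)) / (tt ^ (2 * kk) * y))"
    unfolding d(2) y(2) by (simp add: algebra_simps)
  also have "\<dots> = inverse 3 * ((- c + tt * d) * inverse y)"
    unfolding mult_divide_mult_cancel_left[OF power_not_zero[OF tt(2)]] unfolding divide_inverse ..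
  finally have q: "1 / 3 * NN f 1 / PP 1 ^ 2 = inverse 3 * ((- c + tt * d) * inverse y)" .
  have "1 / 3 * NN f 1 / PP 1 ^ 2 - (- (1 / 3) * c) = inverse 3 * ((y - 1) * (c * inverse y) + tt * (d * inverse y))"
    unfolding q using y'(1) by (simp add: field_simps)
  also have "\<dots> \<in> mm" using y y' c d tt unit_3
    by (intro mm_mult' mm_add mm_mult) auto
  finally show ?thesis .
qed

lemma lambda_tilde_eq: "lambda_tilde ell lam = PP 1"
proof -
  have r: "resp (\<lambda>x. phi (x / lam))" using respD[OF resp_sm] phi_sm unfolding resp_def by metis
  have "lambda_tilde ell lam = (\<Prod>n\<in>CC. phi (of_nat n / lam))"
    unfolding lambda_tilde_def CC_def by (rule prod_residue_units[OF r chi_resp])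
  then show ?thesis unfolding PP_def using phi_sm CC_D(2) by simp
qed

lemma gauss_sum_eq: "gauss_sum ell lam (\<lambda>u. f (phi u)) = 1 / 3 * NN f 1"
proof -
  have r: "resp (\<lambda>x. cres x * f (phi (x / lam)))"
    using respD[OF resp_sm] respD[OF chi_resp] phi_sm unfolding resp_def by metis
  have "gauss_sum ell lam (\<lambda>u. f (phi u)) = 1 / 3 * (\<Sum>n\<in>{1..<ell}. cres (of_nat n) * f (phi (of_nat n / lam)))"
    unfolding gauss_sum_def sum_residue_units[OF r] ..
  also have "(\<Sum>n\<in>{1..<ell}. cres (of_nat n) * f (phi (of_nat n / lam))) = NN f 1"
    unfolding NN_def by (intro sum.cong refl) (simp add: phi_sm nat_U')
  finally show ?thesis .
qed

text \<open>Covers both cases, with \<open>f\<close> the identity or the inverse. Membership in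
  \<open>eisQ\<close> and in \<open>V\<close> gives membership in the localization, and a difference
  in \<open>eisQ\<close> and \<open>mm\<close> is a multiple of \<open>lam\<close> there.\<close>

lemma gauss_sum_congruence:
  assumes c: "c \<in> Zl" and N: "\<exists>d\<in>V. NN f 1 = - c * tt ^ (2 * kk) + tt ^ Suc (2 * kk) * d"
    and f: "\<And>n. n \<in> {1..<ell} \<Longrightarrow> (\<lambda>s. f (sm (of_nat s * of_nat n * v1))) \<in> BB"
  shows "loc_cong lam (gauss_sum ell lam (\<lambda>u. f (phi u)) / lambda_tilde ell lam ^ 2) (- (1 / 3) * c)"
proof -
  define a where "a = gauss_sum ell lam (\<lambda>u. f (phi u)) / lambda_tilde ell lam ^ 2"
  have a: "a = 1 / 3 * NN f 1 / PP 1 ^ 2" unfolding a_def gauss_sum_eq lambda_tilde_eq ..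
  have aQ: "a \<in> eisQ" unfolding a by (rule quotient_eisQ[OF f])
  have cV: "c \<in> V" using c Zl_V by blast
  have diff: "a - (- (1 / 3) * c) \<in> mm" unfolding a by (rule quotient_mm[OF N cV])
  have "inverse (of_nat 3) \<in> Zl" using ell_not_dvd_small[of 3] ell_ge_7 by (intro Zl_inverse) auto
  then have "- (inverse (of_nat 3) * c) \<in> Zl" using c cring_setD(3,6)[OF Zl_ring] by blast
  then have cl: "- (1 / 3) * c \<in> eis_loc lam" using Zl_loc by (auto simp: inverse_eq_divide)
  then have cQ: "- (1 / 3) * c \<in> eisQ" unfolding eis_loc_def by (auto intro!: eisQ_I)
  have "a = (a - (- (1 / 3) * c)) + (- (1 / 3) * c)" by simp
  moreover have "- (1 / 3) * c \<in> V" using cl eis_loc_V by blast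
  ultimately have "a \<in> V" using diff mm_V V_simps(5) by metis
  then have "a \<in> eis_loc lam" using eisQ_V aQ by blast
  then show ?thesis using cl eisQ_mm[OF eisQ_diff[OF aQ cQ] diff] unfolding loc_cong_def a_def by blast
qed

end

theorem theorem2p5:
  fixes ell :: nat and lam :: complex
  assumes "prime ell"
    and "ell mod 9 = 7 \<or> ell mod 9 = 4"
    and "lam \<in> eis"
    and "lam * cnj lam = of_nat ell"
    and "eis_cong 3 lam 1"
  shows "(ell mod 9 = 7 \<longrightarrow>
            (\<exists>q::rat. C_coeff (2 * (ell - 1) div 3) = of_rat q
               \<and> \<not> int ell dvd snd (quotient_of q)
               \<and> loc_cong lam (alpha ell lam) (- (1 / 3) * C_coeff (2 * (ell - 1) div 3))))
       \<and> (ell mod 9 = 4 \<longrightarrow>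
            (\<exists>q::rat. D_coeff (2 * (ell - 1) div 3) = of_rat q
               \<and> \<not> int ell dvd snd (quotient_of q)
               \<and> loc_cong lam (alpha ell lam) (- (1 / 3) * D_coeff (2 * (ell - 1) div 3))))"
proof -
  have "ell mod 3 = 1" using assms(2) by presburger
  then interpret eis_prime3 ell lam using assms by unfold_locales auto
  \<comment> \<open>\<open>lam\<close> is not a unit of \<open>eis\<close>, so the extension theorem
    yields a valuation ring in which it stays a non-unit.\<close>
  have no: "lam * x \<noteq> 1" if "x \<in> eis" for x using lam_not_dvd_1 that unfolding eis_dvd_def by metis
  obtain V where V: "cring_set V" "eis \<subseteq> V" "\<And>x. x \<in> V \<Longrightarrow> lam * x \<noteq> 1" "\<And>x. x \<notin> V \<Longrightarrow> inverse x \<in> V"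
    using valuation_ring_exists[OF cring_set_eis lam_eis no] by blast
  have kk3: "kk mod 3 \<noteq> 0" using assms(2) ell_kk by presburger
  interpret eis_val9 ell lam V using V kk3 by unfold_locales auto
  have k2: "2 * (ell - 1) div 3 = 2 * kk" unfolding ell_minus_1 by simp
  show ?thesis unfolding k2
  proof (intro conjI impI)
    assume m: "ell mod 9 = 7"
    have c: "C_coeff (2 * kk) \<in> Zl" unfolding C_coeff_eq using smF_cmF_Zl[of "2 * kk"] ell_kk by simp
    have "loc_cong lam (gauss_sum ell lam (\<lambda>u. (\<lambda>z. z) (phi u)) / lambda_tilde ell lam ^ 2) (- (1 / 3) * C_coeff (2 * kk))"
    proof (rule gauss_sum_congruence[OF c])
      show "\<exists>d\<in>V. NN (\<lambda>z. z) 1 = - C_coeff (2 * kk) * tt ^ (2 * kk) + tt ^ Suc (2 * kk) * d"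
        using C_sum unfolding NN_def C_coeff_eq by simp
    qed (use BB_sm_cm in blast)
    then have "loc_cong lam (alpha ell lam) (- (1 / 3) * C_coeff (2 * kk))" using m by (simp add: alpha_def)
    then show "\<exists>q::rat. C_coeff (2 * kk) = of_rat q \<and> \<not> int ell dvd snd (quotient_of q)
       \<and> loc_cong lam (alpha ell lam) (- (1 / 3) * C_coeff (2 * kk))" using Zl_rat[OF c] by blast
  next
    assume m: "ell mod 9 = 4"
    \<comment> \<open>The index of \<open>D_coeff\<close> is shifted by 1, and
      \<open>2 * kk + 1\<close> stays below \<open>ell - 1 = 3 * kk\<close> because
      \<open>kk\<close> is at least 2.\<close>
    have "2 * kk + 1 < ell - 1" unfolding ell_minus_1 using kk_ge_2 by simp
    then have c: "D_coeff (2 * kk) \<in> Zl" unfolding D_coeff_eq by (rule inverse_shift_Zl)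
    have "loc_cong lam (gauss_sum ell lam (\<lambda>u. inverse (phi u)) / lambda_tilde ell lam ^ 2) (- (1 / 3) * D_coeff (2 * kk))"
    proof (rule gauss_sum_congruence[OF c])
      show "\<exists>d\<in>V. NN inverse 1 = - D_coeff (2 * kk) * tt ^ (2 * kk) + tt ^ Suc (2 * kk) * d"
        using D_sum unfolding NN_def D_coeff_eq by simp
      fix n assume "n \<in> {1..<ell}"
      then show "(\<lambda>s. inverse (sm (of_nat s * of_nat n * v1))) \<in> BB"
        using BB_sm_cm sm_k_nonzero U_mult nat_U' by (intro BB_inverse) auto
    qed
    then have "loc_cong lam (alpha ell lam) (- (1 / 3) * D_coeff (2 * kk))" using m by (simp add: alpha_def)
    then show "\<exists>q::rat. D_coeff (2 * kk) = of_rat q \<and> \<not> int ell dvd snd (quotient_of q)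
       \<and> loc_cong lam (alpha ell lam) (- (1 / 3) * D_coeff (2 * kk))" using Zl_rat[OF c] by blast
  qed
qed

end
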